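(* Let $u,v:[0,1]\times\mathbb R\to\mathbb R$ be measurable functions, with $u$ non-vanishing, such that for some constant $C_0<\infty$: (A1) $\sup_{t,x}|u(t,x)|\vee|v(t,x)|\le C_0$; (A2) $|u(t,x_1)-u(t,x_2)|\vee|v(t,x_1)-v(t,x_2)|\le C_0|x_1-x_2|$ for all $x_1,x_2\in\mathbb R$, $t\in[0,1]$; (A3) $u(\cdot,x)$ is continuous for all $x\in\mathbb R$; (A4) $u$ and $v$ have bounded strong total variation. Let $(B_t)_{t\in[0,1]}$ be a standard Brownian motion, let $(X_t)_{t\in[0,1]}$ be the strong solution of $\mathrm dX_t=v(t,X_t)\,\mathrm dt+\sqrt{\xi''(t)}\,\mathrm dB_t$, $X_0=0$, and let $M_t=\int_0^t\sqrt{\xi''(s)}\,u(s,X_s)\,\mathrm dB_s$. Assume that for some $t_*\in[0,1]$ we have $M_{t_*}\in[-1,1]$ almost surely and $\mathbb E[M_t^2]=t$ for all $t\in[0,t_*]$. Let $\chi$ denote the computational complexity of evaluating $\nabla H_N(m)$ at a point $m\in[-1,1]^N$, and $\chi_1$ the complexity of evaluating one coordinate of $\nabla\tilde H_N(m)$ at a point $m\in[-1,1]^N$. Then there is a constant $C<\infty$ (not depending on $N$ or $\varepsilon$) such that for any $\varepsilon>0$ there exists a randomized algorithm with complexity $(C/\varepsilon^2)\cdot(\chi+N)+N\chi_1$ which, given the tensors $(W^{(k)})_{k\ge2}$, outputs $\sigma^{\mathrm{alg}}\in\{-1,+1\}^N$ such that $$\frac1N H_N(\sigma^{\mathrm{alg}})\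 \ge\ \int_0^{t_*}\xi''(t)\,\mathbb E\{u(t,X_t)\}\,\mathrm dt-\varepsilon$$ with probability converging to one as $N\to\infty$.
   Context: Model: for $k\ge2$ let $(G^{(k)}_{i_1,\dots,i_k})_{1\le i_1,\dots,i_k\le N}$ be i.i.d. $\mathsf N(0,1)$ (independent over $k$) and $W^{(k)}=N^{-(k-1)/2}\sum_{\pi\in S_k}(G^{(k)})^{\pi}$, where $(G^{(k)})^\pi$ is $G^{(k)}$ with indices permuted by $\pi$. Given real coefficients $(c_k)_{k\ge2}$, the mixture is $\xi(x)=\sum_{k\ge2}c_k^2x^k$, and it is assumed that $\xi(1+\epsilon_0)<\infty$ for some $\epsilon_0>0$. The Hamiltonian is $H_N(\sigma)=\sum_{k\ge2}\frac{c_k}{k!}\sum_{1\le i_1,\dots,i_k\le N}W^{(k)}_{i_1,\dots,i_k}\sigma_{i_1}\cdots\sigma_{i_k}$, and $\tilde H_N$ is obtained from $H_N$ by restricting the sums to distinct indices: $\tilde H_N(\sigma)=\sum_{k\ge2}c_k\sum_{i_1<\dots<i_k}W^{(k)}_{i_1,\dots,i_k}\sigma_{i_1}\cdots\sigma_{i_k}$. A function $f:[a,b]\times\mathbb R\to\mathbb R$ has bounded strong total variation if there is $C<\infty$ with $\sup_n\sup_{a\le t_0<\dots<t_n\le b}\sup_{x_1,\dots,x_n\in\mathbb R}\sum_{i=1}^n|f(t_i,x_i)-f(t_{i-1},x_i)|\le C$. Complexity is measured in a simplified model of computation in which real additions and multiplications have complexity of order one. The constant $C$ may depend on the regularity constants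 in (A1)–(A4). *)

theory Defs
  imports "HOL-Probability.Probability" "HOL-Combinatorics.Permutations"
begin

section \<open>Mixed spin-glass Hamiltonians\<close>

text \<open>
  A tensor of order \<open>k\<close> in dimension \<open>N\<close> is a function on the multi-indices below (sites are
  numbered from 0); a family of tensors takes the order as its first argument. Points of
  \<open>N\<close>-space are functions \<open>nat \<Rightarrow> real\<close> of which only the arguments below \<open>N\<close> matter.
\<close>

definition multi_indices :: "nat \<Rightarrow> nat \<Rightarrow> nat list set" where
  "multi_indices N k = {js. length js = k \<and> set js \<subseteq> {..<N}}"

definition increasing_indices :: "nat \<Rightarrow> nat \<Rightarrow> nat list set" where
  "increasing_indices N k = {js \<in> multi_indices N k. sorted_wrt (<) js}"

definition gaussian_tensors :: "'w measure \<Rightarrow> nat \<Rightarrow> (nat \<Rightarrow> nat list \<Rightarrow> 'w \<Rightarrow> real) \<Rightarrow> bool" where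
  "gaussian_tensors P N G \<longleftrightarrow>
     prob_space P \<and>
     (\<forall>k\<ge>2. \<forall>js\<in>multi_indices N k. distributed P lborel (G k js) std_normal_density) \<and>
     prob_space.indep_vars P (\<lambda>_. borel) (\<lambda>(k, js). G k js) (SIGMA k:{2..}. multi_indices N k)"

definition sym_tensor :: "nat \<Rightarrow> (nat \<Rightarrow> nat list \<Rightarrow> real) \<Rightarrow> nat \<Rightarrow> nat list \<Rightarrow> real" where
  "sym_tensor N g k js =
     real N powr (- (real k - 1) / 2) * (\<Sum>\<pi> | \<pi> permutes {..<k}. g k (permute_list \<pi> js))"

definition sym_disorder ::
  "(nat \<Rightarrow> nat \<Rightarrow> nat list \<Rightarrow> 'w \<Rightarrow> real) \<Rightarrow> nat \<Rightarrow> 'w \<Rightarrow> nat \<Rightarrow> nat list \<Rightarrow> real" where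
  "sym_disorder G N \<omega> = sym_tensor N (\<lambda>k js. G N k js \<omega>)"

definition mixture :: "(nat \<Rightarrow> real) \<Rightarrow> real \<Rightarrow> real" where
  "mixture c x = (\<Sum>k. if 2 \<le> k then (c k)\<^sup>2 * x ^ k else 0)"

definition mixture2 :: "(nat \<Rightarrow> real) \<Rightarrow> real \<Rightarrow> real" where
  "mixture2 c t = deriv (deriv (mixture c)) t"

definition hamiltonian ::
  "(nat \<Rightarrow> real) \<Rightarrow> nat \<Rightarrow> (nat \<Rightarrow> nat list \<Rightarrow> real) \<Rightarrow> (nat \<Rightarrow> real) \<Rightarrow> real" where
  "hamiltonian c N w \<sigma> =
     (\<Sum>k. if 2 \<le> k
           then c k / fact k * (\<Sum>js\<in>multi_indices N k. w k js * (\<Prod>j<k. \<sigma> (js ! j)))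
           else 0)"

definition hamiltonian_distinct ::
  "(nat \<Rightarrow> real) \<Rightarrow> nat \<Rightarrow> (nat \<Rightarrow> nat list \<Rightarrow> real) \<Rightarrow> (nat \<Rightarrow> real) \<Rightarrow> real" where
  "hamiltonian_distinct c N w \<sigma> =
     (\<Sum>k. if 2 \<le> k
           then c k * (\<Sum>js\<in>increasing_indices N k. w k js * (\<Prod>j<k. \<sigma> (js ! j)))
           else 0)"

definition gradient :: "((nat \<Rightarrow> real) \<Rightarrow> real) \<Rightarrow> (nat \<Rightarrow> real) \<Rightarrow> nat \<Rightarrow> real" where
  "gradient F m i = deriv (\<lambda>s. F (m(i := s))) (m i)"

definition in_cube :: "nat \<Rightarrow> (nat \<Rightarrow> real) \<Rightarrow> bool" where
  "in_cube N m \<longleftrightarrow> (\<forall>i<N. m i \<in> {-1..1})"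


section \<open>Brownian motion, Ito integrals and strong solutions on the unit time interval\<close>

definition standard_brownian_motion :: "'a measure \<Rightarrow> (real \<Rightarrow> 'a \<Rightarrow> real) \<Rightarrow> bool" where
  "standard_brownian_motion P B \<longleftrightarrow>
     prob_space P \<and>
     (\<forall>t\<in>{0..1}. B t \<in> borel_measurable P) \<and>
     (\<forall>\<omega>\<in>space P. B 0 \<omega> = 0 \<and> continuous_on {0..1} (\<lambda>t. B t \<omega>)) \<and>
     (\<forall>s t. 0 \<le> s \<and> s < t \<and> t \<le> 1 \<longrightarrow>
        distributed P lborel (\<lambda>\<omega>. B t \<omega> - B s \<omega>) (normal_density 0 (sqrt (t - s)))) \<and>
     (\<forall>n \<tau>. 0 \<le> \<tau> 0 \<and> (\<forall>i<n. \<tau> i < \<tau> (Suc i)) \<and> \<tau> n \<le> (1::real) \<longrightarrow>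
        prob_space.indep_vars P (\<lambda>_. borel) (\<lambda>i \<omega>. B (\<tau> (Suc i)) \<omega> - B (\<tau> i) \<omega>) {..<n})"

text \<open>The filtration generated by \<open>B\<close>, augmented by the null sets.\<close>

definition brownian_filtration :: "'a measure \<Rightarrow> (real \<Rightarrow> 'a \<Rightarrow> real) \<Rightarrow> real \<Rightarrow> 'a measure" where
  "brownian_filtration P B t =
     sigma (space P) ({B s -` A \<inter> space P | s A. s \<in> {0..t} \<and> A \<in> sets borel} \<union> null_sets P)"

definition adapted_process ::
  "'a measure \<Rightarrow> (real \<Rightarrow> 'a \<Rightarrow> real) \<Rightarrow> (real \<Rightarrow> 'a \<Rightarrow> real) \<Rightarrow> bool" where
  "adapted_process P B Y \<longleftrightarrow> (\<forall>t\<in>{0..1}. Y t \<in> borel_measurable (brownian_filtration P B t))"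

definition continuous_process :: "'a measure \<Rightarrow> (real \<Rightarrow> 'a \<Rightarrow> real) \<Rightarrow> bool" where
  "continuous_process P Y \<longleftrightarrow> (\<forall>\<omega>\<in>space P. continuous_on {0..1} (\<lambda>t. Y t \<omega>))"

text \<open>
  A simple integrand takes the bounded, \<open>\<tau> i\<close>-measurable value \<open>\<eta> i\<close> on \<open>{\<tau> i<..\<tau> (i + 1)}\<close>,
  where \<open>0 = \<tau> 0 < \<dots> < \<tau> n = 1\<close>.
\<close>

definition simple_integrand ::
  "'a measure \<Rightarrow> (real \<Rightarrow> 'a \<Rightarrow> real) \<Rightarrow> nat \<Rightarrow> (nat \<Rightarrow> real) \<Rightarrow> (nat \<Rightarrow> 'a \<Rightarrow> real) \<Rightarrow> bool" where
  "simple_integrand P B n \<tau> \<eta> \<longleftrightarrow>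
     \<tau> 0 = 0 \<and> \<tau> n = 1 \<and> (\<forall>i<n. \<tau> i < \<tau> (Suc i)) \<and>
     (\<forall>i<n. \<eta> i \<in> borel_measurable (brownian_filtration P B (\<tau> i)) \<and>
            (\<exists>K. \<forall>\<omega>\<in>space P. \<bar>\<eta> i \<omega>\<bar> \<le> K))"

definition simple_process ::
  "nat \<Rightarrow> (nat \<Rightarrow> real) \<Rightarrow> (nat \<Rightarrow> 'a \<Rightarrow> real) \<Rightarrow> real \<Rightarrow> 'a \<Rightarrow> real" where
  "simple_process n \<tau> \<eta> s \<omega> = (\<Sum>i<n. \<eta> i \<omega> * indicator {\<tau> i<..\<tau> (Suc i)} s)"

definition simple_integral ::
  "(real \<Rightarrow> 'a \<Rightarrow> real) \<Rightarrow> nat \<Rightarrow> (nat \<Rightarrow> real) \<Rightarrow> (nat \<Rightarrow> 'a \<Rightarrow> real) \<Rightarrow> real \<Rightarrow> 'a \<Rightarrow> real" where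
  "simple_integral B n \<tau> \<eta> t \<omega> =
     (\<Sum>i<n. \<eta> i \<omega> * (B (min t (\<tau> (Suc i))) \<omega> - B (min t (\<tau> i)) \<omega>))"

text \<open>
  \<open>ito_integral P B \<phi> J\<close>: the process \<open>J\<close> is a continuous version of the integral of \<open>\<phi>\<close> against
  \<open>B\<close>, obtained as the mean-square limit of integrals of simple integrands that approximate \<open>\<phi>\<close>
  in mean square on \<open>[0,1] \<times> \<Omega>\<close>. Such an approximation exists exactly for the square-integrable
  integrands that are adapted up to null sets.
\<close>

definition ito_integral ::
  "'a measure \<Rightarrow> (real \<Rightarrow> 'a \<Rightarrow> real) \<Rightarrow> (real \<Rightarrow> 'a \<Rightarrow> real) \<Rightarrow> (real \<Rightarrow> 'a \<Rightarrow> real) \<Rightarrow> bool" where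
  "ito_integral P B \<phi> J \<longleftrightarrow>
     (\<lambda>(s, \<omega>). \<phi> s \<omega>) \<in> borel_measurable (restrict_space borel {0..1} \<Otimes>\<^sub>M P) \<and>
     adapted_process P B \<phi> \<and> adapted_process P B J \<and> continuous_process P J \<and>
     (\<exists>n \<tau> \<eta>.
        (\<forall>l. simple_integrand P B (n l) (\<tau> l) (\<eta> l)) \<and>
        (\<lambda>l::nat. \<integral>\<^sup>+\<omega>. (\<integral>\<^sup>+s\<in>{0..1}. ennreal ((simple_process (n l) (\<tau> l) (\<eta> l) s \<omega> - \<phi> s \<omega>)\<^sup>2) \<partial>lborel) \<partial>P)
          \<longlonglongrightarrow> 0 \<and>
        (\<forall>t\<in>{0..1}.
           (\<lambda>l::nat. \<integral>\<^sup>+\<omega>. ennreal ((simple_integral B (n l) (\<tau> l) (\<eta> l) t \<omega> - J t \<omega>)\<^sup>2) \<partial>P)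
             \<longlonglongrightarrow> 0))"

text \<open>
  Strong solution of \<open>dX = b(t, X) dt + s(t, X) dB\<close>, \<open>X\<^sub>0 = x0\<close>: strong means adapted to the
  augmented filtration of the given \<open>B\<close>.
\<close>

definition strong_solution ::
  "'a measure \<Rightarrow> (real \<Rightarrow> 'a \<Rightarrow> real) \<Rightarrow> (real \<Rightarrow> real \<Rightarrow> real) \<Rightarrow> (real \<Rightarrow> real \<Rightarrow> real) \<Rightarrow> real \<Rightarrow>
     (real \<Rightarrow> 'a \<Rightarrow> real) \<Rightarrow> bool" where
  "strong_solution P B b s x0 X \<longleftrightarrow>
     adapted_process P B X \<and> continuous_process P X \<and>
     (\<exists>J. ito_integral P B (\<lambda>t \<omega>. s t (X t \<omega>)) J \<and>
        (AE \<omega> in P. set_integrable lborel {0..1} (\<lambda>t. b t (X t \<omega>)) \<and>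
           (\<forall>t\<in>{0..1}. X t \<omega> = x0 + (LINT r:{0..t}|lborel. b r (X r \<omega>)) + J t \<omega>)))"


section \<open>Coefficient functions on \<open>[0,1] \<times> \<real>\<close>\<close>

definition bounded_strong_variation :: "real \<Rightarrow> real \<Rightarrow> (real \<Rightarrow> real \<Rightarrow> real) \<Rightarrow> bool" where
  "bounded_strong_variation a b f \<longleftrightarrow>
     (\<exists>C. \<forall>(n::nat) (t :: nat \<Rightarrow> real) (x :: nat \<Rightarrow> real).
        a \<le> t 0 \<and> (\<forall>i<n. t i < t (Suc i)) \<and> t n \<le> b \<longrightarrow>
        (\<Sum>i=1..n. \<bar>f (t i) (x i) - f (t (i - 1)) (x i)\<bar>) \<le> C)"

definition regular_coefficients :: "real \<Rightarrow> (real \<Rightarrow> real \<Rightarrow> real) \<Rightarrow> (real \<Rightarrow> real \<Rightarrow> real) \<Rightarrow> bool" where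
  "regular_coefficients C0 u v \<longleftrightarrow>
     (\<forall>t\<in>{0..1}. \<forall>x. \<bar>u t x\<bar> \<le> C0 \<and> \<bar>v t x\<bar> \<le> C0) \<and>
     (\<forall>t\<in>{0..1}. \<forall>x1 x2. \<bar>u t x1 - u t x2\<bar> \<le> C0 * \<bar>x1 - x2\<bar> \<and>
                          \<bar>v t x1 - v t x2\<bar> \<le> C0 * \<bar>x1 - x2\<bar>) \<and>
     (\<forall>x. continuous_on {0..1} (\<lambda>t. u t x)) \<and>
     bounded_strong_variation 0 1 u \<and> bounded_strong_variation 0 1 v"


section \<open>A real random-access machine with gradient oracles\<close>

text \<open>
  The machine has index registers (natural numbers), real registers and real arrays. A program is
  a finite text that works for every dimension; it may contain arbitrary real constants.
  Arithmetic, comparisons, memory accesses, evaluations of the two coefficient functions on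
  \<open>[0,1] \<times> \<real>\<close> and drawing one uniform random number cost one unit each. The disorder is
  accessible only through two oracles: the gradient of the full Hamiltonian, at price
  \<open>grad_price\<close>, and one coordinate of the gradient of the distinct-index Hamiltonian, at price
  \<open>coord_price\<close>. The oracles answer only at points of the cube: a program that queries them
  elsewhere gets stuck, that is, has no terminating run.
\<close>

record machine =
  sites :: nat
  funU :: "real \<Rightarrow> real \<Rightarrow> real"
  funV :: "real \<Rightarrow> real \<Rightarrow> real"
  full_grad :: "(nat \<Rightarrow> real) \<Rightarrow> nat \<Rightarrow> real"
  coord_grad :: "(nat \<Rightarrow> real) \<Rightarrow> nat \<Rightarrow> real"
  coins :: "nat \<Rightarrow> real"
  grad_price :: real
  coord_price :: real

record mstate =
  idx :: "nat \<Rightarrow> nat"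
  reg :: "nat \<Rightarrow> real"
  arr :: "nat \<Rightarrow> nat \<Rightarrow> real"
  drawn :: nat

text \<open>The first argument of an instruction is the target register (or target array).\<close>

datatype instr =
    IConst nat nat
  | IDim nat
  | IAdd nat nat nat
  | RConst nat real
  | RAdd nat nat nat
  | RMul nat nat nat
  | EvalU nat nat nat
  | EvalV nat nat nat
  | Sample nat
  | Load nat nat nat        \<comment> \<open>target register, array, index register\<close>
  | Store nat nat nat       \<comment> \<open>target array, index register, source register\<close>
  | FullGrad nat nat        \<comment> \<open>target array, array holding the query point\<close>
  | CoordGrad nat nat nat   \<comment> \<open>target register, array holding the query point, index register\<close>

fun admissible :: "machine \<Rightarrow> instr \<Rightarrow> mstate \<Rightarrow> bool" where
  "admissible E (EvalU d p q) s = (reg s p \<in> {0..1})"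
| "admissible E (EvalV d p q) s = (reg s p \<in> {0..1})"
| "admissible E (FullGrad d a) s = in_cube (sites E) (arr s a)"
| "admissible E (CoordGrad d a i) s = (in_cube (sites E) (arr s a) \<and> idx s i < sites E)"
| "admissible E _ s = True"

fun price :: "machine \<Rightarrow> instr \<Rightarrow> real" where
  "price E (FullGrad d a) = grad_price E"
| "price E (CoordGrad d a i) = coord_price E"
| "price E _ = 1"

fun effect :: "machine \<Rightarrow> instr \<Rightarrow> mstate \<Rightarrow> mstate" where
  "effect E (IConst d n) s = s\<lparr>idx := (idx s)(d := n)\<rparr>"
| "effect E (IDim d) s = s\<lparr>idx := (idx s)(d := sites E)\<rparr>"
| "effect E (IAdd d i j) s = s\<lparr>idx := (idx s)(d := idx s i + idx s j)\<rparr>"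
| "effect E (RConst d a) s = s\<lparr>reg := (reg s)(d := a)\<rparr>"
| "effect E (RAdd d p q) s = s\<lparr>reg := (reg s)(d := reg s p + reg s q)\<rparr>"
| "effect E (RMul d p q) s = s\<lparr>reg := (reg s)(d := reg s p * reg s q)\<rparr>"
| "effect E (EvalU d p q) s = s\<lparr>reg := (reg s)(d := funU E (reg s p) (reg s q))\<rparr>"
| "effect E (EvalV d p q) s = s\<lparr>reg := (reg s)(d := funV E (reg s p) (reg s q))\<rparr>"
| "effect E (Sample d) s = s\<lparr>reg := (reg s)(d := coins E (drawn s)), drawn := Suc (drawn s)\<rparr>"
| "effect E (Load d a i) s = s\<lparr>reg := (reg s)(d := arr s a (idx s i))\<rparr>"
| "effect E (Store a i p) s = s\<lparr>arr := (arr s)(a := (arr s a)(idx s i := reg s p))\<rparr>"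
| "effect E (FullGrad d a) s = s\<lparr>arr := (arr s)(d := full_grad E (arr s a))\<rparr>"
| "effect E (CoordGrad d a i) s = s\<lparr>reg := (reg s)(d := coord_grad E (arr s a) (idx s i))\<rparr>"

datatype test = ILess nat nat | RLess nat nat

fun holds :: "test \<Rightarrow> mstate \<Rightarrow> bool" where
  "holds (ILess i j) s = (idx s i < idx s j)"
| "holds (RLess p q) s = (reg s p < reg s q)"

datatype prog =
    Skip
  | Instr instr
  | Seq prog prog
  | If test prog prog
  | While test prog

text \<open>\<open>exec E p s T s'\<close>: run on \<open>E\<close> from \<open>s\<close>, the program \<open>p\<close> stops in \<open>s'\<close> at total cost \<open>T\<close>.\<close>

inductive exec :: "machine \<Rightarrow> prog \<Rightarrow> mstate \<Rightarrow> real \<Rightarrow> mstate \<Rightarrow> bool" for E where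
  Skip: "exec E Skip s 0 s"
| Instr: "admissible E a s \<Longrightarrow> exec E (Instr a) s (price E a) (effect E a s)"
| Seq: "exec E p s T s' \<Longrightarrow> exec E q s' T' s'' \<Longrightarrow> exec E (Seq p q) s (T + T') s''"
| IfTrue: "holds b s \<Longrightarrow> exec E p s T s' \<Longrightarrow> exec E (If b p q) s (1 + T) s'"
| IfFalse: "\<not> holds b s \<Longrightarrow> exec E q s T s' \<Longrightarrow> exec E (If b p q) s (1 + T) s'"
| WhileFalse: "\<not> holds b s \<Longrightarrow> exec E (While b p) s 1 s"
| WhileTrue: "holds b s \<Longrightarrow> exec E p s T s' \<Longrightarrow> exec E (While b p) s' T' s'' \<Longrightarrow>
    exec E (While b p) s (1 + T + T') s''"

inductive_cases exec_SkipE: "exec E Skip s T s'"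
inductive_cases exec_InstrE: "exec E (Instr a) s T s'"
inductive_cases exec_SeqE: "exec E (Seq p q) s T s'"
inductive_cases exec_IfE: "exec E (If b p q) s T s'"
inductive_cases exec_WhileE: "exec E (While b p) s T s'"

lemma exec_deterministic:
  "exec E p s T s' \<Longrightarrow> exec E p s R r' \<Longrightarrow> R = T \<and> r' = s'"
proof (induction arbitrary: R r' rule: exec.induct)
  case (Skip s) then show ?case by (auto elim: exec_SkipE)
next
  case (Instr a s) from Instr.prems show ?case by (auto elim: exec_InstrE)
next
  case (Seq p s T s' q T' s'')
  from Seq.prems show ?case by (rule exec_SeqE) (use Seq.IH in blast)
next
  case (IfTrue b s p T s' q)
  from IfTrue.prems show ?case by (rule exec_IfE) (use IfTrue.IH IfTrue.hyps in blast)+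
next
  case (IfFalse b s q T s' p)
  from IfFalse.prems show ?case by (rule exec_IfE) (use IfFalse.IH IfFalse.hyps in blast)+
next
  case (WhileFalse b s p)
  from WhileFalse.prems show ?case by (rule exec_WhileE) (use WhileFalse.hyps in blast)+
next
  case (WhileTrue b s p T s' T' s'')
  from WhileTrue.prems show ?case by (rule exec_WhileE) (use WhileTrue.IH WhileTrue.hyps in blast)+
qed

definition start_state :: mstate where
  "start_state = \<lparr>idx = (\<lambda>_. 0), reg = (\<lambda>_. 0), arr = (\<lambda>_ _. 0), drawn = 0\<rparr>"

text \<open>The output is the vector of signs of array 0, with \<open>+1\<close> for the sign of 0.\<close>

definition spin_output :: "mstate \<Rightarrow> nat \<Rightarrow> real" where
  "spin_output s i = (if 0 \<le> arr s 0 i then 1 else - 1)"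

definition outputs :: "machine \<Rightarrow> prog \<Rightarrow> real \<Rightarrow> (nat \<Rightarrow> real) \<Rightarrow> bool" where
  "outputs E p T \<sigma> \<longleftrightarrow> (\<exists>s. exec E p start_state T s \<and> \<sigma> = spin_output s)"

definition coin_space :: "(nat \<Rightarrow> real) measure" where
  "coin_space = (\<Pi>\<^sub>M i\<in>UNIV. uniform_measure lborel {0..1})"

definition spin_machine ::
  "(nat \<Rightarrow> real) \<Rightarrow> (real \<Rightarrow> real \<Rightarrow> real) \<Rightarrow> (real \<Rightarrow> real \<Rightarrow> real) \<Rightarrow> real \<Rightarrow> real \<Rightarrow> nat \<Rightarrow>
     (nat \<Rightarrow> nat list \<Rightarrow> real) \<Rightarrow> (nat \<Rightarrow> real) \<Rightarrow> machine" where
  "spin_machine c u v \<kappa> \<kappa>1 N w \<rho> =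
     \<lparr>sites = N, funU = u, funV = v,
      full_grad = gradient (hamiltonian c N w),
      coord_grad = gradient (hamiltonian_distinct c N w),
      coins = \<rho>, grad_price = \<kappa>, coord_price = \<kappa>1\<rparr>"

text \<open>
  Probability tending to one, through inner approximation by measurable events so that it does
  not depend on measurability of \<open>A N\<close> itself.
\<close>

definition with_high_probability :: "(nat \<Rightarrow> 'b measure) \<Rightarrow> (nat \<Rightarrow> 'b \<Rightarrow> bool) \<Rightarrow> bool" where
  "with_high_probability Q A \<longleftrightarrow>
     (\<exists>S. (\<forall>N. S N \<in> sets (Q N) \<and> (\<forall>x\<in>S N. A N x)) \<and>
          (\<lambda>N. measure (Q N) (S N)) \<longlonglongrightarrow> 1)"

end

theory Submission
 imports Defs
begin

text \<open>
The algorithm makes \<open>n = O(1/\<epsilon>)\<close> gradient queries at points whose coordinates lie on a finite grid.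
Every query point and answer is orthogonalised (without divisions) against the earlier ones, and a
decision tree maps each coordinate of the current point and of the innovation to the next point.
Along a fixed trajectory the innovations are exactly Gaussian and, modulo the spanned directions,
independent; as the algorithm only sees them modulo that span, it can be compared with a toy run
driven by i.i.d. normals, whose coordinates are i.i.d. Markov chains and obey the law of large numbers.
The trees are chosen such that the chain has the transition law of a randomly rounded discretisation
of \<open>M\<close>, realised by monotone functions of the normals. By rearrangement this gains at least the
correlation of the increments of \<open>M\<close> and \<open>B\<close>, which the Ito isometry turns into
the integral of \<open>\<xi>'' E u\<close> up to \<open>O(1/n)\<close>.
\<close>

text \<open>The covariance of \<open><x, grad H(m)>\<close> and \<open><y, grad H(m')>\<close> has,
  besides its \<xi>' term, a \<xi>'' term with the factor \<open><x, m'> <y, m>\<close>. Projecting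
  away all query points kills this factor, and what a gradient shares with earlier ones is a
  combination of earlier answers. So removing both spans leaves exactly independent Gaussians; this
  takes the place of an Onsager correction, and since the spans have bounded dimension the removal
  is invisible in the limit. For each N there are only finitely many trajectories, so events can be
  split over fixed ones, along which laws are compared by characteristic functions. An exponentially
  fine grid is affordable because binary search in it has depth O(n); the accumulated rounding is
  hidden by shrinking M by the factor 1 - 1/n. With O(n) queries and O(n^2) operations per
  coordinate the cost is of order 1/\<epsilon>^2. All dependence on u, v and \<xi> sits in real
  constants of the program, and the last step of the chain is itself the rounding to signs.\<close>

abbreviation (input) "bm \<equiv> borel_measurable"

abbreviation (input) "Nd \<equiv> std_normal_distribution"

type_synonym vec = "nat => real"

type_synonym field = "nat \<times> nat => real"

lemmas int_bound = Bochner_Integration.integrable_bound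

lemmas int_sum = Bochner_Integration.integral_sum

lemmas int_cong = Bochner_Integration.integral_cong

section \<open>Gram-Schmidt without division\<close>

definition ip :: "nat => vec => vec => real" where
"ip N x y = (\<Sum>i<N. x i*y i)"

text \<open>Multiplying by \<open>ip N w w\<close> replaces the division by it, since the machine
  can only add and multiply.\<close>

definition orth :: "nat => vec => vec => nat => real" where
"orth N w x = (if ip N w w = 0 then x
 else (%i. if i < N then ip N w w*x i-ip N w x*w i else x i))"

definition red :: "nat => vec list => vec => nat => real" where
"red N ws = fold (orth N) ws"

text \<open>The factor that one call of \<open>orth\<close> puts on the orthogonal component. The
  product \<open>scl\<close> of these factors converts the vectors held by the machine into true
  projections.\<close>

definition wt :: "nat => vec => real" where
"wt N w = (if ip N w w = 0 then 1 else ip N w w)"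

definition scl :: "nat => vec list => real" where
"scl N ws = prod_list (map (wt N) ws)"

lemma ip_self_nonneg [simp]: "0 <= ip N w w"
by (simp add: ip_def sum_nonneg)

lemma wt_pos [simp]: "0 < wt N w"
using ip_self_nonneg[of N w] by (auto simp: wt_def simp del: ip_self_nonneg)

lemma scl_pos [simp]: "0 < scl N ws"
by (induction ws) (auto simp: scl_def)

lemma scl_snoc: "scl N (ws @ [w]) = scl N ws*wt N w"
by (simp add: scl_def)

lemma red_snoc: "red N (ws @ [w]) x = orth N w (red N ws x)"
by (simp add: red_def)

lemma red_Nil [simp]: "red N [] x = x"
by (simp add: red_def)

section \<open>Decision trees and the idealised run\<close>

datatype 'a dtree = Leaf 'a | Node real "'a dtree" "'a dtree"

primrec dev :: "'a dtree => real => 'a" where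
"dev (Leaf v) x = v"
| "dev (Node \<theta> l r) x = (if x < \<theta> then dev l x else dev r x)"

primrec depth :: "'a dtree => nat" where
"depth (Leaf v) = 0"
| "depth (Node \<theta> l r) = Suc (max (depth l) (depth r))"

lemma dev_in_set: "dev t x \<in> set_dtree t"
by (induction t) auto

text \<open>The origin would be useless as first query: all terms have degree at least 2, so the
  gradient vanishes there. The all-ones vector gives an innovation of limiting variance \<xi>'(1),
  and later points, having mean zero, are asymptotically orthogonal to it.\<close>

definition ones :: "nat => nat => real" where
"ones N i = (if i < N then 1 else 0)"

text \<open>The state is the list of orthogonalised vectors and the list of query points so far; the
  oracle \<open>Or\<close> sees the query points, the last of which is the current one.\<close>

definition advance :: "nat => (real => real => real) => vec list => vec =>
 vec => nat => real" where
"advance N f ws m y = (%i. if i < N then f (m i) (red N ws y i/scl N ws) else m i)"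

primrec run :: "nat => (nat => real => real => real) => (vec list => nat => real) => nat =>
 vec list \<times> vec list" where
"run N f Or 0 = ([], [ones N])"
| "run N f Or (Suc a) =
 (let ws = fst (run N f Or a); ms = snd (run N f Or a);
    ws' = ws @ [red N ws (last ms)]; y = Or ms
  in (ws' @ [red N ws' y], ms @ [advance N (f a) ws' (last ms) y]))"

section \<open>Cost bounds for machine programs\<close>

definition runs :: "machine => prog => mstate => real => (mstate => bool) => bool" where
"runs E p s c Q \<longleftrightarrow> (\<exists>T s'. exec E p s T s' & T <= c & Q s')"

lemma runs_Skip: "Q s ==> 0 <= c ==> runs E Skip s c Q"
unfolding runs_def by (blast intro: exec.Skip)

lemma runs_Seq:
assumes "runs E p s c Q" "\<And>s'. Q s' ==> runs E q s' d R" "c+d <= e"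
shows "runs E (Seq p q) s e R"
proof -
obtain T s' where 1: "exec E p s T s'" "T <= c" "Q s'" using assms(1) by (auto simp: runs_def)
obtain T' s'' where 2: "exec E q s' T' s''" "T' <= d" "R s''"
 using assms(2)[OF 1(3)] by (auto simp: runs_def)
show ?thesis unfolding runs_def using exec.Seq[OF 1(1) 2(1)] 1(2) 2(2,3) assms(3)
 by (intro exI[of _ "T+T'"] exI[of _ s'']) simp
qed

lemma runs_If:
assumes "holds b s ==> runs E p s c Q" "\<not> holds b s ==> runs E q s c Q" "1+c <= d"
shows "runs E (If b p q) s d Q"
proof (cases "holds b s")
case True
then obtain T s' where "exec E p s T s'" "T <= c" "Q s'" using assms(1) by (auto simp: runs_def)
thus ?thesis using exec.IfTrue[OF True, of E p T s' q] assms(3) unfolding runs_def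
 by (intro exI[of _ "1+T"] exI[of _ s']) auto
next
case False
then obtain T s' where "exec E q s T s'" "T <= c" "Q s'" using assms(2) by (auto simp: runs_def)
thus ?thesis using exec.IfFalse[OF False, of E q T s' p] assms(3) unfolding runs_def
 by (intro exI[of _ "1+T"] exI[of _ s']) auto
qed

lemma runs_mono: "runs E p s c Q ==> c <= d ==> (\<And>s'. Q s' ==> R s') ==> runs E p s d R"
unfolding runs_def by (meson order_trans)

text \<open>These instructions are admissible in every state and cost one unit, so a straight-line
  block is evaluated by folding \<open>effect\<close>.\<close>

fun plain :: "instr => bool" where
"plain (EvalU _ _ _) = False" | "plain (EvalV _ _ _) = False"
| "plain (FullGrad _ _) = False" | "plain (CoordGrad _ _ _) = False" | "plain _ = True"

primrec block :: "instr list => prog" where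
"block [] = Skip"
| "block (a # as) = Seq (Instr a) (block as)"

declare block.simps [simp del]

lemma exec_block: "list_all plain as ==>
exec E (block as) s (real (length as)) (fold (effect E) as s)"
proof (induction as arbitrary: s)
case Nil thus ?case by (simp add: exec.Skip block.simps)
next
case (Cons a as)
have "admissible E a s" "price E a = 1" using Cons.prems by (cases a; simp)+
hence "exec E (Instr a) s 1 (effect E a s)" using exec.Instr[of E a s] by simp
from exec.Seq[OF this Cons.IH] Cons.prems show ?case by (simp add: add.commute block.simps)
qed

lemma runs_block: "list_all plain as ==> Q (fold (effect E) as s) ==> real (length as) <= c ==>
runs E (block as) s c Q"
unfolding runs_def using exec_block by blast

text \<open>Index register 0 is the counter; 1 is expected to hold the dimension and 2 the constant
  1, as there is no increment instruction.\<close>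

definition loop :: "prog => prog" where
"loop body = Seq (block [IConst 0 0]) (While (ILess 0 1) (Seq body (block [IAdd 0 0 2])))"

text \<open>Besides the body each round pays one unit for the test and one for the increment; the
  leading 1 is the final, failing test.\<close>

lemma runs_while:
assumes "i <= sites E" "idx s 0 = i" "idx s 1 = sites E" "idx s 2 = 1" "Inv i (reg s) (arr s)" "0 <= c"
 and body: "\<And>i t. i < sites E ==> Inv i (reg t) (arr t) ==> idx t 0 = i ==> idx t 1 = sites E ==>
  idx t 2 = 1 ==> runs E body t c (%t'. Inv (Suc i) (reg t') (arr t') & idx t' = idx t)"
shows "runs E (While (ILess 0 1) (Seq body (block [IAdd 0 0 2]))) s (1+(c+2)*real (sites E-i))
 (%t. Inv (sites E) (reg t) (arr t) & idx t 1 = sites E & idx t 2 = 1)"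
using assms(1-5)
proof (induction "sites E-i" arbitrary: i s)
case 0
hence "exec E (While (ILess 0 1) (Seq body (block [IAdd 0 0 2]))) s 1 s"
 by (intro exec.WhileFalse) auto
with 0 show ?case unfolding runs_def by (intro exI[of _ 1] exI[of _ s]) auto
next
case (Suc x)
hence lt: "i < sites E" by simp
obtain T s' where 1: "exec E body s T s'" "T <= c" "Inv (Suc i) (reg s') (arr s')" "idx s' = idx s"
 using body[OF lt Suc.prems(5,2,3,4)] by (auto simp: runs_def)
define s'' where "s'' = effect E (IAdd 0 0 2) s'"
have 2: "exec E (block [IAdd 0 0 2]) s' 1 s''"
 using exec_block[of "[IAdd 0 0 2]" E s'] by (simp add: s''_def)
have 3: "idx s'' 0 = Suc i" "idx s'' 1 = sites E" "idx s'' 2 = 1" "Inv (Suc i) (reg s'') (arr s'')"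
 using 1 Suc.prems by (auto simp: s''_def)
have "runs E (While (ILess 0 1) (Seq body (block [IAdd 0 0 2]))) s'' (1+(c+2)*real (sites E-Suc i))
 (%t. Inv (sites E) (reg t) (arr t) & idx t 1 = sites E & idx t 2 = 1)"
 by (rule Suc.hyps(1)) (use Suc.hyps(2) lt 3 in auto)
then obtain T' t where 4: "exec E (While (ILess 0 1) (Seq body (block [IAdd 0 0 2]))) s'' T' t"
 "T' <= 1+(c+2)*real (sites E-Suc i)" "Inv (sites E) (reg t) (arr t) & idx t 1 = sites E & idx t 2 = 1"
 by (auto simp: runs_def)
have "exec E (While (ILess 0 1) (Seq body (block [IAdd 0 0 2]))) s (1+(T+1)+T') t"
 using Suc.prems lt by (intro exec.WhileTrue[OF _ exec.Seq[OF 1(1) 2] 4(1)]) auto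
moreover have "1+(T+1)+T' <= 1+(c+2)*real (sites E-i)"
 using 4(2) 1(2) lt by (simp add: of_nat_diff algebra_simps)
ultimately show ?case unfolding runs_def using 4(3) by blast
qed

lemma runs_loop:
assumes "idx s 1 = sites E" "idx s 2 = 1" "Inv 0 (reg s) (arr s)" "0 <= c"
 and body: "\<And>i t. i < sites E ==> Inv i (reg t) (arr t) ==> idx t 0 = i ==> idx t 1 = sites E ==>
  idx t 2 = 1 ==> runs E body t c (%t'. Inv (Suc i) (reg t') (arr t') & idx t' = idx t)"
 and "2+(c+2)*real (sites E) <= d"
 and "\<And>t. Inv (sites E) (reg t) (arr t) ==> idx t 1 = sites E ==> idx t 2 = 1 ==> Q t"
shows "runs E (loop body) s d Q"
unfolding loop_def
proof (rule runs_Seq)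
show "runs E (block [IConst 0 0]) s 1
 (%t. idx t 0 = 0 & idx t 1 = sites E & idx t 2 = 1 & Inv 0 (reg t) (arr t))"
 by (rule runs_block) (use assms(1-3) in auto)
fix t :: mstate assume t: "idx t 0 = 0 & idx t 1 = sites E & idx t 2 = 1 & Inv 0 (reg t) (arr t)"
have "runs E (While (ILess 0 1) (Seq body (block [IAdd 0 0 2]))) t (1+(c+2)*real (sites E-0))
 (%t. Inv (sites E) (reg t) (arr t) & idx t 1 = sites E & idx t 2 = 1)"
 by (rule runs_while) (use t assms(4) body in auto)
thus "runs E (While (ILess 0 1) (Seq body (block [IAdd 0 0 2]))) t (1+(c+2)*real (sites E)) Q"
 by (rule runs_mono) (use assms(7) in auto)
qed (use assms(6) in auto)

definition dotp :: "nat => nat => nat => prog" where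
"dotp d a b = Seq (block [RConst d 0]) (loop (block [Load 5 a 0, Load 6 b 0, RMul 5 5 6, RAdd d d 5]))"

abbreviation ready :: "machine => mstate => bool" where
"ready E t \<equiv> idx t 1 = sites E & idx t 2 = 1"

lemma runs_dotp:
assumes "ready E s" "d \<notin> {5,6}"
shows "runs E (dotp d a b) s (3+6*real (sites E)) (%t. ready E t & arr t = arr s &
 (\<forall>k. k \<notin> {5,6,d} --> reg t k = reg s k) & reg t d = ip (sites E) (arr s a) (arr s b))"
unfolding dotp_def
proof (rule runs_Seq)
show "runs E (block [RConst d 0]) s 1 (%t. ready E t & arr t = arr s &
 (\<forall>k. k \<notin> {5,6,d} --> reg t k = reg s k) & reg t d = 0)"
 by (rule runs_block) (use assms in auto)
fix t assume t: "ready E t & arr t = arr s & (\<forall>k. k \<notin> {5,6,d} --> reg t k = reg s k) & reg t d = 0"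
show "runs E (loop (block [Load 5 a 0, Load 6 b 0, RMul 5 5 6, RAdd d d 5])) t (2+6*real (sites E))
 (%t. ready E t & arr t = arr s &
 (\<forall>k. k \<notin> {5,6,d} --> reg t k = reg s k) & reg t d = ip (sites E) (arr s a) (arr s b))"
 by (rule runs_loop[where c = 4 and Inv = "%i r A. A = arr s & (\<forall>k. k \<notin> {5,6,d} --> r k = reg s k) &
   r d = ip i (arr s a) (arr s b)"])
  (use t assms(2) in "auto intro!: runs_block simp: ip_def")
qed auto

text \<open>Real register 0 holds 0, register 2 accumulates the scale, 3 and 4 receive
  \<open><w,w>\<close> and \<open>-<w,x>\<close>, 5 and 6 are scratch. Testing
  \<open>0 < <w,w>\<close> is the same as testing that it is nonzero.\<close>

definition orthp :: "nat => nat => prog" where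
"orthp w x = Seq (dotp 3 w w) (Seq (dotp 4 w x) (Seq (block [RConst 5 (-1), RMul 4 4 5])
 (If (RLess 0 3)
   (Seq (loop (block [Load 5 x 0, RMul 5 5 3, Load 6 w 0, RMul 6 6 4, RAdd 5 5 6, Store x 0 5]))
     (block [RMul 2 2 3]))
   Skip)))"

text \<open>Two inner products at \<open>3+6*N\<close>, two instructions, the test, the loop at
  \<open>2+8*N\<close> and one multiplication.\<close>

lemma runs_orthp:
assumes "ready E s" "w \<noteq> x" "reg s 0 = 0"
shows "runs E (orthp w x) s (12+20*real (sites E)) (%t. ready E t &
 arr t = (arr s)(x := orth (sites E) (arr s w) (arr s x)) &
 reg t 0 = 0 & reg t 1 = reg s 1 & reg t 2 = reg s 2*wt (sites E) (arr s w))"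
 (is "runs E _ s _ ?Q")
unfolding orthp_def
proof (rule runs_Seq[OF runs_dotp])
let ?N = "sites E"
let ?n = "ip ?N (arr s w) (arr s w)" and ?p = "ip ?N (arr s w) (arr s x)"
let ?L = "loop (block [Load 5 x 0, RMul 5 5 3, Load 6 w 0, RMul 6 6 4, RAdd 5 5 6, Store x 0 5])"
let ?C = "Seq ?L (block [RMul 2 2 3])"
let ?I = "If (RLess 0 3) ?C Skip" and ?S = "block [RConst 5 (-1), RMul 4 4 5]"
fix t assume t: "ready E t & arr t = arr s &
 (\<forall>k. k \<notin> {5,6,3} --> reg t k = reg s k) & reg t 3 = ?n"
show "runs E (Seq (dotp 4 w x) (Seq ?S
 ?I)) t (9+14*real ?N) ?Q"
proof (rule runs_Seq[OF runs_dotp])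
 fix t' assume t': "ready E t' & arr t' = arr t &
  (\<forall>k. k \<notin> {5,6,4} --> reg t' k = reg t k) & reg t' 4 = ip ?N (arr t w) (arr t x)"
 show "runs E (Seq ?S
 ?I) t' (6+8*real ?N) ?Q"
 proof (rule runs_Seq)
  show "runs E ?S t' 2 (%t. ready E t & arr t = arr s &
   (\<forall>k. k \<notin> {3,4,5,6} --> reg t k = reg s k) & reg t 3 = ?n & reg t 4 = - ?p)"
   by (rule runs_block) (use t t' in auto)
  fix r assume r: "ready E r & arr r = arr s &
   (\<forall>k. k \<notin> {3,4,5,6} --> reg r k = reg s k) & reg r 3 = ?n & reg r 4 = - ?p"
  show "runs E ?I r (4+8*real ?N) ?Q"
  proof (rule runs_If)
   assume "holds (RLess 0 3) r"
   hence n: "?n \<noteq> 0" using r assms(3) by auto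
   show "runs E ?C r (3+8*real ?N) ?Q"
   proof (rule runs_Seq)
    show "runs E (?L)
     r (2+8*real ?N) (%t. ready E t & arr t = (arr s)(x := orth ?N (arr s w) (arr s x)) &
      (\<forall>k. k \<notin> {3,4,5,6} --> reg t k = reg s k) & reg t 3 = ?n)"
    proof (rule runs_loop[where c = 6 and Inv = "%i q A. A = (arr s)(x := (%j. if j < i then
       ?n*arr s x j-?p*arr s w j else arr s x j)) &
       (\<forall>k. k \<notin> {3,4,5,6} --> q k = reg s k) & q 3 = ?n & q 4 = - ?p"], goal_cases)
     case (5 i q)
     thus ?case using assms(2)
      by (intro runs_block) (auto simp: fun_eq_iff less_Suc_eq)
    qed (use r n assms(2) in "auto simp: orth_def")
   next
    fix q assume "ready E q & arr q = (arr s)(x := orth ?N (arr s w) (arr s x)) &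
      (\<forall>k. k \<notin> {3,4,5,6} --> reg q k = reg s k) & reg q 3 = ?n"
    thus "runs E (block [RMul 2 2 3]) q 1 ?Q"
     by (intro runs_block) (use assms(3) n in "auto simp: wt_def")
   qed auto
  next
   assume "\<not> holds (RLess 0 3) r"
   hence n: "?n = 0" using r assms(3) ip_self_nonneg[of ?N "arr s w"] by auto
   show "runs E Skip r (3+8*real ?N) ?Q"
    by (rule runs_Skip) (use r n assms(3) in "auto simp: orth_def wt_def")
  qed auto
 qed auto
qed (use t in auto)
qed (use assms in auto)

primrec redp :: "nat => nat => prog" where
"redp 0 x = Skip"
| "redp (Suc j) x = Seq (redp j x) (orthp (Suc j) x)"

lemma runs_redp:
assumes "ready E s" "j < x" "reg s 0 = 0"
shows "runs E (redp j x) s (real j*(12+20*real (sites E))) (%t. ready E t &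
 arr t = (arr s)(x := red (sites E) (map (%k. arr s (Suc k)) [0..<j]) (arr s x)) &
 reg t 0 = 0 & reg t 1 = reg s 1 &
 reg t 2 = reg s 2 * scl (sites E) (map (%k. arr s (Suc k)) [0..<j]))"
using assms(2)
proof (induction j)
case 0
thus ?case using assms by (auto intro!: runs_Skip simp: scl_def)
next
case (Suc j)
show ?case unfolding redp.simps
proof (rule runs_Seq[OF Suc.IH])
 fix t assume t: "ready E t &
  arr t = (arr s)(x := red (sites E) (map (%k. arr s (Suc k)) [0..<j]) (arr s x)) &
  reg t 0 = 0 & reg t 1 = reg s 1 &
  reg t 2 = reg s 2 * scl (sites E) (map (%k. arr s (Suc k)) [0..<j])"
 have "runs E (orthp (Suc j) x) t (12+20*real (sites E)) (%q. ready E q &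
  arr q = (arr t)(x := orth (sites E) (arr t (Suc j)) (arr t x)) &
  reg q 0 = 0 & reg q 1 = reg t 1 & reg q 2 = reg t 2*wt (sites E) (arr t (Suc j)))"
  by (rule runs_orthp) (use t Suc.prems in auto)
 thus "runs E (orthp (Suc j) x) t (12+20*real (sites E)) (%t. ready E t &
  arr t = (arr s)(x := red (sites E) (map (%k. arr s (Suc k)) [0..<Suc j]) (arr s x)) &
  reg t 0 = 0 & reg t 1 = reg s 1 &
  reg t 2 = reg s 2 * scl (sites E) (map (%k. arr s (Suc k)) [0..<Suc j]))"
  by (rule runs_mono) (use t Suc.prems in "auto simp: red_snoc scl_snoc")
qed (use Suc.prems in "auto simp: algebra_simps")
qed

text \<open>The trees ask whether the quotient of registers \<open>r\<close> and \<open>q\<close> is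
  below \<theta>; as the divisor is positive, this is decided by one multiplication. The
  continuation \<open>k\<close> at the leaves allows trees to be nested.\<close>

primrec comp :: "nat => nat => ('a => prog) => 'a dtree => prog" where
"comp r q k (Leaf v) = k v"
| "comp r q k (Node \<theta> l r') = Seq (block [RConst 5 \<theta>, RMul 5 5 q]) (If (RLess r 5) (comp r q k l) (comp r q k r'))"

lemma runs_comp:
assumes "r \<noteq> 5" "q \<noteq> 5" "reg s q > 0" "0 <= c"
 and leaf: "\<And>v t. v \<in> set_dtree tr ==> idx t = idx s ==> arr t = arr s ==>
  (\<forall>k. k \<noteq> 5 --> reg t k = reg s k) ==> v = dev tr (reg s r/reg s q) ==> runs E (k v) t c Q"
shows "runs E (comp r q k tr) s (3*real (depth tr)+c) Q"
proof -
have "runs E (comp r q k tr) s' (3*real (depth tr)+c) Q"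
 if "idx s' = idx s" "arr s' = arr s" "\<forall>k. k \<noteq> 5 --> reg s' k = reg s k"
  "\<And>v t. v \<in> set_dtree tr ==> idx t = idx s ==> arr t = arr s ==>
  (\<forall>k. k \<noteq> 5 --> reg t k = reg s k) ==> v = dev tr (reg s r/reg s q) ==> runs E (k v) t c Q" for s'
 using that
proof (induction tr arbitrary: s')
 case (Leaf v)
 thus ?case by auto
next
 case (Node \<theta> l r')
 show ?case unfolding comp.simps
 proof (rule runs_Seq)
  show "runs E (block [RConst 5 \<theta>, RMul 5 5 q]) s' 2 (%t. idx t = idx s & arr t = arr s &
   (\<forall>k. k \<noteq> 5 --> reg t k = reg s k) & reg t 5 = \<theta>*reg s q)"
   by (rule runs_block) (use Node.prems assms in auto)
  fix t :: mstate assume t: "idx t = idx s & arr t = arr s &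
   (\<forall>k. k \<noteq> 5 --> reg t k = reg s k) & reg t 5 = \<theta>*reg s q"
  show "runs E (If (RLess r 5) (comp r q k l) (comp r q k r')) t (3*real (depth (Node \<theta> l r'))-2+c) Q"
  proof (rule runs_If)
   assume "holds (RLess r 5) t"
   hence "reg s r/reg s q < \<theta>" using t assms by (auto simp: divide_simps)
   hence "runs E (comp r q k l) t (3*real (depth l)+c) Q"
    using t Node.prems by (intro Node.IH(1)) auto
   thus "runs E (comp r q k l) t (3*real (depth (Node \<theta> l r'))-3+c) Q"
    by (rule runs_mono) auto
  next
   assume "\<not> holds (RLess r 5) t"
   hence "\<not> reg s r/reg s q < \<theta>" using t assms by (auto simp: divide_simps)
   hence "runs E (comp r q k r') t (3*real (depth r')+c) Q"
    using t Node.prems by (intro Node.IH(2)) auto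
   thus "runs E (comp r q k r') t (3*real (depth (Node \<theta> l r'))-3+c) Q"
    by (rule runs_mono) auto
  qed auto
 qed auto
qed
from this[of s] leaf show ?thesis by auto
qed

text \<open>Register 1 holds 1 and register 2 the scale, so the outer tree sees the current
  coordinate and the inner tree the residual divided by the scale.\<close>

definition readp :: "nat => real dtree dtree => prog" where
"readp a T = loop (Seq (block [Load 7 0 0, Load 8 (2*a+2) 0])
 (Seq (comp 7 1 (comp 8 2 (%v. block [RConst 9 v])) T) (block [Store 0 0 9])))"

text \<open>Register 2 is reset between the two reductions because only the scale of the second one,
  against all \<open>2*a+1\<close> vectors, is read by the trees.\<close>

definition stepp :: "nat => real dtree dtree => prog" where
"stepp a T = Seq (loop (block [Load 5 0 0, Store (2*a+1) 0 5])) (Seq (redp (2*a) (2*a+1))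
 (Seq (block [RConst 2 1]) (Seq (Instr (FullGrad (2*a+2) 0)) (Seq (redp (2*a+1) (2*a+2))
   (readp a T)))))"

definition teval :: "real dtree dtree => real => real => real" where
"teval T x z = dev (dev T x) z"

text \<open>The bound on the leaves keeps each new query point in the cube, outside which the oracle
  is stuck.\<close>

definition bounded_tree :: "nat => real dtree dtree => bool" where
"bounded_tree D T \<longleftrightarrow> depth T <= D &
 (\<forall>t\<in>set_dtree T. depth t <= D & (\<forall>v\<in>set_dtree t. -1 <= v & v <= 1))"

lemma bounded_tree_teval: "bounded_tree D T ==> -1 <= teval T x z & teval T x z <= 1"
unfolding bounded_tree_def teval_def using dev_in_set by metis

text \<open>Array 0 holds the query point, array \<open>k + 1\<close> the orthogonalised vector number \<open>k\<close>.\<close>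

definition represents :: "machine => nat => mstate => vec list => vec => bool" where
"represents E a s ws m \<longleftrightarrow> ready E s & reg s 0 = 0 & reg s 1 = 1 & arr s 0 = m & length ws = 2*a &
 (\<forall>k<2*a. arr s (Suc k) = ws ! k) & (\<forall>k>2*a. arr s k = (%_. 0)) &
 in_cube (sites E) m & (\<forall>i\<ge>sites E. m i = 0)"

lemma represents_map: "represents E a s ws m ==> map (%k. arr s (Suc k)) [0..<2*a] = ws"
unfolding represents_def by (intro nth_equalityI) auto

text \<open>Reductions against \<open>2*a\<close> and \<open>2*a+1\<close> vectors are
  \<open>4*a+1\<close> orthogonalisations at about \<open>20*N\<close> each, whence
  \<open>80*a\<close>; two nested trees at three units per level give \<open>6*D\<close>.\<close>

lemma runs_stepp:
assumes rep: "represents E a s ws m" and T: "bounded_tree D T" and g: "0 <= grad_price E"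
defines "ws' \<equiv> ws @ [red (sites E) ws m]"
shows "runs E (stepp a T) s (grad_price E+(80*real a+6*real D+60)*(real (sites E)+1))
 (%t. represents E (Suc a) t (ws' @ [red (sites E) ws' (full_grad E m)])
  (advance (sites E) (teval T) ws' m (full_grad E m)))" (is "runs E _ s _ ?Q")
proof -
let ?R = "redp (2*a+1) (2*a+2)"
let ?A = "Seq (Instr (FullGrad (2*a+2) 0)) (Seq ?R (readp a T))" and ?B = "block [RConst 2 1]"
let ?c = "comp 8 2 (%v. block [RConst 9 v])"
let ?N = "sites E" and ?y = "full_grad E m"
have r: "ready E s" "reg s 0 = 0" "reg s 1 = 1" "arr s 0 = m" "length ws = 2*a"
  "in_cube ?N m"
 and rk: "\<And>k. k < 2*a ==> arr s (Suc k) = ws ! k"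
 and rz: "\<And>k. k > 2*a ==> arr s k = (%_. 0)"
 and mz: "\<And>i. i \<ge> ?N ==> m i = 0"
 using rep unfolding represents_def by blast+
have rz1: "arr s (Suc (2*a)) = (%_. 0)" "arr s (Suc (Suc (2*a))) = (%_. 0)" by (rule rz; simp)+
have A1: "runs E (loop (block [Load 5 0 0, Store (2*a+1) 0 5])) s (2+4*real ?N)
 (%t. ready E t & reg t 0 = 0 & reg t 1 = 1 & arr t = (arr s)(2*a+1 := m))"
proof (rule runs_loop[where c = 2 and Inv = "%i q A. A = (arr s)(2*a+1 := (%j. if j < i then m j else 0)) &
  q 0 = 0 & q 1 = 1"], goal_cases)
 case 3
 thus ?case using r rz1 by (auto simp: fun_eq_iff)
next
 case (5 i t)
 thus ?case using r(4) by (intro runs_block) (auto simp: fun_eq_iff less_Suc_eq)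
next
 case (7 t)
 have "(%j. if j < ?N then m j else 0) = m" using mz by (auto simp: fun_eq_iff not_less)
 thus ?case using 7 by simp
qed (use r in auto)
show ?thesis unfolding stepp_def
proof (rule runs_Seq[OF A1])
 fix t assume t: "ready E t & reg t 0 = 0 & reg t 1 = 1 & arr t = (arr s)(2*a+1 := m)"
 have mt: "map (%k. arr t (Suc k)) [0..<2*a] = ws"
  unfolding represents_map[OF rep, symmetric] using t by (intro map_cong) auto
 have B1: "runs E (redp (2*a) (2*a+1)) t (real (2*a)*(12+20*real ?N)) (%q. ready E q &
  arr q = (arr t)(2*a+1 := red ?N ws (arr t (2*a+1))) &
  reg q 0 = 0 & reg q 1 = reg t 1 & reg q 2 = reg t 2 * scl ?N ws)"
  using runs_redp[where E=E and s=t and j="2*a" and x="2*a+1"] t mt by simp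
 show "runs E (Seq (redp (2*a) (2*a+1))
 (Seq ?B ?A))
  t (grad_price E+real (2*a)*(12+20*real ?N)+1+real (2*a+1)*(12+20*real ?N)
   +(2+(6*real D+6)*real ?N)) ?Q"
 proof (rule runs_Seq[OF B1])
  fix q assume q: "ready E q & arr q = (arr t)(2*a+1 := red ?N ws (arr t (2*a+1))) &
   reg q 0 = 0 & reg q 1 = reg t 1 & reg q 2 = reg t 2 * scl ?N ws"
  show "runs E (Seq ?B ?A)
  q (grad_price E+1+real (2*a+1)*(12+20*real ?N)
   +(2+(6*real D+6)*real ?N)) ?Q"
  proof (rule runs_Seq)
   show "runs E ?B q 1 (%x. ready E x & arr x = (arr s)(2*a+1 := red ?N ws m) &
     reg x 0 = 0 & reg x 1 = 1 & reg x 2 = 1)"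
    by (rule runs_block) (use q t in auto)
   fix x assume x: "ready E x & arr x = (arr s)(2*a+1 := red ?N ws m) &
     reg x 0 = 0 & reg x 1 = 1 & reg x 2 = 1"
   show "runs E ?A
  x (grad_price E+real (2*a+1)*(12+20*real ?N)
   +(2+(6*real D+6)*real ?N)) ?Q"
   proof (rule runs_Seq)
    have "admissible E (FullGrad (2*a+2) 0) x" using x r by auto
    from exec.Instr[OF this]
    show "runs E (Instr (FullGrad (2*a+2) 0)) x (grad_price E) (%x. ready E x &
     arr x = (arr s)(2*a+1 := red ?N ws m, 2*a+2 := ?y) &
     reg x 0 = 0 & reg x 1 = 1 & reg x 2 = 1)"
     unfolding runs_def using x r
     by (intro exI[of _ "grad_price E"] exI[of _ "effect E (FullGrad (2*a+2) 0) x"]) auto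
    fix v assume v: "ready E v &
     arr v = (arr s)(2*a+1 := red ?N ws m, 2*a+2 := ?y) &
     reg v 0 = 0 & reg v 1 = 1 & reg v 2 = 1"
    have mv: "map (%k. arr v (Suc k)) [0..<2*a+1] = ws'"
    proof -
     have "map (%k. arr v (Suc k)) [0..<2*a] = ws"
      unfolding represents_map[OF rep, symmetric] using v by (intro map_cong) auto
     thus ?thesis using v by (simp add: ws'_def)
    qed
    have C1: "runs E ?R v (real (2*a+1)*(12+20*real ?N)) (%q. ready E q &
     arr q = (arr v)(2*a+2 := red ?N ws' (arr v (2*a+2))) &
     reg q 0 = 0 & reg q 1 = reg v 1 & reg q 2 = reg v 2 * scl ?N ws')"
     using runs_redp[where E=E and s=v and j="2*a+1" and x="2*a+2"] v mv by simp
    show "runs E (Seq ?R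
     (readp a T))
     v (real (2*a+1)*(12+20*real ?N)+(2+(6*real D+6)*real ?N)) ?Q"
    proof (rule runs_Seq[OF C1])
     fix z assume z: "ready E z &
      arr z = (arr v)(2*a+2 := red ?N ws' (arr v (2*a+2))) &
      reg z 0 = 0 & reg z 1 = reg v 1 & reg z 2 = reg v 2 * scl ?N ws'"
     let ?A = "(arr s)(2*a+1 := red ?N ws m, 2*a+2 := red ?N ws' ?y)"
     let ?m = "advance ?N (teval T) ws' m ?y"
     show "runs E (readp a T)
      z (2+(6*real D+6)*real ?N) ?Q"
      unfolding readp_def
      proof (rule runs_loop[where c = "6*real D+4" and Inv = "%i q A.
       A = ?A(0 := (%j. if j < i then ?m j else m j)) &
       q 0 = 0 & q 1 = 1 & q 2 = scl ?N ws'"], goal_cases)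
      case (5 i b)
      show ?case
      proof (rule runs_Seq)
       show "runs E (block [Load 7 0 0, Load 8 (2*a+2) 0]) b 2 (%e. arr e = arr b & idx e = idx b &
        reg e 0 = 0 & reg e 1 = 1 & reg e 2 = scl ?N ws' & reg e 7 = m i & reg e 8 = red ?N ws' ?y i)"
        by (rule runs_block) (use 5 in auto)
       fix e :: mstate assume e: "arr e = arr b & idx e = idx b &
        reg e 0 = 0 & reg e 1 = 1 & reg e 2 = scl ?N ws' & reg e 7 = m i & reg e 8 = red ?N ws' ?y i"
       show "runs E (Seq (comp 7 1 ?c T) (block [Store 0 0 9]))
        e (6*real D+2) (%t'. (arr t' = ?A(0 := (%j. if j < Suc i then ?m j else m j)) &
       reg t' 0 = 0 & reg t' 1 = 1 & reg t' 2 = scl ?N ws') & idx t' = idx b)"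
       proof (rule runs_Seq)
        let ?R = "%t. arr t = arr b & idx t = idx b &
         reg t 0 = 0 & reg t 1 = 1 & reg t 2 = scl ?N ws' & reg t 9 = ?m i"
        have "runs E (comp 7 1 ?c T) e (3*real (depth T)+(3*real D+1)) ?R"
        proof (rule runs_comp)
         fix tr and h :: mstate assume h: "tr \<in> set_dtree T" "idx h = idx e" "arr h = arr e"
          "\<forall>k. k \<noteq> 5 --> reg h k = reg e k" "tr = dev T (reg e 7/reg e 1)"
         have "runs E (?c tr) h (3*real (depth tr)+1) ?R"
         proof (rule runs_comp)
          fix w and g :: mstate assume w: "idx g = idx h" "arr g = arr h"
           "\<forall>k. k \<noteq> 5 --> reg g k = reg h k" "w = dev tr (reg h 8/reg h 2)"
          have "w = ?m i" using w h e 5 by (simp add: advance_def teval_def)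
          thus "runs E (block [RConst 9 w]) g 1 ?R"
           by (intro runs_block) (use w h e in auto)
         qed (use h e in auto)
         thus "runs E (?c tr) h (3*real D+1) ?R"
          by (rule runs_mono) (use T h in "auto simp: bounded_tree_def")
        qed (use e in auto)
        thus "runs E (comp 7 1 ?c T) e (6*real D+1) ?R"
         by (rule runs_mono) (use T in "auto simp: bounded_tree_def")
        fix f :: mstate assume "?R f"
        thus "runs E (block [Store 0 0 9]) f 1 (%t'. (arr t' = ?A(0 := (%j. if j < Suc i then ?m j else m j)) &
         reg t' 0 = 0 & reg t' 1 = 1 & reg t' 2 = scl ?N ws') & idx t' = idx b)"
         by (intro runs_block) (use 5 in "auto simp: fun_eq_iff less_Suc_eq")
       qed auto
      qed auto
     next
      case (7 b)
      have eq: "(%j. if j < ?N then ?m j else m j) = ?m" by (auto simp: advance_def fun_eq_iff)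
      have "in_cube ?N ?m" using bounded_tree_teval[OF T] by (auto simp: in_cube_def advance_def)
      moreover have "\<forall>i\<ge>?N. ?m i = 0" using mz by (auto simp: advance_def)
      moreover have "\<forall>k>2*Suc a. arr b k = (%_. 0)" using 7 rz by auto
      moreover have "arr b (Suc k) = (ws' @ [red ?N ws' ?y]) ! k" if "k < 2*Suc a" for k
       using 7 r that rk unfolding ws'_def by (auto simp: nth_append less_Suc_eq)
      ultimately show ?case using 7 r unfolding represents_def eq by (auto simp: ws'_def)
     next
      case 6
      show ?case by (simp add: algebra_simps)
     next
      case 3
      thus ?case using z v r by (auto simp: fun_eq_iff)
     qed (use z v r in auto)
    qed auto
   qed auto
  qed auto
 qed auto
next
 have "0 <= real a*real ?N" "0 <= real D*real ?N" by auto
 thus "2+4*real ?N+(grad_price E+real (2*a)*(12+20*real ?N)+1 +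
   real (2*a+1)*(12+20*real ?N)+(2+(6*real D+6)*real ?N))
  <= grad_price E+(80*real a+6*real D+60)*(real ?N+1)"
  by (simp add: algebra_simps)
qed
qed

primrec stepsp :: "(nat => real dtree dtree) => nat => prog" where
"stepsp T 0 = Seq (block [IDim 1, IConst 2 1, RConst 1 1, RConst 5 1]) (loop (block [Store 0 0 5]))"
| "stepsp T (Suc a) = Seq (stepsp T a) (stepp a (T a))"

lemma runs_stepsp:
assumes T: "\<And>b. bounded_tree D (T b)" and g: "0 <= grad_price E"
defines "R \<equiv> run (sites E) (%a. teval (T a)) (%ms. full_grad E (last ms))"
shows "runs E (stepsp T a) start_state
 (real a*grad_price E+(real a+1)*(80*real a+6*real D+60)*(real (sites E)+1))
 (%t. represents E a t (fst (R a)) (last (snd (R a))))"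
proof (induction a)
case 0
let ?N = "sites E"
show ?case unfolding stepsp.simps
proof (rule runs_Seq)
 show "runs E (block [IDim 1, IConst 2 1, RConst 1 1, RConst 5 1]) start_state 4 (%t. ready E t &
  reg t 0 = 0 & reg t 1 = 1 & reg t 5 = 1 & arr t = (%_ _. 0))"
  by (rule runs_block) (auto simp: start_state_def)
 fix t assume t: "ready E t & reg t 0 = 0 & reg t 1 = 1 & reg t 5 = 1 & arr t = (%_ _. 0)"
 show "runs E (loop (block [Store 0 0 5])) t (2+3*real ?N) (%t. represents E 0 t (fst (R 0)) (last (snd (R 0))))"
 proof (rule runs_loop[where c = 1 and Inv = "%i q A. q 0 = 0 & q 1 = 1 & q 5 = 1 &
   A = (%_ _. 0)(0 := ones i)"], goal_cases)
  case 3
  thus ?case using t by (auto simp: ones_def fun_eq_iff)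
 next
  case (5 i t)
  thus ?case by (intro runs_block) (auto simp: ones_def fun_eq_iff less_Suc_eq)
 next
  case (7 t)
  thus ?case by (auto simp: R_def represents_def in_cube_def ones_def)
 qed (use t in auto)
next
 have "0 <= real D*real ?N" by auto
 thus "4+(2+3*real ?N) <= real 0*grad_price E +
  (real 0+1)*(80*real 0+6*real D+60)*(real ?N+1)" by (simp add: algebra_simps)
qed
next
case (Suc a)
have len: "snd (R a) \<noteq> []" by (cases a) (auto simp: R_def Let_def)
show ?case unfolding stepsp.simps
proof (rule runs_Seq[OF Suc.IH])
 fix t assume "represents E a t (fst (R a)) (last (snd (R a)))"
 from runs_stepp[OF this T g]
 show "runs E (stepp a (T a)) t (grad_price E+(80*real a+6*real D+60)*(real (sites E)+1))
  (%t. represents E (Suc a) t (fst (R (Suc a))) (last (snd (R (Suc a)))))"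
  by (rule runs_mono) (use len in "auto simp: R_def Let_def")
next
 have "(real a+1+1)*(80*real a+6*real D+60)*(real (sites E)+1)
   <= (real a+1+1)*(80*(real a+1)+6*real D+60)*(real (sites E)+1)"
  by (intro mult_right_mono mult_left_mono) auto
 thus "real a*grad_price E+(real a+1)*(80*real a+6*real D+60)*(real (sites E)+1) +
  (grad_price E+(80*real a+6*real D+60)*(real (sites E)+1))
  <= real (Suc a)*grad_price E+(real (Suc a)+1)*(80*real (Suc a)+6*real D+60)*(real (sites E)+1)"
  by (simp add: algebra_simps)
qed
qed

section \<open>Orthogonal projections and spans\<close>

definition vanish :: "nat => vec => bool" where
"vanish N x \<longleftrightarrow> (\<forall>i\<ge>N. x i = 0)"

lemma ip_commute: "ip N x y = ip N y x"
by (simp add: ip_def mult.commute)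

lemma ip_add_right: "ip N x (%i. y i+z i) = ip N x y+ip N x z"
by (simp add: ip_def distrib_left sum.distrib)

lemma ip_diff_right: "ip N x (%i. y i-z i) = ip N x y-ip N x z"
by (simp add: ip_def right_diff_distrib sum_subtractf)

lemma ip_scale_right: "ip N x (%i. c*y i) = c*ip N x y"
by (simp add: ip_def sum_distrib_left mult_ac)

lemma ip_zero_right [simp]: "ip N x (%_. 0) = 0"
by (simp add: ip_def)

lemma ip_sum_right: "ip N x (%i. \<Sum>j\<in>J. f j i) = (\<Sum>j\<in>J. ip N x (f j))"
unfolding ip_def sum_distrib_left by (rule sum.swap)

lemma ip_cong: "(\<And>i. i < N ==> x i = x' i) ==> (\<And>i. i < N ==> y i = y' i) ==> ip N x y = ip N x' y'"
by (auto simp: ip_def intro!: sum.cong)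

lemma ip_self_zero: "ip N w w = 0 ==> i < N ==> w i = 0"
by (simp add: ip_def sum_nonneg_eq_0_iff)

lemma ip_zero_of_self: "ip N w w = 0 ==> ip N w x = 0"
unfolding ip_def[of N w x] by (intro sum.neutral) (simp add: ip_self_zero)

lemma Cauchy_Schwarz_ip: "(ip N x y)^2 <= ip N x x*ip N y y"
using Cauchy_Schwarz_ineq_sum[of x y "{..<N}"] unfolding ip_def power2_eq_square .

lemma orth_linear: "orth N w (%i. a*x i+b*y i) = (%i. a * orth N w x i+b * orth N w y i)"
proof -
have "ip N w (%i. a*x i+b*y i) = a*ip N w x+b*ip N w y"
 by (simp add: ip_add_right ip_scale_right)
thus ?thesis by (auto simp: orth_def fun_eq_iff algebra_simps)
qed

lemma red_linear: "red N ws (%i. a*x i+b*y i) = (%i. a*red N ws x i+b*red N ws y i)"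
by (induction ws rule: rev_induct) (simp_all add: red_snoc orth_linear)

lemma red_zero [simp]: "red N ws (%_. 0) = (%_. 0)"
using red_linear[of N ws 0 "%_. 0" 0 "%_. 0"] by simp

lemma red_diff: "red N ws (%i. x i-y i) = (%i. red N ws x i-red N ws y i)"
using red_linear[of N ws 1 x "-1" y] by simp

lemma red_scale: "red N ws (%i. a*x i) = (%i. a*red N ws x i)"
using red_linear[of N ws a x 0 x] by simp

lemma orth_zero [simp]: "orth N w (%_. 0) = (%_. 0)"
by (auto simp: orth_def)

lemma vanish_orth: "vanish N x ==> vanish N (orth N w x)"
by (auto simp: vanish_def orth_def)

lemma vanish_red: "vanish N x ==> vanish N (red N ws x)"
by (induction ws rule: rev_induct) (auto simp: red_snoc vanish_orth)

text \<open>Stands for membership of \<open>x\<close> in the span of \<open>ws\<close>. Phrased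
  through \<open>red\<close> it is linear in \<open>x\<close> and survives appending further
  vectors, without any talk of coefficients.\<close>

definition dead :: "nat => vec list => vec => bool" where
"dead N ws x \<longleftrightarrow> red N ws x = (%_. 0)"

lemma dead_zero [simp]: "dead N ws (%_. 0)" by (simp add: dead_def)

lemma dead_linear: "dead N ws x ==> dead N ws y ==> dead N ws (%i. a*x i+b*y i)"
by (simp add: dead_def red_linear)

lemma dead_scale: "dead N ws x ==> dead N ws (%i. a*x i)"
by (simp add: dead_def red_scale)

lemma dead_add: "dead N ws x ==> dead N ws y ==> dead N ws (%i. x i+y i)"
using dead_linear[of N ws x y 1 1] by simp

lemma dead_sum: "finite J ==> (\<And>j. j \<in> J ==> dead N ws (f j)) ==> dead N ws (%i. \<Sum>j\<in>J. f j i)"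
by (induction J rule: finite_induct) (auto intro: dead_add)

lemma dead_snoc: "dead N ws x ==> dead N (ws @ [w]) x"
by (simp add: dead_def red_snoc)

lemma dead_append: "dead N ws x ==> dead N (ws @ vs) x"
by (induction vs rule: rev_induct) (auto simp flip: append_assoc intro: dead_snoc)

lemma dead_self: assumes "vanish N x" shows "dead N (ws @ [red N ws x]) x"
proof -
have "vanish N (red N ws x)" using assms by (rule vanish_red)
moreover have "red N ws x i = 0" if "ip N (red N ws x) (red N ws x) = 0" "vanish N (red N ws x)" for i
 using that ip_self_zero[of N "red N ws x" i] by (cases "i < N") (auto simp: vanish_def)
ultimately show ?thesis
 by (auto simp: dead_def red_snoc orth_def fun_eq_iff vanish_def not_less)
qed

definition orthogonal_list :: "nat => vec list => bool" where
"orthogonal_list N ws \<longleftrightarrow> (\<forall>j<length ws. \<forall>i<j. ip N (ws ! i) (ws ! j) = 0)"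

text \<open>Zero vectors in a list get coefficient 0, in agreement with \<open>orth\<close>, which
  skips them.\<close>

definition pcoef :: "nat => vec => vec => real" where
"pcoef N w x = (if ip N w w = 0 then 0 else ip N w x/ip N w w)"

definition proj :: "nat => vec list => vec => nat => real" where
"proj N ws x i = (\<Sum>j<length ws. pcoef N (ws ! j) x*(ws ! j) i)"

definition perp :: "nat => vec list => vec => nat => real" where
"perp N ws x i = (if i < N then x i-proj N ws x i else 0)"

lemma orthogonal_snoc: "orthogonal_list N (ws @ [w]) \<longleftrightarrow>
 orthogonal_list N ws & (\<forall>v\<in>set ws. ip N v w = 0)"
by (auto simp: orthogonal_list_def nth_append less_Suc_eq all_set_conv_all_nth)

lemma proj_snoc: "proj N (ws @ [w]) x i = proj N ws x i+pcoef N w x*w i"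
by (simp add: proj_def nth_append)

lemma pcoef_self: "pcoef N w x*ip N w w = ip N w x"
by (auto simp: pcoef_def ip_zero_of_self)

lemma ip_proj: "ip N y (proj N ws x) = (\<Sum>j<length ws. pcoef N (ws ! j) x*ip N y (ws ! j))"
unfolding proj_def[abs_def] by (simp add: ip_sum_right ip_scale_right)

lemma ip_proj_member:
assumes "orthogonal_list N ws" "j < length ws"
shows "ip N (ws ! j) (proj N ws x) = ip N (ws ! j) x"
proof -
have "ip N (ws ! j) (ws ! k) = 0" if "k < length ws" "k \<noteq> j" for k
 using assms that unfolding orthogonal_list_def by (metis ip_commute linorder_neqE_nat)
hence "ip N (ws ! j) (proj N ws x) = (\<Sum>k<length ws. if k = j then ip N (ws ! j) x else 0)"
 unfolding ip_proj by (intro sum.cong) (auto simp: pcoef_self)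
thus ?thesis using assms by simp
qed

lemma ip_proj_symmetric: "ip N y (proj N ws x) = ip N x (proj N ws y)"
unfolding ip_proj by (intro sum.cong refl) (auto simp: pcoef_def ip_commute)

lemma ip_proj_proj:
assumes "orthogonal_list N ws"
shows "ip N (proj N ws y) (proj N ws x) = ip N y (proj N ws x)"
proof -
have "ip N (proj N ws y) (proj N ws x) = (\<Sum>j<length ws. pcoef N (ws ! j) y*ip N (proj N ws x) (ws ! j))"
 by (subst ip_commute) (rule ip_proj)
also have "... = (\<Sum>j<length ws. pcoef N (ws ! j) y*ip N x (ws ! j))"
proof (intro sum.cong refl)
 fix j assume "j \<in> {..<length ws}"
 hence "ip N (ws ! j) (proj N ws x) = ip N (ws ! j) x" by (intro ip_proj_member[OF assms]) auto
 thus "pcoef N (ws ! j) y*ip N (proj N ws x) (ws ! j) = pcoef N (ws ! j) y*ip N x (ws ! j)"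
  by (simp only: ip_commute[of N "proj N ws x"] ip_commute[of N x])
qed
also have "... = ip N x (proj N ws y)" by (simp add: ip_proj)
also have "... = ip N y (proj N ws x)" by (rule ip_proj_symmetric)
finally show ?thesis .
qed

lemma ip_proj_self:
"orthogonal_list N ws ==> ip N (proj N ws x) (proj N ws x) =
 (\<Sum>j<length ws. pcoef N (ws ! j) x*ip N (ws ! j) x)"
proof -
assume "orthogonal_list N ws"
hence "ip N (proj N ws x) (proj N ws x) = (\<Sum>j<length ws. pcoef N (ws ! j) x*ip N x (ws ! j))"
 by (simp only: ip_proj_proj ip_proj[of N x])
thus ?thesis by (simp only: ip_commute[of N x])
qed

lemma ip_perp_right: "ip N y (perp N ws x) = ip N y x-ip N y (proj N ws x)"
proof -
have "ip N y (perp N ws x) = ip N y (%i. x i-proj N ws x i)" by (rule ip_cong) (auto simp: perp_def)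
thus ?thesis by (simp add: ip_diff_right)
qed

lemma ip_perp_symmetric: "ip N y (perp N ws x) = ip N (perp N ws y) x"
proof -
have "ip N (perp N ws y) x = ip N x (perp N ws y)" by (rule ip_commute)
thus ?thesis using ip_proj_symmetric[of N y ws x] ip_commute[of N x y] by (simp add: ip_perp_right)
qed

lemma perp_member: "orthogonal_list N ws ==> w \<in> set ws ==> ip N w (perp N ws x) = 0"
unfolding in_set_conv_nth by (auto simp only: ip_perp_right ip_proj_member diff_self)

text \<open>By induction: against an orthogonal list each call of \<open>orth\<close> subtracts one
  more projection term and multiplies by \<open><w,w>\<close>, and these factors collect to
  \<open>scl\<close>. Zero vectors enter with weight 1 and coefficient 0 on both sides.\<close>

lemma red_perp:
assumes "orthogonal_list N ws" "i < N"
shows "red N ws x i = scl N ws*perp N ws x i"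
using assms
proof (induction ws arbitrary: i rule: rev_induct)
case Nil
thus ?case by (simp add: perp_def proj_def scl_def)
next
case (snoc w ws)
hence o: "orthogonal_list N ws" "\<forall>v\<in>set ws. ip N v w = 0" by (auto simp: orthogonal_snoc)
have "ip N w (proj N ws x) = 0"
 unfolding ip_proj using o(2) by (intro sum.neutral) (auto simp: ip_commute[of N w])
moreover have "ip N w (red N ws x) = ip N w (%i. scl N ws*perp N ws x i)"
 using snoc.IH[OF o(1)] by (intro ip_cong) auto
ultimately have *: "ip N w (red N ws x) = scl N ws*ip N w x"
 by (simp add: ip_scale_right ip_perp_right)
have r: "red N ws x i = scl N ws*(x i-proj N ws x i)"
 using snoc.IH[OF o(1) snoc.prems(2)] snoc.prems(2) by (simp add: perp_def)
have pc: "ip N w x = pcoef N w x*ip N w w" by (simp add: pcoef_self)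
have p0: "ip N w w = 0 ==> pcoef N w x = 0" by (simp add: pcoef_def)
show ?case
proof (cases "ip N w w = 0")
 case True
 hence "red N (ws @ [w]) x i = red N ws x i" "scl N (ws @ [w]) = scl N ws"
  by (simp_all add: red_snoc orth_def scl_snoc wt_def)
 thus ?thesis using snoc.prems(2) p0[OF True] r by (simp add: perp_def proj_snoc)
next
 case False
 have "red N (ws @ [w]) x i = ip N w w*(scl N ws*(x i-proj N ws x i))-scl N ws*(pcoef N w x*ip N w w)*w i"
  unfolding red_snoc orth_def*pc[symmetric] using False snoc.prems(2) by (simp add: r)
 also have "... = scl N ws*ip N w w*(x i-(proj N ws x i+pcoef N w x*w i))"
  by (simp only: algebra_simps)
 also have "... = scl N (ws @ [w])*perp N (ws @ [w]) x i"
  using False snoc.prems(2) by (simp only: scl_snoc wt_def perp_def proj_snoc if_False if_True)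
 finally show ?thesis .
qed
qed

lemma red_orthogonal:
assumes "orthogonal_list N ws" "w \<in> set ws"
shows "ip N w (red N ws x) = 0"
proof -
have "ip N w (red N ws x) = ip N w (%i. scl N ws*perp N ws x i)"
 using red_perp[OF assms(1)] by (intro ip_cong) auto
thus ?thesis using perp_member[OF assms] by (simp add: ip_scale_right)
qed

lemma orthogonal_red: "orthogonal_list N ws ==> orthogonal_list N (ws @ [red N ws x])"
using red_orthogonal by (auto simp: orthogonal_snoc)

lemma perp_dead: assumes "orthogonal_list N ws" "dead N ws x" shows "perp N ws x = (%_. 0)"
proof
fix i show "perp N ws x i = 0"
proof (cases "i < N")
 case True
 hence "scl N ws*perp N ws x i = 0" using red_perp[OF assms(1) True, of x] assms(2) by (simp add: dead_def)
 thus ?thesis by simp (use scl_pos[of N ws] in linarith)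
qed (simp add: perp_def)
qed

lemma ip_perp_dead: assumes "orthogonal_list N ws" "dead N ws y" shows "ip N (perp N ws x) y = 0"
unfolding ip_perp_symmetric[symmetric] perp_dead[OF assms] by simp

lemma perp_diff: "vanish N x ==> (\<forall>w\<in>set ws. vanish N w) ==> x i-perp N ws x i = proj N ws x i"
by (auto simp: perp_def vanish_def proj_def not_less intro!: sum.neutral)

lemma dead_proj: assumes "\<And>w. w \<in> set ws ==> dead N vs w" shows "dead N vs (proj N ws x)"
unfolding proj_def[abs_def] by (intro dead_sum dead_scale assms) auto

lemma vanish_perp [simp]: "vanish N (perp N ws x)"
by (simp add: perp_def vanish_def)

text \<open>Orthogonal basis of the span of \<open>mu 0, ..., mu (a-1)\<close>. Fed with query
  points alone it is deterministic along a fixed trajectory, in contrast to the list kept by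
  \<open>run\<close>, which also contains the answers.\<close>

primrec gsl :: "nat => (nat => nat => real) => nat => vec list" where
"gsl N mu 0 = []"
| "gsl N mu (Suc a) = gsl N mu a @ [red N (gsl N mu a) (mu a)]"

lemma length_gsl [simp]: "length (gsl N mu a) = a"
by (induction a) auto

lemma orthogonal_gsl: "orthogonal_list N (gsl N mu a)"
by (induction a) (auto simp: orthogonal_list_def[of _ "[]"] orthogonal_red)

lemma vanish_gsl: "(\<And>b. b < a ==> vanish N (mu b)) ==> w \<in> set (gsl N mu a) ==> vanish N w"
by (induction a) (auto simp: vanish_red)

lemma dead_gsl: "vanish N (mu b) ==> b < a ==> dead N (gsl N mu a) (mu b)"
proof (induction a)
case (Suc a)
thus ?case by (cases "b = a") (auto intro: dead_self dead_snoc)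
qed simp

text \<open>\<open>red N ws x\<close> is \<open>x\<close> times a scalar plus a combination of \<open>ws\<close>, hence killed by whatever kills these.\<close>

lemma dead_orth: "dead N vs w ==> vanish N w ==> vanish N x ==> dead N vs x ==> dead N vs (orth N w x)"
proof -
assume *: "dead N vs w" "vanish N w" "vanish N x" "dead N vs x"
have "orth N w x = x \<or> orth N w x = (%i. ip N w w*x i+(- ip N w x)*w i)"
 using *(2,3) by (auto simp: orth_def vanish_def fun_eq_iff)
thus ?thesis using *(4) dead_linear[OF *(4,1), of "ip N w w" "- ip N w x"] by auto
qed

lemma dead_red: "(\<And>w. w \<in> set ws ==> dead N vs w & vanish N w) ==> vanish N x ==> dead N vs x ==> dead N vs (red N ws x)"
by (induction ws rule: rev_induct) (auto simp: red_snoc intro!: dead_orth vanish_red)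

lemma dead_gsl_members:
"(\<And>b. b < a ==> vanish N (mu b) & dead N vs (mu b)) ==> w \<in> set (gsl N mu a) ==> dead N vs w"
proof (induction a arbitrary: w)
case (Suc a)
have "dead N vs w & vanish N w" if "w \<in> set (gsl N mu a)" for w
 using Suc that vanish_gsl[of a N mu w] by auto
thus ?case using Suc.prems by (auto intro!: dead_red)
qed simp

section \<open>Trajectories and the spans that they generate\<close>

definition wlist :: "nat => (nat => real => real => real) => (vec list => nat => real) => nat =>
 vec list" where
"wlist N f Or a = fst (run N f Or a) @ [red N (fst (run N f Or a)) (last (snd (run N f Or a)))]"

lemma run_Suc: "run N f Or (Suc a) =
(wlist N f Or a @ [red N (wlist N f Or a) (Or (snd (run N f Or a)))],
 snd (run N f Or a) @ [advance N (f a) (wlist N f Or a) (last (snd (run N f Or a))) (Or (snd (run N f Or a)))])"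
by (simp add: Let_def wlist_def)

declare run.simps(2) [simp del]

lemma length_run [simp]: "length (snd (run N f Or a)) = Suc a" "length (fst (run N f Or a)) = 2*a"
by (induction a) (simp_all add: run_Suc wlist_def)

lemma length_wlist [simp]: "length (wlist N f Or a) = Suc (2*a)"
by (simp add: wlist_def)

lemma run_ne [simp]: "snd (run N f Or a) \<noteq> []"
by (metis length_run(1) list.size(3) nat.distinct(1))

lemma take_run: "b <= a ==> take (Suc b) (snd (run N f Or a)) = snd (run N f Or b)"
by (induction a) (auto simp: run_Suc le_Suc_eq)

lemma run_nth: "b <= a ==> snd (run N f Or a) ! b = last (snd (run N f Or b))"
proof -
assume b: "b <= a"
have "last (snd (run N f Or b)) = snd (run N f Or b) ! b"
 by (subst last_conv_nth) auto
also have "... = snd (run N f Or a) ! b" by (subst take_run[OF b, symmetric]) simp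
finally show ?thesis ..
qed

lemma orthogonal_run: "orthogonal_list N (fst (run N f Or a))"
proof (induction a)
case 0 thus ?case by (simp add: orthogonal_list_def)
next
case (Suc a) thus ?case by (simp add: run_Suc wlist_def orthogonal_red del: append_assoc)
qed

lemma orthogonal_wlist: "orthogonal_list N (wlist N f Or a)"
by (simp add: wlist_def orthogonal_red orthogonal_run)

lemma vanish_run: "m \<in> set (snd (run N f Or a)) ==> vanish N m"
proof (induction a arbitrary: m)
case 0
thus ?case by (auto simp: vanish_def ones_def)
next
case (Suc a)
have "vanish N (last (snd (run N f Or a)))" by (rule Suc.IH) simp
with Suc show ?case by (auto simp: run_Suc advance_def vanish_def)
qed

lemma vanish_last_run: "vanish N (last (snd (run N f Or a)))"
by (rule vanish_run[of _ N f Or a]) simp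

lemma wlist_Suc: "\<exists>vs. wlist N f Or (Suc a) = (wlist N f Or a @ [red N (wlist N f Or a) (Or (snd (run N f Or a)))]) @ vs"
unfolding wlist_def[of _ _ _ "Suc a"] by (simp add: run_Suc)

lemma dead_wlist_Suc: assumes "dead N (wlist N f Or a @ [red N (wlist N f Or a) (Or (snd (run N f Or a)))]) x"
shows "dead N (wlist N f Or (Suc a)) x"
proof -
obtain vs where "wlist N f Or (Suc a) = (wlist N f Or a @ [red N (wlist N f Or a) (Or (snd (run N f Or a)))]) @ vs"
 using wlist_Suc by blast
thus ?thesis using dead_append[OF assms, of vs] by simp
qed

lemma dead_wlist_point: "b <= a ==> dead N (wlist N f Or a) (last (snd (run N f Or b)))"
proof (induction a)
case 0
thus ?case using vanish_last_run[of N f Or 0] by (auto simp: wlist_def intro!: dead_self[of N _ "[]", simplified])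
next
case (Suc a)
show ?case
proof (cases "b = Suc a")
 case True
 thus ?thesis unfolding wlist_def by (auto intro!: dead_self vanish_last_run)
next
 case False
 hence "dead N (wlist N f Or a) (last (snd (run N f Or b)))" using Suc by simp
 thus ?thesis by (intro dead_wlist_Suc dead_snoc)
qed
qed

lemma dead_wlist_answer: "b < a ==> vanish N (Or (snd (run N f Or b))) ==>
dead N (wlist N f Or a) (Or (snd (run N f Or b)))"
proof (induction a)
case (Suc a)
show ?case
proof (cases "b = a")
 case True
 thus ?thesis using Suc.prems(2) by (auto intro!: dead_wlist_Suc dead_self)
next
 case False
 hence "dead N (wlist N f Or a) (Or (snd (run N f Or b)))" using Suc by simp
 thus ?thesis by (intro dead_wlist_Suc dead_snoc)
qed
qed simp

text \<open>A run reads an answer only after reduction, so two oracles may differ by anything that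
  the reduction kills.\<close>

lemma run_cong:
assumes "\<And>b. b < a ==> red N (wlist N f Or b) (Or (snd (run N f Or b))) = red N (wlist N f Or b) (Or' (snd (run N f Or b)))"
shows "run N f Or a = run N f Or' a"
using assms
proof (induction a)
case (Suc a)
hence eq: "run N f Or a = run N f Or' a" by auto
hence w: "wlist N f Or a = wlist N f Or' a" by (simp add: wlist_def)
have e: "red N (wlist N f Or' a) (Or (snd (run N f Or' a))) = red N (wlist N f Or' a) (Or' (snd (run N f Or' a)))"
 using Suc.prems[of a] by (simp add: eq w)
show ?case unfolding run_Suc eq w advance_def e ..
qed simp

abbreviation seq_oracle :: "(nat => nat => real) => vec list => nat => real" where
"seq_oracle y \<equiv> (%ms. y (length ms-1))"

text \<open>Removes adaptivity: if a run follows \<open>mu\<close>, its answers are those at the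
  prefixes of \<open>mu\<close> and can be listed in advance. The path of either run suffices as
  hypothesis, because inductively both agree up to each step; so the lemma transports events in both
  directions.\<close>

lemma run_seq_oracle:
assumes "\<And>b. b < a ==> y b = Or (take (Suc b) mu)"
 and "snd (run N f Or a) = mu \<or> snd (run N f (seq_oracle y) a) = mu"
shows "run N f Or a = run N f (seq_oracle y) a"
proof -
have "run N f Or b = run N f (seq_oracle y) b" if "b <= a" for b
 using that
proof (induction b)
 case (Suc b)
 hence eq: "run N f Or b = run N f (seq_oracle y) b" by simp
 hence "snd (run N f Or b) = take (Suc b) mu"
  using assms(2) take_run[of b a N f Or] take_run[of b a N f "seq_oracle y"] Suc.prems by auto
 hence "Or (snd (run N f Or b)) = seq_oracle y (snd (run N f (seq_oracle y) b))"
  using assms(1)[of b] Suc.prems by simp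
 thus ?case using eq by (simp add: run_Suc wlist_def)
qed simp
thus ?thesis by simp
qed

text \<open>The trajectory depends on the answer at step \<open>a\<close> only modulo the span of the query points up
  to \<open>a\<close> and of the earlier answers.\<close>

lemma run_modulo_span:
assumes diff: "\<And>a ws. a < n ==> (\<And>b. b <= a ==> dead N ws (mu ! b)) ==> (\<And>b. b < a ==> dead N ws (y b)) ==>
  dead N ws (%i. y a i-y' a i)"
 and van: "\<And>a. a < n ==> vanish N (y a)"
 and path: "snd (run N f (seq_oracle y) n) = mu \<or> snd (run N f (seq_oracle y') n) = mu"
shows "run N f (seq_oracle y) n = run N f (seq_oracle y') n"
proof -
have "run N f (seq_oracle y) b = run N f (seq_oracle y') b" if "b <= n" for b
 using that
proof (induction b)
 case (Suc b)
 hence eq: "run N f (seq_oracle y) b = run N f (seq_oracle y') b" by simp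
 hence w: "wlist N f (seq_oracle y) b = wlist N f (seq_oracle y') b" by (simp add: wlist_def)
 have mu: "snd (run N f (seq_oracle y) b) = take (Suc b) mu"
  using path Suc.prems take_run[of b n N f "seq_oracle y"] take_run[of b n N f "seq_oracle y'"] eq by auto
 have len: "length mu = Suc n" using path by auto
 have mub: "mu ! c = last (snd (run N f (seq_oracle y) c))" if "c <= b" for c
 proof -
  have "snd (run N f (seq_oracle y) b) ! c = take (Suc b) mu ! c" by (simp only: mu)
  also have "... = mu ! c" using that by simp
  finally have "mu ! c = snd (run N f (seq_oracle y) b) ! c" ..
  thus ?thesis by (simp only: run_nth[OF that])
 qed
 \<comment> \<open>The list in use at step \<open>b\<close> kills the points up to \<open>b\<close>
   and the earlier answers, which is what \<open>diff\<close> asks for.\<close>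
 have "dead N (wlist N f (seq_oracle y) b) (%i. y b i-y' b i)"
 proof (rule diff)
  show "dead N (wlist N f (seq_oracle y) b) (mu ! c)" if "c <= b" for c
   using dead_wlist_point[OF that] by (simp only: mub[OF that])
  show "dead N (wlist N f (seq_oracle y) b) (y c)" if "c < b" for c
   using dead_wlist_answer[OF that, of N "seq_oracle y" f] van[of c] Suc.prems that by simp
 qed (use Suc.prems in simp)
 hence "red N (wlist N f (seq_oracle y) b) (y b) = red N (wlist N f (seq_oracle y) b) (y' b)"
  by (auto simp: dead_def red_diff fun_eq_iff)
 hence e: "red N (wlist N f (seq_oracle y') b) (seq_oracle y (snd (run N f (seq_oracle y') b))) =
   red N (wlist N f (seq_oracle y') b) (seq_oracle y' (snd (run N f (seq_oracle y') b)))"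
  using eq w by simp
 show ?case unfolding run_Suc eq w advance_def e ..
qed simp
thus ?thesis by simp
qed

section \<open>Uniqueness of joint laws from trigonometric moments\<close>

lemma (in finite_measure) integrable_trig:
assumes [measurable]: "f \<in> bm M"
shows "integrable M (%x. cos (f x :: real))" "integrable M (%x. sin (f x))"
by (rule integrable_const_bound[where B=1], auto)+

lemma (in finite_measure) integrable_trig_mult:
assumes [measurable]: "f \<in> bm M" "g \<in> bm M"
shows "integrable M (%x. cos (f x :: real) * cos (g x :: real))" "integrable M (%x. sin (f x) * cos (g x))"
 "integrable M (%x. cos (f x :: real) * sin (g x :: real))" "integrable M (%x. sin (f x) * sin (g x))"
by (rule integrable_const_bound[where B=1], auto simp: abs_mult mult_le_one)+

lemma char_distr_Re_Im:
assumes "finite_measure M" and [measurable]: "X \<in> bm M"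
shows "char (distr M borel X) s = Complex (LINT x|M. cos (s*X x)) (LINT x|M. sin (s*X x))"
proof -
interpret finite_measure M by fact
have int: "integrable M (%x. iexp (s*X x))"
 by (rule integrable_const_bound[where B=1]) auto
have "char (distr M borel X) s = (LINT x|M. iexp (s*X x))"
 by (simp add: char_def integral_distr)
moreover have "Re (LINT x|M. iexp (s*X x)) = (LINT x|M. cos (s*X x))"
 using int by (subst integral_Re[symmetric]) (auto simp: cis_conv_exp[symmetric] simp del: of_real_mult)
moreover have "Im (LINT x|M. iexp (s*X x)) = (LINT x|M. sin (s*X x))"
 using int by (subst integral_Im[symmetric]) (auto simp: cis_conv_exp[symmetric] simp del: of_real_mult)
ultimately show ?thesis by (simp add: complex_eq_iff)
qed

lemma (in finite_measure) bounded_density: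
assumes [measurable]: "w \<in> bm M" and w: "\<And>x. 0 <= w x" "\<And>x. w x <= (k :: real)"
defines "D \<equiv> density M (%x. ennreal (w x))"
shows "finite_measure D"
 and "h \<in> bm M ==> (LINT x|D. h x) = (\<integral>x. w x*h x \<partial>M :: real)"
 and "S \<in> sets M ==> measure D S = (LINT x|M. indicator S x*w x)"
proof -
have "integrable M w" by (rule integrable_const_bound[of _ k]) (use w in auto)
hence "(\<integral>\<^sup>+x. ennreal (w x) \<partial>M) \<noteq> \<infinity>" using w by (simp add: nn_integral_eq_integral)
thus "finite_measure D" unfolding D_def by (auto intro!: finite_measureI simp: emeasure_density cong: nn_integral_cong)
show d: "(LINT x|D. h x) = (LINT x|M. w x*h x)" if [measurable]: "h \<in> bm M" for h :: "'a => real"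
 unfolding D_def by (subst integral_density) (auto intro: w)
show "measure D S = (LINT x|M. indicator S x*w x)" if [measurable]: "S \<in> sets M"
 using d[of "indicator S"] sets.sets_into_space[OF that] by (simp add: D_def mult.commute Int_absorb2)
qed

lemma (in finite_measure) normalized_distr:
assumes [measurable]: "X \<in> bm M" "B \<in> sets borel" and m: "measure M (space M) = m" "0 < m"
defines "D \<equiv> distr (density M (%_. ennreal (1/m))) borel X"
shows "real_distribution D" "measure D B = measure M {x\<in>space M. X x \<in> B}/m"
 "char D s = Complex ((LINT x|M. cos (s*X x))/m) ((LINT x|M. sin (s*X x))/m)"
proof -
let ?E = "density M (%_. ennreal (1/m))"
have w: "(%_. 1/m) \<in> bm M" "0 <= 1/m" "1/m <= 1/m" using m by auto
note b = bounded_density[OF w]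
have P: "prob_space ?E"
proof (rule prob_spaceI)
 have "measure ?E (space M) = 1" using b(3)[OF sets.top] m by simp
 thus "emeasure ?E (space ?E) = 1" using finite_measure.emeasure_eq_measure[OF b(1)] by simp
qed
have X: "X \<in> bm ?E" by simp
show "real_distribution D" unfolding D_def by (rule prob_space.real_distribution_distr[OF P X])
have "measure D B = measure ?E {x\<in>space M. X x \<in> B}"
 unfolding D_def by (subst measure_distr) (auto intro!: arg_cong[where f="measure _"])
also have "... = measure M {x\<in>space M. X x \<in> B}/m" by (subst b(3)) auto
finally show "measure D B = measure M {x\<in>space M. X x \<in> B}/m" .
show "char D s = Complex ((LINT x|M. cos (s*X x))/m) ((LINT x|M. sin (s*X x))/m)"
 unfolding D_def char_distr_Re_Im[OF b(1) X] by (simp add: b(2))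
qed

text \<open>Taking \<open>s = 0\<close> shows that the masses agree, so both measures can be
  normalised and Levy's theorem for probability measures applies; mass zero is separated because it
  cannot be normalised.\<close>

lemma finite_char_uniqueness:
fixes X1 :: "'a => real" and X2 :: "'b => real"
assumes fin: "finite_measure M1" "finite_measure M2"
 and X: "X1 \<in> bm M1" "X2 \<in> bm M2"
 and c: "\<And>s. (LINT x|M1. cos (s*X1 x)) = (LINT x|M2. cos (s*X2 x))"
 and s: "\<And>s. (LINT x|M1. sin (s*X1 x)) = (LINT x|M2. sin (s*X2 x))"
 and B: "B \<in> sets borel"
shows "measure M1 {x\<in>space M1. X1 x \<in> B} = measure M2 {x\<in>space M2. X2 x \<in> B}"
proof -
define m where "m = measure M1 (space M1)"
have m2: "measure M2 (space M2) = m" using c[of 0] by (simp add: m_def)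
show ?thesis
proof (cases "m = 0")
 case True
 have "measure M1 {x\<in>space M1. X1 x \<in> B} <= measure M1 (space M1)"
  "measure M2 {x\<in>space M2. X2 x \<in> B} <= measure M2 (space M2)"
  using fin X B by (auto intro!: finite_measure.finite_measure_mono)
 thus ?thesis using True m2 by (simp add: m_def measure_le_0_iff)
next
 case False
 hence m: "0 < m" by (simp add: m_def zero_less_measure_iff)
 note d1 = finite_measure.normalized_distr[OF fin(1) X(1) B m_def[symmetric] m]
  and d2 = finite_measure.normalized_distr[OF fin(2) X(2) B m2 m]
 have "distr (density M1 (%_. ennreal (1/m))) borel X1 = distr (density M2 (%_. ennreal (1/m))) borel X2"
  by (rule Levy_uniqueness[OF d1(1) d2(1)]) (simp add: fun_eq_iff d1(3) d2(3) c s)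
 with d1(2) d2(2) m show ?thesis by simp
qed
qed

text \<open>Reweighting by the positive functions \<open>2 + cos\<close> and \<open>2 + sin\<close> of a linear combination of the
  remaining coordinates reduces the multivariate statement to the univariate one.\<close>

lemma multivariate_char_uniqueness_rectangle:
fixes X1 :: "'i => 'a => real" and X2 :: "'i => 'b => real"
assumes "finite J" "finite_measure M1" "finite_measure M2"
 and "\<And>j. j \<in> J ==> X1 j \<in> bm M1" "\<And>j. j \<in> J ==> X2 j \<in> bm M2"
 and "\<And>t. (LINT x|M1. cos (\<Sum>j\<in>J. t j*X1 j x)) = (LINT x|M2. cos (\<Sum>j\<in>J. t j*X2 j x))"
 and "\<And>t. (LINT x|M1. sin (\<Sum>j\<in>J. t j*X1 j x)) = (LINT x|M2. sin (\<Sum>j\<in>J. t j*X2 j x))"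
 and "\<And>j. j \<in> J ==> B j \<in> sets borel"
shows "measure M1 {x\<in>space M1. \<forall>j\<in>J. X1 j x \<in> B j} = measure M2 {x\<in>space M2. \<forall>j\<in>J. X2 j x \<in> B j}"
using assms
proof (induction J arbitrary: M1 M2 rule: finite_induct)
case empty
from empty.prems(5)[of "%_. 0"] show ?case by simp
next
case (insert j J)
interpret M1: finite_measure M1 by fact
interpret M2: finite_measure M2 by fact
have [measurable]: "X1 j \<in> bm M1" "X2 j \<in> bm M2" "B j \<in> sets borel"
 "\<And>i. i \<in> J ==> X1 i \<in> bm M1" "\<And>i. i \<in> J ==> X2 i \<in> bm M2"
 using insert.prems by auto
define u1 where "u1 t x = (\<Sum>i\<in>J. t i*X1 i x)" for t x
define u2 where "u2 t x = (\<Sum>i\<in>J. t i*X2 i x)" for t x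
have [measurable]: "u1 t \<in> bm M1" "u2 t \<in> bm M2" for t
 unfolding u1_def[abs_def] u2_def[abs_def] by measurable
have upd: "(\<Sum>i\<in>J. (t(j := s)) i*X i x) = (\<Sum>i\<in>J. t i*X i x)" for t :: "'i => real" and s x and X :: "'i => 'c => real"
 using insert.hyps by (intro sum.cong) auto
have cp: "(LINT x|M1. cos (s*X1 j x+u1 t x)) = (LINT x|M2. cos (s*X2 j x+u2 t x))"
 and sp: "(LINT x|M1. sin (s*X1 j x+u1 t x)) = (LINT x|M2. sin (s*X2 j x+u2 t x))" for s t
 using insert.prems(5)[of "t(j := s)"] insert.prems(6)[of "t(j := s)"] insert.hyps
 by (simp_all add: u1_def u2_def upd del: fun_upd_apply) (simp_all)
have neg: "u1 (%i. - t i) x = - u1 t x" "u2 (%i. - t i) y = - u2 t y" for t x y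
 by (simp_all add: u1_def u2_def sum_negf)
have cm: "(LINT x|M1. cos (s*X1 j x-u1 t x)) = (LINT x|M2. cos (s*X2 j x-u2 t x))"
 and sm: "(LINT x|M1. sin (s*X1 j x-u1 t x)) = (LINT x|M2. sin (s*X2 j x-u2 t x))" for s t
 using cp[of s "%i. - t i"] sp[of s "%i. - t i"] by (simp_all add: neg)
note int = M1.integrable_trig M1.integrable_trig_mult M2.integrable_trig M2.integrable_trig_mult
\<comment> \<open>The product formulas reduce these integrals to the hypotheses at
  \<open>s*X_j + u\<close> and \<open>s*X_j - u\<close>.\<close>
have pr: "(LINT x|M1. f (s*X1 j x)*g (u1 t x)) = (LINT x|M2. f (s*X2 j x)*g (u2 t x))"
 if "f = cos \<or> f = sin" "g = cos \<or> g = sin" for f g :: "real => real" and s t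
 using that by (auto simp: cos_times_cos cos_times_sin sin_times_cos sin_times_sin int cp sp cm sm)
have c0: "(LINT x|M1. f (s*X1 j x)) = (LINT x|M2. f (s*X2 j x))" if "f = cos \<or> f = sin" for f :: "real => real" and s
 using that cp[of s "%_. 0"] sp[of s "%_. 0"] by (auto simp: u1_def u2_def)
let ?A1 = "{x\<in>space M1. X1 j x \<in> B j}" and ?A2 = "{x\<in>space M2. X2 j x \<in> B j}"
have A: "measure M1 ?A1 = measure M2 ?A2"
 by (rule finite_char_uniqueness[OF insert.prems(1,2)]) (use c0 in auto)
have tb: "\<bar>g y\<bar> <= 1" "0 <= 2+g y" "2+g y <= 3" "g \<in> bm borel"
 if "g = cos \<or> g = sin" for g :: "real => real" and y
proof -
 show "\<bar>g y\<bar> <= 1" using that by auto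
 thus "0 <= 2+g y" "2+g y <= 3" by linarith+
 show "g \<in> bm borel" using that by auto
qed
have W: "(LINT x|M1. indicator ?A1 x*(2+g (u1 t x))) = (LINT x|M2. indicator ?A2 x*(2+g (u2 t x)))"
 if g: "g = cos \<or> g = sin" for g :: "real => real" and t
proof -
 note [measurable] = tb(4)[OF g]
 let ?D1 = "density M1 (%x. ennreal (2+g (u1 t x)))" and ?D2 = "density M2 (%x. ennreal (2+g (u2 t x)))"
 have w: "(%x. 2+g (u1 t x)) \<in> bm M1" "(%x. 2+g (u2 t x)) \<in> bm M2" by measurable
 note d1 = M1.bounded_density[OF w(1) tb(2,3)[OF g]] and d2 = M2.bounded_density[OF w(2) tb(2,3)[OF g]]
 have e: "(LINT x|?D1. f (s*X1 j x)) = (LINT x|?D2. f (s*X2 j x))" if f: "f = cos \<or> f = sin" for f :: "real => real" and s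
 proof -
  note [measurable] = tb(4)[OF f]
  show ?thesis using f g pr[OF f g, of s t] c0[OF f, of s]
   by (simp add: d1(2) d2(2) distrib_right mult.commute[of "g _"]) (auto simp: int)
 qed
 have "measure ?D1 {x\<in>space ?D1. X1 j x \<in> B j} = measure ?D2 {x\<in>space ?D2. X2 j x \<in> B j}"
  by (rule finite_char_uniqueness[OF d1(1) d2(1)]) (use e in auto)
 thus ?thesis by (simp add: d1(3) d2(3))
qed
let ?D1 = "density M1 (%x. ennreal (indicat_real ?A1 x))" and ?D2 = "density M2 (%x. ennreal (indicat_real ?A2 x))"
have "indicat_real ?A1 \<in> bm M1" "indicat_real ?A2 \<in> bm M2" by measurable
note d1 = M1.bounded_density[OF this(1), of 1, simplified] and d2 = M2.bounded_density[OF this(2), of 1, simplified]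
\<comment> \<open>Subtracting twice the unweighted identity \<open>A\<close> from \<open>W\<close>
  leaves \<open>g\<close> weighted by the event for coordinate \<open>j\<close>. So the measures
  restricted to that event satisfy the hypotheses for the remaining coordinates.\<close>
have V: "(LINT x|?D1. g (u1 t x)) = (LINT x|?D2. g (u2 t x))" if g: "g = cos \<or> g = sin" for g :: "real => real" and t
proof -
 note [measurable] = tb(4)[OF g]
 have "integrable M1 (%x. indicator ?A1 x*g (u1 t x))" "integrable M2 (%x. indicator ?A2 x*g (u2 t x))"
  by (rule M1.integrable_const_bound[where B=1] M2.integrable_const_bound[where B=1];
    use tb(1)[OF g] in "auto simp: abs_mult mult_le_one indicator_def")+
 thus ?thesis using W[OF g, of t] A
  by (simp add: d1(2) d2(2) distrib_left integrable_indicator_iff M1.emeasure_eq_measure M2.emeasure_eq_measure)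
qed
have "measure ?D1 {x\<in>space ?D1. \<forall>j\<in>J. X1 j x \<in> B j} = measure ?D2 {x\<in>space ?D2. \<forall>j\<in>J. X2 j x \<in> B j}"
 by (rule insert.IH[OF d1(1) d2(1)]) (use V insert.prems(7) in "auto simp: u1_def[symmetric] u2_def[symmetric]")
moreover have S: "{x\<in>space M1. \<forall>j\<in>J. X1 j x \<in> B j} \<in> sets M1" "{x\<in>space M2. \<forall>j\<in>J. X2 j x \<in> B j} \<in> sets M2"
 using insert.hyps insert.prems(7) by (auto intro!: sets.sets_Collect_finite_All)
moreover have "{x\<in>space M1. \<forall>j\<in>insert j J. X1 j x \<in> B j} = {x\<in>space M1. \<forall>j\<in>J. X1 j x \<in> B j} \<inter> ?A1"
 "{x\<in>space M2. \<forall>j\<in>insert j J. X2 j x \<in> B j} = {x\<in>space M2. \<forall>j\<in>J. X2 j x \<in> B j} \<inter> ?A2" by auto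
ultimately show ?case by (simp add: d1(3) d2(3) indicator_inter_arith[symmetric])
qed

lemma multivariate_char_uniqueness:
fixes X1 :: "'i => 'a => real" and X2 :: "'i => 'b => real"
assumes J: "finite J" and P: "prob_space M1" "prob_space M2"
 and X: "\<And>j. j \<in> J ==> X1 j \<in> bm M1" "\<And>j. j \<in> J ==> X2 j \<in> bm M2"
 and c: "\<And>t. (LINT x|M1. cos (\<Sum>j\<in>J. t j*X1 j x)) = (LINT x|M2. cos (\<Sum>j\<in>J. t j*X2 j x))"
 and s: "\<And>t. (LINT x|M1. sin (\<Sum>j\<in>J. t j*X1 j x)) = (LINT x|M2. sin (\<Sum>j\<in>J. t j*X2 j x))"
shows "distr M1 (PiM J (%_. borel)) (%x. \<lambda>j\<in>J. X1 j x) = distr M2 (PiM J (%_. borel)) (%x. \<lambda>j\<in>J. X2 j x)"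
proof -
interpret M1: prob_space M1 by fact
interpret M2: prob_space M2 by fact
have [measurable]: "(%x. \<lambda>j\<in>J. X1 j x) \<in> measurable M1 (PiM J (%_. borel))"
 "(%x. \<lambda>j\<in>J. X2 j x) \<in> measurable M2 (PiM J (%_. borel))"
 using X by (auto intro!: measurable_restrict)
interpret D1: prob_space "distr M1 (PiM J (%_. borel)) (%x. \<lambda>j\<in>J. X1 j x)" by (rule M1.prob_space_distr) measurable
show ?thesis
proof (rule measure_eqI_PiM_finite[OF J])
 fix A assume A: "\<And>i. i \<in> J ==> A i \<in> sets (borel :: real measure)"
 have S: "Pi\<^sub>E J A \<in> sets (PiM J (%_. borel))" using A J by (intro sets_PiM_I_finite) auto
 have "measure M1 {x\<in>space M1. \<forall>j\<in>J. X1 j x \<in> A j} = measure M2 {x\<in>space M2. \<forall>j\<in>J. X2 j x \<in> A j}"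
  by (rule multivariate_char_uniqueness_rectangle[OF J]) (use assms A in "auto intro: prob_space.finite_measure")
 moreover have "(%x. \<lambda>j\<in>J. X1 j x) -` Pi\<^sub>E J A \<inter> space M1 = {x\<in>space M1. \<forall>j\<in>J. X1 j x \<in> A j}"
  "(%x. \<lambda>j\<in>J. X2 j x) -` Pi\<^sub>E J A \<inter> space M2 = {x\<in>space M2. \<forall>j\<in>J. X2 j x \<in> A j}" by auto
 ultimately show "emeasure (distr M1 (PiM J (%_. borel)) (%x. \<lambda>j\<in>J. X1 j x)) (Pi\<^sub>E J A) =
   emeasure (distr M2 (PiM J (%_. borel)) (%x. \<lambda>j\<in>J. X2 j x)) (Pi\<^sub>E J A)"
  using S by (simp add: emeasure_distr M1.emeasure_eq_measure M2.emeasure_eq_measure)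
next
 show "range (%_::nat. Pi\<^sub>E J (%_. UNIV)) \<subseteq> prod_algebra J (%_. borel::real measure)"
  using J by (auto intro!: prod_algebraI_finite)
 show "(\<Union>i::nat. Pi\<^sub>E J (%_. UNIV)) = space (PiM J (%_. borel::real measure))" by (simp add: space_PiM)
qed auto
qed

section \<open>Multi-indices and symmetrised tensors\<close>

lemma finite_multi_indices [simp]: "finite (multi_indices N k)"
by (rule finite_subset[OF _ finite_lists_length_eq[of "{..<N}" k]]) (auto simp: multi_indices_def)

lemma multi_indices_nth: "js \<in> multi_indices N k ==> j < k ==> js ! j < N"
unfolding multi_indices_def using nth_mem by fastforce

lemma multi_indices_Suc:
"bij_betw (%(js, i). js @ [i]) (multi_indices N k \<times> {..<N}) (multi_indices N (Suc k))"
proof (rule bij_betwI[where g = "%js. (butlast js, last js)"])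
show "(%(js, i). js @ [i]) \<in> multi_indices N k \<times> {..<N} \<rightarrow> multi_indices N (Suc k)"
 by (auto simp: multi_indices_def)
show "(%js. (butlast js, last js)) \<in> multi_indices N (Suc k) \<rightarrow> multi_indices N k \<times> {..<N}"
proof
 fix js assume "js \<in> multi_indices N (Suc k)"
 hence "length js = Suc k" "set js \<subseteq> {..<N}" "js \<noteq> []" by (auto simp: multi_indices_def)
 thus "(butlast js, last js) \<in> multi_indices N k \<times> {..<N}"
  using subsetD[of "set js" "{..<N}" "last js"] in_set_butlastD[of _ js] by (auto simp: multi_indices_def)
qed
show "(butlast (case x of (js, i) => js @ [i]), last (case x of (js, i) => js @ [i])) = x" for x :: "nat list \<times> nat"
 by (cases x) auto
show "(case (butlast y, last y) of (js, i) => js @ [i]) = y" if "y \<in> multi_indices N (Suc k)" for y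
 using that by (auto simp: multi_indices_def intro!: append_butlast_last_id)
qed

lemma sum_multi_indices_prod:
fixes h :: "nat => nat => real"
shows "(\<Sum>js\<in>multi_indices N k. \<Prod>j<k. h j (js ! j)) = (\<Prod>j<k. \<Sum>i<N. h j i)"
proof (induction k)
case 0
have "multi_indices N 0 = {[]}" by (auto simp: multi_indices_def)
thus ?case by simp
next
case (Suc k)
have "(\<Sum>js\<in>multi_indices N (Suc k). \<Prod>j<Suc k. h j (js ! j)) =
  (\<Sum>(js, i)\<in>multi_indices N k \<times> {..<N}. \<Prod>j<Suc k. h j ((js @ [i]) ! j))"
 by (subst sum.reindex_bij_betw[OF multi_indices_Suc, symmetric]) (auto intro!: sum.cong)
also have "... = (\<Sum>(js, i)\<in>multi_indices N k \<times> {..<N}. (\<Prod>j<k. h j (js ! j))*h k i)"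
 by (intro sum.cong) (auto simp: multi_indices_def nth_append intro!: prod.cong)
also have "... = (\<Sum>js\<in>multi_indices N k. \<Prod>j<k. h j (js ! j))*(\<Sum>i<N. h k i)"
 by (simp add: sum.cartesian_product[symmetric] sum_product)
finally show ?case using Suc by simp
qed

text \<open>A product of the same function over all slots is invariant under permuting the slots, so
  each of the \<open>k!\<close> permutations contributes equally; this cancels the
  \<open>1/k!\<close> of the Hamiltonian.\<close>

lemma sum_sym_tensor:
"(\<Sum>js\<in>multi_indices N k. sym_tensor N g k js*(\<Prod>j<k. \<sigma> (js ! j))) =
 fact k*(real N powr (- (real k-1)/2)*(\<Sum>js\<in>multi_indices N k. g k js*(\<Prod>j<k. \<sigma> (js ! j))))"
proof -
let ?I = "multi_indices N k" and ?P = "{\<pi>. \<pi> permutes {..<k}}"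
have bij: "bij_betw (permute_list \<pi>) ?I ?I" if \<pi>: "\<pi> permutes {..<k}" for \<pi>
proof (rule bij_betwI[where g = "permute_list (inv \<pi>)"])
 have i: "inv \<pi> permutes {..<k}" using \<pi> by (rule permutes_inv)
 show "permute_list \<pi> \<in> ?I \<rightarrow> ?I" "permute_list (inv \<pi>) \<in> ?I \<rightarrow> ?I"
  using \<pi> i by (auto simp: multi_indices_def)
 show "permute_list (inv \<pi>) (permute_list \<pi> x) = x" if "x \<in> ?I" for x
  using that permute_list_compose[of "inv \<pi>" x \<pi>] i \<pi> by (simp add: multi_indices_def permutes_inv_o)
 show "permute_list \<pi> (permute_list (inv \<pi>) x) = x" if "x \<in> ?I" for x
  using that permute_list_compose[of \<pi> x "inv \<pi>"] i \<pi> by (simp add: multi_indices_def permutes_inv_o)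
qed
have one: "(\<Sum>js\<in>?I. g k (permute_list \<pi> js)*(\<Prod>j<k. \<sigma> (js ! j))) = (\<Sum>js\<in>?I. g k js*(\<Prod>j<k. \<sigma> (js ! j)))"
 if \<pi>: "\<pi> permutes {..<k}" for \<pi>
proof -
 have "(\<Prod>j<k. \<sigma> (js ! j)) = (\<Prod>j<k. \<sigma> (permute_list \<pi> js ! j))" if js: "js \<in> ?I" for js
 proof -
  have "(\<Prod>j<k. \<sigma> (permute_list \<pi> js ! j)) = (\<Prod>j<k. \<sigma> (js ! \<pi> j))"
   using js \<pi> by (intro prod.cong) (auto simp: multi_indices_def permute_list_nth)
  also have "... = (\<Prod>j<k. \<sigma> (js ! j))"
   by (subst prod.permute[OF \<pi>, of "%j. \<sigma> (js ! j)"]) (simp add: o_def)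
  finally show ?thesis ..
 qed
 hence "(\<Sum>js\<in>?I. g k (permute_list \<pi> js)*(\<Prod>j<k. \<sigma> (js ! j))) =
   (\<Sum>js\<in>?I. g k (permute_list \<pi> js)*(\<Prod>j<k. \<sigma> (permute_list \<pi> js ! j)))"
  by (intro sum.cong) auto
 also have "... = (\<Sum>js\<in>?I. g k js*(\<Prod>j<k. \<sigma> (js ! j)))"
  by (rule sum.reindex_bij_betw[OF bij[OF \<pi>], of "%js. g k js*(\<Prod>j<k. \<sigma> (js ! j))"])
 finally show ?thesis .
qed
have "(\<Sum>js\<in>?I. sym_tensor N g k js*(\<Prod>j<k. \<sigma> (js ! j))) =
 real N powr (- (real k-1)/2)*(\<Sum>\<pi>\<in>?P. \<Sum>js\<in>?I. g k (permute_list \<pi> js)*(\<Prod>j<k. \<sigma> (js ! j)))"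
 by (subst sum.swap) (simp add: sym_tensor_def sum_distrib_left sum_distrib_right mult_ac)
also have "... = real N powr (- (real k-1)/2)*(\<Sum>\<pi>\<in>?P. \<Sum>js\<in>?I. g k js*(\<Prod>j<k. \<sigma> (js ! j)))"
 by (subst sum.cong[OF refl one]) auto
also have "... = fact k*(real N powr (- (real k-1)/2)*(\<Sum>js\<in>?I. g k js*(\<Prod>j<k. \<sigma> (js ! j))))"
 by (simp add: card_permutations[of "{..<k}" k])
finally show ?thesis .
qed

section \<open>Linear forms and series in independent standard normals\<close>

context prob_space
begin

definition iid_normal :: "('i => 'a => real) => 'i set => bool" where
"iid_normal X I \<longleftrightarrow> indep_vars (%_. borel) X I & (\<forall>i\<in>I. distributed M lborel (X i) std_normal_density)"

lemma iid_normalD: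
assumes "iid_normal X I" "i \<in> I"
shows "X i \<in> bm M" "distributed M lborel (X i) std_normal_density"
 "distr M borel (X i) = Nd"
 "expectation (X i) = 0" "integrable M (X i)" "expectation (%x. (X i x)\<^sup>2) = 1" "integrable M (%x. (X i x)\<^sup>2)"
proof -
show d: "distributed M lborel (X i) std_normal_density" using assms by (auto simp: iid_normal_def)
show [measurable]: "X i \<in> bm M" using distributed_measurable[OF d] by simp
have "distr M lborel (X i) = density lborel std_normal_density" by (rule distributed_distr_eq_density[OF d])
thus s: "distr M borel (X i) = Nd"
 by (simp cong: distr_cong add: distr_def)
have m: "integrable Nd (%x. x^k)" for k by (rule integrable_std_normal_distribution_moment)
have t: "integrable M (%x. X i x^k) \<longleftrightarrow> integrable Nd (%x. x^k)"
  "expectation (%x. X i x^k) = (LINT x|Nd. x^k)" for k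
 using integrable_distr_eq[of "X i" M borel "%x. x^k"] integral_distr[of "X i" M borel "%x. x^k"] s by auto
show "integrable M (X i)" using t(1)[of 1] m[of 1] by simp
show "integrable M (%x. (X i x)\<^sup>2)" using t(1)[of 2] m[of 2] by simp
show "expectation (X i) = 0" using t(2)[of 1] integral_std_normal_distribution_moment_odd[of 1] by simp
show "expectation (%x. (X i x)\<^sup>2) = 1" using t(2)[of 2] std_normal_distribution_even_moments[of 1] by (simp add: has_bochner_integral_iff fact_2)
qed

lemma iid_normal_subset: "iid_normal X I ==> J \<subseteq> I ==> iid_normal X J"
by (auto simp: iid_normal_def intro: indep_vars_subset)

lemma iid_normal_product:
assumes "iid_normal X I" "i \<in> I" "j \<in> I"
shows "integrable M (%x. X i x*X j x)" "expectation (%x. X i x*X j x) = (if i = j then 1 else 0)"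
proof -
have "integrable M (%x. X i x*X j x) & expectation (%x. X i x*X j x) = (if i = j then 1 else 0)"
proof (cases "i = j")
 case True
 thus ?thesis using iid_normalD(6,7)[OF assms(1,2)] by (simp add: power2_eq_square)
next
 case False
 have ind: "indep_vars (%_. borel) X {i, j}"
  using assms indep_vars_subset[of "%_. borel" X I "{i,j}"] by (auto simp: iid_normal_def)
 have int: "\<And>l. l \<in> {i, j} ==> integrable M (X l)" using iid_normalD(5)[OF assms(1)] assms by auto
 show ?thesis
  using indep_vars_lebesgue_integral[OF _ ind int] indep_vars_integrable[OF _ ind int]
   iid_normalD(4)[OF assms(1)] assms False by simp
qed
thus "integrable M (%x. X i x*X j x)" "expectation (%x. X i x*X j x) = (if i = j then 1 else 0)" by auto
qed

lemma iid_normal_second_moment: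
assumes "iid_normal X I" "finite A" "A \<subseteq> I"
shows "integrable M (%x. (\<Sum>i\<in>A. a i*X i x)\<^sup>2)" "expectation (%x. (\<Sum>i\<in>A. a i*X i x)\<^sup>2) = (\<Sum>i\<in>A. (a i)\<^sup>2)"
proof -
have eq: "(%x. (\<Sum>i\<in>A. a i*X i x)\<^sup>2) = (%x. \<Sum>i\<in>A. \<Sum>j\<in>A. a i*a j*(X i x*X j x))"
 by (simp add: power2_eq_square sum_product mult_ac)
have int: "integrable M (%x. a i*a j*(X i x*X j x))" if "i \<in> A" "j \<in> A" for i j
 using iid_normal_product(1)[OF assms(1)] assms(3) that by auto
show "integrable M (%x. (\<Sum>i\<in>A. a i*X i x)\<^sup>2)" unfolding eq using int by auto
have "expectation (%x. (\<Sum>i\<in>A. a i*X i x)\<^sup>2) = (\<Sum>i\<in>A. \<Sum>j\<in>A. a i*a j*(if i = j then 1 else 0))"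
 unfolding eq using int iid_normal_product[OF assms(1)] assms(3)
 by (subst int_sum) (auto intro!: sum.cong simp: subset_iff int_sum)
also have "... = (\<Sum>i\<in>A. (a i)\<^sup>2)" using assms(2) by (simp add: power2_eq_square if_distrib cong: if_cong)
finally show "expectation (%x. (\<Sum>i\<in>A. a i*X i x)\<^sup>2) = (\<Sum>i\<in>A. (a i)\<^sup>2)" .
qed

text \<open>The variance of the absolute value is nonnegative, so its mean is at most the root of
  the second moment.\<close>

lemma iid_normal_abs_moment:
assumes "iid_normal X I" "finite A" "A \<subseteq> I"
shows "(\<integral>\<^sup>+x. ennreal \<bar>\<Sum>i\<in>A. a i*X i x\<bar> \<partial>M) <= ennreal (sqrt (\<Sum>i\<in>A. (a i)\<^sup>2))"
proof -
let ?S = "%x. \<Sum>i\<in>A. a i*X i x"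
have [measurable]: "?S \<in> bm M"
 using iid_normalD(1)[OF assms(1)] assms(3) by (intro borel_measurable_sum) (auto simp: subset_iff)
have int: "integrable M ?S" using iid_normalD(5)[OF assms(1)] assms(3) by (auto simp: subset_iff)
have "(expectation (%x. \<bar>?S x\<bar>))^2 <= expectation (%x. \<bar>?S x\<bar>\<^sup>2)"
 using variance_positive[of "%x. \<bar>?S x\<bar>"] variance_eq[of "%x. \<bar>?S x\<bar>"] int
  iid_normal_second_moment(1)[OF assms, of a] by auto
hence "(expectation (%x. \<bar>?S x\<bar>))^2 <= (\<Sum>i\<in>A. (a i)\<^sup>2)"
 using iid_normal_second_moment(2)[OF assms, of a] by simp
hence "expectation (%x. \<bar>?S x\<bar>) <= sqrt (\<Sum>i\<in>A. (a i)\<^sup>2)" by (rule real_le_rsqrt)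
thus ?thesis using int by (subst nn_integral_eq_integral) (auto intro: ennreal_leI)
qed

lemma iid_normal_trig:
assumes "iid_normal X I" "finite A" "A \<subseteq> I"
shows "expectation (%x. cos (\<Sum>i\<in>A. a i*X i x)) = exp (- (\<Sum>i\<in>A. (a i)\<^sup>2)/2)"
 "expectation (%x. sin (\<Sum>i\<in>A. a i*X i x)) = 0"
proof -
have ind: "indep_vars (%_. borel) X A" using iid_normal_subset[OF assms(1,3)] by (simp add: iid_normal_def)
have meas: "X i \<in> bm M" if "i \<in> A" for i using iid_normalD(1)[OF assms(1)] assms(3) that by auto
hence [measurable]: "(%x. \<Sum>i\<in>A. a i*X i x) \<in> bm M" by (intro borel_measurable_sum) auto
have "indep_vars (%_. borel) (%i x. a i*X i x) A"
 using indep_vars_compose2[OF ind, of "%i x. a i*x" "%_. borel"] by simp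
hence "char (distr M borel (%x. \<Sum>i\<in>A. a i*X i x)) 1 = (\<Prod>i\<in>A. char (distr M borel (%x. a i*X i x)) 1)"
 by (rule char_distr_sum)
also have "... = (\<Prod>i\<in>A. complex_of_real (exp (- (a i)\<^sup>2/2)))"
proof (intro prod.cong refl)
 fix i assume i: "i \<in> A"
 have [measurable]: "X i \<in> bm M" using meas i .
 have "char (distr M borel (%x. a i*X i x)) 1 = char (distr M borel (X i)) (a i)"
  by (simp add: char_def integral_distr)
 also have "distr M borel (X i) = Nd" using iid_normalD(3)[OF assms(1)] assms(3) i by auto
 finally show "char (distr M borel (%x. a i*X i x)) 1 = complex_of_real (exp (- (a i)\<^sup>2/2))"
  by (simp add: char_std_normal_distribution)
qed
also have "... = complex_of_real (exp (- (\<Sum>i\<in>A. (a i)\<^sup>2)/2))"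
 using assms(2) by (simp add: of_real_prod[symmetric] exp_sum[symmetric] sum_negf sum_divide_distrib del: of_real_prod)
finally have "char (distr M borel (%x. \<Sum>i\<in>A. a i*X i x)) 1 = complex_of_real (exp (- (\<Sum>i\<in>A. (a i)\<^sup>2)/2))" .
moreover have "finite_measure M" by (rule finite_measure_axioms)
ultimately have "Complex (expectation (%x. cos (\<Sum>i\<in>A. a i*X i x))) (expectation (%x. sin (\<Sum>i\<in>A. a i*X i x))) =
  complex_of_real (exp (- (\<Sum>i\<in>A. (a i)\<^sup>2)/2))"
 using char_distr_Re_Im[of M "%x. \<Sum>i\<in>A. a i*X i x" 1] by simp
thus "expectation (%x. cos (\<Sum>i\<in>A. a i*X i x)) = exp (- (\<Sum>i\<in>A. (a i)\<^sup>2)/2)"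
 "expectation (%x. sin (\<Sum>i\<in>A. a i*X i x)) = 0" by (simp_all add: complex_eq_iff)
qed

lemma AE_summable_abs:
fixes T :: "nat => 'a => real"
assumes [measurable]: "\<And>k. T k \<in> bm M"
 and b: "\<And>k. (\<integral>\<^sup>+x. ennreal \<bar>T k x\<bar> \<partial>M) <= ennreal (b k)" "\<And>k. 0 <= b k" "summable b"
shows "AE x in M. summable (%k. \<bar>T k x\<bar>)"
proof -
have "(\<integral>\<^sup>+x. (\<Sum>k. ennreal \<bar>T k x\<bar>) \<partial>M) = (\<Sum>k. \<integral>\<^sup>+x. ennreal \<bar>T k x\<bar> \<partial>M)"
 by (rule nn_integral_suminf) simp
also have "... <= (\<Sum>k. ennreal (b k))" by (intro suminf_le b(1)) auto
also have "... = ennreal (suminf b)" using b by (intro suminf_ennreal2) auto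
finally have "(\<integral>\<^sup>+x. (\<Sum>k. ennreal \<bar>T k x\<bar>) \<partial>M) \<noteq> \<infinity>" by (auto simp: top_unique)
hence "AE x in M. (\<Sum>k. ennreal \<bar>T k x\<bar>) \<noteq> \<infinity>" by (intro nn_integral_noteq_infinite) auto
thus ?thesis by eventually_elim (auto intro: summable_suminf_not_top)
qed

text \<open>Partial sums are finite linear forms with known trigonometric moments; cosine and sine
  are bounded, so dominated convergence passes to the series while the variances add up.\<close>

lemma iid_normal_series_trig:
fixes X :: "nat \<times> 'i => 'a => real"
assumes iid: "iid_normal X (Sigma UNIV J)" and J: "\<And>k. finite (J k)"
 and T: "\<And>k x. T k x = (\<Sum>i\<in>J k. f k i*X (k, i) x)"
 and V: "\<And>k. V k = (\<Sum>i\<in>J k. (f k i)\<^sup>2)" and s: "summable V"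
 and conv: "AE x in M. summable (%k. T k x)"
shows "expectation (%x. cos (\<Sum>k. T k x)) = exp (- suminf V/2)" "expectation (%x. sin (\<Sum>k. T k x)) = 0"
proof -
have [measurable]: "T k \<in> bm M" for k
 unfolding T[abs_def] using iid_normalD(1)[OF iid] by (intro borel_measurable_sum borel_measurable_times) auto
have part: "(\<Sum>k<n. T k x) = (\<Sum>p\<in>Sigma {..<n} J. f (fst p) (snd p)*X p x)" for n x
 by (simp add: T sum.Sigma J split_beta)
have vpart: "(\<Sum>k<n. V k) = (\<Sum>p\<in>Sigma {..<n} J. (f (fst p) (snd p))\<^sup>2)" for n
 by (simp add: V sum.Sigma J split_beta)
have c: "expectation (%x. cos (\<Sum>k<n. T k x)) = exp (- (\<Sum>k<n. V k)/2)"
 and z: "expectation (%x. sin (\<Sum>k<n. T k x)) = 0" for n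
 unfolding part vpart using J
 by (intro iid_normal_trig[OF iid]; auto intro!: finite_SigmaI)+
have lim: "AE x in M. (%n. \<Sum>k<n. T k x) \<longlonglongrightarrow> (\<Sum>k. T k x)"
 using conv by eventually_elim (rule summable_LIMSEQ)
have "(%n. expectation (%x. cos (\<Sum>k<n. T k x))) \<longlonglongrightarrow> expectation (%x. cos (\<Sum>k. T k x))"
proof (rule integral_dominated_convergence[where w="%_. 1"])
 show "AE x in M. (%n. cos (\<Sum>k<n. T k x)) \<longlonglongrightarrow> cos (\<Sum>k. T k x)"
  using lim by eventually_elim (rule tendsto_cos)
qed auto
moreover have "(%n. exp (- (\<Sum>k<n. V k)/2)) \<longlonglongrightarrow> exp (- suminf V/2)"
 using s by (intro tendsto_intros summable_LIMSEQ) auto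
ultimately show "expectation (%x. cos (\<Sum>k. T k x)) = exp (- suminf V/2)"
 unfolding c by (rule LIMSEQ_unique)
have "(%n. expectation (%x. sin (\<Sum>k<n. T k x))) \<longlonglongrightarrow> expectation (%x. sin (\<Sum>k. T k x))"
proof (rule integral_dominated_convergence[where w="%_. 1"])
 show "AE x in M. (%n. sin (\<Sum>k<n. T k x)) \<longlonglongrightarrow> sin (\<Sum>k. T k x)"
  using lim by eventually_elim (rule tendsto_sin)
qed auto
hence "(%n. 0) \<longlonglongrightarrow> expectation (%x. sin (\<Sum>k. T k x))" unfolding z .
thus "expectation (%x. sin (\<Sum>k. T k x)) = 0" by (simp add: LIMSEQ_const_iff)
qed

end

section \<open>The Hamiltonian as a random series, and its gradient\<close>

definition deg :: "vec => nat => real" where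
"deg c k = (if 2 <= k then c k else 0)"

definition nrm :: "nat => nat => real" where
"nrm N k = real N powr (- (real k-1)/2)"

text \<open>Summed over the slot \<open>p\<close>, this is the derivative of the monomial at
  \<open>m\<close> in direction \<open>x\<close>.\<close>

definition mono_at :: "nat => nat => vec => vec => nat list => real" where
"mono_at k p x m js = (\<Prod>j<k. (if j = p then x else m) (js ! j))"

definition hterm :: "vec => nat => (nat => nat list => real) => nat => vec => real" where
"hterm c N g k m = deg c k*nrm N k*(\<Sum>js\<in>multi_indices N k. g k js*(\<Prod>j<k. m (js ! j)))"

definition unit_at :: "nat => nat => real" where "unit_at i l = (if l = i then 1 else 0)"

definition dterm :: "vec => nat => (nat => nat list => real) => nat => vec => nat => real" where
"dterm c N g k m i = deg c k*nrm N k *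
 (\<Sum>js\<in>multi_indices N k. g k js*(\<Sum>p<k. mono_at k p (unit_at i) m js))"

lemma hamiltonian_eq: "hamiltonian c N (sym_tensor N g) m = (\<Sum>k. hterm c N g k m)"
unfolding hamiltonian_def hterm_def by (intro suminf_cong) (simp add: sum_sym_tensor deg_def nrm_def)

lemma hterm_cong: "(\<And>i. i < N ==> m i = m' i) ==> hterm c N g k m = hterm c N g k m'"
unfolding hterm_def by (intro arg_cong2[where f="(*)"] sum.cong prod.cong refl) (auto simp: multi_indices_nth)

lemma gradient_outside: "N <= i ==> gradient (hamiltonian c N (sym_tensor N g)) m i = 0"
proof -
assume i: "N <= i"
have "hamiltonian c N (sym_tensor N g) (m(i := s)) = hamiltonian c N (sym_tensor N g) m" for s
 unfolding hamiltonian_eq using i by (intro suminf_cong hterm_cong) auto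
thus ?thesis by (simp add: gradient_def)
qed

lemma deriv_prod_update:
"((%s. \<Prod>j<k. (m(i := s)) (js ! j)) has_field_derivative (\<Sum>p<k. mono_at k p (unit_at i) (m(i := s)) js)) (at (s::real))"
proof -
have "((%s. \<Prod>j\<in>{..<k}. (m(i := s)) (js ! j)) has_field_derivative
 (\<Sum>p\<in>{..<k}. unit_at i (js ! p)*(\<Prod>j\<in>{..<k}-{p}. (m(i := s)) (js ! j)))) (at s)"
 by (rule has_field_derivative_prod) (auto simp: unit_at_def intro!: derivative_eq_intros)
moreover have "unit_at i (js ! p)*(\<Prod>j\<in>{..<k}-{p}. (m(i := s)) (js ! j)) = mono_at k p (unit_at i) (m(i := s)) js"
 if "p < k" for p
 using that unfolding mono_at_def by (subst prod.remove[of "{..<k}" p]) (auto intro!: prod.cong)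
hence "(\<Sum>p\<in>{..<k}. unit_at i (js ! p)*(\<Prod>j\<in>{..<k}-{p}. (m(i := s)) (js ! j))) =
  (\<Sum>p<k. mono_at k p (unit_at i) (m(i := s)) js)"
 by (intro sum.cong) auto
ultimately show ?thesis by (simp only:)
qed

lemma deriv_hterm:
"((%s. hterm c N g k (m(i := s))) has_field_derivative dterm c N g k (m(i := s)) i) (at s)"
unfolding hterm_def dterm_def
by (intro DERIV_cmult DERIV_sum deriv_prod_update)

definition occ :: "nat => nat => nat list => nat" where
"occ k i js = card {p. p < k & js ! p = i}"

definition rest :: "nat => nat => vec => nat list => real" where
"rest k i m js = (\<Prod>j<k. if js ! j = i then 1 else m (js ! j))"

lemma prod_update_occ: "(\<Prod>j<k. (m(i := s)) (js ! j)) = s^occ k i js*rest k i m js"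
proof -
have "(\<Prod>j<k. (m(i := s)) (js ! j)) = (\<Prod>j<k. (if js ! j = i then s else 1)*(if js ! j = i then 1 else m (js ! j)))"
 by (intro prod.cong) auto
also have "... = (\<Prod>j<k. if js ! j = i then s else 1)*rest k i m js"
 by (simp add: prod.distrib rest_def)
also have "(\<Prod>j<k. if js ! j = i then s else 1) = s^occ k i js"
 by (subst prod.If_cases) (auto simp: occ_def Int_def)
finally show ?thesis .
qed

lemma mono_occ: "(\<Sum>p<k. mono_at k p (unit_at i) (m(i := s)) js) = real (occ k i js) * s^(occ k i js-1)*rest k i m js"
proof (rule DERIV_unique[OF deriv_prod_update])
show "((%s. \<Prod>j<k. (m(i := s)) (js ! j)) has_field_derivative real (occ k i js) * s^(occ k i js-1)*rest k i m js) (at s)"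
 unfolding prod_update_occ by (auto intro!: derivative_eq_intros)
qed

text \<open>Multi-indices are grouped by the number \<open>n\<close> of slots equal to
  \<open>i\<close>. The inner sums do not involve the moving coordinate, so they are single Gaussian
  forms and one null set serves all its values up to \<open>r\<close>.\<close>

definition dbound :: "vec => nat => (nat => nat list => real) => nat => vec => nat => real => real" where
"dbound c N g k m i r = \<bar>deg c k\<bar>*nrm N k*(\<Sum>n\<le>k. real k*r^n *
 \<bar>\<Sum>js\<in>multi_indices N k. (if occ k i js = n then rest k i m js else 0)*g k js\<bar>)"

lemma nrm_nonneg [simp]: "0 <= nrm N k" by (simp add: nrm_def)

lemma occ_le: "occ k i js <= k"
using card_mono[of "{..<k}" "{p. p < k & js ! p = i}"] by (auto simp: occ_def)

lemma dterm_bound: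
assumes "\<bar>s\<bar> <= r" "1 <= r"
shows "\<bar>dterm c N g k (m(i := s)) i\<bar> <= dbound c N g k m i r"
proof -
let ?I = "multi_indices N k"
let ?B = "%n. \<Sum>js\<in>?I. (if occ k i js = n then rest k i m js else 0)*g k js"
have "(\<Sum>js\<in>?I. g k js*(\<Sum>p<k. mono_at k p (unit_at i) (m(i := s)) js)) =
  (\<Sum>js\<in>?I. \<Sum>n\<le>k. if n = occ k i js then real n * s^(n-1)*(rest k i m js*g k js) else 0)"
 unfolding mono_occ using occ_le by (intro sum.cong refl) (simp add: mult_ac)
also have "... = (\<Sum>n\<le>k. real n * s^(n-1)*?B n)"
 by (subst sum.swap) (auto simp: sum_distrib_left if_distrib intro!: sum.cong)
finally have *: "(\<Sum>js\<in>?I. g k js*(\<Sum>p<k. mono_at k p (unit_at i) (m(i := s)) js)) = (\<Sum>n\<le>k. real n * s^(n-1)*?B n)" .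
have "\<bar>\<Sum>n\<le>k. real n * s^(n-1)*?B n\<bar> <= (\<Sum>n\<le>k. real k*r^n*\<bar>?B n\<bar>)"
proof (rule order_trans[OF sum_abs sum_mono])
 fix n assume n: "n \<in> {..k}"
 have "\<bar>s\<bar>^(n-1) <= r^(n-1)" using assms by (intro power_mono) auto
 also have "... <= r^n" using assms by (intro power_increasing) auto
 finally have "real n*\<bar>s\<bar>^(n-1) <= real k*r^n" using n by (intro mult_mono) auto
 thus "\<bar>real n * s^(n-1)*?B n\<bar> <= real k*r^n*\<bar>?B n\<bar>"
  by (simp add: abs_mult power_abs mult_right_mono)
qed
thus ?thesis unfolding dterm_def dbound_def *
 by (simp add: abs_mult mult_left_mono)
qed

lemma sqrt_sqrt_power4: "0 <= x ==> sqrt (sqrt x)^4 = x"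
proof -
assume x: "0 <= x"
have "sqrt (sqrt x)^4 = ((sqrt (sqrt x))^2)^2" by (simp only: power_mult[symmetric]) simp
thus ?thesis using x by simp
qed

text \<open>With \<open>s\<close> the fourth root of \<open>q\<close>, half of the decay absorbs the
  polynomial, since \<open>k*s^k\<close> tends to 0, and the other half is a geometric series in
  \<open>s^2\<close>.\<close>

lemma summable_square_geometric: assumes "0 <= q" "q < (1::real)" shows "summable (%k. (real k+1)\<^sup>2*q^k)"
proof (cases "q = 0")
case True
thus ?thesis by (intro summable_finite[of "{0}"]) auto
next
case False
hence q: "0 < q" using assms by simp
define s where "s = sqrt (sqrt q)"
have s: "0 < s" "s < 1" "s^4 = q"
 using q assms by (auto simp: s_def sqrt_sqrt_power4)
have lim: "(%n. real n * s^n) \<longlonglongrightarrow> 0" using powser_times_n_limit_0[of s] s by simp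
have "(%n. (real n * s^n+s^n)\<^sup>2) \<longlonglongrightarrow> (0+0)\<^sup>2"
 using s by (intro tendsto_intros lim LIMSEQ_realpow_zero) auto
from order_tendstoD(2)[OF this, of 1]
have "eventually (%n. (real n * s^n+s^n)\<^sup>2 < 1) sequentially" by simp
hence ev: "eventually (%n. norm ((real n+1)^2*q^n) <= (s^2)^n) sequentially"
proof eventually_elim
 case (elim n)
 have "q^n = (s^n)^4" "(s^2)^n = (s^n)^2"
  by (simp_all add: s(3)[symmetric] power_mult[symmetric] mult.commute)
 hence "(real n+1)^2*q^n = (real n * s^n+s^n)^2*(s^2)^n"
  by (simp add: power2_eq_square power4_eq_xxxx algebra_simps)
 also have "... <= 1*(s^2)^n" using elim by (intro mult_right_mono) auto
 finally show ?case using q by simp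
qed
have "summable (%n. (s^2)^n)" using s by (intro summable_geometric) (auto simp: power_less_one_iff)
thus ?thesis using summable_comparison_test_ev[OF ev] by simp
qed

locale mixture_coeffs =
fixes c :: "nat => real" and \<epsilon>0 :: real
assumes eps0: "0 < \<epsilon>0" and sum_c: "summable (%k. (c k)\<^sup>2*(1+\<epsilon>0)^k)"
begin

text \<open>Boundedness of \<open>(c k)^2*rad^(4*k)\<close> gives decay of \<open>c k\<close> like
  \<open>rad^(-2*k)\<close>. One half of it pays for evaluation up to the radius
  \<open>rad > 1\<close>, the other half for polynomial factors in \<open>k\<close>.\<close>

definition rad :: real where "rad = sqrt (sqrt (1+\<epsilon>0))"

lemma rad: "1 < rad" "rad^2 < 1+\<epsilon>0" "rad^4 = 1+\<epsilon>0"
proof -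
show "1 < rad" "rad^4 = 1+\<epsilon>0" using eps0 by (auto simp: rad_def sqrt_sqrt_power4)
have "sqrt (1+\<epsilon>0) < 1+\<epsilon>0"
 using eps0 by (intro real_less_lsqrt) (auto simp: power2_eq_square algebra_simps add_pos_pos)
thus "rad^2 < 1+\<epsilon>0" using eps0 by (simp add: rad_def)
qed

lemma summable_coeff: "summable (%k. (real k+1)\<^sup>2*(\<bar>deg c k\<bar>*rad^k))"
proof -
obtain B where B: "\<And>k. norm ((c k)^2*(1+\<epsilon>0)^k) <= B"
 using convergent_imp_Bseq[OF convergentI[OF summable_LIMSEQ_zero[OF sum_c]]] unfolding Bseq_def by blast
have Bk: "\<bar>c k\<bar>*(rad^2)^k <= sqrt B" for k
proof (rule real_le_rsqrt)
 have "(\<bar>c k\<bar>*(rad^2)^k)^2 = (c k)^2*(rad^4)^k"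
  by (simp add: power_mult_distrib power_mult[symmetric] mult.commute mult.left_commute)
 thus "(\<bar>c k\<bar>*(rad^2)^k)^2 <= B" using B[of k] rad(3) eps0 by simp
qed
have q: "0 <= 1/rad" "1/rad < 1" using rad(1) by auto
have "summable (%k. (real k+1)\<^sup>2*(1/rad)^k)" by (rule summable_square_geometric[OF q])
hence "summable (%k. sqrt B*((real k+1)^2*(1/rad)^k))" by (rule summable_mult)
thus ?thesis
proof (rule summable_comparison_test'[where N=0])
 fix k :: nat
 have "\<bar>deg c k\<bar>*rad^k <= \<bar>c k\<bar>*(rad^2)^k*(1/rad)^k"
  using rad(1) by (simp add: deg_def power_divide power2_eq_square power_mult_distrib)
 also have "... <= sqrt B*(1/rad)^k" using q by (intro mult_right_mono Bk) auto
 finally show "norm ((real k+1)^2*(\<bar>deg c k\<bar>*rad^k)) <= sqrt B*((real k+1)^2*(1/rad)^k)"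
  using rad(1) by (simp add: mult.left_commute abs_mult mult_left_mono)
qed
qed

lemma summable_coeff':
assumes "\<And>k. \<bar>f k\<bar> <= A*((real k+1)^2*(\<bar>deg c k\<bar>*rad^k))"
shows "summable f"
by (rule summable_comparison_test'[OF summable_mult[OF summable_coeff, of A], where N=0]) (use assms in simp)

lemma summable_deg: "summable (%k. \<bar>deg c k\<bar>)"
proof (rule summable_coeff'[where A=1])
fix k :: nat
have "\<bar>deg c k\<bar>*1 <= \<bar>deg c k\<bar>*((real k+1)^2*rad^k)"
 using rad(1) by (intro mult_left_mono mult_ge1_I) (auto intro: one_le_power)
thus "\<bar>\<bar>deg c k\<bar>\<bar> <= 1*((real k+1)^2*(\<bar>deg c k\<bar>*rad^k))" by (simp add: mult_ac)
qed

end

text \<open>\<open>N^k\<close> entries of variance \<open>nrm^2\<close> have total variance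
  \<open>N\<close>, so all degrees live on the same scale and the energy at a fixed point is only of
  order \<open>sqrt N\<close>.\<close>

lemma nrm_sq: "1 <= N ==> (nrm N k)^2*real N^k = real N"
proof -
assume N: "1 <= N"
have "(nrm N k)^2*real N^k = real N powr (- (real k-1))*real N powr (real k)"
 using N by (simp add: nrm_def power2_eq_square powr_add[symmetric] powr_realpow)
also have "... = real N" using N by (simp add: powr_add[symmetric])
finally show ?thesis .
qed

definition tens :: "(nat => nat list => 'w => real) => 'w => nat => nat list => real" where
"tens G w k js = G k js w"

locale disorder = mixture_coeffs c \<epsilon>0+prob_space P
for c :: "nat => real" and \<epsilon>0 :: real and P :: "'w measure" +
fixes N :: nat and G :: "nat => nat list => 'w => real"
assumes gauss: "gaussian_tensors P N G" and N1: "1 <= N"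
begin

definition XG :: "nat \<times> nat list => 'w => real" where "XG = (%(k, js). G k js)"

text \<open>Empty below degree 2, so that \<open>Sigma UNIV mi\<close> indexes exactly the Gaussian
  entries while the series may start at degree 0.\<close>

definition mi :: "nat => nat list set" where "mi k = (if 2 <= k then multi_indices N k else {})"

lemma iid_G: "iid_normal XG (Sigma UNIV mi)"
proof -
have "Sigma UNIV mi = (SIGMA k:{2..}. multi_indices N k)" by (auto simp: mi_def split: if_splits)
thus ?thesis using gauss unfolding iid_normal_def XG_def gaussian_tensors_def by auto
qed

abbreviation hT where "hT k m w \<equiv> hterm c N (tens G w) k m"
abbreviation dT where "dT k m i w \<equiv> dterm c N (tens G w) k m i"

lemma lin_form:
"deg c k*nrm N k*(\<Sum>js\<in>multi_indices N k. a js*G k js w) =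
 (\<Sum>js\<in>mi k. (deg c k*nrm N k*a js)*XG (k, js) w)"
by (auto simp: mi_def deg_def XG_def sum_distrib_left mult_ac intro!: sum.cong)

lemma finite_mi [simp]: "finite (mi k)" by (simp add: mi_def)

lemma measurable_lin: "(%w. \<Sum>js\<in>mi k. a js*XG (k, js) w) \<in> bm P"
using iid_normalD(1)[OF iid_G] by (intro borel_measurable_sum borel_measurable_times) auto

lemma abs_lin: "(\<integral>\<^sup>+w. ennreal \<bar>\<Sum>js\<in>mi k. a js*XG (k, js) w\<bar> \<partial>P) <= ennreal (sqrt (\<Sum>js\<in>mi k. (a js)\<^sup>2))"
proof -
have "(\<Sum>js\<in>mi k. a js*XG (k, js) w) = (\<Sum>p\<in>Pair k ` mi k. a (snd p)*XG p w)" for w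
 by (subst sum.reindex) (auto simp: inj_on_def)
moreover have "(\<Sum>js\<in>mi k. (a js)\<^sup>2) = (\<Sum>p\<in>Pair k ` mi k. (a (snd p))\<^sup>2)"
 by (subst sum.reindex) (auto simp: inj_on_def)
ultimately show ?thesis
 using iid_normal_abs_moment[OF iid_G, of "Pair k ` mi k" "%p. a (snd p)"] by auto
qed

lemma hT_lin: "hT k m w = (\<Sum>js\<in>mi k. (deg c k*nrm N k*(\<Prod>j<k. m (js ! j)))*XG (k, js) w)"
unfolding hterm_def lin_form[symmetric] by (simp add: tens_def mult.commute)

lemma dT_lin: "dT k m i w = (\<Sum>js\<in>mi k. (deg c k*nrm N k*(\<Sum>p<k. mono_at k p (unit_at i) m js))*XG (k, js) w)"
unfolding dterm_def lin_form[symmetric] by (simp add: tens_def mult.commute)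

lemma measurable_hT [measurable]: "hT k m \<in> bm P"
unfolding hT_lin by (rule measurable_lin)

lemma measurable_dT [measurable]: "dT k m i \<in> bm P"
unfolding dT_lin by (rule measurable_lin)

lemma AE_summable_lin:
assumes "\<And>k. (\<Sum>js\<in>mi k. (a k js)\<^sup>2) <= (b k)^2" "\<And>k. 0 <= b k" "summable b"
shows "AE w in P. summable (%k. \<bar>\<Sum>js\<in>mi k. a k js*XG (k, js) w\<bar>)"
proof (rule AE_summable_abs)
fix k
have "sqrt (\<Sum>js\<in>mi k. (a k js)\<^sup>2) <= b k" using assms(1,2) by (intro real_le_lsqrt) (auto intro: sum_nonneg)
thus "(\<integral>\<^sup>+w. ennreal \<bar>\<Sum>js\<in>mi k. a k js*XG (k, js) w\<bar> \<partial>P) <= ennreal (b k)"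
 by (intro order_trans[OF abs_lin ennreal_leI])
show "(%w. \<Sum>js\<in>mi k. a k js*XG (k, js) w) \<in> bm P" by (rule measurable_lin)
qed (rule assms(2,3))+

lemma sum_prod_sq_le:
assumes h: "\<And>j i. j < k ==> i < N ==> \<bar>h j i\<bar> <= 1"
shows "(\<Sum>js\<in>multi_indices N k. (\<Prod>j<k. h j (js ! j))\<^sup>2) <= real N^k"
proof -
have "(\<Sum>js\<in>multi_indices N k. (\<Prod>j<k. h j (js ! j))\<^sup>2) = (\<Prod>j<k. \<Sum>i<N. (h j i)\<^sup>2)"
 unfolding prod_power_distrib[symmetric] using sum_multi_indices_prod[where h="%j i. (h j i)\<^sup>2"]
 by (simp add: prod_power_distrib)
also have "... <= (\<Prod>j<k. real N)"
proof (intro prod_mono conjI sum_nonneg)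
 fix j assume "j \<in> {..<k}"
 hence "(\<Sum>i<N. (h j i)\<^sup>2) <= (\<Sum>i<N. 1)"
  using h by (intro sum_mono) (auto simp: abs_square_le_1)
 thus "(\<Sum>i<N. (h j i)\<^sup>2) <= real N" by simp
qed auto
finally show ?thesis by simp
qed

lemma hT_variance_le:
assumes "in_cube N m"
shows "(\<Sum>js\<in>mi k. (deg c k*nrm N k*(\<Prod>j<k. m (js ! j)))\<^sup>2) <= (\<bar>deg c k\<bar> * sqrt (real N))^2"
proof -
have "(\<Sum>js\<in>mi k. (deg c k*nrm N k*(\<Prod>j<k. m (js ! j)))\<^sup>2) \<le>
  (\<Sum>js\<in>multi_indices N k. (deg c k*nrm N k*(\<Prod>j<k. m (js ! j)))\<^sup>2)"
 by (intro sum_mono2) (auto simp: mi_def)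
also have "... = (deg c k)^2*((nrm N k)^2*(\<Sum>js\<in>multi_indices N k. (\<Prod>j<k. m (js ! j))\<^sup>2))"
 by (simp add: power_mult_distrib sum_distrib_left mult.assoc)
also have "... <= (deg c k)^2*((nrm N k)^2*real N^k)"
 using assms by (intro mult_left_mono sum_prod_sq_le) (auto simp: in_cube_def abs_le_iff)
finally show ?thesis by (simp add: nrm_sq[OF N1] power_mult_distrib)
qed

lemma AE_summable_hT:
assumes "in_cube N m"
shows "AE w in P. summable (%k. hT k m w)"
proof -
have "AE w in P. summable (%k. \<bar>hT k m w\<bar>)"
 unfolding hT_lin by (rule AE_summable_lin[OF hT_variance_le[OF assms]]) (auto intro: summable_mult2 summable_deg)
thus ?thesis by eventually_elim (rule summable_rabs_cancel)
qed

lemma dbound_lin: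
"dbound c N (tens G w) k m i r = (\<Sum>n\<le>k. real k*r^n *
 \<bar>\<Sum>js\<in>mi k. (deg c k*nrm N k*(if occ k i js = n then rest k i m js else 0))*XG (k, js) w\<bar>)"
unfolding dbound_def lin_form[symmetric] tens_def abs_mult
by (subst sum_distrib_left) (simp add: mult_ac)

text \<open>Each group is a Gaussian form of mean absolute value at most
  \<open>|deg c k|*sqrt N*rad^k\<close>. The factor \<open>(real k+1)^2\<close> pays for the number
  of groups and for the exponent brought down by differentiation.\<close>

lemma AE_summable_dbound:
assumes m: "in_cube N m"
shows "AE w in P. summable (%k. dbound c N (tens G w) k m i rad)"
proof -
let ?b = "%k. sqrt (real N)*((real k+1)^2*(\<bar>deg c k\<bar>*rad^k))"
have nn: "0 <= dbound c N (tens G w) k m i rad" for k w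
 using rad by (auto simp: dbound_def intro!: mult_nonneg_nonneg sum_nonneg)
have "AE w in P. summable (%k. \<bar>dbound c N (tens G w) k m i rad\<bar>)"
proof (rule AE_summable_abs)
 show "summable ?b" by (intro summable_mult summable_coeff)
 show "0 <= ?b k" for k using rad by simp
 fix k
 define a where "a n js = rad^n*(deg c k*nrm N k*(if occ k i js = n then rest k i m js else 0))" for n js
 let ?q = "\<bar>deg c k\<bar> * sqrt (real N)*rad^k"
 let ?L = "%n w. \<Sum>js\<in>mi k. a n js*XG (k, js) w"
 have db: "dbound c N (tens G w) k m i rad = (\<Sum>n\<le>k. real k*\<bar>?L n w\<bar>)" for w
  unfolding dbound_lin using rad(1) by (simp add: a_def mult.assoc sum_distrib_left[symmetric] abs_mult)
 show "(%w. dbound c N (tens G w) k m i rad) \<in> bm P"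
  unfolding db by (intro borel_measurable_sum borel_measurable_times borel_measurable_const borel_measurable_abs measurable_lin)
 have one: "(\<integral>\<^sup>+w. ennreal (real k*\<bar>?L n w\<bar>) \<partial>P) <= ennreal (real k*?q)" if n: "n <= k" for n
 proof -
  have "(\<Sum>js\<in>mi k. (a n js)\<^sup>2) <= (\<Sum>js\<in>multi_indices N k. (a n js)\<^sup>2)"
   by (intro sum_mono2) (auto simp: mi_def)
  also have "... <= (\<Sum>js\<in>multi_indices N k. (rad^k*(deg c k*nrm N k))\<^sup>2*(\<Prod>j<k. 1)^2)"
  proof (rule sum_mono)
   fix js assume js: "js \<in> multi_indices N k"
   have "\<bar>rest k i m js\<bar> <= (\<Prod>j<k. 1)"
    unfolding rest_def abs_prod using m multi_indices_nth[OF js] by (intro prod_mono) (auto simp: in_cube_def abs_le_iff)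
   hence "\<bar>rad^n*(deg c k*nrm N k)*rest k i m js\<bar> <= \<bar>rad^k*(deg c k*nrm N k)\<bar>*1"
    using rad(1) n unfolding abs_mult by (intro mult_mono mult_right_mono) (auto intro: power_increasing)
   thus "(a n js)^2 <= (rad^k*(deg c k*nrm N k))^2*(\<Prod>j<k. 1)^2"
    unfolding a_def by (auto simp: mult.assoc abs_le_square_iff[symmetric])
  qed
  also have "... <= (rad^k*(deg c k*nrm N k))^2*real N^k"
   unfolding sum_distrib_left[symmetric] by (intro mult_left_mono sum_prod_sq_le) auto
  also have "... = (rad^k)^2*(deg c k)^2*((nrm N k)^2*real N^k)" by (simp add: power_mult_distrib mult_ac)
  also have "... = ?q^2" by (simp add: nrm_sq[OF N1] power_mult_distrib)
  finally have v: "sqrt (\<Sum>js\<in>mi k. (a n js)\<^sup>2) <= ?q" using rad(1) by (intro real_le_lsqrt) (auto intro: sum_nonneg)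
  have "(\<integral>\<^sup>+w. ennreal (real k*\<bar>?L n w\<bar>) \<partial>P) = ennreal (real k)*(\<integral>\<^sup>+w. ennreal \<bar>?L n w\<bar> \<partial>P)"
   unfolding ennreal_mult[OF of_nat_0_le_iff abs_ge_zero]
   by (rule nn_integral_cmult, intro measurable_compose[OF _ measurable_ennreal] borel_measurable_abs measurable_lin)
  also have "... <= ennreal (real k)*ennreal ?q"
   by (intro mult_left_mono order_trans[OF abs_lin] ennreal_leI v) auto
  finally show ?thesis using rad(1) by (simp add: ennreal_mult)
 qed
 have "(\<integral>\<^sup>+w. ennreal \<bar>dbound c N (tens G w) k m i rad\<bar> \<partial>P) = (\<integral>\<^sup>+w. (\<Sum>n\<le>k. ennreal (real k*\<bar>?L n w\<bar>)) \<partial>P)"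
  unfolding db by (intro nn_integral_cong) (simp add: sum_ennreal abs_of_nonneg sum_nonneg)
 also have "... = (\<Sum>n\<le>k. \<integral>\<^sup>+w. ennreal (real k*\<bar>?L n w\<bar>) \<partial>P)"
  by (intro nn_integral_sum measurable_compose[OF _ measurable_ennreal] borel_measurable_times
    borel_measurable_const borel_measurable_abs measurable_lin)
 also have "... <= (\<Sum>n\<le>k. ennreal (real k*?q))" by (intro sum_mono one) simp
 also have "... = ennreal ((real k+1)*(real k*?q))"
  using rad(1) by (subst sum_ennreal) (auto simp: algebra_simps)
 also have "... <= ennreal (?b k)"
 proof (rule ennreal_leI)
  have "(real k+1)*real k*?q <= (real k+1)*(real k+1)*?q"
   using rad(1) by (intro mult_right_mono mult_left_mono) auto
  thus "(real k+1)*(real k*?q) <= ?b k" by (simp add: power2_eq_square mult_ac)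
 qed
 finally show "(\<integral>\<^sup>+w. ennreal \<bar>dbound c N (tens G w) k m i rad\<bar> \<partial>P) <= ennreal (?b k)" .
qed
thus ?thesis using nn by simp
qed

lemma AE_gradient:
assumes m: "in_cube N m" and i: "i < N"
shows "AE w in P. summable (%k. dT k m i w) &
 gradient (hamiltonian c N (sym_tensor N (tens G w))) m i = (\<Sum>k. dT k m i w)"
using AE_summable_hT[OF m] AE_summable_dbound[OF m, of i]
proof eventually_elim
case (elim w)
let ?f = "%k s. hT k (m(i := s)) w" and ?f' = "%k s. dT k (m(i := s)) i w"
have bd: "\<bar>?f' k s\<bar> <= dbound c N (tens G w) k m i rad" if "s \<in> {-rad..rad}" for k s
 using dterm_bound[of s rad c N "tens G w" k m i] that rad(1) by auto
have mi: "m i \<in> {-1..1}" using m i by (auto simp: in_cube_def)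
have D: "((%s. \<Sum>k. ?f k s) has_field_derivative (\<Sum>k. ?f' k (m i))) (at (m i))"
\<comment> \<open>As \<open>rad > 1\<close>, every value \<open>m i\<close> in \<open>[-1,1]\<close>
  is interior to the interval, so the derivative obtained is two-sided even at the boundary of the
  cube.\<close>
proof (rule has_field_derivative_series'(2)[where S="{-rad..rad}" and x0="m i"])
 show "(?f k has_field_derivative ?f' k s) (at s within {-rad..rad})" for k s
  using deriv_hterm by (rule has_field_derivative_at_within)
 show "uniformly_convergent_on {-rad..rad} (%n s. \<Sum>k<n. ?f' k s)"
  by (rule Weierstrass_m_test'[OF _ elim(2)]) (use bd in auto)
 show "summable (%k. ?f k (m i))" using elim(1) by simp
qed (use mi rad(1) in auto)
have "summable (%k. ?f' k (m i))"
 by (rule summable_comparison_test'[OF elim(2), where N=0]) (use bd[of "m i"] mi rad(1) in auto)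
moreover have "gradient (hamiltonian c N (sym_tensor N (tens G w))) m i = (\<Sum>k. ?f' k (m i))"
 unfolding gradient_def hamiltonian_eq by (rule DERIV_imp_deriv[OF D])
ultimately show ?case by simp
qed

end

section \<open>Covariances of gradients and energies\<close>

lemma mono_at_remove: "p < k ==> mono_at k p x m js = x (js ! p)*(\<Prod>j\<in>{..<k}-{p}. m (js ! j))"
unfolding mono_at_def by (subst prod.remove[of "{..<k}" p]) (auto intro!: prod.cong)

lemma sum_rotate3:
"(\<Sum>i\<in>I. \<Sum>j\<in>J. \<Sum>p\<in>K. F i j p) = (\<Sum>j\<in>J. \<Sum>p\<in>K. \<Sum>i\<in>I. F i j p)"
by (subst sum.swap) (intro sum.cong refl sum.swap)

lemma sum_mono_at_unit:
assumes "js \<in> multi_indices N k" "p < k"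
shows "(\<Sum>i<N. x i*mono_at k p (unit_at i) m js) = mono_at k p x m js"
proof -
have "(\<Sum>i<N. x i*unit_at i (js ! p)) = x (js ! p)"
 using multi_indices_nth[OF assms] by (simp add: unit_at_def if_distrib cong: if_cong)
thus ?thesis using assms(2)
 by (simp add: mono_at_remove sum_distrib_right[symmetric] mult.assoc[symmetric])
qed

text \<open>The sum factorises over the slots. For \<open>p = q\<close> one slot pairs
  \<open>x\<close> with \<open>y\<close> and the others pair \<open>m\<close> with
  \<open>m'\<close>. For different slots a factor \<open><x,m'> <m,y>\<close> appears: this is the
  \<xi>'' part of the covariance, which the hypothesis kills.\<close>

lemma sum_mono_mono:
assumes "p < k" "q < k" and z: "ip N x m'*ip N m y = 0"
shows "(\<Sum>js\<in>multi_indices N k. mono_at k p x m js*mono_at k q y m' js) =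
 (if p = q then ip N x y*ip N m m'^(k-1) else 0)"
proof -
let ?h = "%j i. (if j = p then x else m) i*(if j = q then y else m') i"
have "(\<Sum>js\<in>multi_indices N k. mono_at k p x m js*mono_at k q y m' js) = (\<Prod>j<k. \<Sum>i<N. ?h j i)"
 unfolding mono_at_def prod.distrib[symmetric] by (rule sum_multi_indices_prod)
also have "... = (\<Sum>i<N. ?h p i)*(\<Prod>j\<in>{..<k}-{p}. \<Sum>i<N. ?h j i)"
 using assms by (subst prod.remove[of "{..<k}" p]) auto
also have "... = (if p = q then ip N x y*ip N m m'^(k-1) else 0)"
proof (cases "p = q")
 case True
 have "(\<Prod>j\<in>{..<k}-{p}. \<Sum>i<N. ?h j i) = (\<Prod>j\<in>{..<k}-{p}. ip N m m')"
  using True by (intro prod.cong) (auto simp: ip_def)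
 thus ?thesis using True assms by (simp add: ip_def)
next
 case False
 have "(\<Prod>j\<in>{..<k}-{p}. \<Sum>i<N. ?h j i) = (\<Sum>i<N. ?h q i)*(\<Prod>j\<in>{..<k}-{p}-{q}. \<Sum>i<N. ?h j i)"
  using False assms by (subst prod.remove[of "{..<k}-{p}" q]) auto
 moreover have "(\<Sum>i<N. ?h p i)*(\<Sum>i<N. ?h q i) = 0" using False z by (simp add: ip_def)
 ultimately show ?thesis using False by (simp add: mult.assoc[symmetric])
qed
finally show ?thesis .
qed

lemma sum_mono_pure:
assumes "p < k"
shows "(\<Sum>js\<in>multi_indices N k. mono_at k p x m js*(\<Prod>j<k. s (js ! j))) = ip N x s*ip N m s^(k-1)"
proof -
have "(\<Sum>js\<in>multi_indices N k. mono_at k p x m js*(\<Prod>j<k. s (js ! j))) =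
  (\<Prod>j<k. \<Sum>i<N. (if j = p then x else m) i * s i)"
 unfolding mono_at_def prod.distrib[symmetric] by (rule sum_multi_indices_prod)
also have "... = (\<Sum>i<N. x i * s i)*(\<Prod>j\<in>{..<k}-{p}. \<Sum>i<N. (if j = p then x else m) i * s i)"
 using assms by (subst prod.remove[of "{..<k}" p]) auto
also have "(\<Prod>j\<in>{..<k}-{p}. \<Sum>i<N. (if j = p then x else m) i * s i) = (\<Prod>j\<in>{..<k}-{p}. ip N m s)"
 by (intro prod.cong) (auto simp: ip_def)
finally show ?thesis using assms by (simp add: ip_def)
qed

lemma sum_pure_pure:
"(\<Sum>js\<in>multi_indices N k. (\<Prod>j<k. s (js ! j))*(\<Prod>j<k. s' (js ! j))) = ip N s s'^k"
unfolding prod.distrib[symmetric] by (subst sum_multi_indices_prod) (simp add: ip_def)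

definition xi :: "vec => real => real" where
"xi c x = (\<Sum>k. (deg c k)\<^sup>2*x^k)"

definition xi1 :: "vec => real => real" where
"xi1 c x = (\<Sum>k. (deg c k)\<^sup>2*(real k*x^(k-1)))"

context mixture_coeffs
begin

lemma deg_sq_le: "\<exists>A. \<forall>k. (deg c k)\<^sup>2 <= A*\<bar>deg c k\<bar>"
proof -
have "Bseq (%k. (real k+1)\<^sup>2*(\<bar>deg c k\<bar>*rad^k))"
 using convergent_imp_Bseq[OF convergentI[OF summable_LIMSEQ_zero[OF summable_coeff]]] .
then obtain A where A: "\<And>k. norm ((real k+1)^2*(\<bar>deg c k\<bar>*rad^k)) <= A" unfolding Bseq_def by blast
have "\<bar>deg c k\<bar> <= A" for k
proof -
 have "1*(\<bar>deg c k\<bar>*1) <= (real k+1)^2*(\<bar>deg c k\<bar>*rad^k)"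
  using rad(1) by (intro mult_mono) (auto intro: one_le_power)
 thus ?thesis using A[of k] by simp
qed
hence "\<bar>deg c k\<bar>*\<bar>deg c k\<bar> <= A*\<bar>deg c k\<bar>" for k by (intro mult_right_mono) auto
thus ?thesis by (intro exI[of _ A]) (simp add: power2_eq_square)
qed

lemma summable_poly_coeff:
assumes "\<And>k. \<bar>f k\<bar> <= B*((real k+1)^2*rad^k)" "0 <= B"
shows "summable (%k. (deg c k)\<^sup>2*f k)"
proof -
obtain A where A: "\<And>k. (deg c k)\<^sup>2 <= A*\<bar>deg c k\<bar>" using deg_sq_le by auto
show ?thesis
proof (rule summable_coeff'[where A="A*B"])
 fix k
 have "\<bar>(deg c k)\<^sup>2*f k\<bar> <= (A*\<bar>deg c k\<bar>)*(B*((real k+1)^2*rad^k))"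
  unfolding abs_mult using A[of k] assms(1)[of k] by (intro mult_mono) (auto intro: order_trans[OF zero_le_power2])
 thus "\<bar>(deg c k)\<^sup>2*f k\<bar> <= A*B*((real k+1)^2*(\<bar>deg c k\<bar>*rad^k))" by (simp add: mult_ac)
qed
qed

lemma power_le_rad: "\<bar>x\<bar> <= rad ==> \<bar>x\<bar>^n <= rad^n"
by (intro power_mono) auto

lemma summable_xi: assumes "\<bar>x\<bar> <= rad" shows "summable (%k. (deg c k)\<^sup>2*x^k)"
proof (rule summable_poly_coeff[where B=1])
fix k
have "1*\<bar>x\<bar>^k <= (real k+1)^2*rad^k" using power_le_rad[OF assms] by (intro mult_mono) auto
thus "\<bar>x^k\<bar> <= 1*((real k+1)^2*rad^k)" by (simp add: power_abs)
qed simp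

lemma summable_xi1: assumes "\<bar>x\<bar> <= rad" shows "summable (%k. (deg c k)\<^sup>2*(real k*x^(k-1)))"
proof (rule summable_poly_coeff[where B=1])
fix k
have "\<bar>x\<bar>^(k-1) <= rad^(k-1)" by (rule power_le_rad[OF assms])
also have "... <= rad^k" using rad(1) by (intro power_increasing) auto
finally have "real k*\<bar>x\<bar>^(k-1) <= (real k+1)^2*rad^k"
 by (intro mult_mono) (auto simp: power2_eq_square algebra_simps)
thus "\<bar>real k*x^(k-1)\<bar> <= 1*((real k+1)^2*rad^k)" by (simp add: power_abs abs_mult)
qed simp

end

context disorder
begin

abbreviation HH :: "vec => 'w => real" where
"HH m w \<equiv> hamiltonian c N (sym_tensor N (tens G w)) m"

text \<open>The termwise gradient, a measurable function of the disorder; it agrees with \<open>gradient\<close>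
  almost surely at every fixed point of the cube.\<close>

definition DH :: "vec => 'w => nat => real" where
"DH m w i = (if i < N then \<Sum>k. dT k m i w else 0)"

lemma measurable_DH [measurable]: "(%w. DH m w i) \<in> bm P"
unfolding DH_def by measurable

lemma measurable_HH [measurable]: "HH m \<in> bm P"
unfolding hamiltonian_eq by measurable

lemma AE_gradient_DH:
assumes "in_cube N m"
shows "AE w in P. gradient (hamiltonian c N (sym_tensor N (tens G w))) m = DH m w"
proof -
have "AE w in P. \<forall>i\<in>{..<N}. gradient (hamiltonian c N (sym_tensor N (tens G w))) m i = (\<Sum>k. dT k m i w)"
 by (intro AE_finite_allI) (use AE_gradient[OF assms] in "auto elim: eventually_mono")
thus ?thesis
 by eventually_elim (auto simp: DH_def gradient_outside fun_eq_iff not_less)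
qed

lemma Rabs: "in_cube N m ==> in_cube N m' ==> \<bar>ip N m m'/real N\<bar> <= 1"
proof -
assume m: "in_cube N m" "in_cube N m'"
have "\<bar>ip N m m'\<bar> <= (\<Sum>i<N. \<bar>m i*m' i\<bar>)" unfolding ip_def by (rule sum_abs)
also have "... <= (\<Sum>i<N. 1)"
 using m by (intro sum_mono) (auto simp: in_cube_def abs_mult abs_le_iff intro!: mult_le_one)
finally show ?thesis using N1 by (simp add: divide_simps)
qed

lemma nrm_pow: "1 <= k ==> (nrm N k)^2*(ip N m m')^(k-1) = (ip N m m'/real N)^(k-1)"
proof -
assume k: "1 <= k"
have "(nrm N k)^2*real N^(k-1)*real N = real N"
 using nrm_sq[OF N1, of k] k by (cases k) (auto simp: mult_ac)
hence "(nrm N k)^2*real N^(k-1) = 1" using N1 by simp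
hence "(nrm N k)^2 = 1/real N^(k-1)" using N1 by (simp add: field_simps)
thus ?thesis by (simp add: power_divide)
qed

lemma nrm_pow': "(nrm N k)^2*(ip N m m')^k = real N*(ip N m m'/real N)^k"
proof -
have "(nrm N k)^2 = real N/real N^k" using nrm_sq[OF N1, of k] N1 by (simp add: field_simps)
thus ?thesis by (simp add: power_divide)
qed

text \<open>The mixed second-order terms are assumed to cancel, which is the only case needed.\<close>

lemma linear_functional_trig:
fixes x mu :: "nat => nat => real" and s :: "nat => real" and t :: real and L :: nat
assumes mu: "\<And>d. d < L ==> in_cube N (mu d)" and s: "in_cube N s"
 and z: "\<And>d e. d < L ==> e < L ==> ip N (x d) (mu e)*ip N (mu d) (x e) = 0"
defines "T \<equiv> %w. (\<Sum>d<L. ip N (x d) (DH (mu d) w))+t*HH s w"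
 and "V \<equiv> (\<Sum>d<L. \<Sum>e<L. ip N (x d) (x e)*xi1 c (ip N (mu d) (mu e)/N)) +
  2*t*(\<Sum>d<L. ip N (x d) s*xi1 c (ip N (mu d) s/N))+t^2*(N*xi c (ip N s s/N))"
shows "expectation (%w. cos (T w)) = exp (- V/2)" "expectation (%w. sin (T w)) = 0"
proof -
define f where "f k js = deg c k*nrm N k*((\<Sum>d<L. \<Sum>p<k. mono_at k p (x d) (mu d) js)+t*(\<Prod>j<k. s (js ! j)))" for k js
define Tk where "Tk k w = (\<Sum>d<L. \<Sum>i<N. x d i*dT k (mu d) i w)+t*hT k s w" for k w
define Vk where "Vk k = (\<Sum>js\<in>mi k. (f k js)\<^sup>2)" for k
have Tk: "Tk k w = (\<Sum>js\<in>mi k. f k js*XG (k, js) w)" for k w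
proof -
 have "(\<Sum>i<N. x d i*dT k (mu d) i w) = (\<Sum>js\<in>mi k. deg c k*nrm N k*(\<Sum>p<k. mono_at k p (x d) (mu d) js)*XG (k, js) w)" for d
 proof -
  have "(\<Sum>i<N. x d i*dT k (mu d) i w) =
    (\<Sum>js\<in>mi k. deg c k*nrm N k*(\<Sum>p<k. \<Sum>i<N. x d i*mono_at k p (unit_at i) (mu d) js)*XG (k, js) w)"
   unfolding dT_lin sum_distrib_left sum_distrib_right
   by (subst sum_rotate3, intro sum.cong refl) (simp only: mult_ac)
  also have "... = (\<Sum>js\<in>mi k. deg c k*nrm N k*(\<Sum>p<k. mono_at k p (x d) (mu d) js)*XG (k, js) w)"
   by (intro sum.cong refl) (auto simp: mi_def sum_mono_at_unit split: if_splits)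
  finally show ?thesis .
 qed
 hence "Tk k w = (\<Sum>d<L. \<Sum>js\<in>mi k. deg c k*nrm N k*(\<Sum>p<k. mono_at k p (x d) (mu d) js)*XG (k, js) w)
  +(\<Sum>js\<in>mi k. deg c k*nrm N k*(t*(\<Prod>j<k. s (js ! j)))*XG (k, js) w)"
  unfolding Tk_def hT_lin by (simp add: sum_distrib_left mult_ac)
 also have "... = (\<Sum>js\<in>mi k. f k js*XG (k, js) w)"
  unfolding f_def distrib_left distrib_right sum.distrib
  by (subst sum.swap) (simp add: sum_distrib_left sum_distrib_right)
 finally show ?thesis .
qed
have Vk: "Vk k = (\<Sum>d<L. \<Sum>e<L. ip N (x d) (x e)*((deg c k)^2*(real k*(ip N (mu d) (mu e)/N)^(k-1)))) +
  2*t*(\<Sum>d<L. ip N (x d) s*((deg c k)^2*(real k*(ip N (mu d) s/N)^(k-1)))) +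
  t\<^sup>2*(N*((deg c k)^2*(ip N s s/N)^k))" for k
proof (cases "2 <= k")
 case False
 thus ?thesis by (simp add: Vk_def mi_def deg_def)
next
 case True
 define A where "A js = (\<Sum>d<L. \<Sum>p<k. mono_at k p (x d) (mu d) js)" for js
 define B where "B js = (\<Prod>j<k. s (js ! j))" for js
 have AA: "(\<Sum>js\<in>multi_indices N k. A js*A js) = (\<Sum>d<L. \<Sum>e<L. real k*(ip N (x d) (x e)*ip N (mu d) (mu e)^(k-1)))"
 proof -
  have "(\<Sum>js\<in>multi_indices N k. A js*A js) =
    (\<Sum>d<L. \<Sum>e<L. \<Sum>p<k. \<Sum>q<k. \<Sum>js\<in>multi_indices N k. mono_at k p (x d) (mu d) js*mono_at k q (x e) (mu e) js)"
  proof -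
   have "A js*A js = (\<Sum>d<L. \<Sum>e<L. \<Sum>p<k. \<Sum>q<k. mono_at k p (x d) (mu d) js*mono_at k q (x e) (mu e) js)" for js
    unfolding A_def by (simp add: sum_product)
   thus ?thesis
    by (simp add: sum.swap[of _ _ "multi_indices N k"])
  qed
  \<comment> \<open>Only \<open>p = q\<close> survives the cancellation, which leaves
    \<open>k\<close> equal terms and hence the coefficients of \<xi>'.\<close>
  also have "... = (\<Sum>d<L. \<Sum>e<L. \<Sum>p<k. \<Sum>q<k. if p = q then ip N (x d) (x e)*ip N (mu d) (mu e)^(k-1) else 0)"
   using z by (intro sum.cong refl sum_mono_mono) auto
  also have "... = (\<Sum>d<L. \<Sum>e<L. real k*(ip N (x d) (x e)*ip N (mu d) (mu e)^(k-1)))" by simp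
  finally show ?thesis .
 qed
 have AB: "(\<Sum>js\<in>multi_indices N k. A js*B js) = (\<Sum>d<L. real k*(ip N (x d) s*ip N (mu d) s^(k-1)))"
 proof -
  have "(\<Sum>js\<in>multi_indices N k. A js*B js) = (\<Sum>d<L. \<Sum>p<k. \<Sum>js\<in>multi_indices N k. mono_at k p (x d) (mu d) js*B js)"
   unfolding A_def sum_distrib_right by (simp add: sum.swap[of _ _ "multi_indices N k"])
  also have "... = (\<Sum>d<L. \<Sum>p<k. ip N (x d) s*ip N (mu d) s^(k-1))"
   unfolding B_def by (intro sum.cong refl sum_mono_pure) auto
  finally show ?thesis by simp
 qed
 have BB: "(\<Sum>js\<in>multi_indices N k. B js*B js) = ip N s s^k" unfolding B_def by (rule sum_pure_pure)
 have "Vk k = (\<Sum>js\<in>multi_indices N k. (deg c k*nrm N k*(A js+t*B js))\<^sup>2)"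
  using True by (simp add: Vk_def mi_def f_def A_def B_def)
 also have "... = (\<Sum>js\<in>multi_indices N k. (deg c k)\<^sup>2*(nrm N k)^2*(A js*A js+2*t*(A js*B js)+t^2*(B js*B js)))"
  by (intro sum.cong refl) (simp add: power2_eq_square algebra_simps)
 also have "... = (deg c k)^2*(nrm N k)^2*((\<Sum>js\<in>multi_indices N k. A js*A js)+2*t*(\<Sum>js\<in>multi_indices N k. A js*B js)
  +t^2*(\<Sum>js\<in>multi_indices N k. B js*B js))"
  unfolding sum_distrib_left[symmetric] sum.distrib ..
 also have "... = (\<Sum>d<L. \<Sum>e<L. ip N (x d) (x e)*((deg c k)^2*(real k*((nrm N k)^2*ip N (mu d) (mu e)^(k-1))))) +
  2*t*(\<Sum>d<L. ip N (x d) s*((deg c k)^2*(real k*((nrm N k)^2*ip N (mu d) s^(k-1))))) +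
  t\<^sup>2*((deg c k)^2*((nrm N k)^2*ip N s s^k))"
  unfolding AA AB BB by (simp add: sum_distrib_left distrib_left mult_ac)
 finally show ?thesis using True unfolding nrm_pow[OF order_trans[OF one_le_numeral True]] nrm_pow'
  by (simp add: mult.left_commute)
qed
have r: "1 <= rad" using rad(1) by simp
have R1: "\<bar>ip N (mu d) (mu e)/N\<bar> <= rad" if "d < L" "e < L" for d e using Rabs[OF mu[OF that(1)] mu[OF that(2)]] r by linarith
have R2: "\<bar>ip N (mu d) s/N\<bar> <= rad" if "d < L" for d using Rabs[OF mu[OF that(1)] s] r by linarith
have R3: "\<bar>ip N s s/N\<bar> <= rad" using Rabs[OF s s] r by linarith
have sV: "Vk sums V"
 unfolding Vk[abs_def] V_def xi1_def xi_def
 by (intro sums_add sums_sum sums_mult summable_sums summable_xi1 summable_xi R1 R2 R3) auto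
have "AE w in P. \<forall>d\<in>{..<L}. \<forall>i\<in>{..<N}. summable (%k. dT k (mu d) i w)"
 by (intro AE_finite_allI) (use AE_gradient[OF mu] in "auto elim: eventually_mono")
hence AE: "AE w in P. (%k. Tk k w) sums T w"
 using AE_summable_hT[OF s]
proof eventually_elim
 case (elim w)
 have d: "(%k. dT k (mu d) i w) sums DH (mu d) w i" if "d < L" "i < N" for d i
  using elim(1) that by (auto simp: DH_def intro: summable_sums)
 have h: "(%k. hT k s w) sums HH s w"
  unfolding hamiltonian_eq by (rule summable_sums[OF elim(2)])
 show ?case unfolding Tk_def T_def ip_def
  by (intro sums_add sums_sum sums_mult h d) auto
qed
have conv: "AE w in P. summable (%k. Tk k w)" using AE by eventually_elim (rule sums_summable)
note tr = iid_normal_series_trig[OF iid_G finite_mi Tk Vk_def sums_summable[OF sV] conv]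
have [measurable]: "Tk k \<in> bm P" for k unfolding Tk[abs_def] by (rule measurable_lin)
have [measurable]: "T \<in> bm P" unfolding T_def ip_def by measurable
have "expectation (%w. cos (T w)) = expectation (%w. cos (\<Sum>k. Tk k w))"
 "expectation (%w. sin (T w)) = expectation (%w. sin (\<Sum>k. Tk k w))"
 by (intro integral_cong_AE; (measurable; fail)?; use AE in eventually_elim; simp add: sums_iff)+
thus "expectation (%w. cos (T w)) = exp (- V/2)" "expectation (%w. sin (T w)) = 0"
 using tr sV by (auto simp: sums_iff)
qed

end

section \<open>Innovations of a covariance kernel\<close>

text \<open>Gram-Schmidt for the standard basis with respect to a symmetric bilinear form \<open>K\<close>; the vector
  number \<open>a\<close> has coefficient \<open>1\<close> at \<open>a\<close> and is supported on \<open>{..a}\<close>.\<close>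

function innov :: "(nat => nat => real) => nat => nat => real" where
"innov K a d = (if d = a then 1 else 0) -
 (\<Sum>b<a. (\<Sum>e\<le>b. innov K b e*K a e)/(\<Sum>e\<le>b. innov K b e*K b e)*innov K b d)"
by pat_completeness auto
termination by (relation "Wellfounded.measure (%(K, a, d). a)") auto

declare innov.simps [simp del] gsl.simps(2) [simp del]

text \<open>If \<open>K\<close> is a covariance matrix, this is the covariance of variable
  \<open>a\<close> with innovation number \<open>b\<close>; on the diagonal it is the variance of
  the innovation.\<close>

definition icov :: "(nat => nat => real) => nat => nat => real" where
"icov K a b = (\<Sum>e\<le>b. innov K b e*K a e)"

abbreviation ivar :: "(nat => nat => real) => nat => real" where
"ivar K b \<equiv> icov K b b"

lemma innov_rec: "innov K a d = (if d = a then 1 else 0)-(\<Sum>b<a. icov K a b/ivar K b*innov K b d)"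
unfolding icov_def by (rule innov.simps)

lemma innov_support: "a < d ==> innov K a d = 0"
proof (induction a rule: less_induct)
case (less a)
have "(\<Sum>b<a. icov K a b/ivar K b*innov K b d) = 0"
 using less by (intro sum.neutral) auto
thus ?case using less.prems by (subst innov_rec) simp
qed

lemma innov_cong: "(\<And>a' d'. a' <= a ==> d' <= a ==> K a' d' = K' a' d') ==> innov K a d = innov K' a d"
proof (induction a arbitrary: d rule: less_induct)
case (less a)
have IH: "innov K b e = innov K' b e" if "b < a" for b e
 using less.prems that by (intro less.IH) auto
have "icov K a b = icov K' a b" "ivar K b = ivar K' b" if "b < a" for b
 unfolding icov_def using less.prems IH that by (auto intro!: sum.cong)
thus ?case using IH by (subst (1 2) innov_rec) (auto intro!: sum.cong arg_cong2[where f="(-)"])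
qed

lemma ivar_cong: "(\<And>a' d'. a' <= a ==> d' <= a ==> K a' d' = K' a' d') ==> ivar K a = ivar K' a"
unfolding icov_def using innov_cong[of a K K'] by (auto intro!: sum.cong)

definition bform :: "nat => (nat => nat => real) => vec => vec => real" where
"bform L K x y = (\<Sum>d<L. \<Sum>e<L. x d*y e*K d e)"

lemma bform_diff_left: "bform L K (%d. x d-y d) z = bform L K x z-bform L K y z"
by (simp add: bform_def left_diff_distrib sum_subtractf)

lemma bform_sum_left: "bform L K (%d. \<Sum>b\<in>A. f b*x b d) z = (\<Sum>b\<in>A. f b*bform L K (x b) z)"
proof -
have "bform L K (%d. \<Sum>b\<in>A. f b*x b d) z = (\<Sum>d<L. \<Sum>e<L. \<Sum>b\<in>A. f b*(x b d*z e*K d e))"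
 unfolding bform_def by (simp add: sum_distrib_right mult.assoc)
also have "... = (\<Sum>b\<in>A. f b*bform L K (x b) z)"
 unfolding bform_def sum_distrib_left by (subst sum_rotate3[symmetric]) (rule refl)
finally show ?thesis .
qed

lemma bform_sym: "(\<And>d e. K d e = K e d) ==> bform L K x y = bform L K y x"
unfolding bform_def by (subst sum.swap) (simp add: mult_ac)

lemma bform_unit: "a < L ==> b < L ==> bform L K (%d. if d = a then 1 else 0) (innov K b) = icov K a b"
proof -
assume a: "a < L" "b < L"
have "bform L K (%d. if d = a then 1 else 0) (innov K b) = (\<Sum>e<L. innov K b e*K a e)"
 unfolding bform_def using a by (simp add: if_distrib if_distribR sum.If_cases mult.assoc sum_distrib_left[symmetric] cong: if_cong)
also have "... = (\<Sum>e\<le>b. innov K b e*K a e)"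
 using a by (intro sum.mono_neutral_right) (auto simp: innov_support)
finally show ?thesis by (simp add: icov_def)
qed

text \<open>The recursion subtracts from unit vector \<open>a\<close> its regression on the earlier
  innovations. By induction these are orthogonal to each other, so what is left is orthogonal to
  each of them.\<close>

lemma innov_orthogonal:
assumes sym: "\<And>d e. K d e = K e d" and L: "a < L" and s: "\<And>b. b < a ==> ivar K b \<noteq> 0"
shows "\<forall>b<a. bform L K (innov K b) (innov K a) = 0" "bform L K (innov K a) (innov K a) = ivar K a"
proof -
have unit: "(%d. if d = a then 1 else 0) = (%d. innov K a d-(\<Sum>b<a. (- (icov K a b/ivar K b))*innov K b d))" for a
 by (rule ext) (simp add: innov_rec[of K a] sum_negf)
have inn: "innov K a = (%d. (if d = a then 1 else 0)-(\<Sum>b<a. icov K a b/ivar K b*innov K b d))" for a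
 by (rule ext) (rule innov_rec)
have "(\<forall>b<a. bform L K (innov K b) (innov K a) = 0) & bform L K (innov K a) (innov K a) = ivar K a"
 using L s
proof (induction a rule: less_induct)
 case (less a)
 have IH: "bform L K (innov K b) (innov K b') = (if b = b' then ivar K b else 0)" if "b < a" "b' < a" for b b'
  using less.IH[of b] less.IH[of b'] that less.prems bform_sym[where K=K, OF sym, where L=L and x="innov K b" and y="innov K b'"]
  by (cases b b' rule: linorder_cases) auto
 have 1: "bform L K (innov K a) (innov K b) = 0" if "b < a" for b
 proof -
  have "bform L K (innov K a) (innov K b) = icov K a b-(\<Sum>b'<a. icov K a b'/ivar K b'*bform L K (innov K b') (innov K b))"
   by (subst inn) (simp only: bform_diff_left bform_sum_left bform_unit[OF less.prems(1) order.strict_trans[OF that less.prems(1)]])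
  also have "(\<Sum>b'<a. icov K a b'/ivar K b'*bform L K (innov K b') (innov K b)) = (\<Sum>b'<a. if b' = b then icov K a b else 0)"
   using that less.prems(2) by (intro sum.cong) (auto simp: IH)
  finally show ?thesis using that by simp
 qed
 have "bform L K (innov K a) (innov K a) = icov K a a-(\<Sum>b<a. icov K a b/ivar K b*bform L K (innov K b) (innov K a))"
  by (subst inn) (simp only: bform_diff_left bform_sum_left bform_unit[OF less.prems(1) less.prems(1)])
 moreover have "bform L K (innov K b) (innov K a) = 0" if "b < a" for b
  using 1[OF that] by (subst bform_sym[where K=K, OF sym])
 ultimately show ?case by simp
qed
thus "\<forall>b<a. bform L K (innov K b) (innov K a) = 0" "bform L K (innov K a) (innov K a) = ivar K a" by auto
qed

lemma bform_innov:
assumes sym: "\<And>d e. K d e = K e d" and s: "\<And>b. b < L ==> ivar K b \<noteq> 0" and ab: "a < L" "b < L"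
shows "bform L K (innov K a) (innov K b) = (if a = b then ivar K a else 0)"
using innov_orthogonal[where K=K, OF sym, where a=a and L=L] innov_orthogonal[where K=K, OF sym, where a=b and L=L] s ab
 bform_sym[where K=K, OF sym, where L=L and x="innov K a" and y="innov K b"]
by (cases a b rule: linorder_cases) auto

lemma perp_idem: "orthogonal_list N ws ==> ip N (perp N ws y) (perp N ws x) = ip N (perp N ws y) x"
proof -
assume o: "orthogonal_list N ws"
have "ip N (perp N ws y) (proj N ws x) = ip N (proj N ws x) (perp N ws y)" by (rule ip_commute)
also have "... = ip N (proj N ws x) y-ip N (proj N ws x) (proj N ws y)" by (rule ip_perp_right)
also have "... = 0" using ip_proj_proj[OF o, of x y] ip_proj_symmetric[of N x ws y] ip_commute[of N y "proj N ws x"] by simp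
finally show ?thesis by (simp add: ip_perp_right)
qed

lemma ip_diff_left: "ip N (%i. x i-y i) z = ip N x z-ip N y z"
by (simp add: ip_def left_diff_distrib sum_subtractf)

lemma ip_scale_left: "ip N (%i. a*x i) z = a*ip N x z"
by (simp add: ip_def sum_distrib_left mult_ac)

lemma ip_sum_left: "ip N (%i. \<Sum>j\<in>J. f j i) z = (\<Sum>j\<in>J. ip N (f j) z)"
unfolding ip_def sum_distrib_right by (rule sum.swap)

lemma proj_linear: "proj N ws (%i. a*x i+b*y i) i = a*proj N ws x i+b*proj N ws y i"
proof -
have "pcoef N w (%i. a*x i+b*y i) = a*pcoef N w x+b*pcoef N w y" for w
 by (simp add: pcoef_def ip_add_right ip_scale_right add_divide_distrib)
thus ?thesis by (simp add: proj_def sum_distrib_left sum.distrib algebra_simps)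
qed

lemma perp_linear: "perp N ws (%i. a*x i+b*y i) = (%i. a*perp N ws x i+b*perp N ws y i)"
by (auto simp: perp_def proj_linear fun_eq_iff algebra_simps)

lemma perp_scale: "perp N ws (%i. a*x i) = (%i. a*perp N ws x i)"
using perp_linear[of N ws a x 0 x] by simp

lemma perp_sub_scale: "perp N ws (%i. x i-b*y i) = (%i. perp N ws x i-b*perp N ws y i)"
using perp_linear[of N ws 1 x "- b" y] by simp

section \<open>A fixed trajectory and the law of its projected innovations\<close>

definition overlap :: "nat => vec list => nat => nat => real" where
"overlap N ms a b = ip N (ms ! a) (ms ! b)/real N"

text \<open>Once the \<xi>'' term is projected away, the gradients at two points of the path have
  this number times the identity as covariance.\<close>

definition kern :: "vec => nat => vec list => nat => nat => real" where
"kern c N ms a b = xi1 c (overlap N ms a b)"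

lemma kern_sym: "kern c N ms a b = kern c N ms b a"
by (simp add: kern_def overlap_def ip_commute)

text \<open>The covariance of innovation number \<open>a\<close> with the Hamiltonian at point number \<open>L\<close>, per unit of overlap.\<close>

definition klast :: "vec => nat => vec list => nat => nat => real" where
"klast c N ms L a = (\<Sum>d\<le>a. innov (kern c N ms) a d*kern c N ms d L)"

abbreviation basis :: "nat => vec list => nat => vec list" where
"basis N ms a \<equiv> gsl N (%b. ms ! b) (Suc a)"

text \<open>Variance of the energy at the last point minus the part explained by the projected
  innovations; it will be the variance of \<open>psi\<close>.\<close>

definition vlast :: "vec => nat => vec list => nat => real" where
"vlast c N ms L = real N*xi c (overlap N ms L L) -
 (\<Sum>a<L. (klast c N ms L a)\<^sup>2/ivar (kern c N ms) a*ip N (perp N (basis N ms a) (ms ! L)) (ms ! L))"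

locale good_path = disorder c \<epsilon>0 P N G
for c :: "nat => real" and \<epsilon>0 :: real and P :: "'w measure" and N :: nat and G :: "nat => nat list => 'w => real" +
fixes ms :: "vec list" and L :: nat
assumes len: "length ms = Suc L"
 and cube: "\<And>a. a <= L ==> in_cube N (ms ! a)"
 and van: "\<And>a. a <= L ==> vanish N (ms ! a)"
 and pos: "\<And>a. a < L ==> 0 < ivar (kern c N ms) a"
begin

abbreviation "K \<equiv> kern c N ms"
abbreviation "al \<equiv> innov K"
abbreviation "sv \<equiv> ivar K"
abbreviation "kl \<equiv> klast c N ms L"
abbreviation "Q a \<equiv> perp N (basis N ms a)"
abbreviation "sg \<equiv> ms ! L"

text \<open>Along a fixed path the coefficients are deterministic, so this innovation of the
  gradient is a linear function of the disorder.\<close>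

definition nu :: "nat => 'w => nat => real" where
"nu a w i = (\<Sum>b\<le>a. al a b*DH (ms ! b) w i)"

text \<open>The residual of the energy after regression on the projected innovations.\<close>

definition psi :: "'w => real" where
"psi w = HH sg w-(\<Sum>a<L. kl a/sv a*ip N sg (Q a (nu a w)))"

lemma orthogonal_basis: "orthogonal_list N (basis N ms a)" by (rule orthogonal_gsl)

text \<open>The exponent \<open>V\<close> has no mixed terms. This says that the projected
  innovations are independent over \<open>a\<close>, that number \<open>a\<close> has covariance
  \<open>sv a\<close> times the projection, and that \<open>psi\<close> is independent of them
  all.\<close>

lemma trig_joint:
fixes t :: "nat => nat => real" and ts :: real
defines "T \<equiv> %w. (\<Sum>a<L. ip N (t a) (Q a (nu a w)))+ts*psi w"
 and "V \<equiv> (\<Sum>a<L. sv a*ip N (Q a (t a)) (t a))+ts^2 * vlast c N ms L"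
shows "expectation (%w. cos (T w)) = exp (- V/2)" "expectation (%w. sin (T w)) = 0"
proof -
\<comment> \<open>The regression terms of \<open>psi\<close> are moved into the test vectors, so
  that \<open>T\<close> becomes one linear functional of the gradients plus \<open>ts\<close> times
  the energy.\<close>
define ca where "ca a = kl a/sv a" for a
define z where "z a = Q a (%i. t a i-ts * ca a * sg i)" for a
define x where "x d i = (\<Sum>a<L. al a d*z a i)" for d i
have T: "T w = (\<Sum>d<L. ip N (x d) (DH (ms ! d) w))+ts*HH sg w" for w
proof -
 have "ip N (t a) (Q a (nu a w))-ts*(ca a*ip N sg (Q a (nu a w))) = (\<Sum>d<L. al a d*ip N (z a) (DH (ms ! d) w))"
  if a: "a < L" for a
 proof -
  have "ip N (t a) (Q a (nu a w))-ts*(ca a*ip N sg (Q a (nu a w))) = ip N (z a) (nu a w)"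
   unfolding z_def ip_perp_symmetric[symmetric] by (simp add: ip_diff_left ip_scale_left mult.assoc)
  also have "... = (\<Sum>d\<le>a. al a d*ip N (z a) (DH (ms ! d) w))"
   unfolding nu_def[abs_def] by (simp add: ip_sum_right ip_scale_right)
  also have "... = (\<Sum>d<L. al a d*ip N (z a) (DH (ms ! d) w))"
   using a by (intro sum.mono_neutral_left) (auto simp: innov_support)
  finally show ?thesis .
 qed
 hence "(\<Sum>a<L. ip N (t a) (Q a (nu a w))-ts*(ca a*ip N sg (Q a (nu a w)))) =
   (\<Sum>a<L. \<Sum>d<L. al a d*ip N (z a) (DH (ms ! d) w))" by (intro sum.cong) auto
 also have "... = (\<Sum>d<L. \<Sum>a<L. al a d*ip N (z a) (DH (ms ! d) w))" by (rule sum.swap)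
 also have "... = (\<Sum>d<L. ip N (x d) (DH (ms ! d) w))"
  unfolding x_def[abs_def] by (simp add: ip_sum_left ip_scale_left)
 finally have "(\<Sum>a<L. ip N (t a) (Q a (nu a w)))-ts*(\<Sum>a<L. ca a*ip N sg (Q a (nu a w))) =
   (\<Sum>d<L. ip N (x d) (DH (ms ! d) w))" by (simp add: sum_subtractf sum_distrib_left)
 thus ?thesis unfolding T_def psi_def ca_def by (simp add: right_diff_distrib)
qed
have zdead: "ip N (z a) (ms ! e) = 0" if "e <= a" "a < L" for a e
 unfolding z_def using that van by (intro ip_perp_dead orthogonal_basis dead_gsl) auto
have xz: "ip N (x d) (ms ! e) = 0" if "e <= d" "d < L" for d e
proof -
 have "al a d*ip N (z a) (ms ! e) = 0" if "a < L" for a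
  using zdead[of e a] innov_support[of a d K] that `e <= d` by (cases "a < d") auto
 thus ?thesis unfolding x_def[abs_def] by (simp add: ip_sum_left ip_scale_left sum.neutral)
qed
\<comment> \<open>\<open>x d\<close> combines only those \<open>z a\<close> with
  \<open>d <= a\<close>, and \<open>z a\<close> is orthogonal to the points up to \<open>a\<close>.
  Hence \<open>x d\<close> is orthogonal to the points up to \<open>d\<close>, and one of the two
  factors is always zero.\<close>
have cross: "ip N (x d) (ms ! e)*ip N (ms ! d) (x e) = 0" if "d < L" "e < L" for d e
 using xz[of e d] xz[of d e] that by (cases "e <= d") (auto simp: ip_commute[of N "ms ! d"])
let ?W = "(\<Sum>d<L. \<Sum>e<L. ip N (x d) (x e)*xi1 c (ip N (ms ! d) (ms ! e)/N)) +
  2*ts*(\<Sum>d<L. ip N (x d) sg*xi1 c (ip N (ms ! d) sg/N))+ts^2*(N*xi c (ip N sg sg/N))"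
\<comment> \<open>Expanding in the \<open>z a\<close> brings out the kernel evaluated at pairs of
  innovations, which is diagonal.\<close>
have W1: "(\<Sum>d<L. \<Sum>e<L. ip N (x d) (x e)*xi1 c (ip N (ms ! d) (ms ! e)/N)) = (\<Sum>a<L. sv a*ip N (z a) (z a))"
proof -
 have "(\<Sum>d<L. \<Sum>e<L. ip N (x d) (x e)*xi1 c (ip N (ms ! d) (ms ! e)/N)) =
   (\<Sum>d<L. \<Sum>e<L. \<Sum>a<L. \<Sum>b<L. ip N (z a) (z b)*(al a d*al b e*K d e))"
  unfolding x_def[abs_def] ip_sum_left ip_sum_right ip_scale_left ip_scale_right kern_def overlap_def
    sum_distrib_left sum_distrib_right
  by (intro sum.cong refl) (simp only: mult_ac)
 also have "... = (\<Sum>a<L. \<Sum>b<L. \<Sum>d<L. \<Sum>e<L. ip N (z a) (z b)*(al a d*al b e*K d e))"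
  by (subst sum_rotate3, subst sum_rotate3, rule refl)
 also have "... = (\<Sum>a<L. \<Sum>b<L. ip N (z a) (z b)*bform L K (al a) (al b))"
  unfolding bform_def by (simp add: sum_distrib_left)
 also have "... = (\<Sum>a<L. \<Sum>b<L. if a = b then ip N (z a) (z b) * sv a else 0)"
  using pos by (intro sum.cong refl) (subst bform_innov; auto simp: kern_sym[of c N ms] less_imp_neq[symmetric])
 also have "... = (\<Sum>a<L. sv a*ip N (z a) (z a))" by (simp add: mult.commute)
 finally show ?thesis .
qed
have W2: "(\<Sum>d<L. ip N (x d) sg*xi1 c (ip N (ms ! d) sg/N)) = (\<Sum>a<L. kl a*ip N (z a) sg)"
proof -
 have "(\<Sum>d<L. ip N (x d) sg*xi1 c (ip N (ms ! d) sg/N)) = (\<Sum>d<L. \<Sum>a<L. ip N (z a) sg*(al a d*K d L))"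
  unfolding x_def[abs_def] ip_sum_left ip_scale_left kern_def overlap_def sum_distrib_right
  by (intro sum.cong refl) (simp only: mult_ac)
 also have "... = (\<Sum>a<L. \<Sum>d<L. ip N (z a) sg*(al a d*K d L))" by (rule sum.swap)
 also have "... = (\<Sum>a<L. kl a*ip N (z a) sg)"
 proof (intro sum.cong refl)
  fix a assume a: "a \<in> {..<L}"
  have "(\<Sum>d<L. al a d*K d L) = kl a" unfolding klast_def
   using a by (intro sum.mono_neutral_right) (auto simp: innov_support)
  thus "(\<Sum>d<L. ip N (z a) sg*(al a d*K d L)) = kl a*ip N (z a) sg"
   by (simp add: sum_distrib_left[symmetric] mult.commute)
 qed
 finally show ?thesis .
qed
have W: "?W = V"
proof -
 have one: "sv a*ip N (z a) (z a)+2*ts*(kl a*ip N (z a) sg) =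
   sv a*ip N (Q a (t a)) (t a)-ts\<^sup>2*((kl a)^2/sv a*ip N (Q a sg) sg)" if "a < L" for a
 proof -
  let ?p = "Q a (t a)" and ?q = "Q a sg"
  have s: "sv a \<noteq> 0" using pos[OF that] by simp
  have z: "z a = (%i. ?p i-ts * ca a*?q i)" unfolding z_def by (rule perp_sub_scale)
  have pq: "ip N ?p ?q = ip N ?p sg" "ip N ?q ?p = ip N ?p sg" "ip N ?p ?p = ip N ?p (t a)" "ip N ?q ?q = ip N ?q sg"
   using perp_idem[OF orthogonal_basis] ip_commute by metis+
  have zz: "ip N (z a) (z a) = ip N ?p (t a)-2*(ts * ca a)*ip N ?p sg+(ts * ca a)^2*ip N ?q sg"
   unfolding z ip_diff_left ip_diff_right ip_scale_left ip_scale_right pq by (simp add: power2_eq_square algebra_simps)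
  have zs: "ip N (z a) sg = ip N ?p sg-ts * ca a*ip N ?q sg"
   unfolding z by (simp add: ip_diff_left ip_scale_left)
  have k: "(kl a)^2/sv a = (ca a)^2 * sv a" "kl a = ca a * sv a"
   using s by (simp_all add: ca_def power2_eq_square)
  show ?thesis unfolding zz zs k(1) unfolding k(2) by (simp add: power2_eq_square algebra_simps)
 qed
 have "?W = (\<Sum>a<L. sv a*ip N (z a) (z a)+2*ts*(kl a*ip N (z a) sg))+ts^2*(N*xi c (overlap N ms L L))"
  unfolding W1 W2 by (simp add: sum.distrib sum_distrib_left overlap_def)
 also have "... = (\<Sum>a<L. sv a*ip N (Q a (t a)) (t a)-ts\<^sup>2*((kl a)^2/sv a*ip N (Q a sg) sg))+ts^2*(N*xi c (overlap N ms L L))"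
  using one by (intro arg_cong2[where f="(+)"] sum.cong) auto
 also have "... = V" unfolding V_def vlast_def by (simp add: sum_subtractf sum_distrib_left right_diff_distrib)
 finally show ?thesis .
qed
note tr = linear_functional_trig[of L "%d. ms ! d" sg x ts, OF cube cube cross, unfolded W]
show "expectation (%w. cos (T w)) = exp (- V/2)" "expectation (%w. sin (T w)) = 0"
 unfolding T by (rule tr; simp)+
qed

text \<open>Tested on \<open>psi\<close> alone, the formula above reads
  \<open>E (cos psi) = exp (- vlast/2)\<close>, and a cosine is at most 1.\<close>

lemma vlast_nonneg: "0 <= vlast c N ms L"
proof -
have "exp (- vlast c N ms L/2) <= 1"
proof -
 have "exp (- vlast c N ms L/2) = expectation (%w. cos (psi w))"
  using trig_joint(1)[of "%_ _. 0" 1] by (simp add: ip_def)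
 also have "... <= expectation (%_. 1)"
 proof (rule integral_mono)
  have "psi \<in> bm P" unfolding psi_def[abs_def] ip_def perp_def proj_def pcoef_def nu_def by measurable
  thus "integrable P (%w. cos (psi w))" by (rule integrable_trig)
 qed auto
 finally show ?thesis by (simp add: prob_space)
qed
thus ?thesis by simp
qed

end

section \<open>Measurability of runs\<close>

lemma measurable_ip:
assumes [measurable]: "\<And>i. (%z. x z i) \<in> bm M" "\<And>i. (%z. y z i) \<in> bm M"
shows "(%z. ip N (x z) (y z)) \<in> bm M"
unfolding ip_def by measurable

lemma measurable_orth:
assumes [measurable]: "\<And>i. (%z. w z i) \<in> bm M" "\<And>i. (%z. x z i) \<in> bm M"
shows "(%z. orth N (w z) (x z) i) \<in> bm M"
proof -
have [measurable]: "(%z. ip N (w z) (w z)) \<in> bm M" "(%z. ip N (w z) (x z)) \<in> bm M"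
 by (rule measurable_ip; fact)+
have "(%z. orth N (w z) (x z) i) = (%z. if ip N (w z) (w z) = 0 then x z i else
  if i < N then ip N (w z) (w z)*x z i-ip N (w z) (x z)*w z i else x z i)"
 by (auto simp: orth_def)
thus ?thesis by simp
qed

lemma list_snoc_nth: "length xs = Suc n ==> xs = take n xs @ [xs ! n]"
by (metis lessI take_Suc_conv_app_nth take_all order_refl)

lemma measurable_red:
assumes "\<And>z. length (ws z) = n" "\<And>k i. k < n ==> (%z. (ws z ! k) i) \<in> bm M"
 "\<And>i. (%z. x z i) \<in> bm M"
shows "(%z. red N (ws z) (x z) i) \<in> bm M"
using assms(1,2)
proof (induction n arbitrary: ws i)
case 0
thus ?case using assms(3) by simp
next
case (Suc n)
have "(%z. red N (ws z) (x z) i) = (%z. orth N (ws z ! n) (red N (take n (ws z)) (x z)) i)"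
 by (rule ext, subst list_snoc_nth[OF Suc.prems(1)], subst red_snoc) (simp add: Suc.prems(1))
moreover have "(%z. red N (take n (ws z)) (x z) i) \<in> bm M" for i
 by (rule Suc.IH) (use Suc.prems in auto)
ultimately show ?case using Suc.prems(2)[of n] by (auto intro!: measurable_orth)
qed

lemma measurable_scl:
assumes "\<And>z. length (ws z) = n" "\<And>k i. k < n ==> (%z. (ws z ! k) i) \<in> bm M"
shows "(%z. scl N (ws z)) \<in> bm M"
using assms
proof (induction n arbitrary: ws)
case 0
thus ?case by (simp add: scl_def)
next
case (Suc n)
have "(%z. scl N (ws z)) = (%z. scl N (take n (ws z))*wt N (ws z ! n))"
 by (rule ext, subst list_snoc_nth[OF Suc.prems(1)], subst scl_snoc) (simp add: Suc.prems(1))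
moreover have "(%z. scl N (take n (ws z))) \<in> bm M"
 by (rule Suc.IH) (use Suc.prems in auto)
moreover have "(%z. wt N (ws z ! n)) \<in> bm M"
 unfolding wt_def using measurable_ip[of "%z. ws z ! n" M "%z. ws z ! n" N] Suc.prems(2)[of n] by simp
ultimately show ?case by simp
qed

definition mfun :: "(nat => real => real => real) => bool" where
"mfun f \<longleftrightarrow> (\<forall>a. (%(u, v). f a u v) \<in> bm (borel \<Otimes>\<^sub>M borel))"

lemma mfunD:
assumes "mfun f" and [measurable]: "g \<in> bm M" "h \<in> bm M"
shows "(%z. f a (g z) (h z)) \<in> bm M"
proof -
have [measurable]: "(%(u, v). f a u v) \<in> bm (borel \<Otimes>\<^sub>M borel)" using assms(1) by (simp add: mfun_def)
have "(%z. (%(u, v). f a u v) (g z, h z)) \<in> bm M" by measurable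
thus ?thesis by simp
qed

lemma measurable_run:
assumes f: "mfun f" and Or: "\<And>b i. b < a ==> (%z. Or z (snd (run N f (Or z) b)) i) \<in> bm M"
shows "\<And>k i. k < 2*a ==> (%z. (fst (run N f (Or z) a) ! k) i) \<in> bm M"
 "\<And>b i. b <= a ==> (%z. (snd (run N f (Or z) a) ! b) i) \<in> bm M"
 "\<And>k i. k < Suc (2*a) ==> (%z. (wlist N f (Or z) a ! k) i) \<in> bm M"
proof -
have last: "last (snd (run N f (Or z) a)) = snd (run N f (Or z) a) ! a" for z a by (simp add: last_conv_nth)
have "(\<forall>k<2*a. \<forall>i. (%z. (fst (run N f (Or z) a) ! k) i) \<in> bm M) &
 (\<forall>b\<le>a. \<forall>i. (%z. (snd (run N f (Or z) a) ! b) i) \<in> bm M) &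
 (\<forall>k<Suc (2*a). \<forall>i. (%z. (wlist N f (Or z) a ! k) i) \<in> bm M)"
 using Or
proof (induction a)
 case 0
 thus ?case by (simp add: wlist_def)
next
 case (Suc a)
 have IH: "\<And>k i. k < 2*a ==> (%z. (fst (run N f (Or z) a) ! k) i) \<in> bm M"
  "\<And>b i. b <= a ==> (%z. (snd (run N f (Or z) a) ! b) i) \<in> bm M"
  "\<And>k i. k < Suc (2*a) ==> (%z. (wlist N f (Or z) a ! k) i) \<in> bm M"
  using Suc by auto
 have y: "(%z. Or z (snd (run N f (Or z) a)) i) \<in> bm M" for i using Suc.prems by auto
 have r: "(%z. red N (wlist N f (Or z) a) (Or z (snd (run N f (Or z) a))) i) \<in> bm M" for i
  by (rule measurable_red[where n="Suc (2*a)"]) (use IH y in auto)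
 have s: "(%z. scl N (wlist N f (Or z) a)) \<in> bm M"
  by (rule measurable_scl[where n="Suc (2*a)"]) (use IH in auto)
 have adv: "(%z. advance N (f a) (wlist N f (Or z) a) (last (snd (run N f (Or z) a))) (Or z (snd (run N f (Or z) a))) i) \<in> bm M" for i
 proof (cases "i < N")
  case True
  thus ?thesis unfolding advance_def last using IH(2)[of a i] r s by (auto intro!: mfunD[OF f])
 next
  case False
  thus ?thesis unfolding advance_def last using IH(2)[of a i] by auto
 qed
 have 1: "(%z. (fst (run N f (Or z) (Suc a)) ! k) i) \<in> bm M" if "k < 2*Suc a" for k i
 proof (cases "k < Suc (2*a)")
  case True
  thus ?thesis using IH(3)[OF True] by (simp add: run_Suc nth_append)
 next
  case False
  hence "k = Suc (2*a)" using that by simp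
  thus ?thesis using r by (simp add: run_Suc nth_append)
 qed
 have 2: "(%z. (snd (run N f (Or z) (Suc a)) ! b) i) \<in> bm M" if "b <= Suc a" for b i
 proof (cases "b <= a")
  case True
  thus ?thesis using IH(2)[OF True] by (simp add: run_Suc nth_append)
 next
  case False
  hence "b = Suc a" using that by simp
  thus ?thesis using adv by (simp add: run_Suc nth_append)
 qed
 have 3: "(%z. (wlist N f (Or z) (Suc a) ! k) i) \<in> bm M" if "k < Suc (2*Suc a)" for k i
 proof (cases "k < 2*Suc a")
  case True
  thus ?thesis using 1[OF True] by (simp add: wlist_def nth_append)
 next
  case False
  hence k: "k = 2*Suc a" using that by simp
  have "(%z. red N (fst (run N f (Or z) (Suc a))) (last (snd (run N f (Or z) (Suc a)))) i) \<in> bm M"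
   unfolding last by (rule measurable_red[where n="2*Suc a"]) (use 1 2 in auto)
  thus ?thesis using k by (simp add: wlist_def nth_append)
 qed
 show ?case using 1 2 3 by blast
qed
thus "\<And>k i. k < 2*a ==> (%z. (fst (run N f (Or z) a) ! k) i) \<in> bm M"
 "\<And>b i. b <= a ==> (%z. (snd (run N f (Or z) a) ! b) i) \<in> bm M"
 "\<And>k i. k < Suc (2*a) ==> (%z. (wlist N f (Or z) a ! k) i) \<in> bm M" by auto
qed

lemma run_eq_iff:
assumes "length ms = Suc a" "\<And>b. b <= a ==> vanish N (ms ! b)"
shows "snd (run N f Or a) = ms \<longleftrightarrow> (\<forall>b\<in>{..a}. \<forall>i\<in>{..<N}. (snd (run N f Or a) ! b) i = (ms ! b) i)"
proof
assume *: "\<forall>b\<in>{..a}. \<forall>i\<in>{..<N}. (snd (run N f Or a) ! b) i = (ms ! b) i"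
show "snd (run N f Or a) = ms"
proof (rule nth_equalityI)
 show "length (snd (run N f Or a)) = length ms" using assms by simp
 fix b assume "b < length (snd (run N f Or a))"
 hence b: "b <= a" by simp
 have "vanish N (snd (run N f Or a) ! b)" using b by (intro vanish_run[of _ N f Or a]) simp
 hence "(snd (run N f Or a) ! b) i = (ms ! b) i" for i
  using*b assms(2)[OF b] by (cases "i < N") (auto simp: vanish_def)
 thus "snd (run N f Or a) ! b = ms ! b" by blast
qed
qed simp

lemma measurable_path:
assumes "mfun f" "\<And>b i. b < a ==> (%z. Or z (snd (run N f (Or z) b)) i) \<in> bm M"
 "length ms = Suc a" "\<And>b. b <= a ==> vanish N (ms ! b)"
shows "{z\<in>space M. snd (run N f (Or z) a) = ms} \<in> sets M"
proof -
have "{z\<in>space M. (snd (run N f (Or z) a) ! b) i = (ms ! b) i} \<in> sets M" if "b \<in> {..a}" "i \<in> {..<N}" for b i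
proof -
 have "(%z. (snd (run N f (Or z) a) ! b) i) \<in> bm M"
  by (rule measurable_run(2)[where Or=Or and a=a and f=f]) (use assms(1,2) that in auto)
 thus ?thesis by simp
qed
moreover have "(snd (run N f (Or z) a) = ms) = (\<forall>b\<in>{..a}. \<forall>i\<in>{..<N}. (snd (run N f (Or z) a) ! b) i = (ms ! b) i)" for z
 by (rule run_eq_iff) (use assms(3,4) in auto)
ultimately show ?thesis by (simp only:) (rule sets.sets_Collect_finite_All; simp)
qed

section \<open>Exact transfer between the disorder and fresh Gaussian noise\<close>

definition gaus :: "field measure" where
"gaus = PiM UNIV (%_. Nd)"

lemma prob_space_std_normal: "prob_space Nd"
using real_dist_normal_dist by (simp add: real_distribution_def)

lemma prob_space_gaus: "prob_space gaus"
unfolding gaus_def by (intro prob_space_PiM prob_space_std_normal)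

lemma measurable_gaus [measurable]: "(%x. x p) \<in> bm gaus"
proof -
have "(%x. x p) \<in> measurable gaus Nd"
 unfolding gaus_def by (rule measurable_component_singleton) simp
thus ?thesis by (simp cong: measurable_cong_sets)
qed

lemma iid_gaus: "prob_space.iid_normal gaus (%p x. x p) UNIV"
proof -
interpret prob_space gaus by (rule prob_space_gaus)
have d: "distr gaus Nd (%x. x p) = Nd" for p
 unfolding gaus_def by (rule distr_PiM_component) (auto intro: prob_space_std_normal)
have d': "distr gaus borel (%x. x p) = Nd" for p
 by (subst d[of p, symmetric]) (rule distr_cong; simp)
have sp: "space gaus = UNIV" by (auto simp: gaus_def space_PiM)
have "distr gaus (PiM UNIV (%_. borel)) (%x. \<lambda>p\<in>UNIV. x p) = gaus"
proof -
 have "distr gaus (PiM UNIV (%_. borel)) (%x. x) = distr gaus gaus (%x. x)"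
  unfolding gaus_def by (intro distr_cong sets_PiM_cong) auto
 thus ?thesis by (simp add: distr_id2 restrict_UNIV)
qed
hence "indep_vars (%_. borel) (%p x. x p) UNIV"
 by (subst indep_vars_iff_distr_eq_PiM') (auto simp: d' gaus_def[symmetric])
moreover have "distributed gaus lborel (%x. x p) std_normal_density" for p
 unfolding distributed_def
proof safe
 have "distr gaus lborel (%x. x p) = distr gaus borel (%x. x p)" by (rule distr_cong) auto
 thus "distr gaus lborel (%x. x p) = density lborel (%x. ennreal (std_normal_density x))" by (simp add: d')
qed auto
ultimately show ?thesis by (simp add: iid_normal_def)
qed

context good_path
begin

text \<open>One row of coordinates for each innovation; the spare entry \<open>(L, 0)\<close> is for
  the residual \<open>psi\<close>.\<close>

definition vars :: "(nat \<times> nat) set" where "vars = {..<L} \<times> {..<N} \<union> {(L, 0)}"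

lemma finite_vars [simp]: "finite vars" by (simp add: vars_def)

lemma sum_vars: "(\<Sum>p\<in>vars. g p) = (\<Sum>a<L. \<Sum>i<N. g (a, i))+(g (L, 0) :: real)"
unfolding vars_def by (subst sum.union_disjoint) (auto simp: sum.cartesian_product)

definition XP :: "nat \<times> nat => 'w => real" where
"XP p w = (if fst p < L then Q (fst p) (nu (fst p) w) (snd p) else psi w)"

text \<open>The counterpart of \<open>XP\<close> with fresh noise: same projections, same
  variances.\<close>

definition XT :: "nat \<times> nat => field => real" where
"XT p x = (if fst p < L then Q (fst p) (%i. sqrt (sv (fst p))*x (fst p, i)) (snd p)
 else sqrt (vlast c N ms L)*x p)"

lemma measurable_nu [measurable]: "(%w. nu a w i) \<in> bm P"
unfolding nu_def by measurable

lemma measurable_Q: "(\<And>i. (%z. x z i) \<in> bm M) ==> (%z. Q a (x z) i) \<in> bm M"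
proof -
assume m: "\<And>i. (%z. x z i) \<in> bm M"
have [measurable]: "(%z. ip N w (x z)) \<in> bm M" for w
 by (rule measurable_ip) (use m in auto)
show ?thesis unfolding perp_def proj_def pcoef_def
 using m[of i] by (cases "i < N") auto
qed

lemma measurable_psi [measurable]: "psi \<in> bm P"
proof -
have [measurable]: "(%w. Q a (nu a w) i) \<in> bm P" for a i by (rule measurable_Q) measurable
show ?thesis unfolding psi_def[abs_def] ip_def by measurable
qed

lemma measurable_XP [measurable]: "XP p \<in> bm P"
unfolding XP_def[abs_def] by (cases "fst p < L") (auto intro!: measurable_Q)

lemma measurable_XT [measurable]: "XT p \<in> bm gaus"
unfolding XT_def[abs_def] by (cases "fst p < L") (auto intro!: measurable_Q)

lemma joint_law: "distr P (PiM vars (%_. borel)) (%w. \<lambda>p\<in>vars. XP p w) =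
 distr gaus (PiM vars (%_. borel)) (%x. \<lambda>p\<in>vars. XT p x)"
proof (rule multivariate_char_uniqueness)
interpret Gm: prob_space gaus by (rule prob_space_gaus)
fix t :: "nat \<times> nat => real"
define V where "V = (\<Sum>a<L. sv a*ip N (Q a (%i. t (a, i))) (%i. t (a, i)))+(t (L, 0))^2 * vlast c N ms L"
have P: "(\<Sum>p\<in>vars. t p*XP p w) = (\<Sum>a<L. ip N (%i. t (a, i)) (Q a (nu a w)))+t (L, 0)*psi w" for w
 by (simp add: sum_vars XP_def ip_def)
define b where "b p = (if fst p < L then sqrt (sv (fst p))*Q (fst p) (%i. t (fst p, i)) (snd p) else t p * sqrt (vlast c N ms L))" for p
have G: "(\<Sum>p\<in>vars. t p*XT p x) = (\<Sum>p\<in>vars. b p*x p)" for x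
proof -
 have "(\<Sum>i<N. t (a, i)*XT (a, i) x) = (\<Sum>i<N. b (a, i)*x (a, i))" if "a < L" for a
 proof -
  have "(\<Sum>i<N. t (a, i)*XT (a, i) x) = ip N (%i. t (a, i)) (Q a (%i. sqrt (sv a)*x (a, i)))"
   using that by (simp add: XT_def ip_def)
  also have "... = sqrt (sv a)*ip N (Q a (%i. t (a, i))) (%i. x (a, i))"
   by (simp add: ip_perp_symmetric ip_scale_right)
  finally show ?thesis using that by (simp add: b_def ip_def sum_distrib_left mult_ac)
 qed
 thus ?thesis by (simp add: sum_vars) (simp add: XT_def b_def)
qed
have bV: "(\<Sum>p\<in>vars. (b p)\<^sup>2) = V"
proof -
 have "(\<Sum>i<N. (b (a, i))\<^sup>2) = sv a*ip N (Q a (%i. t (a, i))) (%i. t (a, i))" if "a < L" for a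
 proof -
  have "(\<Sum>i<N. (b (a, i))\<^sup>2) = sv a*ip N (Q a (%i. t (a, i))) (Q a (%i. t (a, i)))"
   unfolding ip_def sum_distrib_left using that less_imp_le[OF pos[OF that]]
   by (intro sum.cong refl) (simp only: b_def fst_conv snd_conv if_True power_mult_distrib real_sqrt_pow2 power2_eq_square[of "perp _ _ _ _"])
  thus ?thesis by (simp add: perp_idem[OF orthogonal_basis])
 qed
 thus ?thesis using vlast_nonneg by (simp add: sum_vars V_def) (simp add: b_def power_mult_distrib)
qed
have P1: "(LINT w|P. cos (\<Sum>p\<in>vars. t p*XP p w)) = exp (- V/2)" "(LINT w|P. sin (\<Sum>p\<in>vars. t p*XP p w)) = 0"
 unfolding P V_def by (rule trig_joint)+
have G1: "(LINT x|gaus. cos (\<Sum>p\<in>vars. t p*XT p x)) = exp (- V/2)" "(LINT x|gaus. sin (\<Sum>p\<in>vars. t p*XT p x)) = 0"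
 unfolding G using Gm.iid_normal_trig[OF iid_gaus finite_vars subset_UNIV, of b] by (simp_all add: bV)
show "(LINT w|P. cos (\<Sum>p\<in>vars. t p*XP p w)) = (LINT x|gaus. cos (\<Sum>p\<in>vars. t p*XT p x))"
 "(LINT w|P. sin (\<Sum>p\<in>vars. t p*XP p w)) = (LINT x|gaus. sin (\<Sum>p\<in>vars. t p*XT p x))"
 using P1 G1 by simp_all
qed (auto intro: prob_space_gaus prob_space_axioms)

abbreviation toyv :: "field => nat => nat => real" where
"toyv x a \<equiv> (%i. if i < N then sqrt (sv a)*x (a, i) else 0)"

lemma Q_toyv: "Q a (toyv x a) = Q a (%i. sqrt (sv a)*x (a, i))"
proof -
have p: "pcoef N w (toyv x a) = pcoef N w (%i. sqrt (sv a)*x (a, i))" for w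
 by (auto simp: pcoef_def intro!: arg_cong2[where f="(/)"] ip_cong)
show ?thesis by (auto simp: perp_def proj_def p fun_eq_iff)
qed

lemma dead_basis_member:
assumes "a < L" "\<And>b. b <= a ==> dead N ws (ms ! b)" "w \<in> set (basis N ms a)"
shows "dead N ws w" "vanish N w"
proof -
show "dead N ws w" by (rule dead_gsl_members[OF _ assms(3)]) (use assms van in auto)
show "vanish N w" by (rule vanish_gsl[OF _ assms(3)]) (use assms van in auto)
qed

lemma dead_perp_diff:
assumes "a < L" "\<And>b. b <= a ==> dead N ws (ms ! b)" "vanish N v"
shows "dead N ws (%i. v i-Q a v i)"
proof -
have "(%i. v i-Q a v i) = proj N (basis N ms a) v"
 using dead_basis_member(2)[OF assms(1,2)] assms(3) by (intro ext perp_diff) auto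
thus ?thesis using dead_basis_member(1)[OF assms(1,2)] by (auto intro!: dead_proj)
qed

lemma vanish_DH: "vanish N (DH m w)"
by (simp add: vanish_def DH_def)

lemma vanish_nu: "vanish N (nu a w)"
using vanish_DH by (simp add: vanish_def nu_def sum.neutral)

text \<open>A gradient minus its innovation is a combination of earlier answers, and an innovation
  minus its projection lies in the span of the query points. Neither difference is seen by the
  run.\<close>

lemma run_P: "snd (run N f (seq_oracle (%a. DH (ms ! a) w)) L) = ms \<longleftrightarrow>
 snd (run N f (seq_oracle (%a. Q a (nu a w))) L) = ms"
proof -
have diff: "dead N ws (%i. DH (ms ! a) w i-Q a (nu a w) i)"
 if a: "a < L" and m: "\<And>b. b <= a ==> dead N ws (ms ! b)" and y: "\<And>b. b < a ==> dead N ws (DH (ms ! b) w)" for a ws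
proof -
 have "(%i. DH (ms ! a) w i-nu a w i) = (%i. - 1*(\<Sum>b<a. al a b*DH (ms ! b) w i))"
  unfolding nu_def by (rule ext) (simp add: lessThan_Suc_atMost[symmetric] innov_rec[of K a a] innov_support)
 moreover have "dead N ws (%i. - 1*(\<Sum>b<a. al a b*DH (ms ! b) w i))"
  by (intro dead_scale dead_sum) (use y in auto)
 ultimately have "dead N ws (%i. DH (ms ! a) w i-nu a w i)" by simp
 from dead_add[OF this dead_perp_diff[OF a m vanish_nu[of a w]]] show ?thesis by simp
qed
show ?thesis (is "snd ?r = ms \<longleftrightarrow> snd ?r' = ms")
proof
 assume h: "snd ?r = ms"
 have "?r = ?r'" by (rule run_modulo_span[OF diff vanish_DH disjI1[OF h]])
 with h show "snd ?r' = ms" by (simp only:)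
next
 assume h: "snd ?r' = ms"
 have "?r = ?r'" by (rule run_modulo_span[OF diff vanish_DH disjI2[OF h]])
 with h show "snd ?r = ms" by (simp only:)
qed
qed

text \<open>Fresh noise differs from its projection by an element of the span of the query points
  only.\<close>

lemma run_T: "snd (run N f (seq_oracle (toyv x)) L) = ms \<longleftrightarrow>
 snd (run N f (seq_oracle (%a. Q a (%i. sqrt (sv a)*x (a, i)))) L) = ms"
proof -
have v: "vanish N (toyv x a)" for a by (simp add: vanish_def)
have diff: "dead N ws (%i. toyv x a i-Q a (%i. sqrt (sv a)*x (a, i)) i)"
 if a: "a < L" and m: "\<And>b. b <= a ==> dead N ws (ms ! b)" and y: "\<And>b. b < a ==> dead N ws (toyv x b)" for a ws
 using dead_perp_diff[OF a m v[of a]] unfolding Q_toyv by simp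
show ?thesis (is "snd ?r = ms \<longleftrightarrow> snd ?r' = ms")
proof
 assume h: "snd ?r = ms"
 have "?r = ?r'" by (rule run_modulo_span[OF diff v disjI1[OF h]])
 with h show "snd ?r' = ms" by (simp only:)
next
 assume h: "snd ?r' = ms"
 have "?r = ?r'" by (rule run_modulo_span[OF diff v disjI2[OF h]])
 with h show "snd ?r = ms" by (simp only:)
qed
qed

definition true_event :: "(nat => real => real => real) => real => 'w set" where
"true_event f thr = {w\<in>space P. snd (run N f (seq_oracle (%a. DH (ms ! a) w)) L) = ms & thr <= HH sg w}"

definition toy_event :: "(nat => real => real => real) => real => field set" where
"toy_event f thr = {x\<in>space gaus. snd (run N f (seq_oracle (toyv x)) L) = ms &
 thr <= (\<Sum>a<L. kl a/sv a*ip N sg (Q a (%i. sqrt (sv a)*x (a, i))))+sqrt (vlast c N ms L)*x (L, 0)}"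

text \<open>In terms of the projected variables both events are preimages of one set
  \<open>E\<close>, so equality in law gives equal probabilities. The energy is covered too, as it
  is \<open>psi\<close> plus its regression.\<close>

theorem transfer:
assumes f: "mfun f"
shows "measure P (true_event f thr) = measure gaus (toy_event f thr)"
 "true_event f thr \<in> sets P" "toy_event f thr \<in> sets gaus"
proof -
let ?PM = "PiM vars (%_. borel :: real measure)"
\<comment> \<open>Entries that are not recorded are set to 0; the projections are 0 there as well,
  so the recorded entries determine the run.\<close>
define yz where "yz z a i = (if (a, i) \<in> vars & a < L then z (a, i) else (0::real))" for z :: "nat \<times> nat => real" and a i
define E where "E = {z\<in>space ?PM. snd (run N f (seq_oracle (yz z)) L) = ms &
 thr <= (\<Sum>a<L. kl a/sv a*ip N sg (yz z a))+z (L, 0)}"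
have my: "(%z. yz z a i) \<in> bm ?PM" for a i
 unfolding yz_def by (cases "(a, i) \<in> vars & a < L") (auto simp del: not_less)
have [measurable]: "(%z. z (L, 0)) \<in> bm ?PM" by (rule measurable_component_singleton) (simp add: vars_def)
have [measurable]: "(%z. ip N sg (yz z a)) \<in> bm ?PM" for a
 by (rule measurable_ip) (use my in auto)
have 1: "{z\<in>space ?PM. snd (run N f (seq_oracle (yz z)) L) = ms} \<in> sets ?PM"
 by (rule measurable_path[OF f _ len van]) (use my in auto)
have 2: "{z\<in>space ?PM. thr <= (\<Sum>a<L. kl a/sv a*ip N sg (yz z a))+z (L, 0)} \<in> sets ?PM" by measurable
have E: "E \<in> sets ?PM"
 using sets.Int[OF 1 2] by (rule back_subst[where P="%x. x \<in> _"]) (auto simp: E_def)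
have [measurable]: "(%w. \<lambda>p\<in>vars. XP p w) \<in> measurable P ?PM" "(%x. \<lambda>p\<in>vars. XT p x) \<in> measurable gaus ?PM"
 by (auto intro!: measurable_restrict)
have yP: "yz (\<lambda>p\<in>vars. XP p w) a = Q a (nu a w)" if "a < L" for a w
 using that by (auto simp: yz_def XP_def vars_def fun_eq_iff perp_def)
have yT: "yz (\<lambda>p\<in>vars. XT p x) a = Q a (%i. sqrt (sv a)*x (a, i))" if "a < L" for a x
 using that by (auto simp: yz_def XT_def vars_def fun_eq_iff perp_def)
have cong: "run N f (seq_oracle y) L = run N f (seq_oracle y') L" if "\<And>a. a < L ==> y a = y' a" for y y' f
 by (rule run_cong) (use that in auto)
have L0: "(\<lambda>p\<in>vars. XP p w) (L, 0) = psi w" "(\<lambda>p\<in>vars. XT p x) (L, 0) = sqrt (vlast c N ms L)*x (L, 0)" for w x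
 by (auto simp: vars_def XP_def XT_def)
have A: "true_event f thr = (%w. \<lambda>p\<in>vars. XP p w) -` E \<inter> space P"
proof (rule set_eqI)
 fix w
 have "snd (run N f (seq_oracle (yz (\<lambda>p\<in>vars. XP p w))) L) = snd (run N f (seq_oracle (%a. Q a (nu a w))) L)"
  using cong[of "yz (\<lambda>p\<in>vars. XP p w)" "%a. Q a (nu a w)" f] yP by simp
 moreover have "(\<Sum>a<L. kl a/sv a*ip N sg (yz (\<lambda>p\<in>vars. XP p w) a))+psi w = HH sg w"
  by (simp add: yP psi_def)
 ultimately show "w \<in> true_event f thr \<longleftrightarrow> w \<in> (%w. \<lambda>p\<in>vars. XP p w) -` E \<inter> space P"
  unfolding true_event_def E_def vimage_def Int_iff mem_Collect_eq L0 run_P by (auto simp: space_PiM)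
qed
have B: "toy_event f thr = (%x. \<lambda>p\<in>vars. XT p x) -` E \<inter> space gaus"
proof (rule set_eqI)
 fix x
 have "snd (run N f (seq_oracle (yz (\<lambda>p\<in>vars. XT p x))) L) = snd (run N f (seq_oracle (%a. Q a (%i. sqrt (sv a)*x (a, i)))) L)"
  using cong[of "yz (\<lambda>p\<in>vars. XT p x)" "%a. Q a (%i. sqrt (sv a)*x (a, i))" f] yT by simp
 moreover have "(\<Sum>a<L. kl a/sv a*ip N sg (yz (\<lambda>p\<in>vars. XT p x) a)) =
   (\<Sum>a<L. kl a/sv a*ip N sg (Q a (%i. sqrt (sv a)*x (a, i))))" by (simp add: yT)
 ultimately show "x \<in> toy_event f thr \<longleftrightarrow> x \<in> (%x. \<lambda>p\<in>vars. XT p x) -` E \<inter> space gaus"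
  unfolding toy_event_def E_def vimage_def Int_iff mem_Collect_eq L0 run_T by (auto simp: space_PiM)
qed
show "true_event f thr \<in> sets P" "toy_event f thr \<in> sets gaus" unfolding A B using E by measurable
have "measure P (true_event f thr) = measure (distr P ?PM (%w. \<lambda>p\<in>vars. XP p w)) E"
 unfolding A using E by (subst measure_distr) auto
also have "... = measure (distr gaus ?PM (%x. \<lambda>p\<in>vars. XT p x)) E" by (simp add: joint_law)
also have "... = measure gaus (toy_event f thr)"
 unfolding B using E by (subst measure_distr) auto
finally show "measure P (true_event f thr) = measure gaus (toy_event f thr)" .
qed

end

section \<open>Convergence in probability under the fresh noise\<close>

abbreviation whp :: "(nat => field => bool) => bool" where
"whp A \<equiv> with_high_probability (%_. gaus) A"

lemma whp_mono:
assumes "whp A" "\<And>N x. 1 <= N ==> A N x ==> B N x"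
shows "whp B"
proof -
obtain S where S: "\<And>N. S N \<in> sets gaus" "\<And>N x. x \<in> S N ==> A N x" "(%N. measure gaus (S N)) \<longlonglongrightarrow> 1"
 using assms(1) unfolding with_high_probability_def by blast
\<comment> \<open>Dimension 0 is discarded because the implication is only given for
  \<open>1 <= N\<close>; one term does not affect the limit.\<close>
let ?S = "%N. if N = 0 then {} else S N"
have "(%N. measure gaus (?S N)) \<longlonglongrightarrow> 1"
 by (rule Lim_transform_eventually[OF S(3)], rule eventually_sequentiallyI[of 1]) simp
moreover have "\<forall>N. ?S N \<in> sets gaus & (\<forall>x\<in>?S N. B N x)" using S assms(2) by auto
ultimately show ?thesis unfolding with_high_probability_def by (intro exI[of _ ?S] conjI)
qed

lemma whp_conj:
assumes "whp A" "whp B"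
shows "whp (%N x. A N x & B N x)"
proof -
interpret prob_space gaus by (rule prob_space_gaus)
obtain S where S: "\<And>N. S N \<in> events" "\<And>N x. x \<in> S N ==> A N x" "(%N. prob (S N)) \<longlonglongrightarrow> 1"
 using assms(1) unfolding with_high_probability_def by blast
obtain T where T: "\<And>N. T N \<in> events" "\<And>N x. x \<in> T N ==> B N x" "(%N. prob (T N)) \<longlonglongrightarrow> 1"
 using assms(2) unfolding with_high_probability_def by blast
have "(%N. prob (S N \<inter> T N)) \<longlonglongrightarrow> 1"
proof (rule tendsto_sandwich)
 have "prob (S N)+prob (T N)-1 <= prob (S N \<inter> T N)" for N
  using finite_measure_Union'[OF S(1)[of N] T(1)[of N]] finite_measure_Diff'[OF T(1)[of N] S(1)[of N]] prob_le_1[of "S N \<union> T N"]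
  by (simp add: Int_commute)
 thus "\<forall>\<^sub>F N in sequentially. prob (S N)+prob (T N)-1 <= prob (S N \<inter> T N)" by simp
 show "(%N. prob (S N)+prob (T N)-1) \<longlonglongrightarrow> 1" using tendsto_diff[OF tendsto_add[OF S(3) T(3)] tendsto_const[of 1]] by simp
qed (auto intro: prob_le_1)
thus ?thesis unfolding with_high_probability_def
 by (intro exI[of _ "%N. S N \<inter> T N"]) (use S T in auto)
qed

lemma whp_True: "whp (%_ _. True)"
proof -
interpret prob_space gaus by (rule prob_space_gaus)
show ?thesis unfolding with_high_probability_def by (intro exI[of _ "%_. space gaus"]) (simp add: prob_space)
qed

lemma whp_all:
assumes "finite I" "\<And>i. i \<in> I ==> whp (A i)"
shows "whp (%N x. \<forall>i\<in>I. A i N x)"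
using assms
proof (induction I rule: finite_induct)
case empty
thus ?case by (simp add: whp_True)
next
case (insert i I)
hence "whp (%N x. A i N x & (\<forall>i\<in>I. A i N x))" by (intro whp_conj) auto
thus ?case by simp
qed

lemma whp_Markov:
fixes Y :: "nat => field => real"
assumes Y: "\<And>N. 1 <= N ==> integrable gaus (Y N)" "\<And>N x. 1 <= N ==> 0 <= Y N x"
 and b: "\<And>N. 1 <= N ==> (LINT x|gaus. Y N x) <= b N" "b \<longlonglongrightarrow> 0" and t: "0 < t"
shows "whp (%N x. Y N x <= t)"
proof -
interpret prob_space gaus by (rule prob_space_gaus)
let ?S = "%N. if N = 0 then {} else {x\<in>space gaus. Y N x <= t}"
have S: "?S N \<in> events" for N
proof (cases "N = 0")
 case False
 hence [measurable]: "Y N \<in> bm gaus" using borel_measurable_integrable[OF Y(1)[of N]] by simp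
 from borel_measurable_le[OF this borel_measurable_const[of t]] have "{x\<in>space gaus. Y N x <= t} \<in> events" .
 thus ?thesis using False by simp
qed simp
have "(%N. prob (?S N)) \<longlonglongrightarrow> 1"
proof (rule tendsto_sandwich)
 show "\<forall>\<^sub>F N in sequentially. 1-b N/t <= prob (?S N)"
 proof (rule eventually_sequentiallyI[of 1])
  fix N :: nat assume N: "1 <= N"
  have "space gaus-?S N \<subseteq> {x\<in>space gaus. t <= Y N x}" using N by auto
  moreover have "{x\<in>space gaus. t <= Y N x} \<in> events"
  proof -
   have "Y N \<in> bm gaus" using borel_measurable_integrable[OF Y(1)[OF N]] .
   from borel_measurable_le[OF borel_measurable_const[of t] this] show ?thesis .
  qed
  ultimately have "prob (space gaus-?S N) <= prob {x\<in>space gaus. t <= Y N x}" by (intro finite_measure_mono) auto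
  also have "... <= (LINT x|gaus. Y N x)/t"
   by (rule integral_Markov_inequality_measure[where A="{}"]) (use Y N t in auto)
  also have "... <= b N/t" using b(1)[OF N] t by (simp add: divide_right_mono)
  finally show "1-b N/t <= prob (?S N)" using prob_compl[OF S[of N]] by linarith
 qed
 show "(%N. 1-b N/t) \<longlonglongrightarrow> 1" using tendsto_diff[OF tendsto_const[of 1] tendsto_divide[OF b(2) tendsto_const[of t]]] t by simp
qed (auto intro: prob_le_1)
thus ?thesis unfolding with_high_probability_def by (intro exI[of _ ?S]) (use S in auto)
qed

text \<open>Convergence in probability to a constant. One infinite array carries the noise of all
  dimensions, so the probability space does not vary with \<open>N\<close>.\<close>

definition conv :: "(nat => field => real) => real => bool" where
"conv X r \<longleftrightarrow> (\<forall>ep>0. whp (%N x. \<bar>X N x-r\<bar> <= ep))"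

lemma convD: "conv X r ==> 0 < ep ==> whp (%N x. \<bar>X N x-r\<bar> <= ep)"
by (simp add: conv_def)

lemma conv_const [simp]: "conv (%_ _. r) r"
unfolding conv_def by (intro allI impI, rule whp_mono[OF whp_True]) simp

lemma conv_compose2:
assumes X: "conv X r" and Y: "conv Y q" and h: "isCont (%p. h (fst p) (snd p)) (r, q)"
shows "conv (%N x. h (X N x) (Y N x)) (h r q :: real)"
unfolding conv_def
proof (intro allI impI)
fix ep :: real assume "0 < ep"
with h obtain d where d: "d > 0" "\<And>p. dist p (r, q) < d ==> dist (h (fst p) (snd p)) (h r q) < ep"
 unfolding continuous_at_eps_delta by fastforce
have "whp (%N x. \<bar>X N x-r\<bar> <= d/3 & \<bar>Y N x-q\<bar> <= d/3)" using d(1) by (intro whp_conj convD X Y) auto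
thus "whp (%N x. \<bar>h (X N x) (Y N x)-h r q\<bar> <= ep)"
proof (rule whp_mono)
 fix N x assume *: "\<bar>X N x-r\<bar> <= d/3 & \<bar>Y N x-q\<bar> <= d/3"
 have "dist (X N x, Y N x) (r, q) <= \<bar>X N x-r\<bar>+\<bar>Y N x-q\<bar>"
  unfolding dist_Pair_Pair dist_real_def using sqrt_sum_squares_le_sum_abs[of "\<bar>X N x-r\<bar>" "\<bar>Y N x-q\<bar>"] by simp
 also have "... < d" using*d(1) by linarith
 finally show "\<bar>h (X N x) (Y N x)-h r q\<bar> <= ep" using d(2)[of "(X N x, Y N x)"] by (simp add: dist_real_def)
qed
qed

lemma conv_compose: "conv X r ==> isCont h r ==> conv (%N x. h (X N x)) (h r :: real)"
unfolding conv_def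
proof (intro allI impI)
fix ep :: real assume X: "\<forall>ep>0. whp (%N x. \<bar>X N x-r\<bar> <= ep)" and h: "isCont h r" and "0 < ep"
then obtain d where d: "d > 0" "\<And>p. dist p r < d ==> dist (h p) (h r) < ep"
 unfolding continuous_at_eps_delta by fastforce
show "whp (%N x. \<bar>h (X N x)-h r\<bar> <= ep)"
proof (rule whp_mono)
 show "whp (%N x. \<bar>X N x-r\<bar> <= d/2)" using X half_gt_zero[OF d(1)] by blast
 fix N x assume "\<bar>X N x-r\<bar> <= d/2"
 hence "dist (X N x) r < d" using d(1) unfolding dist_real_def by linarith
 from d(2)[OF this] show "\<bar>h (X N x)-h r\<bar> <= ep" by (simp add: dist_real_def)
qed
qed

lemma conv_add: "conv X r ==> conv Y q ==> conv (%N x. X N x+Y N x) (r+q)"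
by (rule conv_compose2[where h="(+)"]) (assumption | rule isCont_add isCont_fst isCont_snd continuous_ident)+

lemma conv_diff: "conv X r ==> conv Y q ==> conv (%N x. X N x-Y N x) (r-q)"
by (rule conv_compose2[where h="(-)"]) (assumption | rule isCont_diff isCont_fst isCont_snd continuous_ident)+

lemma conv_mult: "conv X r ==> conv Y q ==> conv (%N x. X N x*Y N x) (r*q)"
by (rule conv_compose2[where h="(*)"]) (assumption | rule isCont_mult isCont_fst isCont_snd continuous_ident)+

lemma conv_divide: "conv X r ==> conv Y q ==> q \<noteq> 0 ==> conv (%N x. X N x/Y N x) (r/q)"
by (rule conv_compose2[where h="(/)"]) (assumption | rule isCont_divide isCont_fst isCont_snd continuous_ident | simp)+

lemma conv_sum: "finite I ==> (\<And>i. i \<in> I ==> conv (X i) (r i)) ==> conv (%N x. \<Sum>i\<in>I. X i N x) (\<Sum>i\<in>I. r i)"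
by (induction I rule: finite_induct) (simp_all add: conv_add)

lemma conv_close:
assumes "conv X r" "conv D 0" "\<And>N x. 1 <= N ==> \<bar>Y N x-X N x\<bar> <= D N x"
shows "conv Y r"
unfolding conv_def
proof (intro allI impI)
fix ep :: real assume "0 < ep"
hence "whp (%N x. \<bar>X N x-r\<bar> <= ep/2 & \<bar>D N x-0\<bar> <= ep/2)" by (intro whp_conj convD assms) auto
thus "whp (%N x. \<bar>Y N x-r\<bar> <= ep)"
proof (rule whp_mono)
 fix N :: nat and x assume N: "1 <= N" and *: "\<bar>X N x-r\<bar> <= ep/2 & \<bar>D N x-0\<bar> <= ep/2"
 with assms(3)[OF N, of x] show "\<bar>Y N x-r\<bar> <= ep" by linarith
qed
qed

lemma conv_Markov:
assumes Y: "\<And>N. 1 <= N ==> integrable gaus (Y N)" "\<And>N x. 1 <= N ==> 0 <= Y N x"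
 and b: "\<And>N. 1 <= N ==> (LINT x|gaus. Y N x) <= b N" "b \<longlonglongrightarrow> 0"
shows "conv Y 0"
unfolding conv_def
proof (intro allI impI)
fix ep :: real assume "0 < ep"
hence "whp (%N x. Y N x <= ep)" by (intro whp_Markov[OF Y b])
thus "whp (%N x. \<bar>Y N x-0\<bar> <= ep)" by (rule whp_mono) (use Y(2) in auto)
qed

lemma gaus_indep:
fixes g h :: "field => real"
assumes "A \<inter> B = {}" and g: "g \<in> bm (PiM A (%_. borel))" and h: "h \<in> bm (PiM B (%_. borel))"
 and gi: "integrable gaus (%x. g (restrict x A))" and hi: "integrable gaus (%x. h (restrict x B))"
shows "integrable gaus (%x. g (restrict x A)*h (restrict x B) :: real)"
 "(LINT x|gaus. g (restrict x A)*h (restrict x B)) = (LINT x|gaus. g (restrict x A))*(LINT x|gaus. h (restrict x B))"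
proof -
interpret prob_space gaus by (rule prob_space_gaus)
have "indep_vars (%_. borel) (%p x. x p) (UNIV :: (nat \<times> nat) set)" using iid_gaus by (simp add: iid_normal_def)
from indep_var_restrict[OF this assms(1)]
have "indep_var (PiM A (%_. borel)) (%x. restrict x A) (PiM B (%_. borel)) (%x. restrict (%i. x i :: real) B)" by simp
from indep_var_compose[OF this g h]
have i: "indep_var borel (%x. g (restrict x A)) borel (%x. h (restrict x B))" unfolding o_def .
show "integrable gaus (%x. g (restrict x A)*h (restrict x B) :: real)"
 by (rule indep_var_integrable[OF i gi hi])
show "(LINT x|gaus. g (restrict x A)*h (restrict x B)) = (LINT x|gaus. g (restrict x A))*(LINT x|gaus. h (restrict x B))"
 by (rule indep_var_lebesgue_integral[OF i gi hi])
qed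

abbreviation col :: "field => nat => nat => real" where
"col x i \<equiv> (%a. x (a, i))"

abbreviation colm :: "vec measure" where
"colm \<equiv> PiM UNIV (%_. borel)"

lemma measurable_col: "col_fun \<in> bm colm ==> (%x. col_fun (col x i)) \<in> bm gaus"
proof -
assume m: "col_fun \<in> bm colm"
have "(%x. col x i) \<in> measurable gaus colm"
 by (rule measurable_PiM_single') (auto simp: space_PiM)
from measurable_compose[OF this m] show ?thesis .
qed

text \<open>Exchanging the coordinates 0 and \<open>i\<close> preserves the product measure.\<close>

lemma integral_col:
assumes g: "g \<in> bm colm"
shows "integrable gaus (%x. g (col x i)) \<longleftrightarrow> integrable gaus (%x. g (col x 0) :: real)"
 "(LINT x|gaus. g (col x i)) = (LINT x|gaus. g (col x 0))"
proof -
let ?f = "%p::nat \<times> nat. (fst p, Transposition.transpose 0 i (snd p))"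
have inj: "inj ?f" by (auto simp: inj_def transpose_eq_iff prod_eq_iff)
have "distr (PiM UNIV (%_. Nd)) (PiM UNIV (%_. Nd)) (%w. \<lambda>n\<in>UNIV. w (?f n)) =
  PiM (UNIV :: (nat \<times> nat) set) (%_. Nd)"
 by (rule distr_PiM_reindex[of UNIV "%_. Nd" ?f UNIV]) (use inj in "auto intro: prob_space_std_normal")
hence d: "distr gaus gaus (%x p. x (?f p)) = gaus" by (simp add: gaus_def restrict_UNIV)
have gm: "(%x. g (col x 0)) \<in> bm gaus" by (rule measurable_col[OF g])
have "(%x p. x (?f p)) \<in> measurable gaus (PiM UNIV (%_. borel))"
 by (rule measurable_PiM_single') (auto simp: space_PiM)
hence fm: "(%x p. x (?f p)) \<in> measurable gaus gaus"
 by (subst (2) gaus_def, subst measurable_cong_sets[OF refl sets_PiM_cong[OF refl]]) auto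
have e: "g (col (%p. x (?f p)) 0) = g (col x i)" for x by simp
show "integrable gaus (%x. g (col x i)) \<longleftrightarrow> integrable gaus (%x. g (col x 0) :: real)"
 using integrable_distr_eq[OF fm gm] unfolding d e by (rule sym)
show "(LINT x|gaus. g (col x i)) = (LINT x|gaus. g (col x 0))"
 using integral_distr[OF fm gm] unfolding d e by (rule sym)
qed

lemma col_indep:
assumes "i \<noteq> j" and g: "g \<in> bm colm" and h: "h \<in> bm colm"
 and gi: "integrable gaus (%x. g (col x i))" and hi: "integrable gaus (%x. h (col x j))"
shows "integrable gaus (%x. g (col x i)*h (col x j) :: real)"
 "(LINT x|gaus. g (col x i)*h (col x j)) = (LINT x|gaus. g (col x i))*(LINT x|gaus. h (col x j))"
proof -
have m: "(%y. g (col y i)) \<in> bm (PiM (UNIV \<times> {i}) (%_. borel))" if "g \<in> bm colm" for g :: "vec => real" and i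
 by (rule measurable_compose[OF _ that], rule measurable_PiM_single') (auto simp: space_PiM intro!: measurable_component_singleton)
have r: "col (restrict x (UNIV \<times> {i})) i = col x i" for x :: "nat \<times> nat => real" and i by auto
have d: "UNIV \<times> {i} \<inter> UNIV \<times> {j} = ({} :: (nat \<times> nat) set)" using assms(1) by auto
show "integrable gaus (%x. g (col x i)*h (col x j) :: real)"
 "(LINT x|gaus. g (col x i)*h (col x j)) = (LINT x|gaus. g (col x i))*(LINT x|gaus. h (col x j))"
 using gaus_indep[OF d m[OF g] m[OF h]] gi hi unfolding r by auto
qed

text \<open>Distinct columns are independent, so the square of the centred average has mean
  \<open>V/N\<close>; Markov's inequality concludes.\<close>

lemma conv_lln:
assumes g: "g \<in> bm colm" and sq: "integrable gaus (%x. (g (col x 0))\<^sup>2)"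
shows "conv (%N x. (\<Sum>i<N. g (col x i))/real N) (LINT x|gaus. g (col x 0))"
proof -
interpret prob_space gaus by (rule prob_space_gaus)
let ?e = "\<integral>x. g (col x 0) \<partial>gaus"
define h where "h y = g y-?e" for y
have h: "h \<in> bm colm" unfolding h_def[abs_def] using g by measurable
have g1: "integrable gaus (%x. g (col x 0))"
 by (rule square_integrable_imp_integrable[OF measurable_col[OF g] sq])
have h1: "integrable gaus (%x. h (col x 0))" unfolding h_def using g1 by simp
have h0: "(LINT x|gaus. h (col x 0)) = 0" unfolding h_def using g1 by (simp add: prob_space)
have "integrable gaus (%x. (g (col x 0))\<^sup>2+?e^2-2*g (col x 0)*?e)"
 using sq g1 by auto
hence h2: "integrable gaus (%x. (h (col x 0))\<^sup>2)" unfolding h_def power2_diff .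
let ?V = "\<integral>x. (h (col x 0))\<^sup>2 \<partial>gaus"
have hh: "integrable gaus (%x. h (col x i)*h (col x j)) &
  (LINT x|gaus. h (col x i)*h (col x j)) = (if i = j then ?V else 0)" for i j
proof (cases "i = j")
 case True
 have "(%y. (h y)\<^sup>2) \<in> bm colm" using h by measurable
 from integral_col[OF this, of i] show ?thesis using True h2 by (simp add: power2_eq_square)
next
 case False
 from col_indep[OF this h h] show ?thesis using False h1 integral_col[OF h] by (auto simp: h0)
qed
let ?Y = "%N x. ((\<Sum>i<N. h (col x i))/real N)\<^sup>2"
have Y: "?Y N x = (\<Sum>i<N. \<Sum>j<N. h (col x i)*h (col x j))/(real N)^2" for N x
 by (simp add: power_divide power2_eq_square sum_product)
have "conv ?Y 0"
proof (rule conv_Markov)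
 fix N :: nat assume N: "1 <= N"
 show "integrable gaus (?Y N)" unfolding Y using hh by auto
 have "(LINT x|gaus. ?Y N x) = (\<Sum>i<N. \<Sum>j<N. if i = j then ?V else 0)/(real N)^2"
  unfolding Y using hh by (simp add: int_sum)
 also have "... = ?V/real N" using N by (simp add: power2_eq_square)
 finally show "(LINT x|gaus. ?Y N x) <= ?V/real N" by simp
next
 show "(%N. ?V/real N) \<longlonglongrightarrow> 0" by (rule lim_const_over_n)
qed auto
from conv_compose[OF this, of sqrt] have "conv (%N x. \<bar>(\<Sum>i<N. h (col x i))/real N\<bar>) 0"
 using isCont_real_sqrt[of 0] by simp
thus ?thesis
proof (rule conv_close[rotated])
 fix N :: nat and x :: "nat \<times> nat => real" assume "1 <= N"
 thus "\<bar>(\<Sum>i<N. g (col x i))/real N-?e\<bar> <= \<bar>(\<Sum>i<N. h (col x i))/real N\<bar>"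
  by (simp add: h_def sum_subtractf field_simps)
qed simp
qed

section \<open>Derivatives of the mixture\<close>

definition xi2 :: "vec => real => real" where
"xi2 c x = (\<Sum>k. diffs (diffs (%k. (deg c k)\<^sup>2)) k*x^k)"

context mixture_coeffs
begin

lemma summable_xi': "norm (x :: real) < rad ==> summable (%k. (deg c k)\<^sup>2*x^k)"
by (rule summable_xi) simp

lemma summable_diffs: "norm (x :: real) < rad ==> summable (%k. diffs (%k. (deg c k)\<^sup>2) k*x^k)"
by (rule termdiff_converges[OF _ summable_xi'])

lemma summable_diffs2: "norm (x :: real) < rad ==> summable (%k. diffs (diffs (%k. (deg c k)\<^sup>2)) k*x^k)"
by (rule termdiff_converges[OF _ summable_diffs])

lemma xi1_diffs: "norm (x :: real) < rad ==> xi1 c x = (\<Sum>k. diffs (%k. (deg c k)\<^sup>2) k*x^k)"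
proof -
assume x: "norm x < rad"
have "(\<Sum>k. (deg c k)\<^sup>2*(real k*x^(k-1))) = (\<Sum>k. (deg c (Suc k))\<^sup>2*(real (Suc k)*x^k))"
 using suminf_split_head[OF summable_xi1[of x]] x by simp
thus ?thesis by (simp add: xi1_def diffs_def mult_ac)
qed

lemma DERIV_xi: "norm (x :: real) < rad ==> DERIV (xi c) x :> xi1 c x"
unfolding xi1_diffs xi_def[abs_def] by (rule termdiffs_strong'[OF summable_xi'])

lemma nhds_rad: "norm (x :: real) < rad ==> eventually (%y. norm y < rad) (nhds x)"
using eventually_nhds_in_open[of "ball 0 rad" x] by (simp add: dist_norm)

lemma DERIV_xi1:
assumes "norm (x :: real) < rad"
shows "DERIV (xi1 c) x :> xi2 c x"
proof -
have "DERIV (%x. \<Sum>k. diffs (%k. (deg c k)\<^sup>2) k*x^k) x :> xi2 c x"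
 unfolding xi2_def by (rule termdiffs_strong'[OF summable_diffs assms])
thus ?thesis
 by (subst DERIV_cong_ev[OF refl _ refl]) (use nhds_rad[OF assms] in "auto elim!: eventually_mono simp: xi1_diffs")
qed

lemma isCont_xi1: "\<bar>x\<bar> <= 1 ==> isCont (xi1 c) x"
using rad(1) by (intro DERIV_isCont[OF DERIV_xi1]) simp

lemma mixture_xi: "mixture c x = xi c x"
unfolding mixture_def xi_def by (intro suminf_cong) (simp add: deg_def)

lemma mixture2_xi2: assumes "norm (x :: real) < rad" shows "mixture2 c x = xi2 c x"
proof -
have m: "mixture c = xi c" by (rule ext) (rule mixture_xi)
have "deriv (deriv (mixture c)) x = deriv (xi1 c) x"
 by (rule deriv_cong_ev) (use nhds_rad[OF assms] in "auto elim!: eventually_mono simp: m intro!: DERIV_imp_deriv DERIV_xi")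
also have "... = xi2 c x" by (rule DERIV_imp_deriv[OF DERIV_xi1[OF assms]])
finally show ?thesis by (simp add: mixture2_def)
qed

lemma diffs_nonneg: "0 <= diffs (%k. (deg c k)\<^sup>2) k" "0 <= diffs (diffs (%k. (deg c k)\<^sup>2)) k"
by (simp_all add: diffs_def)

lemma less_rad: "x \<in> {0..1} ==> norm (x :: real) < rad"
using rad(1) by simp

lemma xi2_mono: assumes "0 <= x" "x <= y" "y <= 1" shows "xi2 c x <= xi2 c y"
unfolding xi2_def using assms
by (intro suminf_le summable_diffs2 less_rad mult_left_mono power_mono diffs_nonneg) auto

lemma xi2_nonneg: "0 <= x ==> x <= 1 ==> 0 <= xi2 c x"
unfolding xi2_def by (intro suminf_nonneg summable_diffs2 less_rad mult_nonneg_nonneg diffs_nonneg) auto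

lemma xi1_zero: "xi1 c 0 = 0"
proof -
have "(%k. (deg c k)\<^sup>2*(real k*0^(k-1))) = (%_. 0)" by (auto simp: deg_def fun_eq_iff power_0_left)
thus ?thesis by (simp add: xi1_def)
qed

lemma isCont_xi2: "\<bar>x\<bar> <= 1 ==> isCont (xi2 c) x"
proof -
assume "\<bar>x\<bar> <= 1"
hence "norm x < rad" using rad(1) by simp
hence "DERIV (%x. \<Sum>k. diffs (diffs (%k. (deg c k)\<^sup>2)) k*x^k) x :> (\<Sum>k. diffs (diffs (diffs (%k. (deg c k)\<^sup>2))) k*x^k)"
 by (intro termdiffs_strong'[where K=rad]) (use summable_diffs2 in auto)
thus ?thesis unfolding xi2_def[abs_def] by (rule DERIV_isCont)
qed

text \<open>Mean value theorem: the derivative \<xi>'' is nondecreasing on \<open>[0,1]\<close>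
  because its power series has nonnegative coefficients.\<close>

lemma xi1_increment:
assumes "0 <= x" "x <= y" "y <= 1"
shows "xi2 c x*(y-x) <= xi1 c y-xi1 c x" "xi1 c y-xi1 c x <= xi2 c y*(y-x)"
proof -
have "\<exists>z. x <= z & z <= y & xi1 c y-xi1 c x = (y-x)*xi2 c z"
proof (cases "x = y")
 case False
 thus ?thesis
  using MVT2[of x y "xi1 c" "xi2 c"] DERIV_xi1 less_rad assms by (metis atLeastAtMost_iff less_le order.trans)
qed auto
then obtain z where z: "x <= z" "z <= y" "xi1 c y-xi1 c x = (y-x)*xi2 c z" by blast
have "xi2 c x <= xi2 c z" "xi2 c z <= xi2 c y" using z assms by (auto intro: xi2_mono)
thus "xi2 c x*(y-x) <= xi1 c y-xi1 c x" "xi1 c y-xi1 c x <= xi2 c y*(y-x)"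
 unfolding z(3) using assms by (simp_all add: mult.commute[of "y-x"] mult_right_mono)
qed

lemma xi1_strict_mono:
assumes "2 <= k" "c k \<noteq> 0" "0 <= x" "x < y" "y <= 1"
shows "xi1 c x < xi1 c y"
proof -
have s: "summable (%j. (deg c j)\<^sup>2*(real j*y^(j-1))-(deg c j)\<^sup>2*(real j*x^(j-1)))"
 using assms rad(1) by (intro summable_diff summable_xi1) auto
have t: "0 <= (deg c j)^2*(real j*y^(j-1))-(deg c j)\<^sup>2*(real j*x^(j-1))" for j
 using assms by (simp add: mult_left_mono power_mono)
have "x^(k-1) < y^(k-1)" using assms by (intro power_strict_mono) auto
hence "0 < (deg c k)^2*(real k*y^(k-1))-(deg c k)\<^sup>2*(real k*x^(k-1))"
 using assms by (simp add: deg_def)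
hence "0 < (\<Sum>j. (deg c j)\<^sup>2*(real j*y^(j-1))-(deg c j)\<^sup>2*(real j*x^(j-1)))"
 by (rule suminf_pos2[OF s t])
also have "... = xi1 c y-xi1 c x"
 unfolding xi1_def using assms rad(1) by (intro suminf_diff[symmetric] summable_xi1) auto
finally show ?thesis by simp
qed

end

section \<open>The toy run and its scalar limit\<close>

lemma measurable_innov:
assumes K: "\<And>a' d'. a' <= n ==> d' <= n ==> (%z. K z a' d') \<in> bm M"
shows "a <= n ==> (%z. innov (K z) a d) \<in> bm M"
proof (induction a arbitrary: d rule: less_induct)
case (less a)
have i: "(%z. icov (K z) a' b) \<in> bm M" if "b < a" "a' <= a" for a' b
 unfolding icov_def using less that K by (intro borel_measurable_sum borel_measurable_times) auto
show ?case unfolding innov_rec[of _ a d]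
 using i less by (intro borel_measurable_diff borel_measurable_sum borel_measurable_times borel_measurable_divide) auto
qed

lemma measurable_ivar:
assumes K: "\<And>a' d'. a' <= a ==> d' <= a ==> (%z. K z a' d') \<in> bm M"
shows "(%z. ivar (K z) a) \<in> bm M"
unfolding icov_def using measurable_innov[of a K M a] K by (intro borel_measurable_sum borel_measurable_times) auto

lemma conv_innov:
assumes K: "\<And>a' d'. a' <= n ==> d' <= n ==> conv (%N x. K N x a' d') (Kl a' d')"
 and p: "\<And>b. b < n ==> ivar Kl b \<noteq> 0"
shows "a <= n ==> conv (%N x. innov (K N x) a d) (innov Kl a d)"
proof (induction a arbitrary: d rule: less_induct)
case (less a)
have i: "conv (%N x. icov (K N x) a' b) (icov Kl a' b)" if "b < a" "a' <= a" for a' b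
 unfolding icov_def using less that K by (intro conv_sum conv_mult) auto
show ?case unfolding innov_rec[of _ a d]
 using i less p by (intro conv_diff conv_const conv_sum conv_mult conv_divide) auto
qed

lemma conv_ivar:
assumes K: "\<And>a' d'. a' <= a ==> d' <= a ==> conv (%N x. K N x a' d') (Kl a' d')"
 and p: "\<And>b. b < a ==> ivar Kl b \<noteq> 0"
shows "conv (%N x. ivar (K N x) a) (ivar Kl a)"
proof -
note i = conv_innov[of a K Kl a, OF K p]
show ?thesis unfolding icov_def using i K by (intro conv_sum conv_mult) auto
qed

lemma measurable_xi1 [measurable]: "xi1 c \<in> bm borel"
unfolding xi1_def[abs_def] by measurable

text \<open>The scale comes from the path actually followed and not from its limit; this makes the
  toy run agree exactly with the Gaussian model of every fixed trajectory.\<close>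

definition toy_or :: "vec => nat => field => vec list => nat => real" where
"toy_or c N x ms i = (if i < N then sqrt (ivar (kern c N ms) (length ms-1))*x (length ms-1, i) else 0)"

abbreviation row :: "field => nat => nat => real" where
"row x a \<equiv> (%i. x (a, i))"

abbreviation past :: "nat => (nat \<times> nat) set" where
"past a \<equiv> {..<a} \<times> UNIV"

lemma run_past: "run N f (toy_or c N x) a = run N f (toy_or c N (restrict x (past a))) a"
proof (rule run_cong)
fix b assume "b < a"
hence "toy_or c N x (snd (run N f (toy_or c N x) b)) = toy_or c N (restrict x (past a)) (snd (run N f (toy_or c N x) b))"
 by (auto simp: toy_or_def)
thus "red N (wlist N f (toy_or c N x) b) (toy_or c N x (snd (run N f (toy_or c N x) b))) =
  red N (wlist N f (toy_or c N x) b) (toy_or c N (restrict x (past a)) (snd (run N f (toy_or c N x) b)))" by simp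
qed

lemma wlist_past: "wlist N f (toy_or c N x) a = wlist N f (toy_or c N (restrict x (past a))) a"
using run_past[of N f c x a] by (simp add: wlist_def)

lemma measurable_toy_or:
assumes f: "mfun f" and x: "\<And>b i. b < a ==> (%z. z (b, i)) \<in> bm M" and "b < a"
shows "(%z. toy_or c N z (snd (run N f (toy_or c N z) b)) i) \<in> bm M"
using assms(3)
proof (induction b arbitrary: i rule: less_induct)
case (less b)
have p: "(%z. (snd (run N f (toy_or c N z) b) ! b') j) \<in> bm M" if "b' <= b" for b' j
 by (rule measurable_run(2)[where a=b, OF f _ that]) (use less in auto)
have k: "(%z. kern c N (snd (run N f (toy_or c N z) b)) a' d') \<in> bm M" if "a' <= b" "d' <= b" for a' d'
proof -
 have [measurable]: "(%z. ip N (snd (run N f (toy_or c N z) b) ! a') (snd (run N f (toy_or c N z) b) ! d')) \<in> bm M"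
  by (rule measurable_ip) (use p that in auto)
 show ?thesis unfolding kern_def overlap_def by measurable
qed
have "(%z. ivar (kern c N (snd (run N f (toy_or c N z) b))) b) \<in> bm M"
 by (rule measurable_ivar[where K="%z. kern c N (snd (run N f (toy_or c N z) b))", OF k])
hence "(%z. sqrt (ivar (kern c N (snd (run N f (toy_or c N z) b))) b)*z (b, i)) \<in> bm M"
 using x[OF less.prems, of i] by auto
moreover have "(%z. toy_or c N z (S z) i) =
  (%z. if i < N then sqrt (ivar (kern c N (S z)) (length (S z)-1))*z (length (S z)-1, i) else 0)" for S
 by (rule ext) (rule toy_or_def)
ultimately show ?case by (cases "i < N") simp_all
qed

lemma measurable_wlist_past:
assumes "mfun f" "k < Suc (2*a)"
shows "(%z. (wlist N f (toy_or c N z) a ! k) i) \<in> bm (PiM (past a) (%_. borel))"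
using assms by (intro measurable_run(3)[of f] measurable_toy_or[where a=a]) auto

text \<open>Given the past, the direction is fixed and row \<open>a\<close> is fresh, so its squared
  projection has mean 1, or 0 if the direction is zero. In coordinates: the matrix entries
  \<open>h\<close> depend on the past and are bounded by 1, and only their trace survives.\<close>

lemma line_projection:
fixes w :: "field => nat => real"
assumes w: "\<And>i. (%z. w z i) \<in> bm (PiM (past a) (%_. borel))"
defines "W \<equiv> %x. w (restrict x (past a))"
shows "integrable gaus (%x. pcoef N (W x) (row x a)*ip N (W x) (row x a))"
 "(LINT x|gaus. pcoef N (W x) (row x a)*ip N (W x) (row x a)) <= 1"
proof -
interpret prob_space gaus by (rule prob_space_gaus)
define h where "h i j z = (if ip N (w z) (w z) = 0 then 0 else w z i*w z j/ip N (w z) (w z))" for i j z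
have [measurable]: "(%z. ip N (w z) (w z)) \<in> bm (PiM (past a) (%_. borel))"
 by (rule measurable_ip) (use w in auto)
have h: "h i j \<in> bm (PiM (past a) (%_. borel))" for i j
 unfolding h_def[abs_def] using w[of i] w[of j] by measurable
have hb: "\<bar>h i j z\<bar> <= 1" if "i < N" "j < N" for i j z
proof (cases "ip N (w z) (w z) = 0")
 case False
 have le: "(w z i)^2 <= ip N (w z) (w z)" if "i < N" for i
  unfolding ip_def power2_eq_square using that by (intro member_le_sum) auto
 have "2*\<bar>w z i*w z j\<bar> <= (w z i)^2+(w z j)^2"
  using sum_squares_bound[of "\<bar>w z i\<bar>" "\<bar>w z j\<bar>"] by (simp add: abs_mult)
 hence "\<bar>w z i*w z j\<bar> <= ip N (w z) (w z)" using le[OF that(1)] le[OF that(2)] by linarith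
 thus ?thesis using False less_le[of 0 "ip N (w z) (w z)"] by (simp add: h_def)
qed (simp add: h_def)
have rm: "(%x. restrict x A) \<in> measurable gaus (PiM A (%_. borel))" for A :: "(nat \<times> nat) set"
 by (rule measurable_restrict) simp
have hi: "integrable gaus (%x. h i j (restrict x (past a)))" if "i < N" "j < N" for i j
 by (rule integrable_const_bound[where B=1]) (use hb that measurable_compose[OF rm h] in auto)
have g: "(%z :: nat \<times> nat => real. z (a, i)*z (a, j)) \<in> bm (PiM ({a} \<times> UNIV) (%_. borel))" for i j
 by (intro borel_measurable_times measurable_component_singleton) auto
note pr = iid_normal_product[OF iid_gaus, OF UNIV_I UNIV_I, of "(a, i)" "(a, j)" for i j]
have d: "past a \<inter> {a} \<times> UNIV = {}" by auto
have t: "integrable gaus (%x. h i j (restrict x (past a))*(x (a, i)*x (a, j))) &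
  (LINT x|gaus. h i j (restrict x (past a))*(x (a, i)*x (a, j))) = (LINT x|gaus. h i j (restrict x (past a)))*(if i = j then 1 else 0)"
 if "i < N" "j < N" for i j
 using gaus_indep[OF d h g, of i j i j] hi[OF that] pr[of i j] by auto
have e: "pcoef N (W x) (row x a)*ip N (W x) (row x a) = (\<Sum>i<N. \<Sum>j<N. h i j (restrict x (past a))*(x (a, i)*x (a, j)))" for x
proof -
 have "ip N (W x) (row x a)*ip N (W x) (row x a)/ip N (W x) (W x) =
  (\<Sum>i<N. \<Sum>j<N. W x i*W x j/ip N (W x) (W x)*(x (a, i)*x (a, j)))"
  unfolding ip_def[of N "W x" "row x a"] sum_product sum_divide_distrib by (intro sum.cong refl) simp
 thus ?thesis by (auto simp: pcoef_def h_def W_def)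
qed
show "integrable gaus (%x. pcoef N (W x) (row x a)*ip N (W x) (row x a))"
 unfolding e by (intro Bochner_Integration.integrable_sum) (use t in auto)
have "(LINT x|gaus. pcoef N (W x) (row x a)*ip N (W x) (row x a)) =
  (\<Sum>i<N. \<Sum>j<N. (LINT x|gaus. h i j (restrict x (past a)))*(if i = j then 1 else 0))"
 unfolding e using t by (subst int_sum, force intro!: Bochner_Integration.integrable_sum)
  (auto intro!: sum.cong)
also have "... = (LINT x|gaus. (\<Sum>i<N. h i i (restrict x (past a))))"
 using hi by (simp add: int_sum if_distrib cong: if_cong)
also have "... <= (LINT x|gaus. 1)"
proof (rule integral_mono)
 have "(\<Sum>i<N. h i i z) <= 1" for z
 proof (cases "ip N (w z) (w z) = 0")
  case False
  hence "(\<Sum>i<N. h i i z) = (\<Sum>i<N. w z i*w z i)/ip N (w z) (w z)" by (simp add: h_def sum_divide_distrib)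
  thus ?thesis using False by (simp add: ip_def)
 qed (simp add: h_def)
 thus "(\<Sum>i<N. h i i (restrict x (past a))) <= 1" for x .
qed (use hi in auto)
finally show "(LINT x|gaus. pcoef N (W x) (row x a)*ip N (W x) (row x a)) <= 1" by (simp add: prob_space)
qed

text \<open>The projection onto \<open>B\<close> lies in the span of \<open>W\<close>, so its
  product with \<open>x\<close> equals its product with the projection onto \<open>W\<close>; apply
  Cauchy-Schwarz.\<close>

lemma proj_le:
assumes B: "orthogonal_list N B" and W: "orthogonal_list N W" and d: "\<And>b. b \<in> set B ==> dead N W b"
shows "ip N (proj N B x) (proj N B x) <= ip N (proj N W x) (proj N W x)"
proof -
let ?p = "proj N B x" and ?q = "proj N W x"
have "ip N ?p (perp N W x) = 0" using ip_perp_dead[OF W dead_proj[OF d], of B x] by (simp add: ip_commute)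
hence 1: "ip N ?p x = ip N ?p ?q" by (simp add: ip_perp_right)
have "ip N ?p ?p = ip N ?p ?q" using ip_proj_proj[OF B, of x x] 1 by (simp add: ip_commute)
with Cauchy_Schwarz_ip[of N ?p ?q] have "ip N ?p ?p*ip N ?p ?p <= ip N ?p ?p*ip N ?q ?q" by (simp add: power2_eq_square)
thus ?thesis using ip_self_nonneg[of N ?p] ip_self_nonneg[of N ?q] by (cases "ip N ?p ?p = 0") (auto simp: mult_le_cancel_left)
qed

text \<open>Counts the thresholds that a relative error \<open>et\<close> together with a shift of
  size \<open>et\<close> could make \<open>z\<close> cross.\<close>

definition nr :: "real set => real => real => real" where
"nr \<Theta> et z = (\<Sum>\<theta>\<in>\<Theta>. if \<bar>z-\<theta>\<bar> <= et*(1+\<bar>z\<bar>) then 1 else 0)"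

lemma measurable_nr [measurable]: "nr \<Theta> et \<in> bm borel"
unfolding nr_def[abs_def] by measurable

lemma nr_bounds: "0 <= nr \<Theta> et z" "nr \<Theta> et z <= real (card \<Theta>)"
proof -
show "0 <= nr \<Theta> et z" by (simp add: nr_def sum_nonneg)
have "nr \<Theta> et z <= (\<Sum>\<theta>\<in>\<Theta>. 1)" unfolding nr_def by (rule sum_mono) simp
thus "nr \<Theta> et z <= real (card \<Theta>)" by simp
qed

lemma AE_gaus_neq: "AE x in gaus. x p \<noteq> \<theta>"
proof -
interpret prob_space gaus by (rule prob_space_gaus)
have d: "distr gaus borel (%x. x p) = Nd" using iid_normalD(3)[OF iid_gaus] by simp
have "AE z in Nd. z \<noteq> \<theta>"
 by (subst AE_density) (use AE_lborel_singleton[of \<theta>] in auto)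
hence "AE z in distr gaus borel (%x. x p). z \<noteq> \<theta>" unfolding d .
thus ?thesis by (subst (asm) AE_distr_iff) auto
qed

text \<open>A normal variable almost surely hits none of the finitely many thresholds, so the
  bounded count tends to 0 as the tolerance shrinks.\<close>

lemma nr_small:
assumes "finite \<Theta>" "0 < ep"
shows "\<exists>et>0. et <= 1 & (LINT x|gaus. nr \<Theta> et (x p)) < ep"
proof -
interpret prob_space gaus by (rule prob_space_gaus)
have "(%n. \<integral>x. nr \<Theta> (inverse (real (Suc n))) (x p) \<partial>gaus) \<longlonglongrightarrow> (LINT x|gaus. 0)"
proof (rule integral_dominated_convergence[where w="%_. real (card \<Theta>)"])
 have "AE x in gaus. \<forall>\<theta>\<in>\<Theta>. x p \<noteq> \<theta>" using assms(1) by (intro AE_finite_allI AE_gaus_neq)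
 thus "AE x in gaus. (%n. nr \<Theta> (inverse (real (Suc n))) (x p)) \<longlonglongrightarrow> 0"
 proof eventually_elim
  case (elim x)
  show ?case unfolding nr_def
  proof (rule tendsto_null_sum)
   fix \<theta> assume "\<theta> \<in> \<Theta>"
   hence *: "0 < \<bar>x p-\<theta>\<bar>" using elim by simp
   have "(%n. inverse (real (Suc n))*(1+\<bar>x p\<bar>)) \<longlonglongrightarrow> 0*(1+\<bar>x p\<bar>)"
    by (intro tendsto_mult LIMSEQ_inverse_real_of_nat tendsto_const)
   hence "eventually (%n. inverse (real (Suc n))*(1+\<bar>x p\<bar>) < \<bar>x p-\<theta>\<bar>) sequentially"
    by (rule order_tendstoD(2)) (use*in simp)
   thus "(%n. if \<bar>x p-\<theta>\<bar> <= inverse (real (Suc n))*(1+\<bar>x p\<bar>) then 1 else 0 :: real) \<longlonglongrightarrow> 0"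
    by (intro tendsto_eventually) (auto elim: eventually_mono)
  qed
 qed
 show "AE x in gaus. norm (nr \<Theta> (inverse (real (Suc n))) (x p)) <= real (card \<Theta>)" for n
  using nr_bounds by auto
qed auto
hence "eventually (%n. (LINT x|gaus. nr \<Theta> (inverse (real (Suc n))) (x p)) < ep) sequentially"
 using assms(2) by (intro order_tendstoD(2)) auto
then obtain n where "(LINT x|gaus. nr \<Theta> (inverse (real (Suc n))) (x p)) < ep" by (auto simp: eventually_sequentially)
thus ?thesis by (intro exI[of _ "inverse (real (Suc n))"]) (auto simp: field_simps)
qed

text \<open>The ideal chain of a single coordinate: one fresh standard normal per step, no
  projections, started at the value 1 of \<open>ones\<close>.\<close>

fun fc :: "(nat => real => real => real) => nat => vec => real" where
"fc \<phi> 0 y = 1"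
| "fc \<phi> (Suc a) y = \<phi> a (fc \<phi> a y) (y a)"

text \<open>\<open>thr\<close> makes each step piecewise constant in the noise with break points
  common to all current values, so that small errors rarely matter. \<open>spos\<close> keeps the
  limiting innovations non-degenerate.\<close>

locale toy = mixture_coeffs c \<epsilon>0 for c :: "nat => real" and \<epsilon>0 :: real +
fixes \<phi> :: "nat => real => real => real" and L :: nat
assumes mf: "mfun \<phi>"
 and bd: "\<And>a x z. \<bar>\<phi> a x z\<bar> <= 1"
 and thr: "\<And>a. \<exists>\<Theta>. finite \<Theta> & (\<forall>x z z'. (\<forall>\<theta>\<in>\<Theta>. \<theta> <= z \<longleftrightarrow> \<theta> <= z') --> \<phi> a x z = \<phi> a x z')"
 and spos: "\<And>a. a < L ==> 0 < ivar (%a b. xi1 c (LINT x|gaus. fc \<phi> a (col x 0)*fc \<phi> b (col x 0))) a"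
begin

abbreviation "F \<equiv> fc \<phi>"

definition Rl :: "nat => nat => real" where
"Rl a b = (LINT x|gaus. F a (col x 0)*F b (col x 0))"

definition Kl :: "nat => nat => real" where "Kl a b = xi1 c (Rl a b)"

abbreviation "s \<equiv> ivar Kl"

lemma s_pos: "a < L ==> 0 < s a"
using spos[of a] unfolding Kl_def[abs_def] Rl_def by simp

lemma s_nz: "a < L ==> s a \<noteq> 0"
using s_pos[of a] by simp

text \<open>A run hands over residuals of limiting variance \<open>s a\<close>; the division makes
  them nearly standard normal.\<close>

definition f :: "nat => real => real => real" where "f a x r = \<phi> a x (r/sqrt (s a))"

lemma mfun_f: "mfun f"
unfolding mfun_def f_def case_prod_beta by (intro allI mfunD[OF mf]) auto

lemma F_bound: "\<bar>F a y\<bar> <= 1"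
by (cases a) (auto simp: bd)

lemma measurable_F: "F a \<in> bm colm"
proof (induction a)
case (Suc a)
show ?case unfolding fc.simps(2)[abs_def] by (rule mfunD[OF mf Suc]) simp
qed simp

lemma measurable_F_col: "(%x. F a (col x i)) \<in> bm gaus"
by (rule measurable_col[OF measurable_F])

lemma integrable_FF: "integrable gaus (%x. F a (col x i)*F b (col x i))"
proof -
interpret prob_space gaus by (rule prob_space_gaus)
show ?thesis
proof (rule integrable_const_bound[where B=1])
 show "AE x in gaus. norm (F a (col x i)*F b (col x i)) <= 1"
  using F_bound by (auto simp: abs_mult intro!: mult_le_one)
qed (use measurable_F_col in auto)
qed

lemma Rl_bound: "\<bar>Rl a b\<bar> <= 1"
proof -
interpret prob_space gaus by (rule prob_space_gaus)
have "\<bar>Rl a b\<bar> <= (LINT x|gaus. \<bar>F a (col x 0)*F b (col x 0)\<bar>)" unfolding Rl_def by (rule integral_abs_bound)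
also have "... <= (LINT x|gaus. 1)"
proof (rule integral_mono)
 show "integrable gaus (%x. \<bar>F a (col x 0)*F b (col x 0)\<bar>)" by (rule integrable_abs[OF integrable_FF])
qed (use F_bound in "auto simp: abs_mult intro!: mult_le_one")
finally show ?thesis by (simp add: prob_space)
qed

abbreviation pts :: "nat => field => vec list" where
"pts N x \<equiv> snd (run N f (toy_or c N x) L)"

abbreviation W :: "nat => field => nat => vec list" where
"W N x a \<equiv> wlist N f (toy_or c N x) a"

abbreviation sv :: "nat => field => nat => real" where
"sv N x a \<equiv> ivar (kern c N (pts N x)) a"

lemma sv_prefix: "a <= L ==> ivar (kern c N (snd (run N f (toy_or c N x) a))) a = sv N x a"
by (rule ivar_cong) (simp add: kern_def overlap_def run_nth)

lemma pts_0: "pts N x ! 0 = ones N"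
using run_nth[of 0 L N f "toy_or c N x"] by simp

lemma pts_Suc:
assumes "a < L" "i < N"
shows "(pts N x ! Suc a) i = f a ((pts N x ! a) i) (sqrt (sv N x a)*(x (a, i)-proj N (W N x a) (row x a) i))"
proof -
let ?O = "toy_or c N x"
have y: "perp N (W N x a) (?O (snd (run N f ?O a))) i = sqrt (sv N x a)*(x (a, i)-proj N (W N x a) (row x a) i)"
proof -
 have "pcoef N w (?O (snd (run N f ?O a))) = pcoef N w (%i. sqrt (sv N x a)*x (a, i))" for w
  unfolding pcoef_def by (intro if_cong arg_cong2[where f="(/)"] ip_cong)
   (use assms in "auto simp: toy_or_def sv_prefix")
 hence "proj N (W N x a) (?O (snd (run N f ?O a))) i = sqrt (sv N x a)*proj N (W N x a) (row x a) i"
  using proj_linear[of N "W N x a" "sqrt (sv N x a)" "row x a" 0 "row x a" i] by (simp add: proj_def)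
 thus ?thesis using assms by (simp add: perp_def toy_or_def sv_prefix right_diff_distrib)
qed
have "pts N x ! Suc a = last (snd (run N f ?O (Suc a)))" using assms by (intro run_nth) simp
hence "(pts N x ! Suc a) i = f a (last (snd (run N f ?O a)) i) (red N (W N x a) (?O (snd (run N f ?O a))) i/scl N (W N x a))"
 using assms by (simp add: run_Suc advance_def)
also have "last (snd (run N f ?O a)) = pts N x ! a" using assms by (intro run_nth[symmetric]) simp
also have "red N (W N x a) (?O (snd (run N f ?O a))) i/scl N (W N x a) = sqrt (sv N x a)*(x (a, i)-proj N (W N x a) (row x a) i)"
 unfolding red_perp[OF orthogonal_wlist assms(2)] y by (simp add: less_imp_neq[OF scl_pos, symmetric])
finally show ?thesis .
qed

lemma pts_bound: "a <= L ==> i < N ==> \<bar>(pts N x ! a) i\<bar> <= 1"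
by (cases a) (auto simp: pts_0 ones_def pts_Suc f_def bd)

text \<open>Fraction of coordinates that have left the ideal chain. Exact agreement can be asked for
  because the steps are piecewise constant in the noise.\<close>

definition mis :: "nat => field => nat => real" where
"mis N x a = (\<Sum>i<N. if (pts N x ! a) i = F a (col x i) then 0 else 1)/real N"

lemma mis_nonneg: "0 <= mis N x a"
by (simp add: mis_def sum_nonneg)

text \<open>All values lie in \<open>[-1,1]\<close>, so replacing the points by the ideal chain
  costs at most 2 per mismatch; the ideal overlap obeys the law of large numbers.\<close>

lemma conv_overlap:
assumes "conv (%N x. mis N x a) 0" "conv (%N x. mis N x b) 0" "a <= L" "b <= L"
shows "conv (%N x. overlap N (pts N x) a b) (Rl a b)"
proof (rule conv_close)
have m: "(%y. F a y*F b y) \<in> bm colm" using measurable_F by simp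
interpret prob_space gaus by (rule prob_space_gaus)
have "integrable gaus (%x. (F a (col x 0)*F b (col x 0))\<^sup>2)"
proof (rule integrable_const_bound[where B=1])
 have "(F a y*F b y)^2 <= 1" for y
  using F_bound[of a y] F_bound[of b y] by (simp add: abs_square_le_1 abs_mult mult_le_one)
 thus "AE x in gaus. norm ((F a (col x 0)*F b (col x 0))^2) <= 1" by simp
qed (use measurable_F_col in auto)
thus "conv (%N x. (\<Sum>i<N. F a (col x i)*F b (col x i))/real N) (Rl a b)"
 unfolding Rl_def by (rule conv_lln[OF m])
show "conv (%N x. 2*mis N x a+2*mis N x b) 0"
 using conv_add[OF conv_mult[OF conv_const[of 2] assms(1)] conv_mult[OF conv_const[of 2] assms(2)]] by simp
fix N :: nat and x :: "nat \<times> nat => real" assume N: "1 <= N"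
let ?d = "%i. (pts N x ! a) i*(pts N x ! b) i-F a (col x i)*F b (col x i)"
have "\<bar>?d i\<bar> <= 2*(if (pts N x ! a) i = F a (col x i) then 0 else 1)+2*(if (pts N x ! b) i = F b (col x i) then 0 else 1)"
 if "i < N" for i
proof -
 have "\<bar>(pts N x ! a) i*(pts N x ! b) i\<bar> <= 1" "\<bar>F a (col x i)*F b (col x i)\<bar> <= 1"
  using pts_bound[OF assms(3) that] pts_bound[OF assms(4) that] F_bound by (auto simp: abs_mult intro!: mult_le_one)
 thus ?thesis by auto
qed
hence "(\<Sum>i<N. \<bar>?d i\<bar>) <= (\<Sum>i<N. 2*(if (pts N x ! a) i = F a (col x i) then 0 else 1)+2*(if (pts N x ! b) i = F b (col x i) then 0 else 1))"
 by (intro sum_mono) auto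
also have "... = real N*(2*mis N x a+2*mis N x b)"
 using N by (simp add: mis_def sum.distrib sum_distrib_left[symmetric] field_simps)
finally have "\<bar>\<Sum>i<N. ?d i\<bar> <= real N*(2*mis N x a+2*mis N x b)" using sum_abs[of ?d "{..<N}"] by linarith
moreover have "overlap N (pts N x) a b-(\<Sum>i<N. F a (col x i)*F b (col x i))/real N = (\<Sum>i<N. ?d i)/real N"
 by (simp add: overlap_def ip_def sum_subtractf diff_divide_distrib)
ultimately show "\<bar>overlap N (pts N x) a b-(\<Sum>i<N. F a (col x i)*F b (col x i))/real N\<bar> <= 2*mis N x a+2*mis N x b"
 using N by (simp add: field_simps)
qed

lemma conv_kern:
assumes "conv (%N x. mis N x a) 0" "conv (%N x. mis N x b) 0" "a <= L" "b <= L"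
shows "conv (%N x. kern c N (pts N x) a b) (Kl a b)"
unfolding kern_def Kl_def by (intro conv_compose[OF conv_overlap[OF assms]] isCont_xi1 Rl_bound)

definition pj :: "nat => field => nat => real" where
"pj N x a = ip N (proj N (W N x a) (row x a)) (proj N (W N x a) (row x a))/real N"

text \<open>The list has \<open>2*a+1\<close> members, which depend on earlier rows only, and each
  captures at most 1 of the expected squared norm of a fresh row.\<close>

lemma conv_pj: "conv (%N x. pj N x a) 0"
proof (rule conv_Markov)
let ?t = "%N x k. pcoef N (W N x a ! k) (row x a)*ip N (W N x a ! k) (row x a)"
have e: "pj N x a = (\<Sum>k<Suc (2*a). ?t N x k)/real N" for N x
 unfolding pj_def by (subst ip_proj_self[OF orthogonal_wlist]) simp
have t: "integrable gaus (%x. ?t N x k)" "(LINT x|gaus. ?t N x k) <= 1" if "k < Suc (2*a)" for N k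
 using line_projection[of "%z. W N z a ! k" a N, OF measurable_wlist_past[OF mfun_f that]] unfolding wlist_past[symmetric] by auto
fix N :: nat assume N: "1 <= N"
show "integrable gaus (%x. pj N x a)"
 unfolding e divide_inverse by (intro integrable_mult_left Bochner_Integration.integrable_sum t(1)) auto
have "(LINT x|gaus. pj N x a) = (\<Sum>k<Suc (2*a). \<integral>x. ?t N x k \<partial>gaus)/real N"
 unfolding e integral_divide_zero by (subst int_sum) (use t(1) in "auto simp del: sum.lessThan_Suc")
also have "... <= (\<Sum>k<Suc (2*a). 1)/real N" using t(2) by (intro divide_right_mono sum_mono) auto
finally show "(LINT x|gaus. pj N x a) <= real (Suc (2*a))/real N" by simp
show "0 <= pj N x a" for x by (simp add: pj_def)
next
show "(%N. real (Suc (2*a))/real N) \<longlonglongrightarrow> 0" by (rule lim_const_over_n)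
qed

text \<open>A coordinate is wrong after the step only if it was wrong before, if its noise is near a
  threshold, or if the projection there exceeds \<open>et/2\<close>. The last case is charged as in
  Chebyshev's inequality, whence \<open>4/et^2\<close>.\<close>

lemma mis_step_pointwise:
assumes "a < L" "i < N" and eta: "0 < et" "et <= 1"
 and T: "\<And>x z z'. (\<forall>\<theta>\<in>\<Theta>. \<theta> <= z \<longleftrightarrow> \<theta> <= z') ==> \<phi> a x z = \<phi> a x z'" and fin: "finite \<Theta>"
 and rho: "\<bar>sqrt (sv N x a)/sqrt (s a)-1\<bar> <= et"
shows "(if (pts N x ! Suc a) i = F (Suc a) (col x i) then 0 else 1) \<le>
 (if (pts N x ! a) i = F a (col x i) then 0 else 1)+nr \<Theta> et (x (a, i))+4/et^2*(proj N (W N x a) (row x a) i)^2"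
proof (cases "(pts N x ! a) i = F a (col x i) & (\<forall>\<theta>\<in>\<Theta>. et*(1+\<bar>x (a, i)\<bar>) < \<bar>x (a, i)-\<theta>\<bar>) & \<bar>proj N (W N x a) (row x a) i\<bar> <= et/2")
case True
let ?p = "proj N (W N x a) (row x a) i" and ?r = "sqrt (sv N x a)/sqrt (s a)" and ?x = "x (a, i)"
\<comment> \<open>Therefore a projection of at most \<open>et/2\<close> moves the argument by at
  most \<open>et\<close>.\<close>
have r: "\<bar>?r\<bar> <= 2" using rho eta by linarith
have "r*(y-q)-y = (r-1)*y-r*q" for r y q :: real by (simp add: algebra_simps)
hence "\<bar>?r*(?x-?p)-?x\<bar> = \<bar>(?r-1)*?x-?r*?p\<bar>" by (simp only:)
also have "... <= \<bar>?r-1\<bar>*\<bar>?x\<bar>+\<bar>?r\<bar>*\<bar>?p\<bar>" unfolding abs_mult[symmetric] by (rule abs_triangle_ineq4)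
also have "... <= et*\<bar>?x\<bar>+2*(et/2)" using rho r True by (intro add_mono mult_mono) auto
finally have d: "\<bar>?r*(?x-?p)-?x\<bar> <= et*(1+\<bar>?x\<bar>)" by (simp add: algebra_simps)
have th: "\<forall>\<theta>\<in>\<Theta>. \<theta> <= ?r*(?x-?p) \<longleftrightarrow> \<theta> <= ?x"
proof
 fix \<theta> assume "\<theta> \<in> \<Theta>"
 hence "\<bar>?r*(?x-?p)-?x\<bar> < \<bar>?x-\<theta>\<bar>" using d True by force
 thus "\<theta> <= ?r*(?x-?p) \<longleftrightarrow> \<theta> <= ?x" by arith
qed
have "(pts N x ! Suc a) i = \<phi> a (F a (col x i)) (?r*(?x-?p))"
 using True assms(1,2) by (simp add: pts_Suc f_def)
also have "... = F (Suc a) (col x i)" using T[OF th] by simp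
finally show ?thesis using nr_bounds(1)[of \<Theta> et ?x] by simp
next
case False
let ?p = "proj N (W N x a) (row x a) i"
have n0: "0 <= nr \<Theta> et (x (a, i))" by (rule nr_bounds)
have p0: "0 <= 4/et^2*?p^2" by simp
consider "(pts N x ! a) i \<noteq> F a (col x i)" | \<theta> where "\<theta> \<in> \<Theta>" "\<bar>x (a, i)-\<theta>\<bar> <= et*(1+\<bar>x (a, i)\<bar>)" | "et/2 < \<bar>?p\<bar>"
 using False by force
hence "1 <= (if (pts N x ! a) i = F a (col x i) then 0 else 1)+nr \<Theta> et (x (a, i))+4/et^2*?p^2"
proof cases
 case 1
 thus ?thesis using n0 p0 by simp
next
 case (2 \<theta>)
 have "1 <= nr \<Theta> et (x (a, i))" unfolding nr_def
  using member_le_sum[of \<theta> \<Theta> "%\<theta>. if \<bar>x (a, i)-\<theta>\<bar> <= et*(1+\<bar>x (a, i)\<bar>) then 1 else 0 :: real"] 2 fin by simp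
 moreover have "(0 :: real) <= (if (pts N x ! a) i = F a (col x i) then 0 else 1)" by simp
 ultimately show ?thesis using p0 by linarith
next
 case 3
 have "(et/2)^2 <= \<bar>?p\<bar>^2" using 3 eta by (intro power_mono) auto
 hence "1 <= 4/et^2*?p^2" using eta by (simp add: power_divide field_simps)
 thus ?thesis using n0 by simp
qed
thus ?thesis by simp
qed

lemma conv_sv:
assumes "a < L" "\<And>b. b <= a ==> conv (%N x. mis N x b) 0"
shows "conv (%N x. sv N x a) (s a)"
by (rule conv_ivar[where K="%N x. kern c N (pts N x)"])
 (use assms s_nz in "simp_all add: conv_kern")

text \<open>Agreement so far gives convergence of overlaps and variances, hence a ratio of
  deviations near 1, hence agreement after the next step. The tolerance \<open>et\<close> is fixed
  first, so that the fraction near a threshold is below \<open>ep/4\<close>.\<close>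

lemma conv_mis: "a <= L ==> conv (%N x. mis N x a) 0"
proof (induction a rule: less_induct)
case (less a)
show ?case
proof (cases a)
 case 0
 have "mis N x a = 0" for N x by (simp add: mis_def 0 pts_0 ones_def)
 thus ?thesis by simp
next
 case (Suc b)
 hence b: "b < L" using less.prems by simp
 have IH: "conv (%N x. mis N x d) 0" if "d <= b" for d using less that Suc by auto
 obtain \<Theta> where \<Theta>: "finite \<Theta>" "\<And>x z z'. (\<forall>\<theta>\<in>\<Theta>. \<theta> <= z \<longleftrightarrow> \<theta> <= z') ==> \<phi> b x z = \<phi> b x z'" using thr[of b] by blast
 have sp: "0 < s b" by (rule s_pos[OF b])
 have r: "conv (%N x. sqrt (sv N x b)/sqrt (s b)) 1"
  using conv_divide[OF conv_compose[OF conv_sv[OF b IH] isCont_real_sqrt] conv_const[of "sqrt (s b)"]] sp by simp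
 show ?thesis unfolding conv_def
 proof (intro allI impI)
  fix ep :: real assume "0 < ep"
  hence "0 < ep/4" by simp
  from nr_small[OF \<Theta>(1) this, of "(b, 0)"] obtain et where et: "0 < et" "et <= 1" "(LINT x|gaus. nr \<Theta> et (x (b, 0))) < ep/4" by blast
  interpret prob_space gaus by (rule prob_space_gaus)
  have g: "(%y. nr \<Theta> et (y b)) \<in> bm colm" by measurable
  have "integrable gaus (%x. (nr \<Theta> et (x (b, 0)))\<^sup>2)"
   by (rule integrable_const_bound[where B="(real (card \<Theta>))^2"]) (use nr_bounds in "auto intro!: power_mono")
  from conv_lln[OF g this] have l: "conv (%N x. (\<Sum>i<N. nr \<Theta> et (x (b, i)))/real N) (LINT x|gaus. nr \<Theta> et (x (b, 0)))" .
  have q: "conv (%N x. 4/et^2*pj N x b) 0" using conv_mult[OF conv_const[of "4/et^2"] conv_pj[of b]] unfolding mult_zero_right .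
  have "whp (%N x. (\<bar>mis N x b-0\<bar> <= ep/4 & \<bar>sqrt (sv N x b)/sqrt (s b)-1\<bar> <= et) &
    (\<bar>(\<Sum>i<N. nr \<Theta> et (x (b, i)))/real N-(LINT x|gaus. nr \<Theta> et (x (b, 0)))\<bar> <= ep/4 & \<bar>4/et^2*pj N x b-0\<bar> <= ep/4))"
   using `0 < ep` et by (intro whp_conj convD IH r l q) auto
  thus "whp (%N x. \<bar>mis N x a-0\<bar> <= ep)"
  proof (rule whp_mono)
   fix N :: nat and x
   assume N: "1 <= N" and *: "(\<bar>mis N x b-0\<bar> <= ep/4 & \<bar>sqrt (sv N x b)/sqrt (s b)-1\<bar> <= et) &
    (\<bar>(\<Sum>i<N. nr \<Theta> et (x (b, i)))/real N-(LINT x|gaus. nr \<Theta> et (x (b, 0)))\<bar> <= ep/4 & \<bar>4/et^2*pj N x b-0\<bar> <= ep/4)"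
   have "mis N x a <= (\<Sum>i<N. (if (pts N x ! b) i = F b (col x i) then 0 else 1)+nr \<Theta> et (x (b, i)) +
     4/et^2*(proj N (W N x b) (row x b) i)^2)/real N"
    unfolding mis_def Suc
    by (intro divide_right_mono sum_mono mis_step_pointwise[OF b _ et(1,2) \<Theta>(2) \<Theta>(1)]) (use*in auto)
   also have "... = mis N x b+(\<Sum>i<N. nr \<Theta> et (x (b, i)))/real N+4/et^2*pj N x b"
    unfolding mis_def pj_def ip_def sum.distrib sum_distrib_left[symmetric] add_divide_distrib power2_eq_square[of "proj _ _ _ _"]
    by simp
   also have "... <= ep" using*et(3) by linarith
   finally show "\<bar>mis N x a-0\<bar> <= ep" using mis_nonneg[of N x a] by simp
  qed
 qed
qed
qed

definition kl :: "nat => real" where "kl a = (\<Sum>d\<le>a. innov Kl a d*Kl d L)"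

definition corr :: "nat => real" where "corr a = (LINT x|gaus. F L (col x 0)*x (a, 0))"

text \<open>The limiting energy per site: \<open>kl a/s a\<close> is the regression coefficient on
  innovation \<open>a\<close>, and \<open>sqrt (s a)\<close> its standard deviation.\<close>

definition elim :: real where "elim = (\<Sum>a<L. kl a/sqrt (s a) * corr a)"

definition energy :: "nat => field => real" where
"energy N x = (let ms = pts N x in
 (\<Sum>a<L. klast c N ms L a/ivar (kern c N ms) a*ip N (ms ! L) (perp N (basis N ms a) (%i. sqrt (ivar (kern c N ms) a)*x (a, i)))) +
 sqrt (vlast c N ms L)*x (L, 0))"

lemma conv_kl: "a < L ==> conv (%N x. klast c N (pts N x) L a) (kl a)"
unfolding klast_def kl_def
proof (intro conv_sum conv_mult)
fix d assume "a < L" "d \<in> {..a}"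
thus "conv (%N x. innov (kern c N (pts N x)) a d) (innov Kl a d)"
 by (intro conv_innov[where n=a] conv_kern conv_mis) (use s_nz in auto)
show "conv (%N x. kern c N (pts N x) d L) (Kl d L)"
 using `a < L` `d \<in> {..a}` by (intro conv_kern conv_mis) auto
qed simp

lemma gaus_moment: "integrable gaus (%x. (x p)\<^sup>2)" "(LINT x|gaus. (x p)\<^sup>2) = 1"
using prob_space.iid_normalD[OF prob_space_gaus iid_gaus, of p] by auto

lemma integrable_gaus_square: "integrable gaus (%x. ((x p)^2)\<^sup>2)"
proof -
have d: "distr gaus borel (%x. x p) = Nd"
 using prob_space.iid_normalD(3)[OF prob_space_gaus iid_gaus, of p] by simp
have "integrable Nd (%z. z^(2*2))"
 using std_normal_moment_even[of 2] by (subst integrable_density) (auto simp: has_bochner_integral_iff)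
hence "integrable (distr gaus borel (%x. x p)) (%z. z^(2*2))" unfolding d .
thus ?thesis by (subst (asm) integrable_distr_eq) (auto simp: power_mult[symmetric])
qed

lemma conv_row_square: "conv (%N x. ip N (row x a) (row x a)/real N) 1"
proof -
have "(%y. (y a)\<^sup>2) \<in> bm colm" by measurable
from conv_lln[OF this integrable_gaus_square] gaus_moment(2)[of "(a, 0)"]
show ?thesis by (simp add: ip_def power2_eq_square)
qed

lemma ip_self_bound: "(\<And>i. i < N ==> \<bar>v i\<bar> <= 1) ==> ip N v v <= real N"
unfolding ip_def using sum_bounded_above[of "{..<N}" "%i. v i * v i" 1]
by (simp add: abs_square_le_1 power2_eq_square[symmetric])

text \<open>There are two errors. Mismatched coordinates are off by at most 2 and are paired with
  the noise row by Cauchy-Schwarz, whence the factor 4. The removed projection is no longer than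
  that onto the larger span \<open>W\<close>.\<close>

lemma conv_corr:
assumes a: "a < L"
shows "conv (%N x. ip N (pts N x ! L) (perp N (basis N (pts N x) a) (row x a))/real N) (corr a)"
proof (rule conv_close)
interpret prob_space gaus by (rule prob_space_gaus)
have m: "(%y. F L y*y a) \<in> bm colm" using measurable_F by measurable
have "integrable gaus (%x. (F L (col x 0)*x (a, 0))\<^sup>2)"
proof (rule int_bound[OF gaus_moment(1)[of "(a, 0)"]])
 show "(%x. (F L (col x 0)*x (a, 0))\<^sup>2) \<in> bm gaus" using measurable_F_col by measurable
 have "(F L y)^2*z <= 1*z" if "0 <= z" for y z
  using F_bound that by (intro mult_right_mono) (simp_all add: abs_square_le_1)
 thus "AE x in gaus. norm ((F L (col x 0)*x (a, 0))^2) <= norm ((x (a, 0))^2)"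
  by (simp add: power_mult_distrib)
qed
thus "conv (%N x. (\<Sum>i<N. F L (col x i)*x (a, i))/real N) (corr a)"
 unfolding corr_def by (rule conv_lln[OF m])
let ?D = "%N x. sqrt (4*mis N x L*(ip N (row x a) (row x a)/real N))+sqrt (pj N x a)"
have "conv (%N x. 4*mis N x L*(ip N (row x a) (row x a)/real N)) (4*0*1)"
 by (intro conv_mult conv_const conv_mis conv_row_square) simp
from conv_add[OF conv_compose[OF this isCont_real_sqrt] conv_compose[OF conv_pj isCont_real_sqrt]]
show "conv ?D 0" by simp
fix N :: nat and x :: "nat \<times> nat => real" assume N: "1 <= N"
let ?g = "pts N x ! L" and ?x = "row x a" and ?G = "%i. F L (col x i)"
let ?q = "proj N (basis N (pts N x) a) ?x"
have sq: "\<bar>ip N u v\<bar>/real N <= sqrt (A*(ip N v v/real N))" if "ip N u u <= A*real N" for u v A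
proof (rule real_le_rsqrt)
 have "(\<bar>ip N u v\<bar>/real N)^2 <= ip N u u*ip N v v/(real N)^2"
  using Cauchy_Schwarz_ip[of N u v] by (simp add: power_divide divide_right_mono)
 also have "... <= A*real N*ip N v v/(real N)^2" using that by (intro divide_right_mono mult_right_mono) auto
 finally show "(\<bar>ip N u v\<bar>/real N)^2 <= A*(ip N v v/real N)" using N by (simp add: power2_eq_square)
qed
have "ip N (%i. ?g i-?G i) (%i. ?g i-?G i) <= 4*mis N x L*real N"
proof -
 have "(?g i-?G i)*(?g i-?G i) <= 4*(if ?g i = ?G i then 0 else 1)" if "i < N" for i
 proof -
  have "\<bar>?g i-?G i\<bar> <= 2" using pts_bound[of L i N x] F_bound[of L "col x i"] that by linarith
  hence "\<bar>?g i-?G i\<bar>\<^sup>2 <= 2^2" by (intro power_mono) auto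
  thus ?thesis by (simp add: power2_eq_square)
 qed
 hence "ip N (%i. ?g i-?G i) (%i. ?g i-?G i) <= (\<Sum>i<N. 4*(if ?g i = ?G i then 0 else 1))"
  unfolding ip_def by (intro sum_mono) auto
 thus ?thesis using N by (simp add: mis_def sum_distrib_left[symmetric])
qed
from sq[OF this, of ?x] have 1: "\<bar>ip N (%i. ?g i-?G i) ?x\<bar>/real N <= sqrt (4*mis N x L*(ip N ?x ?x/real N))" .
have "ip N ?g ?g <= 1*real N" using ip_self_bound[of N ?g] pts_bound by simp
from sq[OF this, of ?q] have "\<bar>ip N ?g ?q\<bar>/real N <= sqrt (ip N ?q ?q/real N)" by simp
also have "... <= sqrt (pj N x a)" unfolding pj_def
proof (intro real_sqrt_le_mono divide_right_mono proj_le orthogonal_gsl orthogonal_wlist)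
 fix b assume "b \<in> set (basis N (pts N x) a)"
 thus "dead N (W N x a) b"
 proof (rule dead_gsl_members[rotated])
  fix d assume "d < Suc a"
  thus "vanish N (pts N x ! d) & dead N (W N x a) (pts N x ! d)"
   using a dead_wlist_point[of d a N f "toy_or c N x"] run_nth[of d L N f "toy_or c N x"]
    vanish_run[OF nth_mem[of d "pts N x"]] by simp
 qed
qed simp
finally have 2: "\<bar>ip N ?g ?q\<bar>/real N <= sqrt (pj N x a)" .
have "ip N ?g (perp N (basis N (pts N x) a) ?x)-(\<Sum>i<N. ?G i*x (a, i)) = ip N (%i. ?g i-?G i) ?x-ip N ?g ?q"
 by (simp add: ip_perp_right ip_diff_left) (simp add: ip_def)
hence "\<bar>ip N ?g (perp N (basis N (pts N x) a) ?x)/real N-(\<Sum>i<N. ?G i*x (a, i))/real N\<bar> =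
  \<bar>ip N (%i. ?g i-?G i) ?x-ip N ?g ?q\<bar>/real N" by (simp add: diff_divide_distrib[symmetric])
also have "... <= (\<bar>ip N (%i. ?g i-?G i) ?x\<bar>+\<bar>ip N ?g ?q\<bar>)/real N"
 by (intro divide_right_mono abs_triangle_ineq4) simp
also have "... <= ?D N x" using 1 2 by (simp add: add_divide_distrib)
finally show "\<bar>ip N ?g (perp N (basis N (pts N x) a) ?x)/real N-(\<Sum>i<N. ?G i*x (a, i))/real N\<bar> <= ?D N x" .
qed

text \<open>\<open>vlast\<close> is of order \<open>N\<close>, so the residual is a normal of size
  \<open>sqrt N\<close> and disappears after division by \<open>N\<close>.\<close>

lemma conv_last: "conv (%N x. sqrt (vlast c N (pts N x) L)*x (L, 0)/real N) 0"
proof (rule conv_close[where X="%_ _. 0"])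
let ?A = "%N x. \<bar>xi c (overlap N (pts N x) L L)\<bar>+(\<Sum>a<L. (klast c N (pts N x) L a)\<^sup>2/\<bar>sv N x a\<bar>)"
have xc: "isCont (xi c) (Rl L L)"
 using Rl_bound[of L L] rad(1) by (intro DERIV_isCont[OF DERIV_xi]) simp
have "conv (%N x. (klast c N (pts N x) L a)\<^sup>2/\<bar>sv N x a\<bar>) ((kl a)^2/\<bar>s a\<bar>)" if "a < L" for a
 using that s_pos[OF that] by (intro conv_divide conv_compose[where h="%x. x\<^sup>2"] conv_compose[where h=abs] conv_kl conv_sv conv_mis) auto
hence A: "conv ?A (\<bar>xi c (Rl L L)\<bar>+(\<Sum>a<L. (kl a)\<^sup>2/\<bar>s a\<bar>))"
 by (intro conv_add conv_sum conv_compose[where h="%x. \<bar>xi c x\<bar>"] conv_overlap conv_mis) (use xc in "auto intro!: continuous_intros")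
have B: "conv (%N x. (x (L, 0))\<^sup>2/real N) 0"
proof (rule conv_Markov)
 show "(LINT x|gaus. (x (L, 0))\<^sup>2/real N) <= 1/real N" for N using gaus_moment(2)[of "(L, 0)"] by simp
 show "(%N. 1/real N) \<longlonglongrightarrow> 0" by (rule lim_const_over_n)
qed (use gaus_moment(1) in auto)
let ?D = "%N x. sqrt (?A N x*((x (L, 0))^2/real N))"
show "conv ?D 0" using conv_compose[OF conv_mult[OF A B] isCont_real_sqrt] by simp
fix N :: nat and x :: "nat \<times> nat => real" assume N: "1 <= N"
let ?v = "vlast c N (pts N x) L"
have "\<bar>?v\<bar> <= real N*?A N x"
proof -
 let ?p = "%a. ip N (perp N (basis N (pts N x) a) (pts N x ! L)) (pts N x ! L)"
 have p: "0 <= ?p a & ?p a <= real N" for a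
 proof -
  let ?g = "pts N x ! L" and ?B = "basis N (pts N x) a"
  have "?p a = ip N (perp N ?B ?g) (perp N ?B ?g)" by (rule perp_idem[OF orthogonal_gsl, symmetric])
  moreover have "?p a = ip N ?g ?g-ip N (proj N ?B ?g) (proj N ?B ?g)"
   unfolding ip_proj_proj[OF orthogonal_gsl] by (subst ip_commute) (rule ip_perp_right)
  moreover have "ip N ?g ?g <= real N" by (rule ip_self_bound) (rule pts_bound; simp)
  ultimately show ?thesis using ip_self_nonneg[of N "perp N ?B ?g"] ip_self_nonneg[of N "proj N ?B ?g"] by linarith
 qed
 have "\<bar>(klast c N (pts N x) L a)\<^sup>2/sv N x a*?p a\<bar> <= (klast c N (pts N x) L a)^2/\<bar>sv N x a\<bar>*real N" for a
  unfolding abs_mult using p[of a] by (intro mult_mono) auto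
 hence "(\<Sum>a<L. \<bar>(klast c N (pts N x) L a)\<^sup>2/sv N x a*?p a\<bar>) <= (\<Sum>a<L. (klast c N (pts N x) L a)\<^sup>2/\<bar>sv N x a\<bar>*real N)"
  by (intro sum_mono) auto
 hence "\<bar>\<Sum>a<L. (klast c N (pts N x) L a)\<^sup>2/sv N x a*?p a\<bar> <= real N*(\<Sum>a<L. (klast c N (pts N x) L a)\<^sup>2/\<bar>sv N x a\<bar>)"
  using sum_abs[of "%a. (klast c N (pts N x) L a)\<^sup>2/sv N x a*?p a" "{..<L}"]
  by (simp add: sum_distrib_left mult.commute)
 moreover have "\<bar>real N*xi c (overlap N (pts N x) L L)\<bar> = real N*\<bar>xi c (overlap N (pts N x) L L)\<bar>" by (simp add: abs_mult)
 ultimately show ?thesis unfolding vlast_def distrib_left by linarith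
qed
hence "\<bar>?v\<bar>*(x (L, 0))^2/(real N)^2 <= real N*?A N x*(x (L, 0))^2/(real N)^2"
 by (intro divide_right_mono mult_right_mono) auto
also have "... = ?A N x*((x (L, 0))^2/real N)" using N by (simp add: power2_eq_square)
finally have "sqrt (\<bar>?v\<bar>*(x (L, 0))^2/(real N)^2) <= ?D N x" by (rule real_sqrt_le_mono)
moreover have "\<bar>sqrt v\<bar> = sqrt \<bar>v\<bar>" for v :: real by (cases "0 <= v") (simp_all add: real_sqrt_minus)
hence "sqrt (\<bar>?v\<bar>*(x (L, 0))^2/(real N)^2) = \<bar>sqrt ?v * x (L, 0)/real N\<bar>"
 by (simp add: real_sqrt_mult real_sqrt_divide abs_mult)
ultimately show "\<bar>sqrt ?v * x (L, 0)/real N-0\<bar> <= ?D N x" by simp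
qed simp

theorem conv_energy: "conv (%N x. energy N x/real N) elim"
proof -
have "conv (%N x. (\<Sum>a<L. klast c N (pts N x) L a/sv N x a*(sqrt (sv N x a) *
   (ip N (pts N x ! L) (perp N (basis N (pts N x) a) (row x a))/real N)))+sqrt (vlast c N (pts N x) L)*x (L, 0)/real N)
  ((\<Sum>a<L. kl a/s a*(sqrt (s a) * corr a))+0)"
 by (intro conv_add conv_last conv_sum conv_mult conv_divide conv_kl conv_sv conv_mis conv_corr conv_compose[where h=sqrt] isCont_real_sqrt)
  (use s_nz in auto)
moreover have "kl a/s a*(sqrt (s a) * corr a) = kl a/sqrt (s a) * corr a" if "a < L" for a
 using s_pos[OF that] by (simp add: field_simps)
moreover have "energy N x/real N = (\<Sum>a<L. klast c N (pts N x) L a/sv N x a*(sqrt (sv N x a) *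
   (ip N (pts N x ! L) (perp N (basis N (pts N x) a) (row x a))/real N)))+sqrt (vlast c N (pts N x) L)*x (L, 0)/real N" for N x
 by (simp add: energy_def Let_def perp_scale ip_scale_right add_divide_distrib sum_divide_distrib)
ultimately show ?thesis unfolding elim_def by simp
qed

theorem whp_energy:
assumes "0 < ep"
shows "whp (%N x. (\<forall>a<L. 0 < sv N x a) & real N*(elim-ep) <= energy N x)"
proof -
have "whp (%N x. \<forall>a\<in>{..<L}. 0 < sv N x a)"
proof (rule whp_all)
 fix a assume "a \<in> {..<L}"
 hence a: "a < L" by simp
 have "whp (%N x. \<bar>sv N x a-s a\<bar> <= s a/2)" using s_pos[OF a] a by (intro convD conv_sv conv_mis) auto
 thus "whp (%N x. 0 < sv N x a)" by (rule whp_mono) (use s_pos[OF a] in linarith)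
qed simp
from whp_conj[OF this convD[OF conv_energy assms]]
show ?thesis
proof (rule whp_mono)
 fix N :: nat and x assume N: "1 <= N" and *: "(\<forall>a\<in>{..<L}. 0 < sv N x a) & \<bar>energy N x/real N-elim\<bar> <= ep"
 hence "elim-ep <= energy N x/real N" by linarith
 thus "(\<forall>a<L. 0 < sv N x a) & real N*(elim-ep) <= energy N x"
  using N*by (simp add: field_simps)
qed
qed

end

section \<open>From the toy run to the program\<close>

primrec rescale :: "real => 'a dtree => 'a dtree" where
"rescale k (Leaf v) = Leaf v"
| "rescale k (Node \<theta> l r) = Node (k*\<theta>) (rescale k l) (rescale k r)"

lemma dev_rescale: "0 < k ==> dev (rescale k t) x = dev t (x/k)"
by (induction t) (auto simp: field_simps)

lemma set_rescale: "set_dtree (rescale k t) = set_dtree t"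
by (induction t) auto

lemma depth_rescale: "depth (rescale k t) = depth t"
by (induction t) auto

lemma dev_map: "dev (map_dtree g t) x = g (dev t x)"
by (induction t) auto

lemma depth_map: "depth (map_dtree g t) = depth t"
by (induction t) auto

lemma teval_rescale: "0 < k ==> teval (map_dtree (rescale k) T) x z = teval T x (z/k)"
by (simp add: teval_def dev_map dev_rescale)

lemma bounded_tree_rescale: "bounded_tree D T ==> bounded_tree D (map_dtree (rescale k) T)"
by (simp add: bounded_tree_def depth_map dtree.set_map depth_rescale set_rescale)

lemma run_fun_cong: "(\<And>b. b < a ==> f b = g b) ==> run N f Or a = run N g Or a"
proof (induction a)
case (Suc a)
hence "run N f Or a = run N g Or a" by simp
thus ?case using Suc.prems[of a] by (simp add: run_Suc wlist_def)
qed simp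

primrec breaks :: "'a dtree => real set" where
"breaks (Leaf v) = {}"
| "breaks (Node \<theta> l r) = insert \<theta> (breaks l \<union> breaks r)"

lemma finite_breaks [simp]: "finite (breaks t)"
by (induction t) auto

lemma dev_breaks: "(\<And>\<theta>. \<theta> \<in> breaks t ==> \<theta> <= z \<longleftrightarrow> \<theta> <= z') ==> dev t z = dev t z'"
proof (induction t)
case (Node \<theta> l r)
have "\<theta> <= z \<longleftrightarrow> \<theta> <= z'" using Node.prems by simp
hence "z < \<theta> \<longleftrightarrow> z' < \<theta>" by linarith
thus ?case using Node by simp
qed simp

lemma finite_set_dtree [simp]: "finite (set_dtree t)"
by (induction t) auto

lemma measurable_dev [measurable]: "dev t \<in> bm borel" for t :: "real dtree"
by (induction t) auto

lemma measurable_teval: "(%(x, z). teval T x z) \<in> bm (borel \<Otimes>\<^sub>M borel)"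
proof (induction T)
case (Leaf t)
thus ?case by (simp add: teval_def case_prod_beta)
next
case (Node \<theta> l r)
have "(%(x, z). teval (Node \<theta> l r) x z) = (%p. if fst p < \<theta> then (%(x, z). teval l x z) p else (%(x, z). teval r x z) p)"
 by (auto simp: teval_def)
thus ?case using Node by simp
qed

lemma mfun_teval: "mfun (%a. teval (T a))"
unfolding mfun_def using measurable_teval by auto

lemma thresholds_teval:
"\<exists>\<Theta>. finite \<Theta> & (\<forall>x z z'. (\<forall>\<theta>\<in>\<Theta>. \<theta> <= z \<longleftrightarrow> \<theta> <= z') --> teval T x z = teval T x z')"
proof (intro exI conjI allI impI)
show "finite (\<Union>t\<in>set_dtree T. breaks t)" by auto
fix x z z' assume "\<forall>\<theta>\<in>(\<Union>t\<in>set_dtree T. breaks t). \<theta> <= z \<longleftrightarrow> \<theta> <= z'"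
thus "teval T x z = teval T x z'"
 unfolding teval_def by (intro dev_breaks) (use dev_in_set[of T x] in auto)
qed

lemma hamiltonian_cong: "(\<And>i. i < N ==> m i = m' i) ==> hamiltonian c N (sym_tensor N g) m = hamiltonian c N (sym_tensor N g) m'"
unfolding hamiltonian_eq by (intro suminf_cong hterm_cong)

lemma prob_space_coin: "prob_space coin_space"
unfolding coin_space_def by (intro prob_space_PiM prob_space_uniform_measure) auto

lemma with_high_probability_mono: "with_high_probability Q A ==> (\<And>N x. A N x ==> B N x) ==> with_high_probability Q B"
unfolding with_high_probability_def by metis

lemma with_high_probability_pair:
assumes P: "\<And>N. prob_space (P N)" and C: "prob_space M"
 and w: "with_high_probability P A" and AB: "\<And>N x y. 1 <= N ==> A N x ==> x \<in> space (P N) ==> y \<in> space M ==> B N (x, y)"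
shows "with_high_probability (%N. P N \<Otimes>\<^sub>M M) B"
proof -
obtain S where S: "\<And>N. S N \<in> sets (P N)" "\<And>N x. x \<in> S N ==> A N x" "(%N. measure (P N) (S N)) \<longlonglongrightarrow> 1"
 using w unfolding with_high_probability_def by blast
interpret M: prob_space M by (rule C)
let ?S = "%N. if N = 0 then {} else S N \<times> space M"
have "measure (P N \<Otimes>\<^sub>M M) (S N \<times> space M) = measure (P N) (S N)" for N
 using M.emeasure_pair_measure_Times[OF S(1)[of N] sets.top] by (simp add: measure_def M.emeasure_space_1)
hence "(%N. measure (P N \<Otimes>\<^sub>M M) (?S N)) \<longlonglongrightarrow> 1"
 by (intro Lim_transform_eventually[OF S(3)] eventually_sequentiallyI[of 1]) simp
moreover have "?S N \<in> sets (P N \<Otimes>\<^sub>M M)" for N using S(1) by simp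
moreover have "B N z" if "z \<in> ?S N" for N z
proof -
 have N: "1 <= N" and "z \<in> S N \<times> space M" using that by (auto split: if_splits)
 then obtain x y where z: "z = (x, y)" and x: "x \<in> S N" and y: "y \<in> space M" by auto
 have "x \<in> space (P N)" using x sets.sets_into_space[OF S(1)[of N]] by blast
 thus ?thesis unfolding z by (rule AB[OF N S(2)[OF x] _ y])
qed
ultimately show ?thesis unfolding with_high_probability_def by (intro exI[of _ ?S] conjI allI ballI)
qed

text \<open>\<open>b N kp \<kappa>1\<close> bounds the cost in dimension \<open>N\<close> at the oracle prices \<open>kp, \<kappa>1\<close>.\<close>

definition achieves :: "vec => (real => real => real) => (real => real => real) => (nat => 'w measure) =>
(nat => nat => nat list => 'w => real) => (nat => real => real => real) => real => prog => bool" where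
"achieves c u v P G b r alg \<longleftrightarrow> (\<forall>kp \<kappa>1 :: nat => real. (\<forall>N. 0 <= kp N & 0 <= \<kappa>1 N) \<longrightarrow>
 (\<forall>N\<ge>1. \<forall>w\<in>space (P N). \<forall>\<rho>\<in>space coin_space.
  \<exists>T \<sigma>. outputs (spin_machine c u v (kp N) (\<kappa>1 N) N (sym_disorder G N w) \<rho>) alg T \<sigma> & T <= b N (kp N) (\<kappa>1 N)) &
 with_high_probability (%N. P N \<Otimes>\<^sub>M coin_space) (%N (w, \<rho>).
  \<exists>T \<sigma>. outputs (spin_machine c u v (kp N) (\<kappa>1 N) N (sym_disorder G N w) \<rho>) alg T \<sigma> &
   hamiltonian c N (sym_disorder G N w) \<sigma>/real N \<ge> r))"

text \<open>The energy of the output is that of \<open>h N y\<close>, which depends on the disorder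
  alone; so an event of the disorder lifts to the product with the coin space.\<close>

lemma achievesI:
assumes P: "\<And>N. prob_space (P N)"
 and out: "\<And>kp \<kappa>1 N y \<rho>. 0 <= kp ==> 0 <= \<kappa>1 ==> 1 <= N ==>
  \<exists>T \<sigma>. outputs (spin_machine c u v kp \<kappa>1 N (sym_disorder G N y) \<rho>) alg T \<sigma> & T <= b N kp \<kappa>1 &
   hamiltonian c N (sym_disorder G N y) \<sigma> = hamiltonian c N (sym_disorder G N y) (h N y)"
 and w: "with_high_probability P (%N y. hamiltonian c N (sym_disorder G N y) (h N y)/real N \<ge> r)"
shows "achieves c u v P G b r alg"
unfolding achieves_def
proof (intro allI impI conjI ballI)
fix kp \<kappa>1 :: "nat => real" assume k: "\<forall>N. 0 <= kp N & 0 <= \<kappa>1 N"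
note o = out[OF conjunct1[OF spec[OF k]] conjunct2[OF spec[OF k]]]
show "\<exists>T \<sigma>. outputs (spin_machine c u v (kp N) (\<kappa>1 N) N (sym_disorder G N y) \<rho>) alg T \<sigma> & T <= b N (kp N) (\<kappa>1 N)"
 if "1 <= N" for N y \<rho> using o[OF that] by blast
show "with_high_probability (%N. P N \<Otimes>\<^sub>M coin_space) (%N (y, \<rho>).
  \<exists>T \<sigma>. outputs (spin_machine c u v (kp N) (\<kappa>1 N) N (sym_disorder G N y) \<rho>) alg T \<sigma> &
   hamiltonian c N (sym_disorder G N y) \<sigma>/real N \<ge> r)"
 by (rule with_high_probability_pair[OF P prob_space_coin w]) (unfold prod.case, metis o)
qed

lemma achieves_mono:
assumes "achieves c u v P G b r alg" "\<And>N kp \<kappa>1. 1 <= N ==> 0 <= kp ==> 0 <= \<kappa>1 ==> b N kp \<kappa>1 <= b' N kp \<kappa>1" "r' <= r"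
shows "achieves c u v P G b' r' alg"
unfolding achieves_def
proof (intro allI impI conjI ballI)
fix kp \<kappa>1 :: "nat => real" assume k: "\<forall>N. 0 <= kp N & 0 <= \<kappa>1 N"
show "\<exists>T \<sigma>. outputs (spin_machine c u v (kp N) (\<kappa>1 N) N (sym_disorder G N w) \<rho>) alg T \<sigma> & T <= b' N (kp N) (\<kappa>1 N)"
 if "1 <= N" "w \<in> space (P N)" "\<rho> \<in> space coin_space" for N w \<rho>
 using conjunct1[OF assms(1)[unfolded achieves_def, rule_format, OF k[rule_format]], rule_format, OF that]
  assms(2)[OF that(1), of "kp N" "\<kappa>1 N"] k by (meson order_trans)
show "with_high_probability (%N. P N \<Otimes>\<^sub>M coin_space) (%N (w, \<rho>).
  \<exists>T \<sigma>. outputs (spin_machine c u v (kp N) (\<kappa>1 N) N (sym_disorder G N w) \<rho>) alg T \<sigma> &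
   hamiltonian c N (sym_disorder G N w) \<sigma>/real N \<ge> r')"
 by (rule with_high_probability_mono[OF conjunct2[OF assms(1)[unfolded achieves_def, rule_format, OF k[rule_format]]]],
  unfold case_prod_beta, elim exE conjE, intro exI conjI, assumption, erule order_trans[OF assms(3)])
qed

locale spin_algorithm = toy c \<epsilon>0 "%a. teval (T a)" L
for c :: "nat => real" and \<epsilon>0 :: real and T :: "nat => real dtree dtree" and L :: nat +
fixes D :: nat and V :: "real set" and P :: "nat => 'w measure" and G :: "nat => nat => nat list => 'w => real"
assumes gaussT: "\<And>N. gaussian_tensors (P N) N (G N)"
 and trees: "\<And>a. bounded_tree D (T a)"
 and V: "finite V" "V \<subseteq> {-1..1}" "1 \<in> V" "\<And>a x z. teval (T a) x z \<in> V"
 and signs: "0 < L" "\<And>x z. teval (T (L-1)) x z \<in> {-1, 1}"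
begin

text \<open>The limiting deviations are multiplied into the thresholds of the inner trees, as real
  constants of the program.\<close>

definition T' :: "nat => real dtree dtree" where "T' a = map_dtree (rescale (sqrt (s a))) (T a)"

lemma run_T': "run N (%a. teval (T' a)) Or L = run N f Or L"
by (rule run_fun_cong) (simp add: T'_def f_def[abs_def] teval_rescale[OF real_sqrt_gt_zero[OF s_pos]] fun_eq_iff)

text \<open>The finite value set \<open>V\<close> makes these trajectories finite in number; the
  positive variances make the transfer applicable to them.\<close>

definition paths :: "nat => vec list set" where
"paths N = {ms. length ms = Suc L & (\<forall>m\<in>set ms. vanish N m & (\<forall>i<N. m i \<in> V)) &
 (\<forall>a<L. 0 < ivar (kern c N ms) a)}"

lemma finite_paths: "finite (paths N)"
proof -
have "finite {m. \<forall>i. (i \<in> {..<N} --> m i \<in> V) & (i \<notin> {..<N} --> m i = (0 :: real))}"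
 by (rule finite_set_of_finite_funs) (use V(1) in auto)
hence "finite {ms. set ms \<subseteq> {m. vanish N m & (\<forall>i<N. m i \<in> V)} & length ms = Suc L}"
 by (intro finite_lists_length_eq) (auto elim!: rev_finite_subset simp: vanish_def)
thus ?thesis by (rule rev_finite_subset) (auto simp: paths_def)
qed

lemma good_path: "1 <= N ==> ms \<in> paths N ==> good_path c \<epsilon>0 (P N) N (G N) ms L"
proof -
assume N: "1 <= N" and ms: "ms \<in> paths N"
have m: "vanish N (ms ! a)" "\<And>i. i < N ==> (ms ! a) i \<in> V" if "a <= L" for a
 using ms nth_mem[of a ms] that by (auto simp: paths_def)
have "prob_space (P N)" using gaussT[of N] by (simp add: gaussian_tensors_def)
hence "disorder c \<epsilon>0 (P N) N (G N)"
 by (intro disorder.intro mixture_coeffs_axioms disorder_axioms.intro gaussT N)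
moreover have "in_cube N (ms ! a)" if "a <= L" for a
 using m(2)[OF that] V(2) unfolding in_cube_def by blast
ultimately show ?thesis
 using ms m(1) by (intro good_path.intro good_path_axioms.intro) (simp_all add: paths_def)
qed

lemma pts_in_paths: "\<forall>a<L. 0 < sv N x a ==> pts N x \<in> paths N"
proof -
assume p: "\<forall>a<L. 0 < sv N x a"
have "(pts N x ! b) i \<in> V" if "b <= L" "i < N" for b i
 using that V(3,4) by (cases b) (auto simp: pts_0 ones_def pts_Suc f_def)
thus ?thesis using p vanish_run[of _ N f "toy_or c N x" L] by (auto simp: paths_def all_set_conv_all_nth less_Suc_eq_le)
qed

definition pth :: "nat => 'w => vec list" where
"pth N w = snd (run N f (%ms. gradient (hamiltonian c N (sym_disorder G N w)) (last ms)) L)"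

text \<open>The toy event of high probability is covered by the events \<open>B ms\<close> over
  admissible trajectories. By transfer \<open>B ms\<close> is as probable as \<open>A ms\<close>,
  and the \<open>A ms\<close> are disjoint, so their union is at least as probable.\<close>

lemma whp_true_event:
assumes "0 < ep"
shows "with_high_probability P (%N w. hamiltonian c N (sym_disorder G N w) (pth N w ! L)/real N \<ge> elim-ep)"
proof -
let ?H = "%N w. hamiltonian c N (sym_disorder G N w)"
have sd: "sym_disorder G N w = sym_tensor N (tens (G N) w)" for N w
 by (simp add: sym_disorder_def tens_def[abs_def])
obtain R where R: "\<And>N. R N \<in> sets gaus" "\<And>N x. x \<in> R N ==> (\<forall>a<L. 0 < sv N x a) & real N*(elim-ep) <= energy N x"
 "(%N. measure gaus (R N)) \<longlonglongrightarrow> 1"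
 using whp_energy[OF assms] unfolding with_high_probability_def by blast
interpret Gm: prob_space gaus by (rule prob_space_gaus)
have "\<exists>S\<in>sets (P N). (\<forall>w\<in>S. real N*(elim-ep) <= ?H N w (pth N w ! L)) &
  measure gaus (R N) <= measure (P N) S" if N: "1 <= N" for N
proof -
 have PN: "prob_space (P N)" using gaussT[of N] by (simp add: gaussian_tensors_def)
 interpret disorder c \<epsilon>0 "P N" N "G N"
  by (intro disorder.intro mixture_coeffs_axioms disorder_axioms.intro gaussT N PN)
 let ?thr = "real N*(elim-ep)"
 define A where "A ms = good_path.true_event c (P N) N (G N) ms L f ?thr" for ms
 define B where "B ms = good_path.toy_event c N ms L f ?thr" for ms
 have A: "A ms = {w\<in>space (P N). snd (run N f (seq_oracle (%a. DH (ms ! a) w)) L) = ms & ?thr <= HH (ms ! L) w}"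
  and AB: "prob (A ms) = measure gaus (B ms)" "A ms \<in> events" "B ms \<in> sets gaus" if "ms \<in> paths N" for ms
  using good_path.true_event_def[OF good_path[OF N that], of f ?thr]
   good_path.transfer[OF good_path[OF N that] mfun_f, of ?thr] by (simp_all add: A_def B_def)
 have B: "B ms = {x\<in>space gaus. snd (run N f (seq_oracle (%a i. if i < N then sqrt (ivar (kern c N ms) a)*x (a, i) else 0)) L) = ms &
  ?thr <= (\<Sum>a<L. klast c N ms L a/ivar (kern c N ms) a*ip N (ms ! L) (perp N (basis N ms a) (%i. sqrt (ivar (kern c N ms) a)*x (a, i)))) +
   sqrt (vlast c N ms L)*x (L, 0)}" if "ms \<in> paths N" for ms
  using good_path.toy_event_def[OF good_path[OF N that], of f ?thr] by (simp add: B_def)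
 \<comment> \<open>At each fixed point the gradient is almost surely the series of derivatives. The
   run is adaptive, but it can only visit finitely many points, so one null set \<open>Z\<close>
   suffices.\<close>
 have "AE w in P N. \<forall>ms\<in>paths N. \<forall>a\<in>{..L}. gradient (?H N w) (ms ! a) = DH (ms ! a) w"
  unfolding sd
 proof (intro AE_finite_allI finite_paths)
  fix ms a assume "ms \<in> paths N" "a \<in> {..L}"
  hence "in_cube N (ms ! a)" using good_path.cube[OF good_path[OF N]] by simp
  thus "AE w in P N. gradient (hamiltonian c N (sym_tensor N (tens (G N) w))) (ms ! a) = DH (ms ! a) w"
   by (rule AE_gradient_DH)
 qed simp
 then obtain Z where Z: "{w\<in>space (P N). \<not> (\<forall>ms\<in>paths N. \<forall>a\<in>{..L}. gradient (?H N w) (ms ! a) = DH (ms ! a) w)} \<subseteq> Z"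
  "emeasure (P N) Z = 0" "Z \<in> events" by (rule AE_E)
 define S where "S = (\<Union>ms\<in>paths N. A ms)-Z"
 have U: "(\<Union>ms\<in>paths N. A ms) \<in> events" using AB finite_paths by (intro sets.finite_UN) auto
 have one: "pth N w = ms"
  if "ms \<in> paths N" "w \<in> A ms" "w \<notin> Z" for ms w
 proof -
  have g: "gradient (?H N w) (ms ! a) = DH (ms ! a) w" if "a <= L" for a
   using Z(1) `ms \<in> paths N` `w \<in> A ms` `w \<notin> Z` that A by auto
  have "run N f (%ms. gradient (?H N w) (last ms)) L = run N f (seq_oracle (%a. DH (ms ! a) w)) L"
  proof (rule run_seq_oracle[where mu=ms])
   fix b assume "b < L"
   moreover have "length ms = Suc L" using `ms \<in> paths N` by (simp add: paths_def)
   ultimately have "last (take (Suc b) ms) = ms ! b" by (simp add: take_Suc_conv_app_nth)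
   thus "DH (ms ! b) w = gradient (?H N w) (last (take (Suc b) ms))" using g[of b] `b < L` by simp
  next
   show "snd (run N f (%ms. gradient (?H N w) (last ms)) L) = ms \<or> snd (run N f (seq_oracle (%a. DH (ms ! a) w)) L) = ms"
    using that A by auto
  qed
  thus ?thesis using that A by (auto simp: pth_def)
 qed
 \<comment> \<open>On \<open>A ms\<close> the run driven by \<open>DH\<close> follows
   \<open>ms\<close>, and it has only one trajectory.\<close>
 have two: "A ms \<inter> A ms' = {}" if "ms \<in> paths N" "ms' \<in> paths N" "ms \<noteq> ms'" for ms ms'
 proof -
  have "snd (run N f (%ms. DH (last ms) w) L) = ms" if "ms \<in> paths N" "w \<in> A ms" for ms w
  proof -
   have "run N f (%ms. DH (last ms) w) L = run N f (seq_oracle (%a. DH (ms ! a) w)) L"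
   proof (rule run_seq_oracle[where mu=ms])
    fix b assume "b < L"
    moreover have "length ms = Suc L" using that by (simp add: paths_def)
    ultimately show "DH (ms ! b) w = DH (last (take (Suc b) ms)) w" by (simp add: take_Suc_conv_app_nth)
   qed (use that A in auto)
   thus ?thesis using that A by auto
  qed
  thus ?thesis using that by blast
 qed
 \<comment> \<open>Each outcome is assigned to the event of the trajectory that its own toy run
   follows; there the two ways of scaling the noise coincide.\<close>
 have "R N \<subseteq> (\<Union>ms\<in>paths N. B ms)"
 proof
  fix x assume x: "x \<in> R N"
  let ?ms = "pts N x"
  have p: "?ms \<in> paths N" using R(2)[OF x] by (intro pts_in_paths) blast
  have "run N f (toy_or c N x) L = run N f (seq_oracle (%a i. if i < N then sqrt (sv N x a)*x (a, i) else 0)) L"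
  proof (rule run_seq_oracle[where mu="?ms"])
   fix b assume b: "b < L"
   thus "(%i. if i < N then sqrt (sv N x b)*x (b, i) else 0) = toy_or c N x (take (Suc b) ?ms)"
    by (auto simp: toy_or_def take_run sv_prefix)
  qed simp
  hence "x \<in> B ?ms" unfolding B[OF p]
   using R(2)[OF x] sets.sets_into_space[OF R(1)] x by (auto simp: energy_def Let_def)
  thus "x \<in> (\<Union>ms\<in>paths N. B ms)" using p by blast
 qed
 hence "measure gaus (R N) <= measure gaus (\<Union>ms\<in>paths N. B ms)"
  using AB finite_paths by (intro Gm.finite_measure_mono sets.finite_UN) auto
 also have "... <= (\<Sum>ms\<in>paths N. measure gaus (B ms))"
  using AB finite_paths by (intro Gm.finite_measure_subadditive_finite) auto
 also have "... = (\<Sum>ms\<in>paths N. prob (A ms))" using AB by simp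
 also have "... = prob (\<Union>ms\<in>paths N. A ms)"
  using AB two finite_paths by (intro finite_measure_finite_Union[symmetric]) (auto simp: disjoint_family_on_def)
 also have "... = prob S" unfolding S_def
  by (rule measure_Diff_null_set[symmetric]) (use Z U in "auto simp: null_sets_def")
 finally have "measure gaus (R N) <= prob S" .
 moreover have "\<forall>w\<in>S. ?thr <= ?H N w (pth N w ! L)"
 proof
  fix w assume "w \<in> S"
  then obtain ms where ms: "ms \<in> paths N" "w \<in> A ms" "w \<notin> Z" by (auto simp: S_def)
  hence "?thr <= ?H N w (ms ! L)" using A[OF ms(1)] by (auto simp: sd)
  thus "?thr <= ?H N w (pth N w ! L)" unfolding one[OF ms] .
 qed
 moreover have "S \<in> events" unfolding S_def using U Z(3) by auto
 ultimately show ?thesis by blast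
qed
then obtain S where S: "\<And>N. 1 <= N ==> S N \<in> sets (P N)"
 "\<And>N w. 1 <= N ==> w \<in> S N ==> real N*(elim-ep) <= ?H N w (pth N w ! L)"
 "\<And>N. 1 <= N ==> measure gaus (R N) <= measure (P N) (S N)" by metis
have le1: "measure (P N) A <= 1" for N A
 using prob_space.prob_le_1[of "P N" A] gaussT[of N] by (simp add: gaussian_tensors_def)
have "(%N. measure (P N) (if N = 0 then {} else S N)) \<longlonglongrightarrow> 1"
proof (rule tendsto_sandwich[OF _ _ R(3) tendsto_const])
 show "\<forall>\<^sub>F N in sequentially. measure gaus (R N) <= measure (P N) (if N = 0 then {} else S N)"
  using S(3) by (intro eventually_sequentiallyI[of 1]) simp
qed (use le1 in simp)
thus ?thesis unfolding with_high_probability_def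
 by (intro exI[of _ "%N. if N = 0 then {} else S N"]) (use S(1,2) in "auto simp: field_simps")
qed

text \<open>The last tree has only the leaves 1 and -1, so reading off signs reproduces the last
  point, whose energy is controlled.\<close>

theorem algorithm:
assumes eps: "0 < ep"
shows "achieves c u v P G (%N kp \<kappa>1. real L*kp+(real L+1)*(80*real L+6*real D+60)*(real N+1))
 (elim-ep) (stepsp T' L)"
proof (rule achievesI[OF _ _ whp_true_event[OF eps]])
show "prob_space (P N)" for N using gaussT[of N] by (simp add: gaussian_tensors_def)
fix kp \<kappa>1 :: real and N w \<rho> assume k: "0 <= kp"
let ?M = "spin_machine c u v kp \<kappa>1 N (sym_disorder G N w) \<rho>" and ?H = "hamiltonian c N (sym_disorder G N w)"
 and ?b = "real L*kp+(real L+1)*(80*real L+6*real D+60)*(real N+1)"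
have "bounded_tree D (T' b)" for b unfolding T'_def by (rule bounded_tree_rescale[OF trees])
moreover have sel: "sites ?M = N" "grad_price ?M = kp" "full_grad ?M = gradient ?H" by (simp_all add: spin_machine_def)
moreover have "0 <= grad_price ?M" using k sel(2) by simp
ultimately have "runs ?M (stepsp T' L) start_state ?b (%z. arr z 0 = last (pth N w))"
 using runs_mono[OF runs_stepsp[of D T' ?M L], of _ "%z. arr z 0 = last (pth N w)"]
 unfolding sel run_T' represents_def pth_def by blast
then obtain t z where t: "exec ?M (stepsp T' L) start_state t z" "t <= ?b" "arr z 0 = last (pth N w)"
 unfolding runs_def by blast
have "spin_output z i = (pth N w ! L) i" if "i < N" for i
proof -
 obtain n where n: "L = Suc n" using signs(1) by (cases L) auto
 have "last (pth N w) i \<in> {-1, 1}" using that signs(2) unfolding pth_def by (simp add: n run_Suc advance_def f_def)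
 moreover have "last (pth N w) = pth N w ! L" unfolding pth_def by (subst last_conv_nth) auto
 ultimately show ?thesis using t(3) by (auto simp: spin_output_def)
qed
hence "?H (spin_output z) = ?H (pth N w ! L)" unfolding sym_disorder_def by (rule hamiltonian_cong)
thus "\<exists>T \<sigma>. outputs ?M (stepsp T' L) T \<sigma> & T <= ?b & ?H \<sigma> = ?H (pth N w ! L)"
 using t(1,2) unfolding outputs_def by blast
qed

end

section \<open>Monotone rearrangement of one rounding step\<close>

lemma integral_gaus_coord:
assumes [measurable]: "(g :: real => real) \<in> bm borel"
shows "integrable gaus (%x. g (x p)) \<longleftrightarrow> integrable Nd g" "(LINT x|gaus. g (x p)) = (LINT z|Nd. g z)"
proof -
have d: "distr gaus borel (%x. x p) = Nd"
 using prob_space.iid_normalD(3)[OF prob_space_gaus iid_gaus, of p] by simp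
have m: "(%x. x p) \<in> measurable gaus borel" "g \<in> bm borel" by simp_all
show "integrable gaus (%x. g (x p)) \<longleftrightarrow> integrable Nd g" using integrable_distr_eq[OF m] unfolding d by (rule sym)
show "(LINT x|gaus. g (x p)) = (LINT z|Nd. g z)" using integral_distr[OF m] unfolding d by (rule sym)
qed

lemma Nd_moments: "integrable Nd (%z. z)" "(LINT z|Nd. z) = 0"
proof -
have m: "(%z::real. z) \<in> bm borel" by simp
note D = prob_space.iid_normalD[OF prob_space_gaus iid_gaus UNIV_I, of "(0, 0)"]
show "integrable Nd (%z. z)" by (rule iffD1[OF integral_gaus_coord(1)[OF m] D(5)])
show "(LINT z|Nd. z) = 0" by (rule trans[OF integral_gaus_coord(2)[OF m, symmetric] D(4)])
qed

interpretation Nd: real_distribution Nd by (rule real_dist_normal_dist)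

lemma Nd_atomless: "measure Nd {z} = 0"
proof -
have "AE x in Nd. x \<noteq> z" by (subst AE_density) (use AE_lborel_singleton[of z] in auto)
hence "emeasure Nd {x\<in>space Nd. \<not> x \<noteq> z} = 0" by (subst (asm) AE_iff_measurable[OF _ refl]) auto
thus ?thesis by (simp add: measure_def)
qed

lemma Nd_level:
assumes "0 < \<rho>" "\<rho> < 1"
shows "\<exists>\<theta>. measure Nd {\<theta>..} = \<rho>"
proof -
have c: "isCont (cdf Nd) x" for x using Nd.isCont_cdf[of x] Nd_atomless by simp
have "eventually (%x. cdf Nd x < 1-\<rho>) at_bot" using Nd.cdf_lim_at_bot assms by (intro order_tendstoD(2)) auto
then obtain a where a: "\<And>x. x <= a ==> cdf Nd x < 1-\<rho>" by (auto simp: eventually_at_bot_linorder)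
have "eventually (%x. 1-\<rho> < cdf Nd x) at_top" using Nd.cdf_lim_at_top_prob assms by (intro order_tendstoD(1)) auto
then obtain b where b: "\<And>x. b <= x ==> 1-\<rho> < cdf Nd x" by (auto simp: eventually_at_top_linorder)
have "\<exists>\<theta>\<ge>min a b. \<theta> <= b & cdf Nd \<theta> = 1-\<rho>"
 by (rule IVT) (use a[of "min a b"] b[of b] c in auto)
then obtain \<theta> where \<theta>: "cdf Nd \<theta> = 1-\<rho>" by auto
have "measure Nd {..<\<theta>} = cdf Nd \<theta>-measure Nd {\<theta>}"
 unfolding cdf_def using Nd.finite_measure_Diff[of "{..\<theta>}" "{\<theta>}"] by (simp add: ivl_disj_un_singleton(2)[symmetric])
moreover have "{\<theta>..} = space Nd - {..<\<theta>}" by auto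
ultimately have "measure Nd {\<theta>..} = \<rho>" using Nd.prob_compl[of "{..<\<theta>}"] \<theta> Nd_atomless by simp
thus ?thesis by blast
qed

definition \<Theta> :: "real => real" where "\<Theta> \<rho> = (SOME \<theta>. measure Nd {\<theta>..} = \<rho>)"

text \<open>The upper level set of normal mass \<rho>. Masses 0 and 1 are treated apart because no
  finite threshold attains them. Monotonicity in \<rho> is what lets these sets drive a binary
  search.\<close>

definition lev :: "real => real => bool" where
"lev \<rho> z \<longleftrightarrow> (if 1 <= \<rho> then True else if \<rho> <= 0 then False else \<Theta> \<rho> <= z)"

lemma \<Theta>: "0 < \<rho> ==> \<rho> < 1 ==> measure Nd {\<Theta> \<rho>..} = \<rho>"
unfolding \<Theta>_def by (rule someI_ex[OF Nd_level])

lemma lev_mono: "\<rho> <= \<rho>' ==> lev \<rho> z ==> lev \<rho>' z"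
proof (cases "0 < \<rho> & \<rho>' < 1")
case True
assume le: "\<rho> <= \<rho>'" and l: "lev \<rho> z"
have "\<Theta> \<rho>' <= \<Theta> \<rho>"
proof (rule ccontr)
 assume "\<not> \<Theta> \<rho>' <= \<Theta> \<rho>"
 hence "measure Nd {\<Theta> \<rho>'..} <= measure Nd {\<Theta> \<rho>..}" by (intro Nd.finite_measure_mono) auto
 hence "\<rho> = \<rho>'" using True le \<Theta>[of \<rho>] \<Theta>[of \<rho>'] by simp
 thus False using `\<not> \<Theta> \<rho>' <= \<Theta> \<rho>` by simp
qed
thus ?thesis using True le l by (simp add: lev_def)
qed (auto simp: lev_def split: if_splits)

lemma measurable_lev [measurable]: "Measurable.pred borel (lev \<rho>)"
unfolding lev_def[abs_def] by measurable

lemma lev_prob: "0 <= \<rho> ==> \<rho> <= 1 ==> measure Nd {z. lev \<rho> z} = \<rho>"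
proof -
assume r: "0 <= \<rho>" "\<rho> <= 1"
consider "\<rho> = 0" | "\<rho> = 1" | "0 < \<rho>" "\<rho> < 1" using r by linarith
thus ?thesis
proof cases
 case 2
 thus ?thesis using Nd.prob_space by (simp add: lev_def)
next
 case 3
 hence "{z. lev \<rho> z} = {\<Theta> \<rho>..}" by (auto simp: lev_def)
 thus ?thesis using \<Theta> 3 by simp
qed (simp add: lev_def)
qed

lemma lev_shape: "(\<forall>z. lev \<rho> z) \<or> (\<forall>z. \<not> lev \<rho> z) \<or> (\<exists>\<theta>. \<forall>z. lev \<rho> z \<longleftrightarrow> \<theta> <= z)"
by (auto simp: lev_def)

text \<open>Binary search for the largest \<open>j\<close> with \<open>q j z\<close>. Where
  \<open>q j\<close> is constant in \<open>z\<close> no node is made, so infinite thresholds never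
  arise.\<close>

lemma search_tree:
assumes "\<And>j. (\<forall>z. q j z) \<or> (\<forall>z. \<not> q j z) \<or> (\<exists>\<theta>. \<forall>z. q j z \<longleftrightarrow> \<theta> <= z)"
 and "\<And>j j' z. j <= j' ==> q j' z ==> q j z"
shows "\<exists>t :: nat dtree. depth t <= d & (\<forall>z. lo <= dev t z & dev t z < lo+2^d &
 (\<forall>j. lo < j & j < lo+2^d --> (j <= dev t z \<longleftrightarrow> q j z)))"
proof (induction d arbitrary: lo)
case 0
thus ?case by (intro exI[of _ "Leaf lo"]) auto
next
case (Suc d)
let ?m = "lo+2^d"
obtain l where l: "depth l <= d" "\<And>z. lo <= dev l z & dev l z < ?m & (\<forall>j. lo < j & j < ?m --> (j <= dev l z \<longleftrightarrow> q j z))"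
 using Suc[of lo] by blast
obtain r where r: "depth r <= d" "\<And>z. ?m <= dev r z & dev r z < ?m+2^d & (\<forall>j. ?m < j & j < ?m+2^d --> (j <= dev r z \<longleftrightarrow> q j z))"
 using Suc[of ?m] by blast
have R: "j <= dev r z \<longleftrightarrow> q j z" if "lo < j" "j < lo+2^Suc d" "q ?m z" for j z
proof (cases "?m < j")
 case False
 thus ?thesis using r(2)[of z] assms(2)[of j ?m z] that by auto
qed (use r(2)[of z] that in auto)
have L: "j <= dev l z \<longleftrightarrow> q j z" if "lo < j" "j < lo+2^Suc d" "\<not> q ?m z" for j z
proof (cases "j < ?m")
 case False
 hence "\<not> q j z" using assms(2)[of ?m j z] that by auto
 thus ?thesis using l(2)[of z] False by (meson leD order_less_le_trans not_less order.trans)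
qed (use l(2)[of z] that in auto)
have bl: "lo <= dev l z & dev l z < lo+2^Suc d" "lo <= dev r z & dev r z < lo+2^Suc d" for z
 using l(2)[of z] r(2)[of z] by auto
from assms(1)[of ?m] show ?case
proof (elim disjE)
 assume "\<forall>z. q ?m z"
 thus ?thesis using R r(1) bl(2) by (intro exI[of _ r]) auto
next
 assume "\<forall>z. \<not> q ?m z"
 thus ?thesis using L l(1) bl(1) by (intro exI[of _ l]) auto
next
 assume "\<exists>\<theta>. \<forall>z. q ?m z \<longleftrightarrow> \<theta> <= z"
 then obtain \<theta> where "\<And>z. q ?m z \<longleftrightarrow> \<theta> <= z" by blast
 thus ?thesis using L R l(1) r(1) bl by (intro exI[of _ "Node \<theta> l r"]) (auto simp: not_less)
qed
qed

text \<open>Probability that the unbiased random rounding of \<open>x\<close> to a neighbouring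
  integer is at least \<open>j\<close>; consecutive differences are the rounding
  probabilities.\<close>

definition ramp :: "nat => real => real" where
"ramp j x = min x (real j)-min x (real j-1)"

lemma ramp_bounds: "0 <= ramp j x" "ramp j x <= 1" "ramp (Suc j) x <= ramp j x"
by (auto simp: ramp_def min_def)

lemma ramp_mono: "j <= j' ==> ramp j' x <= ramp j x"
using lift_Suc_antimono_le[of "%j. ramp j x" j j', OF ramp_bounds(3)] .

lemma ramp_ends: "0 <= x ==> ramp 0 x = 1" "x <= real k ==> ramp (Suc k) x = 0"
by (auto simp: ramp_def min_def)

lemma sum_ramp: "0 <= x ==> x <= real k ==> (\<Sum>j<k. ramp (Suc j) x) = x"
proof -
assume "0 <= x" "x <= real k"
have "(\<Sum>j<k. ramp (Suc j) x) = min x (real k)-min x 0"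
 by (induction k) (auto simp: ramp_def)
thus ?thesis using `0 <= x` `x <= real k` by simp
qed

text \<open>The sum is the second moment of the rounding written through its tails, and unbiased
  rounding cannot lower the second moment.\<close>

lemma sum_ramp_square: "0 <= x ==> x <= real k ==> x^2 <= (\<Sum>j<k. (2*real j+1)*ramp (Suc j) x)"
proof -
assume x: "0 <= x" "x <= real k"
have "(min x (real k))^2 <= (\<Sum>j<k. (2*real j+1)*ramp (Suc j) x)"
proof (induction k)
 case (Suc k)
 let ?a = "min x (real (Suc k))" and ?b = "min x (real k)"
 have "(?a-?b)*(?a+?b) <= (?a-?b)*(2*real k+1)" by (intro mult_left_mono) (auto simp: min_def)
 hence "?a^2 <= ?b^2+(2*real k+1)*(?a-?b)" by (simp add: power2_eq_square algebra_simps)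
 thus ?case using Suc by (simp add: ramp_def)
qed (use x in simp)
thus ?thesis using x by simp
qed

lemma measurable_ramp [measurable]: "ramp j \<in> bm borel"
unfolding ramp_def[abs_def] by measurable

lemma ramp_near: "ramp j x \<noteq> ramp (Suc j) x ==> \<bar>x-real j\<bar> <= 1"
by (auto simp: ramp_def min_def split: if_splits)

lemma measurable_dev_nat [measurable]: "dev t \<in> measurable borel (count_space UNIV)" for t :: "nat dtree"
by (induction t) auto

lemma dev_set [measurable]: "{z. Pr (dev t z)} \<in> sets borel" for t :: "nat dtree"
using measurable_sets[OF measurable_dev_nat[of t], of "{n. Pr n}"] unfolding vimage_def by simp

lemma sum_tail_nat: "m <= k ==> (\<Sum>j<k. if Suc j <= m then f j else 0) = (\<Sum>j<m. f j :: real)"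
by (rule sum.mono_neutral_cong_right) auto

text \<open>Fed with a standard normal, the tree has the law of the random rounding of
  \<open>X\<close> under the weight \<open>w\<close>. The mean is kept, while correlation with the
  noise and second moment do not fall below those of \<open>X\<close>.\<close>

definition fits :: "'a measure => ('a => real) => ('a => real) => ('a => real) => nat => nat dtree => bool" where
"fits Q w X \<zeta> d t \<longleftrightarrow> depth t <= d & (\<forall>z. dev t z < 2^d) &
 (\<forall>j<2^d. (LINT y|Q. w y)*measure Nd {z. dev t z = j} = (LINT y|Q. w y*(ramp j (X y)-ramp (Suc j) (X y)))) &
 (LINT y|Q. w y)*(LINT z|Nd. real (dev t z)) = (LINT y|Q. w y*X y) &
 (LINT y|Q. w y*X y*\<zeta> y) <= (LINT y|Q. w y)*(LINT z|Nd. real (dev t z)*z) &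
 (LINT y|Q. w y*(X y)^2) <= (LINT y|Q. w y)*(LINT z|Nd. (real (dev t z))\<^sup>2)"

text \<open>Encodes that \<zeta> is standard normal and independent of \<open>Fm\<close>, through
  factorisation of expectations.\<close>

locale noise = prob_space Q for Q :: "'a measure" +
fixes Fm :: "'a measure" and \<zeta> :: "'a => real"
assumes sub: "\<And>Y :: 'a => real. Y \<in> bm Fm ==> Y \<in> bm Q"
 and zeta: "\<zeta> \<in> bm Q"
 and indep: "\<And>Y h k. Y \<in> bm Fm ==> (\<And>w. \<bar>Y w\<bar> <= k) ==> h \<in> bm borel ==> integrable Nd h ==>
  integrable Q (%w. Y w*h (\<zeta> w) :: real) & expectation (%w. Y w*h (\<zeta> w)) = expectation Y*(LINT z|Nd. h z)"
begin

lemma indepD: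
assumes "Y \<in> bm Fm" "\<And>w. \<bar>Y w\<bar> <= k" "h \<in> bm borel" "integrable Nd h"
shows "integrable Q (%w. Y w*h (\<zeta> w) :: real)" "expectation (%w. Y w*h (\<zeta> w)) = expectation Y*(LINT z|Nd. h z)"
by (rule conjunct1[OF indep[OF assms]], rule conjunct2[OF indep[OF assms]])

lemma zeta_mean:
assumes "Y \<in> bm Fm" "\<And>w. \<bar>Y w\<bar> <= k"
shows "integrable Q (%w. Y w*\<zeta> w)" "expectation (%w. Y w*\<zeta> w) = 0"
using indepD[OF assms measurable_ident_sets[OF refl, of borel, unfolded id_def] Nd_moments(1)] unfolding Nd_moments(2) mult_zero_right .

text \<open>With \<theta> the level of mass \<rho>,
  \<open>(1[\<zeta> >= \<theta>] - r)*(\<zeta> - \<theta>)\<close> is nonnegative for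
  \<open>r\<close> in \<open>[0,1]\<close>. Integrated against \<open>w\<close>, the terms with
  \<theta> cancel because both masses agree. For \<rho> equal to 0 or 1 the function
  \<open>w*r\<close> is almost surely 0 or \<open>w\<close>.\<close>

lemma bathtub:
assumes w: "w \<in> bm Fm" "\<And>y. 0 <= w y" "\<And>y. w y <= k"
 and r: "r \<in> bm Q" "\<And>y. 0 <= r y" "\<And>y. r y <= 1"
 and \<rho>: "expectation (%y. w y*r y) = \<rho>*expectation w" "0 < expectation w"
shows "0 <= \<rho>" "\<rho> <= 1"
 "expectation (%y. w y*r y*\<zeta> y) <= expectation w*(LINT z|Nd. (if lev \<rho> z then z else 0))"
proof -
note [measurable] = sub[OF w(1)] r(1) zeta
have wk: "\<bar>w y\<bar> <= k" for y using w by simp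
have iw: "integrable Q w" by (rule integrable_const_bound[where B=k]) (use wk in auto)
have iwr: "integrable Q (%y. w y*r y)"
 by (rule int_bound[OF iw]) (use w r in "auto simp: abs_mult intro!: mult_left_le")
have wr: "w y*r y <= w y" "0 <= w y*r y" for y using w r by (auto intro: mult_left_le)
have "0 <= expectation (%y. w y*r y)" using wr by (intro integral_nonneg_AE) auto
thus r0: "0 <= \<rho>" using \<rho> by (simp add: zero_le_mult_iff)
have "expectation (%y. w y*r y) <= expectation w" using iw iwr wr by (intro integral_mono) auto
thus r1: "\<rho> <= 1" using \<rho> by simp
note wz = zeta_mean[OF w(1) wk]
have wrz: "integrable Q (%y. w y*r y*\<zeta> y)"
 by (rule int_bound[OF wz(1)]) (use wr w r in "auto simp: abs_mult intro!: mult_right_mono mult_left_le")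
show "expectation (%y. w y*r y*\<zeta> y) <= expectation w*(LINT z|Nd. (if lev \<rho> z then z else 0))"
proof -
 consider "\<rho> = 0" | "\<rho> = 1" | "0 < \<rho>" "\<rho> < 1" using r0 r1 by linarith
 thus ?thesis
 proof cases
  case 1
  hence "AE y in Q. w y*r y = 0"
   using \<rho> integral_nonneg_eq_0_iff_AE[OF iwr] wr(2) by simp
  hence "expectation (%y. w y*r y*\<zeta> y) = expectation (%_. 0)" by (intro integral_cong_AE) auto
  thus ?thesis using 1 by (simp add: lev_def)
 next
  case 2
  hence "expectation (%y. w y-w y*r y) = 0" using \<rho> iw iwr by simp
  hence "AE y in Q. w y-w y*r y = 0"
   using integral_nonneg_eq_0_iff_AE[of Q "%y. w y-w y*r y"] iw iwr wr(1) by simp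
  hence "expectation (%y. w y*r y*\<zeta> y) = expectation (%y. w y*\<zeta> y)" by (intro integral_cong_AE) auto
  thus ?thesis using 2 wz(2) Nd_moments(2) by (simp add: lev_def)
 next
  case 3
  let ?t = "\<Theta> \<rho>" and ?i = "%z. if lev \<rho> z then 1 else 0 :: real"
  have i1: "integrable Nd ?i" by (rule Nd.integrable_const_bound[where B=1]) auto
  have "integrable Nd (%z. ?i z*z)"
   by (rule int_bound[OF Nd_moments(1)]) auto
  moreover have m: "?i \<in> bm borel" "(%z. ?i z*z) \<in> bm borel" by measurable
  ultimately have i2: "integrable Nd (%z. ?i z*z)" by blast
  note a = indepD[OF w(1) wk m(1) i1] indepD[OF w(1) wk m(2) i2]
  have a1: "integrable Q (%y. w y*?i (\<zeta> y))" "expectation (%y. w y*?i (\<zeta> y)) = expectation w*\<rho>"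
  proof -
   have "(LINT z|Nd. ?i z) = (LINT z|Nd. indicator {z. lev \<rho> z} z)" by (intro int_cong) (auto simp: indicator_def)
   also have "... = \<rho>" using lev_prob[OF r0 r1] by simp
   finally show "integrable Q (%y. w y*?i (\<zeta> y))" "expectation (%y. w y*?i (\<zeta> y)) = expectation w*\<rho>"
    using a(1,2) by simp_all
  qed
  have a2: "integrable Q (%y. w y*(?i (\<zeta> y)*\<zeta> y))"
   "expectation (%y. w y*(?i (\<zeta> y)*\<zeta> y)) = expectation w*(LINT z|Nd. (if lev \<rho> z then z else 0))"
   using a(3,4) by (simp_all add: if_distrib[of "%u. u*_"] cong: if_cong)
  have "0 <= expectation (%y. w y*(?i (\<zeta> y)*\<zeta> y)-w y*r y*\<zeta> y-?t*(w y*?i (\<zeta> y)-w y*r y))"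
  proof (intro integral_nonneg_AE AE_I2)
   fix y
   have "0 <= (?i (\<zeta> y)-r y)*(\<zeta> y-?t)"
    using 3 r(2,3)[of y] by (cases "?t <= \<zeta> y") (auto simp: lev_def mult_nonneg_nonpos mult_nonneg_nonneg)
   hence "0 <= w y*((?i (\<zeta> y)-r y)*(\<zeta> y-?t))" by (rule mult_nonneg_nonneg[OF w(2)])
   thus "0 <= w y*(?i (\<zeta> y)*\<zeta> y)-w y*r y*\<zeta> y-?t*(w y*?i (\<zeta> y)-w y*r y)"
    by (simp add: right_diff_distrib left_diff_distrib mult_ac split del: if_split)
  qed
  also have "... = expectation w*(LINT z|Nd. (if lev \<rho> z then z else 0))-expectation (%y. w y*r y*\<zeta> y)"
   using a1 a2 iwr wrz \<rho>(1) by simp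
  finally show ?thesis by simp
 qed
qed
qed

text \<open>Layer by layer: \<open>X\<close> is the sum of its ramps and the tree value the sum of
  its tail indicators. In each layer the masses agree, and \<open>bathtub\<close> compares the
  correlations.\<close>

lemma step:
assumes w: "w \<in> bm Fm" "\<And>y. 0 <= w y" "\<And>y. w y <= k" and X: "X \<in> bm Q"
 and rng: "AE y in Q. 0 < w y --> 0 <= X y & X y <= real (2^d-1)"
shows "\<exists>t. fits Q w X \<zeta> d t"
proof -
note [measurable] = sub[OF w(1)] X zeta
let ?k = "2^d-1 :: nat"
have wk: "\<bar>w y\<bar> <= k" for y using w by simp
have iw: "integrable Q w" by (rule integrable_const_bound[where B=k]) (use wk in auto)
have iwr: "integrable Q (%y. w y*ramp j (X y))" for j
 by (rule int_bound[OF iw]) (use w ramp_bounds in "auto simp: abs_mult intro!: mult_left_le")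
have AE_X: "AE y in Q. w y = 0 \<or> (0 <= X y & X y <= real ?k)" using rng by eventually_elim (use w(2) in "auto simp: less_le")
have X1: "expectation (%y. w y*X y) = (\<Sum>j<?k. expectation (%y. w y*ramp (Suc j) (X y)))"
proof -
 have "expectation (%y. w y*X y) = expectation (%y. \<Sum>j<?k. w y*ramp (Suc j) (X y))"
  using AE_X by (intro integral_cong_AE) (auto elim!: eventually_mono simp: sum_distrib_left[symmetric] sum_ramp)
 thus ?thesis using iwr by (simp add: int_sum)
qed
have wrz: "integrable Q (%y. w y*ramp j (X y)*\<zeta> y)" for j
proof (rule int_bound)
 show "integrable Q (%y. w y*\<zeta> y)" by (rule zeta_mean(1)[OF w(1) wk])
qed (use w ramp_bounds in "auto simp: abs_mult intro!: mult_right_mono mult_left_le")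
have X2: "expectation (%y. w y*X y*\<zeta> y) = (\<Sum>j<?k. expectation (%y. w y*ramp (Suc j) (X y)*\<zeta> y))"
proof -
 have "expectation (%y. w y*X y*\<zeta> y) = expectation (%y. \<Sum>j<?k. w y*ramp (Suc j) (X y)*\<zeta> y)"
  using AE_X by (intro integral_cong_AE) (auto elim!: eventually_mono simp: sum_distrib_left[symmetric] sum_distrib_right[symmetric] sum_ramp)
 thus ?thesis using wrz by (simp add: int_sum)
qed
have X3: "expectation (%y. w y*(X y)^2) <= (\<Sum>j<?k. (2*real j+1)*expectation (%y. w y*ramp (Suc j) (X y)))"
proof -
 have i: "integrable Q (%y. \<Sum>j<?k. (2*real j+1)*(w y*ramp (Suc j) (X y)))" using iwr by auto
 have le: "AE y in Q. w y*(X y)^2 <= (\<Sum>j<?k. (2*real j+1)*(w y*ramp (Suc j) (X y)))"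
  using AE_X
 proof eventually_elim
  case (elim y)
  thus ?case
  proof
   assume x: "0 <= X y & X y <= real ?k"
   hence "w y*(X y)^2 <= w y*(\<Sum>j<?k. (2*real j+1)*ramp (Suc j) (X y))"
    using sum_ramp_square w(2) by (intro mult_left_mono) auto
   thus ?thesis by (simp add: sum_distrib_left mult_ac)
  qed simp
 qed
 have "integrable Q (%y. w y*(X y)^2)"
  by (rule int_bound[OF i]) (use le w(2) in "auto elim!: eventually_mono")
 from integral_mono_AE[OF this i le] show ?thesis using iwr by (simp add: int_sum)
qed
show ?thesis
proof (cases "expectation w = 0")
 \<comment> \<open>A state of zero weight puts no condition on the law, so a leaf will do.\<close>
 case True
 hence w0: "AE y in Q. w y = 0" using integral_nonneg_eq_0_iff_AE[OF iw] w(2) by simp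
 have z: "expectation (%y. w y*g y) = 0" for g
 proof -
  have "AE y in Q. w y*g y = 0" using w0 by eventually_elim simp
  thus ?thesis by (rule integral_eq_zero_AE)
 qed
 have "expectation (%y. w y*g y*h y) = 0" for g h unfolding mult.assoc by (rule z)
 thus ?thesis using True z by (intro exI[of _ "Leaf 0"]) (simp add: fits_def)
next
 case False
 moreover have "0 <= expectation w" using w(2) by simp
 ultimately have p: "0 < expectation w" by simp
 \<comment> \<open>The conditional probability, under the weight \<open>w\<close>, that the rounding
   is at least \<open>j\<close>.\<close>
 define \<rho> where "\<rho> j = expectation (%y. w y*ramp j (X y))/expectation w" for j
 have \<rho>: "expectation (%y. w y*ramp j (X y)) = \<rho> j*expectation w" for j using p by (simp add: \<rho>_def)
 have rm: "(%y. ramp j (X y)) \<in> bm Q" for j by measurable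
 note b = bathtub[OF w rm ramp_bounds(1) ramp_bounds(2) \<rho> p]
 have anti: "\<rho> j' <= \<rho> j" if "j <= j'" for j j'
  unfolding \<rho>_def using p iwr w(2) ramp_mono[OF that] by (intro divide_right_mono integral_mono mult_left_mono) auto
 have "\<exists>t :: nat dtree. depth t <= d & (\<forall>z. 0 <= dev t z & dev t z < 0+2^d &
   (\<forall>j. 0 < j & j < 0+2^d --> (j <= dev t z \<longleftrightarrow> lev (\<rho> j) z)))"
 proof (rule search_tree[OF lev_shape])
  fix j j' z assume "j <= j'" "lev (\<rho> j') z"
  thus "lev (\<rho> j) z" by (rule lev_mono[OF anti])
 qed
 then obtain t :: "nat dtree" where t: "depth t <= d" "\<And>z. dev t z < 2^d" "\<And>z j. 0 < j ==> j < 2^d ==> j <= dev t z \<longleftrightarrow> lev (\<rho> j) z"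
  by auto
 have tail: "expectation w*measure Nd {z. j <= dev t z} = expectation (%y. w y*ramp j (X y))" if j: "j <= 2^d" for j
 proof -
  consider "j = 0" | "0 < j" "j < 2^d" | "j = 2^d" using j by (cases "j = 0"; cases "j = 2^d") auto
  thus ?thesis
  proof cases
   case 1
   have "expectation (%y. w y*ramp 0 (X y)) = expectation w"
    using AE_X by (intro integral_cong_AE) (auto elim!: eventually_mono simp: ramp_ends)
   thus ?thesis using 1 Nd.prob_space by simp
  next
   case 2
   thus ?thesis using t(3)[OF 2] lev_prob[OF b(1,2)] \<rho>[of j] by simp
  next
   case 3
   have "\<not> j <= dev t z" for z using t(2)[of z] 3 by simp
   hence "{z. j <= dev t z} = {}" by blast
   moreover have "expectation (%y. w y*ramp j (X y)) = expectation (%_. 0)"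
    using AE_X ramp_ends(2)[of _ ?k] 3 by (intro integral_cong_AE) (auto elim!: eventually_mono)
   ultimately show ?thesis by simp
  qed
 qed
 have le_k: "dev t z <= ?k" for z using t(2)[of z] by simp
 have tint: "integrable Nd (%z. if j <= dev t z then 1 else 0 :: real)" "(LINT z|Nd. (if j <= dev t z then 1 else 0)) = measure Nd {z. j <= dev t z}" for j
 proof -
  have e: "(%z. if j <= dev t z then 1 else 0 :: real) = indicator {z. j <= dev t z}" by (auto simp: fun_eq_iff)
  show "integrable Nd (%z. if j <= dev t z then 1 else 0 :: real)" "(LINT z|Nd. (if j <= dev t z then 1 else 0)) = measure Nd {z. j <= dev t z}"
   unfolding e using dev_set[of "%m. j <= m" t] by (simp_all add: less_top[symmetric] Nd.emeasure_finite)
 qed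
 have D1: "real (dev t z) = (\<Sum>j<?k. if Suc j <= dev t z then 1 else 0)" for z
  using sum_tail_nat[OF le_k, of z "%_. 1"] by simp
 have D2: "(real (dev t z))^2 = (\<Sum>j<?k. (2*real j+1)*(if Suc j <= dev t z then 1 else 0))" for z
 proof -
  have "(\<Sum>j<m. 2*real j+1) = (real m)^2" for m by (induction m) (auto simp: power2_eq_square algebra_simps)
  thus ?thesis using sum_tail_nat[OF le_k, of z "%j. 2*real j+1"] by (simp add: if_distrib cong: if_cong)
 qed
 have 1: "expectation w*measure Nd {z. dev t z = j} = expectation (%y. w y*(ramp j (X y)-ramp (Suc j) (X y)))" if "j < 2^d" for j
 proof -
  have e: "{z. dev t z = j} = {z. j <= dev t z} - {z. Suc j <= dev t z}" by auto
  have "measure Nd {z. dev t z = j} = measure Nd {z. j <= dev t z} - measure Nd {z. Suc j <= dev t z}"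
   unfolding e
  proof (rule Nd.finite_measure_Diff)
   show "{z. j <= dev t z} \<in> Nd.events" using dev_set[of "%m. j <= m" t] by simp
   show "{z. Suc j <= dev t z} \<in> Nd.events" using dev_set[of "%m. Suc j <= m" t] by simp
  qed auto
  thus ?thesis using tail[of j] tail[of "Suc j"] that iwr by (simp add: right_diff_distrib)
 qed
 have 2: "expectation w*(LINT z|Nd. real (dev t z)) = expectation (%y. w y*X y)"
  unfolding D1 X1 using tint tail by (simp add: int_sum sum_distrib_left)
 have 3: "expectation (%y. w y*(X y)^2) <= expectation w*(LINT z|Nd. (real (dev t z))\<^sup>2)"
 proof -
  have "expectation w*(LINT z|Nd. (real (dev t z))\<^sup>2) = (\<Sum>j<?k. (2*real j+1)*(expectation w*measure Nd {z. Suc j <= dev t z}))"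
   unfolding D2 using tint by (simp add: int_sum sum_distrib_left mult_ac)
  also have "... = (\<Sum>j<?k. (2*real j+1)*expectation (%y. w y*ramp (Suc j) (X y)))"
   using tail by (intro sum.cong) auto
  finally show ?thesis using X3 by simp
 qed
 have 4: "expectation (%y. w y*X y*\<zeta> y) <= expectation w*(LINT z|Nd. real (dev t z)*z)"
 proof -
  have e: "real (dev t z)*z = (\<Sum>j<?k. if lev (\<rho> (Suc j)) z then z else 0)" for z
  proof -
   have "real (dev t z)*z = (\<Sum>j<?k. (if Suc j <= dev t z then 1 else 0)*z)" by (subst D1) (rule sum_distrib_right)
   also have "... = (\<Sum>j<?k. if lev (\<rho> (Suc j)) z then z else 0)" by (intro sum.cong) (auto simp: t(3))
   finally show ?thesis .
  qed
  have "integrable Nd (%z. if lev (\<rho> j) z then z else 0)" for j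
   by (rule int_bound[OF Nd_moments(1)]) auto
  hence "expectation w*(LINT z|Nd. real (dev t z)*z) = (\<Sum>j<?k. expectation w*(LINT z|Nd. (if lev (\<rho> (Suc j)) z then z else 0)))"
   unfolding e by (simp add: int_sum sum_distrib_left)
  moreover have "(\<Sum>j<?k. expectation (%y. w y*ramp (Suc j) (X y)*\<zeta> y)) \<le>
    (\<Sum>j<?k. expectation w*(LINT z|Nd. (if lev (\<rho> (Suc j)) z then z else 0)))" by (intro sum_mono b(3))
  ultimately show ?thesis unfolding X2 by simp
 qed
 show ?thesis unfolding fits_def by (intro exI[of _ t] conjI allI impI t(1,2) 1 2 3 4)
qed
qed

end

declare fc.simps(2) [simp del]

section \<open>The rounded chain and its correlations\<close>

lemma past_indep:
assumes Y: "Y \<in> bm colm" and dep: "\<And>y y'. (\<And>b. b <= a ==> y b = y' b) ==> Y y = Y y'"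
 and iY: "integrable gaus (%x. Y (col x 0))" and g: "g \<in> bm borel" "integrable Nd g"
shows "integrable gaus (%x. Y (col x 0)*g (x (Suc a, 0)) :: real)"
 "(LINT x|gaus. Y (col x 0)*g (x (Suc a, 0))) = (LINT x|gaus. Y (col x 0))*(LINT z|Nd. g z)"
proof -
let ?A = "{..a} \<times> {0::nat}" and ?B = "{(Suc a, 0::nat)}"
define Y' where "Y' z = Y (%b. if b <= a then z (b, 0) else 0)" for z :: "nat \<times> nat => real"
have "(%z b. if b <= a then z (b, 0) else 0 :: real) \<in> measurable (PiM ?A (%_. borel)) colm"
proof (rule measurable_PiM_single')
 show "(%z. if b <= a then z (b, 0) else 0 :: real) \<in> bm (PiM ?A (%_. borel))" for b
  by (cases "b <= a") (auto intro!: measurable_component_singleton)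
qed (auto simp: space_PiM)
from measurable_compose[OF this Y] have mY: "Y' \<in> bm (PiM ?A (%_. borel))" unfolding Y'_def[abs_def] .
have mg: "(%z. g (z (Suc a, 0))) \<in> bm (PiM ?B (%_. borel))"
 by (rule measurable_compose[OF _ g(1)], rule measurable_component_singleton) simp
have e: "Y' (restrict x ?A) = Y (col x 0)" "g (restrict x ?B (Suc a, 0)) = g (x (Suc a, 0))" for x
 unfolding Y'_def by (rule dep) auto
have ig: "integrable gaus (%x. g (x (Suc a, 0)))" using integral_gaus_coord(1)[OF g(1)] g(2) by simp
have "?A \<inter> ?B = {}" by auto
from gaus_indep[OF this mY mg] iY ig
show "integrable gaus (%x. Y (col x 0)*g (x (Suc a, 0)) :: real)"
 "(LINT x|gaus. Y (col x 0)*g (x (Suc a, 0))) = (LINT x|gaus. Y (col x 0))*(LINT z|Nd. g z)"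
 unfolding e integral_gaus_coord(2)[OF g(1)] by blast+
qed

lemma dev_integrable: "integrable Nd (%z. h (dev t z) :: real)" "integrable Nd (%z. h (dev t z)*z)" for t :: "nat dtree"
proof -
have [measurable]: "(%z. h (dev t z)) \<in> bm borel"
 by (rule measurable_compose[OF measurable_dev_nat]) simp
obtain B where B: "\<And>z. \<bar>h (dev t z)\<bar> <= B"
proof
 show "\<bar>h (dev t z)\<bar> <= Max ((%v. \<bar>h v\<bar>) ` set_dtree t)" for z
  using dev_in_set[of t z] by (intro Max_ge) auto
qed
show "integrable Nd (%z. h (dev t z))" by (rule Nd.integrable_const_bound[where B=B]) (use B in auto)
have "integrable Nd (%z. B*z)" using Nd_moments by simp
thus "integrable Nd (%z. h (dev t z)*z)"
 by (rule int_bound) (use B in "auto simp: abs_mult intro!: mult_right_mono order.trans[OF B]")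
qed

lemma Nd_UNIV [simp]: "measure Nd UNIV = 1"
using Nd.prob_space by simp

lemma mean_affine: "(LINT z|Nd. a*real (dev t z)-b) = a*(LINT z|Nd. real (dev t z))-b"
using dev_integrable(1)[of real t] by simp

text \<open>The grid has spacing \<open>2/(2^d-1)\<close>. The last assumption bounds the total
  rounding error over \<open>n\<close> steps by \<open>kp\<close>, and the martingale is shrunk by
  \<open>1-kp\<close>, so the rounded values never leave \<open>[-1,1]\<close>.\<close>

locale chain = prob_space Q for Q :: "'a measure" +
fixes Fm :: "nat => 'a measure" and M \<zeta> :: "nat => 'a => real" and n d :: nat and \<delta> kp :: real
assumes noise: "\<And>a. 1 <= a ==> a < n ==> noise Q (Fm a) (\<zeta> a)"
 and Fmono: "\<And>a Y. (Y :: 'a => real) \<in> bm (Fm a) ==> a < n ==> Y \<in> bm (Fm (Suc a))"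
 and Fsub: "\<And>a Y. (Y :: 'a => real) \<in> bm (Fm a) ==> a <= n ==> Y \<in> bm Q"
 and M_meas: "\<And>a. a <= n ==> M a \<in> bm (Fm a)"
 and M_bound: "\<And>a. a <= n ==> AE w in Q. \<bar>M a w\<bar> <= 1"
 and mart: "\<And>a Y k. 1 <= a ==> a < n ==> Y \<in> bm (Fm a) ==> (\<And>w. \<bar>Y w\<bar> <= k) ==>
  (LINT w|Q. Y w*(M (Suc a) w-M a w)) = 0"
 and M_first: "(LINT w|Q. M 1 w) = 0" "(LINT w|Q. (M 1 w)\<^sup>2) = \<delta>"
 and M_incr: "\<And>a. 1 <= a ==> a < n ==> (LINT w|Q. (M (Suc a) w-M a w)\<^sup>2) = \<delta>"
 and kappa: "0 < kp" "kp < 1" "2 <= n" "1 <= d" "real n*(2/real (2^d-1)) <= kp"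
begin

definition K :: nat where "K = 2^d-1"

definition et :: real where "et = 2/real K"

definition v :: "nat => real" where "v j = et*real j-1"

abbreviation "\<Delta> a w \<equiv> M (Suc a) w-M a w"

text \<open>The value \<open>(1-kp)*M 1\<close> in grid units, where the grid runs from
  \<open>v 0 = -1\<close> to \<open>v K = 1\<close>.\<close>

definition X0 :: "'a => real" where "X0 w = real K/2+(1-kp)/et*M 1 w"

definition X :: "nat => nat => 'a => real" where "X a j w = real j+(1-kp)/et*\<Delta> a w"

text \<open>Given the martingale, a random rounding of it to the grid \<open>v 0, \<dots>, v K\<close> is at \<open>v j\<close> with
  probability \<open>wgt a j\<close> at time \<open>a + 1\<close>; only the law of the rounding is used.\<close>

primrec wgt :: "nat => nat => 'a => real" where
"wgt 0 i w = ramp i (X0 w)-ramp (Suc i) (X0 w)"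
| "wgt (Suc a) i w = (\<Sum>j\<le>K. wgt a j w*(ramp i (X (Suc a) j w)-ramp (Suc i) (X (Suc a) j w)))"

lemma K: "1 <= K" "Suc K = 2^d"
proof -
have "(2::nat)^1 <= 2^d" using kappa by (intro power_increasing) auto
thus "1 <= K" "Suc K = 2^d" by (auto simp: K_def)
qed

lemma eta: "0 < et" "et*real K = 2" "real n*et <= kp"
proof -
show "real n*et <= kp" using kappa(5) unfolding et_def K_def .
qed (use K(1) in "simp_all add: et_def")

lemma j_K: "j <= K \<longleftrightarrow> j < 2^d" using K(2) by linarith

lemma M_Q: "a <= n ==> M a \<in> bm Q" by (rule Fsub[OF M_meas])

lemma X_meas: "a < n ==> X a j \<in> bm (Fm (Suc a))" "a < n ==> X a j \<in> bm Q"
proof -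
show 1: "X a j \<in> bm (Fm (Suc a))" if "a < n"
proof -
 have [measurable]: "M (Suc a) \<in> bm (Fm (Suc a))" "M a \<in> bm (Fm (Suc a))"
  using that M_meas[of "Suc a"] Fmono[OF M_meas[of a] that] by auto
 show ?thesis unfolding X_def[abs_def] by measurable
qed
show "X a j \<in> bm Q" if "a < n" using 1[OF that] that by (intro Fsub[of _ "Suc a"]) auto
qed

lemma X0_meas: "X0 \<in> bm (Fm 1)" "X0 \<in> bm Q"
proof -
have [measurable]: "M 1 \<in> bm (Fm 1)" using M_meas[of 1] kappa by simp
show 1: "X0 \<in> bm (Fm 1)" unfolding X0_def[abs_def] by measurable
show "X0 \<in> bm Q" using 1 kappa by (intro Fsub[of _ 1]) auto
qed

lemma wgt_meas: "a < n ==> wgt a j \<in> bm (Fm (Suc a))"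
proof (induction a arbitrary: j)
case 0
have [measurable]: "X0 \<in> bm (Fm (Suc 0))" using X0_meas(1) by simp
show ?case unfolding wgt.simps[abs_def] by measurable
next
case (Suc a)
have [measurable]: "wgt a j \<in> bm (Fm (Suc (Suc a)))" for j
 using Suc by (intro Fmono[of _ "Suc a"]) auto
have [measurable]: "X (Suc a) j \<in> bm (Fm (Suc (Suc a)))" for j using X_meas(1) Suc by auto
show ?case unfolding wgt.simps[abs_def] by measurable
qed

lemma wgt_Q: "a < n ==> wgt a j \<in> bm Q"
by (rule Fsub[OF wgt_meas]) auto

lemma wgt_nonneg: "0 <= wgt a j w"
by (induction a arbitrary: j) (auto intro!: sum_nonneg mult_nonneg_nonneg simp: ramp_bounds)

lemma wgt_le: "wgt a j w <= real (Suc K)^a"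
proof (induction a arbitrary: j)
case 0
thus ?case using ramp_bounds(2)[of j "X0 w"] ramp_bounds(1)[of "Suc j" "X0 w"] by simp
next
case (Suc a)
have "wgt a i w*(ramp j x-ramp (Suc j) x) <= real (Suc K)^a*1" for i x
 using Suc[of i] wgt_nonneg[of a i w] ramp_bounds(1)[of "Suc j" x] ramp_bounds(2,3)[of j x] by (intro mult_mono) auto
hence "wgt (Suc a) j w <= (\<Sum>i\<le>K. real (Suc K)^a*1)" unfolding wgt.simps by (intro sum_mono)
thus ?case by simp
qed

lemma wgt_abs: "\<bar>wgt a j w\<bar> <= real (Suc K)^a"
using wgt_nonneg wgt_le by simp

lemma X_eq: "et*X a j w-1 = v j+(1-kp)*\<Delta> a w"
using eta(1) by (simp add: X_def v_def distrib_left)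

lemma X0_eq: "et*X0 w-1 = (1-kp)*M 1 w"
using eta(1,2) by (simp add: X0_def distrib_left)

lemma X_range:
assumes "\<bar>v j-(1-kp)*M a w\<bar> <= real a*et" "\<bar>M (Suc a) w\<bar> <= 1" "a < n"
shows "0 <= X a j w & X a j w <= real K"
proof -
have "(1-kp)*\<bar>M (Suc a) w\<bar> <= (1-kp)*1" using assms kappa by (intro mult_left_mono) auto
hence "\<bar>(1-kp)*M (Suc a) w\<bar> <= 1-kp" using kappa by (simp add: abs_mult)
moreover have "real a*et <= real n*et" using eta assms(3) by (intro mult_right_mono) auto
hence "real a*et <= kp" using eta(3) by linarith
ultimately have "\<bar>et*X a j w-1\<bar> <= 1" unfolding X_eq right_diff_distrib using assms(1) by linarith
hence "0 <= et*X a j w" "et*X a j w <= et*real K" using eta by auto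
thus ?thesis using eta(1) by (simp add: zero_le_mult_iff mult_le_cancel_left)
qed

lemma X0_range: "\<bar>M 1 w\<bar> <= 1 ==> 0 <= X0 w & X0 w <= real K"
proof -
assume m: "\<bar>M 1 w\<bar> <= 1"
have "\<bar>(1-kp)*M 1 w\<bar> <= 1" using m kappa by (auto simp: abs_mult intro!: mult_le_one)
hence "0 <= et*X0 w" "et*X0 w <= et*real K" using X0_eq[of w] eta by auto
thus ?thesis using eta(1) by (simp add: zero_le_mult_iff mult_le_cancel_left)
qed

text \<open>One rounding moves the value by at most one grid unit, so the errors add up to one
  \<open>et\<close> per step on the support of the weights.\<close>

lemma near: "a < n ==> AE y in Q. \<forall>j. 0 < wgt a j y --> \<bar>v j-(1-kp)*M (Suc a) y\<bar> <= real (Suc a)*et"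
proof (induction a)
case 0
have "\<bar>v j-(1-kp)*M 1 y\<bar> <= et" if "0 < wgt 0 j y" for j y
proof -
 have "\<bar>X0 y-real j\<bar> <= 1" using that by (intro ramp_near) auto
 hence "et*\<bar>X0 y-real j\<bar> <= et*1" using eta by (intro mult_left_mono) auto
 moreover have "et*(X0 y-real j) = (1-kp)*M 1 y-v j"
  using X0_eq[of y] by (simp add: v_def right_diff_distrib)
 hence "et*\<bar>X0 y-real j\<bar> = \<bar>(1-kp)*M 1 y-v j\<bar>" using eta(1) by (metis abs_mult abs_of_pos)
 ultimately show ?thesis by linarith
qed
thus ?case by simp
next
case (Suc a)
hence "AE y in Q. \<forall>j. 0 < wgt a j y --> \<bar>v j-(1-kp)*M (Suc a) y\<bar> <= real (Suc a)*et" by simp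
thus ?case
proof eventually_elim
 case (elim y)
 show ?case
 proof (intro allI impI)
  fix i assume "0 < wgt (Suc a) i y"
  then obtain j where j: "0 < wgt a j y*(ramp i (X (Suc a) j y)-ramp (Suc i) (X (Suc a) j y))"
   unfolding wgt.simps by (meson sum_nonpos not_less)
  hence w: "0 < wgt a j y" using wgt_nonneg[of a j y] by (auto simp: less_le)
  have "\<bar>X (Suc a) j y-real i\<bar> <= 1" using j by (intro ramp_near) auto
  hence "et*\<bar>X (Suc a) j y-real i\<bar> <= et*1" using eta by (intro mult_left_mono) auto
  moreover have "et*(X (Suc a) j y-real i) = v j+(1-kp)*\<Delta> (Suc a) y-v i"
   using X_eq[of "Suc a" j y] by (simp add: v_def[of i] right_diff_distrib)
  hence "et*\<bar>X (Suc a) j y-real i\<bar> = \<bar>v j+(1-kp)*\<Delta> (Suc a) y-v i\<bar>" using eta(1) by (metis abs_mult abs_of_pos)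
  ultimately have "\<bar>v j+(1-kp)*\<Delta> (Suc a) y-v i\<bar> <= et" by simp
  moreover have "\<bar>v j-(1-kp)*M (Suc a) y\<bar> <= real (Suc a)*et" using elim w by blast
  ultimately show "\<bar>v i-(1-kp)*M (Suc (Suc a)) y\<bar> <= real (Suc (Suc a))*et"
   unfolding right_diff_distrib of_nat_Suc distrib_right by linarith
 qed
qed
qed

lemma rng: "Suc a < n ==> AE w in Q. \<forall>j. 0 < wgt a j w --> 0 <= X (Suc a) j w & X (Suc a) j w <= real K"
proof -
assume a: "Suc a < n"
have "AE w in Q. \<bar>M (Suc (Suc a)) w\<bar> <= 1" using a by (intro M_bound) auto
thus ?thesis using near[OF Suc_lessD[OF a]] by eventually_elim (use X_range[OF _ _ a] in blast)
qed

lemma sum_ramp_diff: "0 <= x ==> x <= real K ==> (\<Sum>i\<le>K. ramp i x-ramp (Suc i) x) = 1"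
by (subst sum_telescope) (simp add: ramp_ends)

lemma total: "a < n ==> AE w in Q. (\<Sum>j\<le>K. wgt a j w) = 1"
proof (induction a)
case 0
have "AE w in Q. \<bar>M 1 w\<bar> <= 1" using kappa by (intro M_bound) auto
thus ?case unfolding wgt.simps by eventually_elim (use X0_range sum_ramp_diff in auto)
next
case (Suc a)
have "AE w in Q. (\<Sum>j\<le>K. wgt a j w) = 1" using Suc by simp
thus ?case using rng[OF Suc.prems]
proof eventually_elim
 case (elim w)
 have "(\<Sum>i\<le>K. wgt (Suc a) i w) = (\<Sum>j\<le>K. wgt a j w*(\<Sum>i\<le>K. ramp i (X (Suc a) j w)-ramp (Suc i) (X (Suc a) j w)))"
  unfolding wgt.simps by (subst sum.swap) (simp add: sum_distrib_left)
 also have "... = (\<Sum>j\<le>K. wgt a j w)"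
 proof (intro sum.cong refl)
  fix j
  show "wgt a j w*(\<Sum>i\<le>K. ramp i (X (Suc a) j w)-ramp (Suc i) (X (Suc a) j w)) = wgt a j w"
   using elim(2) wgt_nonneg[of a j w] sum_ramp_diff[of "X (Suc a) j w"] by (cases "wgt a j w = 0") (auto simp: less_le)
 qed
 finally show ?case using elim(1) by simp
qed
qed

definition t0 :: "nat dtree" where "t0 = (SOME t. fits Q (%_. 1) X0 (\<zeta> 1) d t)"

definition tr :: "nat => nat => nat dtree" where
"tr a j = (SOME t. fits Q (wgt a j) (X (Suc a) j) (\<zeta> (Suc a)) d t)"

text \<open>The final rounding of \<open>v j\<close> to a sign: the target is the constant
  \<open>j/K\<close>, the probability of +1 that preserves the mean.\<close>

definition tl :: "nat => nat dtree" where
"tl j = (SOME t. fits Q (%_. 1) (%_. real j/real K) (\<zeta> 1) 1 t)"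

lemma t0: "fits Q (%_. 1) X0 (\<zeta> 1) d t0"
unfolding t0_def
proof (rule someI_ex, rule noise.step[OF noise])
have "AE w in Q. \<bar>M 1 w\<bar> <= 1" using kappa by (intro M_bound) auto
thus "AE w in Q. 0 < (1::real) --> 0 <= X0 w & X0 w <= real (2^d-1)"
 by eventually_elim (use X0_range in "simp add: K_def")
qed (use kappa X0_meas in auto)

lemma tr: "Suc a < n ==> fits Q (wgt a j) (X (Suc a) j) (\<zeta> (Suc a)) d (tr a j)"
unfolding tr_def
proof (rule someI_ex, rule noise.step[OF noise])
assume a: "Suc a < n"
from rng[OF this] show "AE w in Q. 0 < wgt a j w --> 0 <= X (Suc a) j w & X (Suc a) j w <= real (2^d-1)"
 by eventually_elim (simp add: K_def)
qed (use wgt_meas wgt_nonneg wgt_le X_meas(2) in auto)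

lemma tl: "j <= K ==> fits Q (%_. 1) (%_. real j/real K) (\<zeta> 1) 1 (tl j)"
unfolding tl_def by (rule someI_ex, rule noise.step[OF noise]) (use kappa K in auto)

definition pr :: "nat => nat => real" where "pr a j = (LINT w|Q. wgt a j w)"

lemma Delta_bound: "a < n ==> AE w in Q. \<bar>\<Delta> a w\<bar> <= 2"
proof -
assume a: "a < n"
have "AE w in Q. \<bar>M (Suc a) w\<bar> <= 1" "AE w in Q. \<bar>M a w\<bar> <= 1" using a by (auto intro: M_bound)
thus ?thesis by eventually_elim auto
qed

lemma weighted:
assumes a: "Suc a < n"
shows "integrable Q (wgt a j)" "integrable Q (%y. wgt a j y*\<Delta> (Suc a) y)"
 "integrable Q (%y. wgt a j y*(\<Delta> (Suc a) y)^2)" "integrable Q (%y. wgt a j y*\<Delta> (Suc a) y*\<zeta> (Suc a) y)"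
proof -
have [measurable]: "wgt a j \<in> bm Q" "M (Suc a) \<in> bm Q" "M (Suc (Suc a)) \<in> bm Q"
  "\<zeta> (Suc a) \<in> bm Q"
 using a wgt_Q M_Q noise.zeta[OF noise[of "Suc a"]] by auto
have D: "AE y in Q. \<bar>\<Delta> (Suc a) y\<bar> <= 2" by (rule Delta_bound[OF a])
show w: "integrable Q (wgt a j)" by (rule integrable_const_bound[where B="real (Suc K)^a"]) (use wgt_abs in auto)
have w2: "integrable Q (%y. 4*wgt a j y)" using w by simp
show "integrable Q (%y. wgt a j y*\<Delta> (Suc a) y)"
proof (rule int_bound[OF w2])
 show "AE y in Q. norm (wgt a j y*\<Delta> (Suc a) y) <= norm (4*wgt a j y)"
  using D
 proof eventually_elim
  case (elim y)
  have "wgt a j y*\<bar>\<Delta> (Suc a) y\<bar> <= wgt a j y*4" using elim wgt_nonneg by (intro mult_left_mono) auto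
  thus ?case using wgt_nonneg[of a j y] by (simp add: abs_mult)
 qed
qed measurable
show "integrable Q (%y. wgt a j y*(\<Delta> (Suc a) y)^2)"
proof (rule int_bound[OF w2])
 show "AE y in Q. norm (wgt a j y*(\<Delta> (Suc a) y)^2) <= norm (4*wgt a j y)"
  using D
 proof eventually_elim
  case (elim y)
  have "\<bar>\<Delta> (Suc a) y\<bar>\<^sup>2 <= 2^2" using elim by (intro power_mono) auto
  hence "wgt a j y*(\<Delta> (Suc a) y)^2 <= wgt a j y*4" using wgt_nonneg by (intro mult_left_mono) auto
  thus ?case using wgt_nonneg[of a j y] by (simp add: abs_mult)
 qed
qed measurable
have wz: "integrable Q (%y. wgt a j y*\<zeta> (Suc a) y)"
 using a by (intro noise.zeta_mean(1)[OF noise wgt_meas wgt_abs]) auto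
have "integrable Q (%y. 2*(wgt a j y*\<zeta> (Suc a) y))" using wz by simp
thus "integrable Q (%y. wgt a j y*\<Delta> (Suc a) y*\<zeta> (Suc a) y)"
proof (rule int_bound)
 show "AE y in Q. norm (wgt a j y*\<Delta> (Suc a) y*\<zeta> (Suc a) y) <= norm (2*(wgt a j y*\<zeta> (Suc a) y))"
  using D
 proof eventually_elim
  case (elim y)
  have "\<bar>\<Delta> (Suc a) y\<bar>*\<bar>wgt a j y*\<zeta> (Suc a) y\<bar> <= 2*\<bar>wgt a j y*\<zeta> (Suc a) y\<bar>" using elim by (intro mult_right_mono) auto
  thus ?case by (simp add: abs_mult mult_ac)
 qed
qed measurable
qed

text \<open>Terms linear in the increment vanish by the martingale property. So the mean stays at
  \<open>j\<close>, and correlation and second moment gain the contributions of the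
  increment.\<close>

lemma transition:
assumes a: "Suc a < n"
defines "c \<equiv> (1-kp)/et"
shows "pr a j*(LINT z|Nd. real (dev (tr a j) z)) = pr a j*real j"
 "c*(LINT w|Q. wgt a j w*\<Delta> (Suc a) w*\<zeta> (Suc a) w) <= pr a j*(LINT z|Nd. real (dev (tr a j) z)*z)"
 "pr a j*(real j)^2+c^2*(LINT w|Q. wgt a j w*(\<Delta> (Suc a) w)^2) <= pr a j*(LINT z|Nd. (real (dev (tr a j) z))\<^sup>2)"
proof -
note f = tr[OF a, of j, unfolded fits_def, folded pr_def]
note i = weighted[OF a, of j]
have wz: "integrable Q (%w. wgt a j w*\<zeta> (Suc a) w)" "(LINT w|Q. wgt a j w*\<zeta> (Suc a) w) = 0"
 using a by (intro noise.zeta_mean[OF noise wgt_meas wgt_abs]; simp)+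
have m: "(LINT w|Q. wgt a j w*\<Delta> (Suc a) w) = 0" using a by (intro mart[OF _ _ wgt_meas wgt_abs]) auto
have X: "X (Suc a) j w = real j+c*\<Delta> (Suc a) w" for w by (simp add: X_def c_def)
have e1: "wgt a j w*X (Suc a) j w = real j*wgt a j w+c*(wgt a j w*\<Delta> (Suc a) w)"
 and e2: "wgt a j w*X (Suc a) j w*\<zeta> (Suc a) w = real j*(wgt a j w*\<zeta> (Suc a) w)+c*(wgt a j w*\<Delta> (Suc a) w*\<zeta> (Suc a) w)"
 and e3: "wgt a j w*(X (Suc a) j w)^2 = (real j)^2*wgt a j w+2*real j * c*(wgt a j w*\<Delta> (Suc a) w)+c^2*(wgt a j w*(\<Delta> (Suc a) w)^2)" for w
 unfolding X power2_eq_square by algebra+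
have "(LINT w|Q. wgt a j w*X (Suc a) j w) = real j*pr a j" unfolding e1 pr_def using i m by simp
thus "pr a j*(LINT z|Nd. real (dev (tr a j) z)) = pr a j*real j" using f by simp
have "(LINT w|Q. wgt a j w*X (Suc a) j w*\<zeta> (Suc a) w) = c*(LINT w|Q. wgt a j w*\<Delta> (Suc a) w*\<zeta> (Suc a) w)"
 unfolding e2 using i wz by simp
thus "c*(LINT w|Q. wgt a j w*\<Delta> (Suc a) w*\<zeta> (Suc a) w) <= pr a j*(LINT z|Nd. real (dev (tr a j) z)*z)"
 using f by simp
have "(LINT w|Q. wgt a j w*(X (Suc a) j w)^2) = pr a j*(real j)^2+c^2*(LINT w|Q. wgt a j w*(\<Delta> (Suc a) w)^2)"
 unfolding e3 pr_def using i m by simp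
thus "pr a j*(real j)^2+c^2*(LINT w|Q. wgt a j w*(\<Delta> (Suc a) w)^2) <= pr a j*(LINT z|Nd. (real (dev (tr a j) z))\<^sup>2)"
 using f by simp
qed

lemma summed:
assumes a: "Suc a < n"
shows "(\<Sum>j\<le>K. \<integral>w. wgt a j w*\<Delta> (Suc a) w*\<zeta> (Suc a) w \<partial>Q) = (LINT w|Q. \<Delta> (Suc a) w*\<zeta> (Suc a) w)"
 "(\<Sum>j\<le>K. \<integral>w. wgt a j w*(\<Delta> (Suc a) w)^2 \<partial>Q) = \<delta>"
proof -
have [measurable]: "wgt a j \<in> bm Q" "M (Suc a) \<in> bm Q" "M (Suc (Suc a)) \<in> bm Q"
  "\<zeta> (Suc a) \<in> bm Q" for j
 using a wgt_Q M_Q noise.zeta[OF noise[of "Suc a"]] by auto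
have t: "AE w in Q. (\<Sum>j\<le>K. wgt a j w) = 1" using a by (intro total) simp
have "(\<Sum>j\<le>K. \<integral>w. wgt a j w*\<Delta> (Suc a) w*\<zeta> (Suc a) w \<partial>Q) = (LINT w|Q. (\<Sum>j\<le>K. wgt a j w*\<Delta> (Suc a) w*\<zeta> (Suc a) w))"
 using weighted(4)[OF a] by (simp add: int_sum)
also have "... = (LINT w|Q. \<Delta> (Suc a) w*\<zeta> (Suc a) w)"
proof (rule integral_cong_AE)
 show "AE w in Q. (\<Sum>j\<le>K. wgt a j w*\<Delta> (Suc a) w*\<zeta> (Suc a) w) = \<Delta> (Suc a) w*\<zeta> (Suc a) w"
  using t by eventually_elim (simp only: sum_distrib_right[symmetric] mult_1_left)
qed measurable
finally show "(\<Sum>j\<le>K. \<integral>w. wgt a j w*\<Delta> (Suc a) w*\<zeta> (Suc a) w \<partial>Q) = (LINT w|Q. \<Delta> (Suc a) w*\<zeta> (Suc a) w)" .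
have "(\<Sum>j\<le>K. \<integral>w. wgt a j w*(\<Delta> (Suc a) w)^2 \<partial>Q) = (LINT w|Q. (\<Sum>j\<le>K. wgt a j w*(\<Delta> (Suc a) w)^2))"
 using weighted(3)[OF a] by (simp add: int_sum)
also have "... = (LINT w|Q. (\<Delta> (Suc a) w)\<^sup>2)"
proof (rule integral_cong_AE)
 show "AE w in Q. (\<Sum>j\<le>K. wgt a j w*(\<Delta> (Suc a) w)^2) = (\<Delta> (Suc a) w)^2"
  using t by eventually_elim (simp only: sum_distrib_right[symmetric] mult_1_left)
qed measurable
finally show "(\<Sum>j\<le>K. \<integral>w. wgt a j w*(\<Delta> (Suc a) w)^2 \<partial>Q) = \<delta>" using M_incr[of "Suc a"] a by simp
qed

primrec idx :: "nat => vec => nat" where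
"idx 0 y = dev t0 (y 0)"
| "idx (Suc a) y = dev (tr a (idx a y)) (y (Suc a))"

lemma idx_le: "a < n ==> idx a y <= K"
using t0 tr unfolding fits_def by (cases a) (auto simp: j_K)

lemma measurable_idx [measurable]: "idx a \<in> measurable colm (count_space UNIV)"
proof (induction a)
case 0
show ?case unfolding idx.simps[abs_def] by (rule measurable_compose[OF _ measurable_dev_nat]) simp
next
case (Suc a)
show ?case unfolding idx.simps[abs_def]
 by (rule measurable_compose_countable[OF _ Suc, of "%i y. dev (tr a i) (y (Suc a))"])
  (rule measurable_compose[OF _ measurable_dev_nat], simp)
qed

lemma idx_dep: "(\<And>b. b <= a ==> y b = y' b) ==> idx a y = idx a y'"
by (induction a) auto

text \<open>Conditioning on the state at time \<open>a\<close>; the next normal is independent of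
  everything before.\<close>

lemma mix:
fixes G :: "nat => real => real"
assumes a: "a < n" and Y: "Y \<in> bm colm" and dep: "\<And>y y'. (\<And>b. b <= a ==> y b = y' b) ==> Y y = Y y'"
 and iY: "integrable gaus (%x. Y (col x 0))" and G: "\<And>j. G j \<in> bm borel" "\<And>j. integrable Nd (G j)"
shows "(LINT x|gaus. Y (col x 0)*G (idx a (col x 0)) (x (Suc a, 0))) =
  (\<Sum>j\<le>K. (LINT x|gaus. (if idx a (col x 0) = j then Y (col x 0) else 0))*(LINT z|Nd. G j z))"
proof -
define Z where "Z j y = (if idx a y = j then Y y else 0)" for j y
have Zm: "Z j \<in> bm colm" for j unfolding Z_def[abs_def] using Y by measurable
have Zd: "Z j y = Z j y'" if "\<And>b. b <= a ==> y b = y' b" for j y y'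
 using dep[OF that] idx_dep[OF that] by (simp add: Z_def)
have Zi: "integrable gaus (%x. Z j (col x 0))" for j
 by (rule int_bound[OF iY measurable_col[OF Zm]]) (simp add: Z_def)
note p = past_indep[OF Zm Zd Zi G]
have e: "Y (col x 0)*G (idx a (col x 0)) (x (Suc a, 0)) = (\<Sum>j\<le>K. Z j (col x 0)*G j (x (Suc a, 0)))" for x
 using idx_le[OF a, of "col x 0"] by (simp add: Z_def if_distrib[of "%u. u*_"] cong: if_cong)
show ?thesis unfolding e using p by (simp add: int_sum Z_def)
qed

lemma mix_one:
fixes G :: "nat => real => real"
assumes a: "a < n" and G: "\<And>j. G j \<in> bm borel" "\<And>j. integrable Nd (G j)"
shows "(LINT x|gaus. G (idx a (col x 0)) (x (Suc a, 0))) =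
  (\<Sum>j\<le>K. (LINT x|gaus. (if idx a (col x 0) = j then 1 else 0))*(LINT z|Nd. G j z))"
proof -
interpret Gm: prob_space gaus by (rule prob_space_gaus)
have "(LINT x|gaus. 1*G (idx a (col x 0)) (x (Suc a, 0))) =
  (\<Sum>j\<le>K. (LINT x|gaus. (if idx a (col x 0) = j then 1 else 0))*(LINT z|Nd. G j z))"
 by (rule mix[where Y="%_. 1" and G=G]) (use a G in auto)
thus ?thesis unfolding mult_1_left .
qed

text \<open>Both sides satisfy the same recursion, since each tree was fitted to the one-step law of
  the rounding.\<close>

lemma law: "a < n ==> j <= K ==> (LINT x|gaus. (if idx a (col x 0) = j then 1 else 0)) = pr a j"
proof (induction a arbitrary: j)
case 0
have m: "(%z. if dev t0 z = j then 1 else 0 :: real) \<in> bm borel" by (rule measurable_compose[OF measurable_dev_nat]) simp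
have e: "(%z. if dev t0 z = j then 1 else 0 :: real) = indicator {z. dev t0 z = j}" by (auto simp: fun_eq_iff)
have "(LINT x|gaus. (if idx 0 (col x 0) = j then 1 else 0 :: real)) = (LINT z|Nd. (if dev t0 z = j then 1 else 0))"
 unfolding idx.simps by (rule integral_gaus_coord(2)[OF m])
also have "... = measure Nd {z. dev t0 z = j}" unfolding e by simp
finally show ?case using t0 0 by (simp add: fits_def pr_def j_K prob_space)
next
case (Suc a)
interpret Gm: prob_space gaus by (rule prob_space_gaus)
let ?G = "%i z. if dev (tr a i) z = j then 1 else 0 :: real"
have e: "?G i = indicator {z. dev (tr a i) z = j}" for i by (auto simp: fun_eq_iff)
have Gm: "?G i \<in> bm borel" for i by (rule measurable_compose[OF measurable_dev_nat]) simp
have Gi: "integrable Nd (?G i)" for i using dev_integrable(1)[of "%m. if m = j then 1 else 0"] .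
have Gv: "(LINT z|Nd. ?G i z) = measure Nd {z. dev (tr a i) z = j}" for i unfolding e by simp
have "(LINT x|gaus. (if idx (Suc a) (col x 0) = j then 1 else 0)) = (\<Sum>i\<le>K. pr a i*measure Nd {z. dev (tr a i) z = j})"
 unfolding idx.simps using Suc.IH Suc.prems(1)
 by (intro trans[OF mix_one[where G="?G", OF Suc_lessD[OF Suc.prems(1)] Gm Gi]] sum.cong refl) (simp add: Gv)
also have "... = (\<Sum>i\<le>K. \<integral>w. wgt a i w*(ramp j (X (Suc a) i w)-ramp (Suc j) (X (Suc a) i w)) \<partial>Q)"
 using tr[OF Suc.prems(1)] Suc.prems(2) by (intro sum.cong refl) (simp add: fits_def pr_def j_K)
also have "... = pr (Suc a) j" unfolding pr_def wgt.simps
proof (rule int_sum[symmetric])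
 fix i
 have [measurable]: "wgt a i \<in> bm Q" "X (Suc a) i \<in> bm Q"
  using Suc.prems(1) wgt_Q X_meas(2) by auto
 show "integrable Q (%w. wgt a i w*(ramp j (X (Suc a) i w)-ramp (Suc j) (X (Suc a) i w)))"
 proof (rule int_bound[OF weighted(1)[OF Suc.prems(1), of i]])
  have "wgt a i w*(ramp j x-ramp (Suc j) x) <= wgt a i w*1" for w x
   using wgt_nonneg[of a i w] ramp_bounds(1)[of "Suc j" x] ramp_bounds(2)[of j x] by (intro mult_left_mono) auto
  thus "AE w in Q. norm (wgt a i w*(ramp j (X (Suc a) i w)-ramp (Suc j) (X (Suc a) i w))) <= norm (wgt a i w)"
   using wgt_nonneg ramp_bounds(3) by (simp add: abs_mult)
 qed measurable
qed
finally show ?case .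
qed

lemma martingale:
fixes g :: "nat => real"
assumes a: "a < n" and Y: "Y \<in> bm colm" and dep: "\<And>y y'. (\<And>b. b <= a ==> y b = y' b) ==> Y y = Y y'"
 and iY: "integrable gaus (%x. Y (col x 0))" and g: "\<And>j. j <= K ==> pr a j \<noteq> 0 ==> (LINT z|Nd. g (dev (u j) z)) = v j"
shows "(LINT x|gaus. Y (col x 0)*g (dev (u (idx a (col x 0))) (x (Suc a, 0)))) = (LINT x|gaus. Y (col x 0) * v (idx a (col x 0)))"
proof -
have m: "(%z. g (dev (u j) z)) \<in> bm borel" for j by (rule measurable_compose[OF measurable_dev_nat]) simp
have "(LINT x|gaus. Y (col x 0)*g (dev (u (idx a (col x 0))) (x (Suc a, 0)))) =
  (\<Sum>j\<le>K. (LINT x|gaus. (if idx a (col x 0) = j then Y (col x 0) else 0))*(LINT z|Nd. g (dev (u j) z)))"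
 by (rule mix[OF a Y dep iY m dev_integrable(1)])
also have "... = (\<Sum>j\<le>K. (LINT x|gaus. (if idx a (col x 0) = j then Y (col x 0) else 0)) * v j)"
proof (intro sum.cong refl)
 fix j assume "j \<in> {..K}"
 show "(LINT x|gaus. (if idx a (col x 0) = j then Y (col x 0) else 0))*(LINT z|Nd. g (dev (u j) z)) =
  (LINT x|gaus. (if idx a (col x 0) = j then Y (col x 0) else 0)) * v j"
 proof (cases "pr a j = 0")
  \<comment> \<open>For a state of probability zero the mean of its tree is unknown, but the event
    is null.\<close>
  case True
  interpret Gm: prob_space gaus by (rule prob_space_gaus)
  have [measurable]: "(%x. idx a (col x 0)) \<in> measurable gaus (count_space UNIV)"
   by (rule measurable_compose[OF _ measurable_idx], rule measurable_PiM_single') (auto simp: space_PiM)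
  have "(LINT x|gaus. (if idx a (col x 0) = j then 1 else 0 :: real)) = 0" using law[OF a] `j \<in> {..K}` True by simp
  moreover have "integrable gaus (%x. if idx a (col x 0) = j then 1 else 0 :: real)"
   by (rule Gm.integrable_const_bound[where B=1]) auto
  ultimately have "AE x in gaus. (if idx a (col x 0) = j then 1 else 0 :: real) = 0"
   using integral_nonneg_eq_0_iff_AE[of gaus "%x. if idx a (col x 0) = j then 1 else 0"] by simp
  hence "AE x in gaus. (if idx a (col x 0) = j then Y (col x 0) else 0) = 0" by eventually_elim (simp split: if_splits)
  hence "(LINT x|gaus. (if idx a (col x 0) = j then Y (col x 0) else 0)) = 0" by (rule integral_eq_zero_AE)
  thus ?thesis by simp
 qed (use g `j \<in> {..K}` in simp)
qed
also have "... = (LINT x|gaus. Y (col x 0) * v (idx a (col x 0)))"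
proof -
 interpret Gm: prob_space gaus by (rule prob_space_gaus)
 show ?thesis using mix[of a Y "%j _. v j", OF a Y dep iY] by simp
qed
finally show ?thesis .
qed

definition pm :: "nat => real" where "pm i = 2*real i-1"

text \<open>Grid values are \<open>et\<close> apart, so thresholds half a unit below each of them
  recover the index from the value.\<close>

lemma outer_tree: "\<exists>t :: nat dtree. depth t <= d & (\<forall>j\<le>K. dev t (v j) = j)"
proof -
have "\<exists>t :: nat dtree. depth t <= d & (\<forall>z. 0 <= dev t z & dev t z < 0+2^d &
   (\<forall>j. 0 < j & j < 0+2^d --> (j <= dev t z \<longleftrightarrow> v j-et/2 <= z)))"
proof (rule search_tree)
 fix j j' z assume "j <= j'" "v j'-et/2 <= z"
 moreover from `j <= j'` have "v j <= v j'" using eta(1) by (simp add: v_def mult_left_mono)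
 ultimately show "v j-et/2 <= z" by linarith
qed blast
then obtain t :: "nat dtree" where t: "depth t <= d" "\<And>z. dev t z < 2^d"
 "\<And>z j. 0 < j ==> j < 2^d ==> j <= dev t z \<longleftrightarrow> v j-et/2 <= z" by auto
have "dev t (v j) = j" if "j <= K" for j
proof (rule antisym)
 show "j <= dev t (v j)"
 proof (cases "j = 0")
  case False
  thus ?thesis using t(3)[of j "v j"] that eta(1) by (simp add: j_K)
 qed simp
 show "dev t (v j) <= j"
 proof (rule ccontr)
  assume "\<not> dev t (v j) <= j"
  hence "Suc j <= dev t (v j)" "Suc j < 2^d" using t(2)[of "v j"] by auto
  hence "v (Suc j)-et/2 <= v j" using t(3)[of "Suc j" "v j"] by simp
  thus False using eta(1) by (simp add: v_def algebra_simps)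
 qed
qed
thus ?thesis using t(1) by blast
qed

definition ot :: "nat dtree" where "ot = (SOME t. depth t <= d & (\<forall>j\<le>K. dev t (v j) = j))"

lemma ot: "depth ot <= d" "j <= K ==> dev ot (v j) = j"
proof -
note dv = someI_ex[OF outer_tree, folded ot_def]
show "depth ot <= d" using dv by (rule conjunct1)
show "j <= K ==> dev ot (v j) = j" using dv by blast
qed

text \<open>The indices are cut off because the unreachable leaves of the trees are arbitrary.\<close>

definition T :: "nat => real dtree dtree" where
"T a = (if a = 0 then Leaf (map_dtree (%i. v (min i K)) t0)
 else if a < n then map_dtree (%j. map_dtree (%i. v (min i K)) (tr (a-1) j)) ot
 else if a = n then map_dtree (%j. map_dtree (%i. pm (min i 1)) (tl (min j K))) ot else Leaf (Leaf 1))"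

abbreviation "F \<equiv> fc (%a. teval (T a))"

lemma dev_le: "dev t0 z <= K" "Suc a < n ==> dev (tr a j) z <= K" "j <= K ==> dev (tl j) z <= 1"
using t0 tr[of a j] tl[of j] unfolding fits_def j_K by (auto simp: numeral_2_eq_2 less_Suc_eq_le)

lemma teval_T: "teval (T 0) x z = v (dev t0 z)" "Suc a < n ==> teval (T (Suc a)) x z = v (dev (tr a (dev ot x)) z)"
"teval (T n) x z = pm (dev (tl (min (dev ot x) K)) z)"
using kappa dev_le(1)[of z] dev_le(2)[of a "dev ot x" z] dev_le(3)[of "min (dev ot x) K" z]
by (simp_all add: T_def teval_def dev_map)

lemma F_idx: "a < n ==> F (Suc a) y = v (idx a y)"
by (induction a) (auto simp: teval_T ot idx_le fc.simps(2))

lemma F_last: "F (Suc n) y = pm (dev (tl (idx (n-1) y)) (y n))"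
proof -
have "n = Suc (n-1)" "n-1 < n" using kappa by auto
hence "F n y = v (idx (n-1) y)" using F_idx[of "n-1" y] by simp
thus ?thesis using idx_le[OF `n-1 < n`, of y] by (simp add: teval_T ot fc.simps(2))
qed

lemma mean_v: "Suc a < n ==> pr a j \<noteq> 0 ==> (LINT z|Nd. v (dev (tr a j) z)) = v j"
unfolding v_def mean_affine using transition(1)[of a j] by simp

lemma mean_tl: "j <= K ==> (LINT z|Nd. real (dev (tl j) z)) = real j/real K"
using tl[of j] by (simp add: fits_def prob_space)

lemma mean_pm: "j <= K ==> (LINT z|Nd. pm (dev (tl j) z)) = v j"
unfolding v_def pm_def mean_affine by (simp add: mean_tl et_def)

lemma v_bounds: "j <= K ==> -1 <= v j & v j <= 1"
proof -
assume "j <= K"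
hence "et*real j <= et*real K" using eta(1) by (intro mult_left_mono) auto
thus ?thesis using eta by (simp add: v_def)
qed

lemma pm_cases: "m <= 1 ==> pm m \<in> {-1, 1}"
by (cases m) (auto simp: pm_def)

lemma range_T: "teval (T n) x z \<in> {-1, 1}" "teval (T a) x z \<in> v ` {..K} \<union> {-1, 1}"
proof -
show l: "teval (T n) x z \<in> {-1, 1}" unfolding teval_T by (intro pm_cases dev_le) simp
consider "a = 0" | b where "a = Suc b" "Suc b < n" | "a = n" | "n < a"
 by (cases a; cases a n rule: linorder_cases) auto
thus "teval (T a) x z \<in> v ` {..K} \<union> {-1, 1}"
proof cases
 case 1
 thus ?thesis using dev_le(1) by (simp add: teval_T)
next
 case 2
 thus ?thesis using dev_le(2) by (simp add: teval_T)
next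
 case 4
 thus ?thesis using kappa by (simp add: T_def teval_def)
qed (use l in auto)
qed

lemma bounded_T: "bounded_tree d (T a)"
proof -
have pmb: "-1 <= pm (min i 1) & pm (min i 1) <= 1" for i using pm_cases[of "min i 1"] by auto
have dep: "depth t0 <= d" "Suc b < n ==> depth (tr b j) <= d" "j <= K ==> depth (tl j) <= 1" for b j
 using t0 tr[of b j] tl[of j] by (simp_all add: fits_def)
consider "a = 0" | b where "a = Suc b" "Suc b < n" | "a = n" | "n < a"
 by (cases a; cases a n rule: linorder_cases) auto
thus ?thesis
proof cases
 case 1
 thus ?thesis using dep(1) v_bounds by (simp add: T_def bounded_tree_def depth_map dtree.set_map)
next
 case 2
 thus ?thesis using dep(2) v_bounds ot(1) by (simp add: T_def bounded_tree_def depth_map dtree.set_map)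
next
 case 3
 have "depth (tl (min j K)) <= d" for j using dep(3)[of "min j K"] kappa by simp
 thus ?thesis using 3 kappa pmb ot(1) by (simp add: T_def bounded_tree_def depth_map dtree.set_map)
next
 case 4
 thus ?thesis using kappa by (simp add: T_def bounded_tree_def)
qed
qed

lemma F_bound: "\<bar>F a y\<bar> <= 1"
using bounded_tree_teval[OF bounded_T] by (cases a) (auto simp: abs_le_iff fc.simps(2) minus_le_iff)

lemma measurable_F: "F a \<in> bm colm"
proof (induction a)
case (Suc a)
show ?case unfolding fc.simps(2)[abs_def] by (rule mfunD[OF mfun_teval Suc]) simp
qed simp

lemma F_dep: "(\<And>b. b < a ==> y b = y' b) ==> F a y = F a y'"
by (induction a) (auto simp: fc.simps(2))

lemma F_next:
assumes a: "a < n" and Y: "Y \<in> bm colm" and dep: "\<And>y y'. (\<And>b. b <= a ==> y b = y' b) ==> Y y = Y y'"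
 and iY: "integrable gaus (%x. Y (col x 0))"
shows "(LINT x|gaus. Y (col x 0)*F (Suc (Suc a)) (col x 0)) = (LINT x|gaus. Y (col x 0)*F (Suc a) (col x 0))"
proof (cases "Suc a < n")
case True
have e: "F (Suc (Suc a)) y = v (dev (tr a (idx a y)) (y (Suc a)))" for y using F_idx[OF True] by simp
show ?thesis unfolding F_idx[OF a] e by (rule martingale[OF a Y _ iY], rule dep, blast, rule mean_v[OF True])
next
case False
hence n: "n = Suc a" using a by simp
have e: "F (Suc (Suc a)) y = pm (dev (tl (idx a y)) (y (Suc a)))" for y
 using F_last[of y] unfolding n[symmetric] by (simp add: n[symmetric]) (simp add: n)
show ?thesis unfolding F_idx[OF a] e by (rule martingale[OF a Y _ iY], rule dep, blast, rule mean_pm)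
qed

text \<open>Tower property, one step at a time: from its first step on, the ideal chain is a
  martingale in the noise.\<close>

lemma F_project:
assumes Y: "Y \<in> bm colm" and dep: "\<And>y y'. (\<And>b. b <= a ==> y b = y' b) ==> Y y = Y y'"
 and iY: "integrable gaus (%x. Y (col x 0))" and b: "Suc a <= b" "b <= Suc n"
shows "(LINT x|gaus. Y (col x 0)*F b (col x 0)) = (LINT x|gaus. Y (col x 0)*F (Suc a) (col x 0))"
using b
proof (induction b rule: dec_induct)
case (step m)
then obtain k where k: "m = Suc k" "a <= k" "k < n" by (cases m) auto
have "(LINT x|gaus. Y (col x 0)*F (Suc (Suc k)) (col x 0)) = (LINT x|gaus. Y (col x 0)*F (Suc k) (col x 0))"
 by (rule F_next[OF k(3) Y _ iY], rule dep) (use k(2) in auto)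
thus ?case using step k by simp
qed simp

definition q :: "nat => real" where "q a = (LINT x|gaus. (F a (col x 0))\<^sup>2)"

lemma integrable_F: "integrable gaus (%x. F a (col x 0))"
proof -
interpret Gm: prob_space gaus by (rule prob_space_gaus)
show ?thesis by (rule Gm.integrable_const_bound[where B=1]) (use F_bound measurable_col[OF measurable_F] in auto)
qed

lemma F_mean: "1 <= b ==> b <= Suc n ==> (LINT x|gaus. F b (col x 0)) = 0"
proof -
assume b: "1 <= b" "b <= Suc n"
interpret Gm: prob_space gaus by (rule prob_space_gaus)
have n0: "0 < n" using kappa by simp
have m: "(%z. v (dev t0 z)) \<in> bm borel" by (rule measurable_compose[OF measurable_dev_nat]) simp
have "(LINT x|gaus. F b (col x 0)) = (LINT x|gaus. F (Suc 0) (col x 0))"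
 using F_project[OF borel_measurable_const[of 1] refl Gm.integrable_const, of 0 b] b unfolding mult_1_left by simp
also have "... = (LINT x|gaus. v (dev t0 (x (0, 0))))" unfolding F_idx[OF n0] by simp
also have "... = (LINT z|Nd. v (dev t0 z))" by (rule integral_gaus_coord(2)[OF m])
also have "... = et*(LINT w|Q. X0 w)-1" using t0 unfolding v_def mean_affine by (simp add: fits_def prob_space)
also have "... = (LINT w|Q. et*X0 w-1)"
proof -
 have "integrable Q X0" by (rule integrable_const_bound[where B="real K"])
  (use X0_meas M_bound[of 1] kappa X0_range in "auto elim!: eventually_mono")
 thus ?thesis by (simp add: prob_space)
qed
also have "... = 0" unfolding X0_eq using M_first(1) by simp
finally show ?thesis .
qed

lemma F_product:
assumes "1 <= a" "a <= b" "b <= Suc n"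
shows "(LINT x|gaus. F a (col x 0)*F b (col x 0)) = q a"
proof -
obtain c where c: "a = Suc c" using assms by (cases a) auto
have "(LINT x|gaus. F a (col x 0)*F b (col x 0)) = (LINT x|gaus. F a (col x 0)*F (Suc c) (col x 0))"
 by (rule F_project[OF measurable_F F_dep integrable_F]) (use assms c in auto)
thus ?thesis by (simp add: q_def c power2_eq_square)
qed

lemma F_product_zero: "1 <= b ==> b <= Suc n ==> (LINT x|gaus. F 0 (col x 0)*F b (col x 0)) = 0"
using F_mean[of b] by simp

lemma q_le: "q a <= 1"
proof -
interpret Gm: prob_space gaus by (rule prob_space_gaus)
have "q a <= (LINT x|gaus. 1)" unfolding q_def
proof (rule integral_mono)
 show "integrable gaus (%x. (F a (col x 0))\<^sup>2)"
  by (rule Gm.integrable_const_bound[where B=1]) (use F_bound measurable_col[OF measurable_F] in "auto simp: abs_square_le_1")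
qed (use F_bound in "auto simp: abs_square_le_1")
thus ?thesis by (simp add: Gm.prob_space)
qed

lemma square_v: "(LINT z|Nd. (v (dev t z))\<^sup>2) = et^2*(LINT z|Nd. (real (dev t z))\<^sup>2)-2*et*(LINT z|Nd. real (dev t z))+1"
proof -
have e: "(v i)^2 = et^2*(real i)^2-2*et*real i+1" for i
 by (simp add: v_def power2_eq_square algebra_simps)
show ?thesis unfolding e using dev_integrable(1)[of real t] dev_integrable(1)[of "%i. (real i)\<^sup>2" t] by simp
qed

lemma q_first: "(1-kp)^2*\<delta> <= q 1"
proof -
have n0: "0 < n" using kappa by simp
have m: "(%z. (v (dev t0 z))\<^sup>2) \<in> bm borel" by (rule measurable_compose[OF measurable_dev_nat]) simp
have i: "integrable Q (%w. (X0 w)\<^sup>2)" "integrable Q X0"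
 by (rule integrable_const_bound[where B="(real K)^2"], use X0_meas M_bound[of 1] kappa X0_range in "auto elim!: eventually_mono intro!: power_mono")
  (rule integrable_const_bound[where B="real K"], use X0_meas M_bound[of 1] kappa X0_range in "auto elim!: eventually_mono")
have "(1-kp)^2*\<delta> = (LINT w|Q. ((1-kp)*M 1 w)\<^sup>2)" using M_first(2) by (simp add: power_mult_distrib)
also have "... = (LINT w|Q. et\<^sup>2*(X0 w)^2-2*et*X0 w+1)"
 unfolding X0_eq[symmetric] by (intro int_cong) (auto simp: power2_eq_square algebra_simps)
also have "... = et^2*(LINT w|Q. (X0 w)\<^sup>2)-2*et*(LINT w|Q. X0 w)+1" using i by (simp add: prob_space)
also have "... <= (LINT z|Nd. (v (dev t0 z))\<^sup>2)"
 unfolding square_v using t0 by (simp add: fits_def prob_space mult_left_mono)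
also have "... = (LINT x|gaus. (v (dev t0 (x (0, 0))))\<^sup>2)" by (rule integral_gaus_coord(2)[OF m, symmetric])
also have "... = q 1" unfolding q_def One_nat_def F_idx[OF n0] by simp
finally show ?thesis .
qed

lemma mix_law:
fixes G :: "nat => real => real"
assumes a: "a < n" and G: "\<And>j. G j \<in> bm borel" "\<And>j. integrable Nd (G j)"
shows "(LINT x|gaus. G (idx a (col x 0)) (x (Suc a, 0))) = (\<Sum>j\<le>K. pr a j*(LINT z|Nd. G j z))"
by (intro trans[OF mix_one[where G=G, OF a G]] sum.cong refl) (simp add: law[OF a])

text \<open>Unbiased rounding can only add to the second moment, so it grows at least by that of the
  shrunk increment, \<open>(1-kp)^2*\<delta>\<close>.\<close>

lemma q_step:
assumes a: "1 <= a" "a < n"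
shows "q a+(1-kp)^2*\<delta> <= q (Suc a)"
proof -
obtain b where b: "a = Suc b" using a by (cases a) auto
have bn: "b < n" "Suc b < n" using a b by auto
have m: "(%z. (v (dev (tr b j) z))\<^sup>2) \<in> bm borel" for j by (rule measurable_compose[OF measurable_dev_nat]) simp
have "q (Suc a) = (\<Sum>j\<le>K. pr b j*(LINT z|Nd. (v (dev (tr b j) z))\<^sup>2))"
 unfolding q_def b F_idx[OF bn(2)] idx.simps by (rule mix_law[OF bn(1) m dev_integrable(1)])
also have "... \<ge> (\<Sum>j\<le>K. pr b j*(v j)^2+(1-kp)^2*(LINT w|Q. wgt b j w*(\<Delta> (Suc b) w)^2))"
proof (rule sum_mono)
 fix j
 let ?w = "\<integral>w. wgt b j w*(\<Delta> (Suc b) w)^2 \<partial>Q"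
 have c: "et^2*((1-kp)/et)^2 = (1-kp)^2" using eta(1) by (simp add: power_divide)
 have "pr b j*(v j)^2+(1-kp)^2*?w =
   et\<^sup>2*(pr b j*(real j)^2+((1-kp)/et)^2*?w)-2*et*(pr b j*real j)+pr b j"
  unfolding distrib_left mult.assoc[symmetric] c by (simp add: v_def power2_eq_square algebra_simps)
 also have "... <= et^2*(pr b j*(LINT z|Nd. (real (dev (tr b j) z))\<^sup>2))-2*et*(pr b j*(LINT z|Nd. real (dev (tr b j) z)))+pr b j"
  using mult_left_mono[OF transition(3)[OF bn(2), of j], of "et^2"] unfolding transition(1)[OF bn(2), of j] by simp
 also have "... = pr b j*(LINT z|Nd. (v (dev (tr b j) z))\<^sup>2)" unfolding square_v by (simp add: algebra_simps)
 finally show "pr b j*(v j)^2+(1-kp)^2*?w <= pr b j*(LINT z|Nd. (v (dev (tr b j) z))\<^sup>2)" .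
qed
also have "(\<Sum>j\<le>K. pr b j*(v j)^2+(1-kp)^2*(LINT w|Q. wgt b j w*(\<Delta> (Suc b) w)^2)) = q a+(1-kp)^2*\<delta>"
proof -
 have "q a = (\<Sum>j\<le>K. pr b j*(v j)^2)"
  unfolding q_def b F_idx[OF bn(1)] using mix_law[OF bn(1), of "%j _. (v j)\<^sup>2"] by simp
 thus ?thesis using summed(2)[OF bn(2)] by (simp add: sum.distrib sum_distrib_left[symmetric])
qed
finally show ?thesis .
qed

text \<open>By the martingale property only the step that reads noise \<open>a\<close> counts. There
  each tree is at least as correlated with its normal as the shrunk increment of \<open>M\<close> is
  with \<zeta>.\<close>

lemma correlation:
assumes a: "1 <= a" "a < n"
shows "(1-kp)*(LINT w|Q. \<Delta> a w*\<zeta> a w) <= (LINT x|gaus. F (Suc n) (col x 0)*x (a, 0))"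
proof -
obtain b where b: "a = Suc b" using a by (cases a) auto
have bn: "b < n" "Suc b < n" using a b by auto
have iz: "integrable gaus (%x. x (a, 0))" using prob_space.iid_normalD(5)[OF prob_space_gaus iid_gaus] by simp
have y: "(%y. y a) \<in> bm colm" by simp
have vz: "integrable Nd (%z. v (dev t z)*z)" for t by (rule dev_integrable(2))
have m: "(%z. v (dev (tr b j) z)*z) \<in> bm borel" for j
 by (intro borel_measurable_times measurable_compose[OF measurable_dev_nat]) auto
have "(LINT x|gaus. F (Suc n) (col x 0)*x (a, 0)) = (LINT x|gaus. F (Suc a) (col x 0)*x (a, 0))"
 using F_project[OF y _ iz, of a "Suc n"] a by (simp add: mult.commute)
also have "... = (\<Sum>j\<le>K. pr b j*(LINT z|Nd. v (dev (tr b j) z)*z))"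
 unfolding b F_idx[OF bn(2)] idx.simps by (rule mix_law[OF bn(1) m vz])
also have "... \<ge> (\<Sum>j\<le>K. (1-kp)*(LINT w|Q. wgt b j w*\<Delta> (Suc b) w*\<zeta> (Suc b) w))"
proof (rule sum_mono)
 fix j
 have e: "v (dev (tr b j) z)*z = et*(real (dev (tr b j) z)*z)-z" for z by (simp add: v_def algebra_simps)
 have "(LINT z|Nd. v (dev (tr b j) z)*z) = et*(LINT z|Nd. real (dev (tr b j) z)*z)"
  unfolding e using dev_integrable(2)[of real "tr b j"] Nd_moments by simp
 moreover have "et*((1-kp)/et*(LINT w|Q. wgt b j w*\<Delta> (Suc b) w*\<zeta> (Suc b) w)) <= et*(pr b j*(LINT z|Nd. real (dev (tr b j) z)*z))"
  using eta(1) transition(2)[OF bn(2), of j] by (intro mult_left_mono) auto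
 ultimately show "(1-kp)*(LINT w|Q. wgt b j w*\<Delta> (Suc b) w*\<zeta> (Suc b) w) <= pr b j*(LINT z|Nd. v (dev (tr b j) z)*z)"
  using eta(1) by (simp add: mult_ac)
qed
finally show ?thesis using summed(1)[OF bn(2)] by (simp add: sum_distrib_left[symmetric] b)
qed

text \<open>Here the tree is compared with the constant \<open>j/K\<close>, whose correlation with
  the noise is zero.\<close>

lemma correlation_last: "0 <= (LINT x|gaus. F (Suc n) (col x 0)*x (n, 0))"
proof -
define b where "b = n-1"
have sb: "Suc b = n" and bn: "b < n" using kappa by (simp_all add: b_def)
define G where "G j z = pm (dev (tl (min j K)) z)*z" for j z
have m: "G j \<in> bm borel" for j unfolding G_def[abs_def]
 by (intro borel_measurable_times measurable_compose[OF measurable_dev_nat]) auto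
have i: "integrable Nd (G j)" for j unfolding G_def[abs_def] by (rule dev_integrable(2))
have e: "F (Suc n) (col x 0)*x (n, 0) = G (idx b (col x 0)) (x (n, 0))" for x
 using idx_le[OF bn, of "col x 0"] F_last[of "col x 0", folded b_def] by (simp add: G_def)
have "(LINT x|gaus. F (Suc n) (col x 0)*x (n, 0)) = (\<Sum>j\<le>K. pr b j*(LINT z|Nd. G j z))"
 unfolding e using mix_law[where G=G, OF bn m i] unfolding sb .
moreover have "0 <= pr b j*(LINT z|Nd. G j z)" if "j <= K" for j
proof (rule mult_nonneg_nonneg)
 show "0 <= pr b j" unfolding pr_def using wgt_nonneg by simp
 have e: "G j z = 2*(real (dev (tl j) z)*z)-z" for z using that by (simp add: G_def pm_def algebra_simps)
 have "(LINT z|Nd. G j z) = 2*(LINT z|Nd. real (dev (tl j) z)*z)"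
  unfolding e using dev_integrable(2)[of real "tl j"] Nd_moments by simp
 moreover have z: "(LINT w|Q. real j/real K*\<zeta> 1 w) = 0"
  using noise.zeta_mean(2)[OF noise, of 1 "%_. real j/real K" "real j/real K"] kappa by simp
 have "(LINT w|Q. 1*(real j/real K)*\<zeta> 1 w) <= (LINT w|Q. 1)*(LINT z|Nd. real (dev (tl j) z)*z)"
  using tl[OF that] unfolding fits_def by blast
 hence "0 <= (LINT z|Nd. real (dev (tl j) z)*z)" unfolding mult_1_left z by (simp add: prob_space)
 ultimately show "0 <= (LINT z|Nd. G j z)" by simp
qed
ultimately show ?thesis by (auto intro!: sum_nonneg)
qed

end

text \<open>From index 1 on, the kernel is \<open>g\<close> of the smaller index, as for a process
  with uncorrelated increments, so the innovations are the increments. Index 0 is uncorrelated with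
  the others, hence the condition \<open>2 <= a\<close>.\<close>

lemma markov_kernel:
assumes K: "K 0 0 = (A::real)" "A \<noteq> 0" "\<And>a. 1 <= a ==> a <= N ==> K 0 a = 0 & K a 0 = 0"
 "\<And>a b. 1 <= a ==> a <= b ==> b <= N ==> K a b = g a & K b a = g a"
 and g: "g 0 = 0" "\<And>a. 1 <= a ==> a < N ==> g a \<noteq> g (a-1)"
shows "a < N ==> innov K a d = (if d = a then 1 else if d = a-1 & 2 <= a then -1 else 0)"
 "b <= a ==> a <= N ==> b < N ==> icov K a b = (if b = 0 then (if a = 0 then A else 0) else g b-g (b-1))"
proof -
have I: "icov K a b = (if b = 0 then (if a = 0 then A else 0) else g b-g (b-1))"
 if i: "\<And>d. innov K b d = (if d = b then 1 else if d = b-1 & 2 <= b then -1 else 0)" and "b <= a" "a <= N" for a b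
proof (cases "2 <= b")
 case True
 have "icov K a b = (\<Sum>e\<in>{b-1, b}. innov K b e*K a e)" unfolding icov_def
  by (rule sum.mono_neutral_right) (auto simp: i)
 also have "... = g b-g (b-1)" using True that K(4)[of b a] K(4)[of "b-1" a] by (simp add: i)
 finally show ?thesis using True by simp
next
 case False
 hence "icov K a b = (\<Sum>e\<in>{b}. innov K b e*K a e)" unfolding icov_def
  by (intro sum.mono_neutral_right) (auto simp: i)
 thus ?thesis using False that K(1) K(3)[of a] K(4)[of b a] g(1) by (cases "b = 0"; cases "a = 0") (auto simp: i)
qed
have J: "\<forall>d. innov K a d = (if d = a then 1 else if d = a-1 & 2 <= a then -1 else 0)" if "a < N" for a
 using that
proof (induction a rule: less_induct)
 case (less a)
 have IH: "innov K b d = (if d = b then 1 else if d = b-1 & 2 <= b then -1 else 0)" if "b < a" for b d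
  using less that by auto
 have c: "icov K a b = (if b = 0 then 0 else g b-g (b-1))" "ivar K b = (if b = 0 then A else g b-g (b-1))" if "b < a" for b
  using I[OF IH[OF that], of a] I[OF IH[OF that], of b] that less.prems by auto
 have "innov K a d = (if d = a then 1 else 0)-(\<Sum>b<a. (if b = 0 then 0 else innov K b d))" for d
  unfolding innov_rec[of K a d] using c g(2) less.prems by (intro arg_cong2[where f="(-)"] sum.cong) auto
 moreover have "(\<Sum>b<a. (if b = 0 then 0 else innov K b d)) = (if d = a-1 & 2 <= a then 1 else 0)" for d
 proof -
  have t: "(\<Sum>b<m. (if b = 0 then 0 else (if d = b then 1 else if d = b-1 & 2 <= b then -1 else 0 :: real))) = (if d = m-1 & 2 <= m then 1 else 0)" for m
  proof (induction m)
   case (Suc m)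
   thus ?case by (cases m) auto
  qed simp
  have "(\<Sum>b<a. (if b = 0 then 0 else innov K b d)) = (\<Sum>b<a. (if b = 0 then 0 else (if d = b then 1 else if d = b-1 & 2 <= b then -1 else 0)))"
   using IH by (intro sum.cong) auto
  thus ?thesis unfolding t .
 qed
 ultimately show ?case by auto
qed
show "innov K a d = (if d = a then 1 else if d = a-1 & 2 <= a then -1 else 0)" if "a < N" using J[OF that] by blast
show "icov K a b = (if b = 0 then (if a = 0 then A else 0) else g b-g (b-1))" if "b <= a" "a <= N" "b < N"
 using I[OF J[OF that(3), rule_format] that(1,2)] .
qed

section \<open>Limiting energy of the algorithm built from the chain\<close>

locale chain_algorithm = chain Q Fm M \<zeta> n d \<delta> kp+mixture_coeffs c \<epsilon>0
for Q :: "'a measure" and Fm M \<zeta> n d \<delta> kp and c :: "nat => real" and \<epsilon>0 :: real +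
fixes P :: "nat => 'w measure" and G :: "nat => nat => nat list => 'w => real"
assumes gauss: "\<And>N. gaussian_tensors (P N) N (G N)"
 and nontrivial: "\<exists>k\<ge>2. c k \<noteq> 0" and delta: "0 < \<delta>"
 and rho: "\<And>a. 1 <= a ==> a < n ==> 0 <= (LINT w|Q. \<Delta> a w*\<zeta> a w)"
begin

text \<open>\<open>q 0\<close> is 1 because the run starts at the all-ones vector; with 0 instead,
  the second moments are those of a martingale started at 0.\<close>

definition q0 :: "nat => real" where "q0 a = (if a = 0 then 0 else q a)"

abbreviation "ep \<equiv> (1-kp)\<^sup>2*\<delta>"

lemma eps_pos: "0 < ep" using kappa delta by simp

lemma q0_step: "a < n ==> q0 a+ep <= q0 (Suc a)"
using q_first q_step[of a] by (cases "a = 0") (auto simp: q0_def)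

lemma q0_lower: "a <= n ==> real a*ep <= q0 a"
proof (induction a)
case (Suc a)
thus ?case using q0_step[of a] by (simp add: distrib_right)
qed (simp add: q0_def)

lemma q0_bounds: "q0 a <= 1" "a <= n ==> 0 <= q0 a"
proof -
show "q0 a <= 1" using q_le[of a] by (simp add: q0_def)
have "0 <= real a*ep" by (rule mult_nonneg_nonneg[OF of_nat_0_le_iff less_imp_le[OF eps_pos]])
thus "0 <= q0 a" if "a <= n" using q0_lower[OF that] by linarith
qed

abbreviation "KL a b \<equiv> xi1 c (LINT x|gaus. F a (col x 0)*F b (col x 0))"

lemma xi1_q0: "a < n ==> xi1 c (q0 a) < xi1 c (q0 (Suc a))"
proof -
assume a: "a < n"
obtain k where "2 <= k" "c k \<noteq> 0" using nontrivial by blast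
thus ?thesis using q0_step[OF a] eps_pos q0_bounds[of a] q0_bounds[of "Suc a"] a by (intro xi1_strict_mono) auto
qed

lemma KL: "a < Suc n ==> innov KL a d = (if d = a then 1 else if d = a-1 & 2 <= a then -1 else 0)"
"b <= a ==> a <= Suc n ==> b < Suc n ==> icov KL a b = (if b = 0 then (if a = 0 then xi1 c 1 else 0) else xi1 c (q0 b)-xi1 c (q0 (b-1)))"
proof -
interpret Gm: prob_space gaus by (rule prob_space_gaus)
obtain k where k: "2 <= k" "c k \<noteq> 0" using nontrivial by blast
have 1: "KL 0 0 = xi1 c 1" by (simp add: Gm.prob_space)
have 2: "xi1 c 1 \<noteq> 0" using xi1_strict_mono[OF k, of 0 1] xi1_zero by simp
have 3: "KL 0 a = 0 & KL a 0 = 0" if "1 <= a" "a <= Suc n" for a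
 using F_product_zero[OF that] xi1_zero by (simp add: mult.commute)
have 4: "KL a b = xi1 c (q0 a) & KL b a = xi1 c (q0 a)" if "1 <= a" "a <= b" "b <= Suc n" for a b
 using F_product[OF that] that by (simp add: q0_def mult.commute[of "F b _"])
have 5: "xi1 c (q0 a) \<noteq> xi1 c (q0 (a-1))" if "1 <= a" "a < Suc n" for a
 using xi1_q0[of "a-1"] that by (cases a) auto
have 6: "xi1 c (q0 0) = 0" by (simp add: q0_def xi1_zero)
note m = markov_kernel[of KL "xi1 c 1" "Suc n" "%a. xi1 c (q0 a)", OF 1 2 3 4 6 5]
show "a < Suc n ==> innov KL a d = (if d = a then 1 else if d = a-1 & 2 <= a then -1 else 0)"
 by (rule m(1))
show "b <= a ==> a <= Suc n ==> b < Suc n ==> icov KL a b = (if b = 0 then (if a = 0 then xi1 c 1 else 0) else xi1 c (q0 b)-xi1 c (q0 (b-1)))"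
 by (rule m(2))
qed

lemma spos: "a < Suc n ==> 0 < ivar KL a"
proof -
assume a: "a < Suc n"
obtain k where k: "2 <= k" "c k \<noteq> 0" using nontrivial by blast
show ?thesis using KL(2)[of a a] a xi1_strict_mono[OF k, of 0 1] xi1_zero xi1_q0[of "a-1"] by (cases a) auto
qed

lemma spin_algorithm: "spin_algorithm c \<epsilon>0 T (Suc n) d (v ` {..K} \<union> {-1, 1}) P G"
proof (intro spin_algorithm.intro toy.intro mixture_coeffs_axioms toy_axioms.intro spin_algorithm_axioms.intro)
show "mfun (%a. teval (T a))" by (rule mfun_teval)
show "\<bar>teval (T a) x z\<bar> <= 1" for a x z using bounded_tree_teval[OF bounded_T, of a x z] by (simp add: abs_le_iff minus_le_iff)
show "\<exists>\<Theta>. finite \<Theta> & (\<forall>x z z'. (\<forall>\<theta>\<in>\<Theta>. \<theta> <= z \<longleftrightarrow> \<theta> <= z') --> teval (T a) x z = teval (T a) x z')" for a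
 by (rule thresholds_teval)
qed (use spos gauss bounded_T v_bounds range_T in auto)

text \<open>The innovation variance is an increment of \<xi>' over at least \<open>ep\<close>, hence
  at least \<xi>'' at its left end times \<open>ep\<close>; both are bounded below through
  monotonicity of \<xi>''. One factor \<open>1-kp\<close> comes from this deviation and one from the
  correlation.\<close>

theorem elim_bound:
"(\<Sum>a=1..<n. (1-kp)\<^sup>2 * sqrt (xi2 c (real (a-1)*ep))*(sqrt \<delta>*(LINT w|Q. \<Delta> a w*\<zeta> a w)))
 <= toy.elim c (%a. teval (T a)) (Suc n)"
proof -
interpret A: spin_algorithm c \<epsilon>0 T "Suc n" d "v ` {..K} \<union> {-1, 1}" P G by (rule spin_algorithm)
have AK: "A.Kl = KL" by (simp add: A.Kl_def[abs_def] A.Rl_def)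
\<comment> \<open>By the Markov form of the kernel, innovation \<open>a\<close> has the same
  covariance with the last point as with point \<open>a\<close>, so its regression coefficient is
  1.\<close>
have kl: "A.kl a = A.s a" if "1 <= a" "a < Suc n" for a
proof -
 have "A.kl a = (\<Sum>d\<le>a. innov KL a d*KL d (Suc n))" by (simp add: A.kl_def AK)
 also have "... = (\<Sum>d\<le>a. innov KL a d*KL (Suc n) d)" by (simp add: mult.commute[of "F (Suc n) _"])
 also have "... = A.s a" using KL(2)[of a "Suc n"] KL(2)[of a a] that by (simp add: icov_def AK)
 finally show ?thesis .
qed
have kl0: "A.kl 0 = 0" using F_product_zero[of "Suc n"] xi1_zero by (simp add: A.kl_def AK)
have tm: "A.kl a/sqrt (A.s a)*A.corr a = sqrt (A.s a)*A.corr a" if "1 <= a" "a < Suc n" for a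
 using A.s_pos[OF that(2)] kl[OF that] by (simp add: real_div_sqrt)
have "A.elim = (\<Sum>a=1..<Suc n. A.kl a/sqrt (A.s a)*A.corr a)"
 unfolding A.elim_def by (subst lessThan_atLeast0, subst sum.atLeast_Suc_lessThan) (simp_all add: kl0)
also have "... = (\<Sum>a=1..<Suc n. sqrt (A.s a)*A.corr a)" using tm by (intro sum.cong) auto
also have "... = (\<Sum>a=1..<n. sqrt (A.s a)*A.corr a)+sqrt (A.s n)*A.corr n" using kappa by simp
\<comment> \<open>The final rounding to signs contributes a nonnegative amount, which is
  dropped.\<close>
also have "... \<ge> (\<Sum>a=1..<n. sqrt (A.s a)*A.corr a)"
 using A.s_pos[of n] correlation_last by (simp add: A.corr_def mult.commute)
also have "(\<Sum>a=1..<n. sqrt (A.s a)*A.corr a) \<ge>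
  (\<Sum>a=1..<n. (1-kp)\<^sup>2 * sqrt (xi2 c (real (a-1)*ep))*(sqrt \<delta>*(LINT w|Q. \<Delta> a w*\<zeta> a w)))"
proof (rule sum_mono)
 fix a assume "a \<in> {1..<n}"
 hence a: "1 <= a" "a < n" by auto
 let ?r = "\<integral>w. \<Delta> a w*\<zeta> a w \<partial>Q" and ?p = "real (a-1)*ep"
 have q: "0 <= ?p" "?p <= q0 (a-1)" "q0 (a-1)+ep <= q0 a" "q0 a <= 1" "0 <= q0 (a-1)"
  using q0_bounds(2)[of "a-1"] a q0_lower[of "a-1"] q0_step[of "a-1"] q0_bounds(1)[of a] eps_pos by auto
 have "xi2 c ?p*ep <= xi2 c (q0 (a-1))*(q0 a-q0 (a-1))"
  using q eps_pos by (intro mult_mono xi2_mono xi2_nonneg) auto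
 also have "... <= xi1 c (q0 a)-xi1 c (q0 (a-1))" using q eps_pos by (intro xi1_increment) auto
 also have "... = A.s a" using KL(2)[of a a] a by (simp add: AK)
 finally have 1: "sqrt (xi2 c ?p*ep) <= sqrt (A.s a)" by (rule real_sqrt_le_mono)
 have 2: "sqrt (xi2 c ?p*ep) = (1-kp) * sqrt (xi2 c ?p) * sqrt \<delta>" using kappa by (simp add: real_sqrt_mult)
 have 3: "(1-kp)*?r <= A.corr a" using correlation[OF a] by (simp add: A.corr_def)
 have "(1-kp) * sqrt (xi2 c ?p) * sqrt \<delta>*((1-kp)*?r) <= sqrt (A.s a)*A.corr a"
  by (rule mult_mono[OF 1[unfolded 2] 3]) (use A.s_pos[of a] a kappa rho[OF a] in "auto intro!: mult_nonneg_nonneg")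
 thus "(1-kp)^2 * sqrt (xi2 c ?p)*(sqrt \<delta>*?r) <= sqrt (A.s a)*A.corr a" by (simp add: power2_eq_square mult_ac)
qed
finally show ?thesis .
qed

end

section \<open>Brownian motion and Ito integrals\<close>

locale brownian = prob_space Q for Q :: "'a measure" +
fixes B :: "real => 'a => real"
assumes brownian: "standard_brownian_motion Q B"
begin

abbreviation "Ft \<equiv> brownian_filtration Q B"

lemma B_meas: "0 <= t ==> t <= 1 ==> B t \<in> bm Q"
and B_zero: "w \<in> space Q ==> B 0 w = 0"
and B_incr: "0 <= s ==> s < t ==> t <= 1 ==>
 distributed Q lborel (%w. B t w-B s w) (normal_density 0 (sqrt (t-s)))"
and B_indep: "0 <= \<tau> 0 ==> (\<And>i. i < n ==> \<tau> i < \<tau> (Suc i)) ==> \<tau> n <= 1 ==>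
 indep_vars (%_. borel) (%i w. B (\<tau> (Suc i)) w-B (\<tau> i) w) {..<n}"
using brownian unfolding standard_brownian_motion_def by auto

lemma Ft_gen: "{B r -` A \<inter> space Q | r A. r \<in> {0..t} & A \<in> sets borel} \<union> null_sets Q \<subseteq> Pow (space Q)"
using sets.sets_into_space by (auto simp: null_sets_def)

lemma space_Ft [simp]: "space (Ft t) = space Q"
unfolding brownian_filtration_def by (rule space_measure_of[OF Ft_gen])

lemma sets_Ft: "sets (Ft t) = sigma_sets (space Q) ({B r -` A \<inter> space Q | r A. r \<in> {0..t} & A \<in> sets borel} \<union> null_sets Q)"
unfolding brownian_filtration_def by (rule sets_measure_of[OF Ft_gen])

lemma Ft_sub: "t <= 1 ==> sets (Ft t) \<subseteq> events"
unfolding sets_Ft using B_meas by (intro sets.sigma_sets_subset) (auto intro: measurable_sets)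

lemma Ft_mono: "s <= t ==> sets (Ft s) \<subseteq> sets (Ft t)"
proof -
assume "s <= t"
hence "{0..s} \<subseteq> {0..t}" by auto
thus ?thesis unfolding sets_Ft by (intro sigma_sets_mono' Un_mono order_refl) blast
qed

lemma Ft_meas: "Y \<in> bm (Ft t) ==> t <= 1 ==> Y \<in> bm Q"
using Ft_sub[of t] by (auto simp: measurable_def)

lemma Ft_meas_mono: "Y \<in> bm (Ft s) ==> s <= t ==> Y \<in> bm (Ft t)"
using Ft_mono[of s t] by (auto simp: measurable_def)

lemma B_Ft: "0 <= s ==> s <= t ==> B s \<in> bm (Ft t)"
by (rule measurableI) (auto simp: sets_Ft intro!: sigma_sets.Basic)

text \<open>Sorting 0, \<open>s\<close> and the times in \<open>S\<close>, and appending
  \<open>t\<close>, makes the past values partial sums of the first increments and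
  \<open>B t - B s\<close> the last increment.\<close>

lemma past_indep:
assumes s: "0 <= s" "s < t" "t <= 1" and S: "finite S" "S \<subseteq> {0..s}"
 and A: "\<And>r. A r \<in> sets borel" and D: "D \<in> sets borel"
shows "prob ({z \<in> space Q. \<forall>r\<in>S. B r z \<in> A r} \<inter> {z \<in> space Q. B t z-B s z \<in> D}) =
 prob {z \<in> space Q. \<forall>r\<in>S. B r z \<in> A r}*prob {z \<in> space Q. B t z-B s z \<in> D}"
proof -
define xs where "xs = sorted_list_of_set (insert 0 (insert s S))"
have fin: "finite (insert 0 (insert s S))" using S by simp
have xs: "set xs = insert 0 (insert s S)" "sorted_wrt (<) xs"
 unfolding xs_def using set_sorted_list_of_set[OF fin] sorted_list_of_set.strict_sorted_key_list_of_set by auto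
define n where "n = length xs"
have n: "0 < n" using xs(1) by (auto simp: n_def)
define \<tau> where "\<tau> i = (if i < n then xs ! i else t)" for i
have lt: "xs ! i < xs ! j" if "i < j" "j < n" for i j
 using sorted_wrt_nth_less[OF xs(2)] that by (auto simp: n_def)
have le: "xs ! i \<in> {0..s}" if "i < n" for i
 using nth_mem[of i xs] that xs(1) S s by (auto simp: n_def)
have ex: "\<exists>i<n. xs ! i = r" if "r \<in> insert 0 (insert s S)" for r
 using that unfolding xs(1)[symmetric] in_set_conv_nth n_def by auto
obtain i0 where i0: "i0 < n" "xs ! i0 = 0" using ex by blast
obtain i1 where i1: "i1 < n" "xs ! i1 = s" using ex by blast
have t0: "\<tau> 0 = 0" using i0 lt[of 0 i0] le[OF n] n by (cases "i0 = 0") (auto simp: \<tau>_def)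
have ts: "\<tau> (n-1) = s" 
proof -
 have "xs ! (n-1) <= s" using le[of "n-1"] n by simp
 hence "\<not> i1 < n-1" using lt[of i1 "n-1"] n i1(2) by linarith
 hence "i1 = n-1" using i1(1) by linarith
 thus ?thesis using i1 by (simp add: \<tau>_def)
qed
have tn: "\<tau> n = t" by (simp add: \<tau>_def)
have inc: "\<tau> i < \<tau> (Suc i)" if "i < n" for i
 using lt[of i "Suc i"] le[of i] that s by (auto simp: \<tau>_def)
have ind: "indep_vars (%_. borel) (%i z. B (\<tau> (Suc i)) z-B (\<tau> i) z) {..<n}"
 by (rule B_indep) (use t0 tn inc s in auto)
let ?P = "\<Pi>\<^sub>M i\<in>{..<n-1}. (borel :: real measure)" and ?r = "%T z. restrict (%i. B (\<tau> (Suc i)) z-B (\<tau> i) z) T"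
let ?D = "(%y. y (n-1)) -` D \<inter> space (\<Pi>\<^sub>M i\<in>{n-1}. (borel :: real measure))"
let ?C = "{z \<in> space Q. \<forall>r\<in>S. B r z \<in> A r}" and ?G = "{z \<in> space Q. B t z-B s z \<in> D}"
define E where "E = {y \<in> space ?P. \<forall>i<n. xs ! i \<in> S --> (\<Sum>j<i. y j) \<in> A (xs ! i)}"
have E: "E \<in> sets ?P"
proof -
 have "(%y. \<Sum>j<i. y j :: real) \<in> bm ?P" if "i < n" for i
  using that by (intro borel_measurable_sum measurable_component_singleton) auto
 from measurable_sets[OF this A]
 have "{y \<in> space ?P. (\<Sum>j<i. y j) \<in> A (xs ! i)} \<in> sets ?P" if "i < n" for i
  using that by (simp add: vimage_def Int_def conj_commute)
 hence "{y \<in> space ?P. \<forall>i\<in>{i. i < n & xs ! i \<in> S}. (\<Sum>j<i. y j) \<in> A (xs ! i)} \<in> sets ?P"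
  by (intro sets.sets_Collect_finite_All) auto
 also have "{y \<in> space ?P. \<forall>i\<in>{i. i < n & xs ! i \<in> S}. (\<Sum>j<i. y j) \<in> A (xs ! i)} = E" unfolding E_def by blast
 finally show ?thesis .
qed
have D': "?D \<in> sets (\<Pi>\<^sub>M i\<in>{n-1}. borel)"
 by (rule measurable_sets[OF _ D]) (rule measurable_component_singleton, simp)
have sum: "(\<Sum>j<i. B (\<tau> (Suc j)) z-B (\<tau> j) z) = B (\<tau> i) z" if "z \<in> space Q" for i z
 using sum_lessThan_telescope[of "%j. B (\<tau> j) z" i] that by (simp add: t0 B_zero)
have e1: "?r {..<n-1} -` E \<inter> space Q = ?C"
proof -
 have "(?r {..<n-1} z \<in> E) \<longleftrightarrow> (\<forall>r\<in>S. B r z \<in> A r)" if w: "z \<in> space Q" for z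
 proof -
  have "(\<Sum>j<i. ?r {..<n-1} z j) = B (xs ! i) z" if "i < n" for i
  proof -
   have "(\<Sum>j<i. ?r {..<n-1} z j) = (\<Sum>j<i. B (\<tau> (Suc j)) z-B (\<tau> j) z)"
    using that by (intro sum.cong) auto
   thus ?thesis unfolding sum[OF w] using that by (simp add: \<tau>_def)
  qed
  hence "(?r {..<n-1} z \<in> E) \<longleftrightarrow> (\<forall>i<n. xs ! i \<in> S --> B (xs ! i) z \<in> A (xs ! i))"
   by (simp add: E_def space_PiM)
  also have "... \<longleftrightarrow> (\<forall>r\<in>S. B r z \<in> A r)" using ex by blast
  finally show ?thesis .
 qed
 thus ?thesis by auto
qed
have e2: "?r {n-1} -` ?D \<inter> space Q
 = ?G"
 using n ts tn by (auto simp: space_PiM)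
have "prob ((%z. (?r {..<n-1} z, ?r {n-1} z)) -`
  (E \<times> ?D) \<inter> space Q) =
 prob ?C*prob ?G"
 unfolding e1[symmetric] e2[symmetric]
 by (rule indep_varD[OF indep_var_restrict[OF ind] E D']) (use n in auto)
moreover have "(%z. (?r {..<n-1} z, ?r {n-1} z)) -`
  (E \<times> ?D) \<inter> space Q =
 ?C \<inter> ?G"
 unfolding e1[symmetric] e2[symmetric] by auto
ultimately show ?thesis by simp
qed

text \<open>Events that agree almost surely with a finite cylinder form an intersection-stable class
  \<open>U\<close>. It contains the generators of the augmented filtration, null sets included, and
  independence extends to the generated sigma-algebra.\<close>

lemma Ft_indep:
assumes s: "0 <= s" "s < t" "t <= 1" and Y: "Y \<in> bm (Ft s)"
shows "indep_var borel Y borel (%w. B t w-B s w)"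
proof -
let ?D = "{(%w. B t w-B s w) -` D \<inter> space Q | D. D \<in> sets borel}"
define U where "U = {G \<in> events. \<exists>S A. finite S & S \<subseteq> {0..s} & (\<forall>r. A r \<in> sets borel) &
 (AE w in Q. w \<in> G \<longleftrightarrow> (\<forall>r\<in>S. B r w \<in> A r))}"
have Bt: "(%w. B t w-B s w) \<in> bm Q"
 using B_meas s by (intro borel_measurable_diff) auto
have UI: "G \<in> U" if "G \<in> events" "finite S" "S \<subseteq> {0..s}" "\<And>r. A r \<in> sets borel" "AE w in Q. w \<in> G \<longleftrightarrow> (\<forall>r\<in>S. B r w \<in> A r)" for G S A
 unfolding U_def using that by blast
have U: "U \<subseteq> events" unfolding U_def by auto
have "Int_stable U"
proof (rule Int_stableI)
 fix G H assume "G \<in> U" "H \<in> U"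
 then obtain S A S' A' where g: "G \<in> events" "finite S" "S \<subseteq> {0..s}" "\<And>r. A r \<in> sets borel" "AE w in Q. w \<in> G \<longleftrightarrow> (\<forall>r\<in>S. B r w \<in> A r)"
  "H \<in> events" "finite S'" "S' \<subseteq> {0..s}" "\<And>r. A' r \<in> sets borel" "AE w in Q. w \<in> H \<longleftrightarrow> (\<forall>r\<in>S'. B r w \<in> A' r)"
  unfolding U_def by blast
 show "G \<inter> H \<in> U"
 proof (rule UI[of _ "S \<union> S'" "%r. (if r \<in> S then A r else UNIV) \<inter> (if r \<in> S' then A' r else UNIV)"])
  show "AE w in Q. w \<in> G \<inter> H \<longleftrightarrow> (\<forall>r\<in>S \<union> S'. B r w \<in> (if r \<in> S then A r else UNIV) \<inter> (if r \<in> S' then A' r else UNIV))"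
   using g(5,10) by eventually_elim auto
  show "(if r \<in> S then A r else UNIV) \<inter> (if r \<in> S' then A' r else UNIV) \<in> sets borel" for r using g(4,9) by auto
 qed (use g in auto)
qed
moreover have "Int_stable ?D"
proof (rule Int_stableI)
 fix a b assume "a \<in> ?D" "b \<in> ?D"
 then obtain D D' where "a = (%w. B t w-B s w) -` D \<inter> space Q" "b = (%w. B t w-B s w) -` D' \<inter> space Q" "D \<in> sets borel" "D' \<in> sets borel" by blast
 thus "a \<inter> b \<in> ?D" by (intro CollectI exI[of _ "D \<inter> D'"]) auto
qed
moreover have "indep_set U ?D"
proof (rule indep_setI)
 show "U \<subseteq> events" by (rule U)
 show "?D \<subseteq> events" using measurable_sets[OF Bt] by blast
 fix G b assume "G \<in> U" "b \<in> ?D"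
 then obtain S A D where g: "G \<in> events" "finite S" "S \<subseteq> {0..s}" "\<And>r. A r \<in> sets borel" "AE w in Q. w \<in> G \<longleftrightarrow> (\<forall>r\<in>S. B r w \<in> A r)"
  and D: "D \<in> sets borel" "b = (%w. B t w-B s w) -` D \<inter> space Q" unfolding U_def by blast
 let ?C = "{w \<in> space Q. \<forall>r\<in>S. B r w \<in> A r}"
 have C: "?C \<in> events"
 proof (rule sets.sets_Collect_finite_All[OF _ g(2)])
  show "{w \<in> space Q. B r w \<in> A r} \<in> events" if "r \<in> S" for r
   using measurable_sets[OF B_meas g(4), of r r] that g(3) s by (auto simp: vimage_def Int_def conj_commute)
 qed
 have b: "b = {w \<in> space Q. B t w-B s w \<in> D}" "b \<in> events" using D measurable_sets[OF Bt D(1)] by auto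
 have "prob G = prob ?C" by (rule measure_eq_AE[OF _ g(1) C]) (use g(5) AE_space in eventually_elim, auto)
 moreover have "prob (G \<inter> b) = prob (?C \<inter> b)"
  by (rule measure_eq_AE) (use g(5) AE_space in eventually_elim, use g(1) C b in auto)
 ultimately show "prob (G \<inter> b) = prob G*prob b"
  using past_indep[OF s g(2,3,4) D(1)] b(1) by simp
qed
ultimately have ind: "indep_set (sigma_sets (space Q) U) (sigma_sets (space Q) ?D)"
 by (intro indep_set_sigma_sets)
have "sets (Ft s) \<subseteq> sigma_sets (space Q) U" unfolding sets_Ft
proof (rule sigma_sets_mono', safe)
 fix r A assume r: "r \<in> {0..s}" "A \<in> sets (borel :: real measure)"
 show "B r -` A \<inter> space Q \<in> U"
  by (rule UI[of _ "{r}" "%_. A"]) (use r s measurable_sets[OF B_meas r(2)] in "auto intro: AE_I2")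
next
 fix N assume N: "N \<in> null_sets Q"
 show "N \<in> U"
  by (rule UI[of _ "{0}" "%_. {}"]) (use N s AE_not_in[OF N] in auto)
qed
hence Ysub: "{Y -` A \<inter> space Q | A. A \<in> sets borel} \<subseteq> sigma_sets (space Q) U"
 using measurable_sets[OF Y] by auto
have Y': "Y \<in> bm Q" using Ft_meas[OF Y] s by simp
have "indep_set {Y -` A \<inter> space Q | A. A \<in> sets borel} ?D"
proof (rule indep_setI)
 show "{Y -` A \<inter> space Q | A. A \<in> sets borel} \<subseteq> events" using measurable_sets[OF Y'] by blast
 show "?D \<subseteq> events" using measurable_sets[OF Bt] by blast
 show "prob (a \<inter> b) = prob a*prob b" if "a \<in> {Y -` A \<inter> space Q | A. A \<in> sets borel}" "b \<in> ?D" for a b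
  by (rule indep_setD[OF ind subsetD[OF Ysub that(1)] sigma_sets.Basic[OF that(2)]])
qed
moreover have "Int_stable {Y -` A \<inter> space Q | A. A \<in> sets borel}"
proof (rule Int_stableI)
 fix a b assume "a \<in> {Y -` A \<inter> space Q | A. A \<in> sets borel}" "b \<in> {Y -` A \<inter> space Q | A. A \<in> sets borel}"
 then obtain D D' where "a = Y -` D \<inter> space Q" "b = Y -` D' \<inter> space Q" "D \<in> sets borel" "D' \<in> sets borel" by blast
 thus "a \<inter> b \<in> {Y -` A \<inter> space Q | A. A \<in> sets borel}" by (intro CollectI exI[of _ "D \<inter> D'"]) auto
qed
ultimately have "indep_set (sigma_sets (space Q) {Y -` A \<inter> space Q | A. A \<in> sets borel}) (sigma_sets (space Q) ?D)"
 using `Int_stable ?D` by (rule indep_set_sigma_sets)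
thus ?thesis unfolding indep_var_eq using Y' Bt by blast
qed

end

text \<open>Cauchy-Schwarz for the pairing of \<open>X l - Y\<close> with \<open>Z\<close>. As
  \<open>X l\<close> and \<open>Y\<close> are only known to be measurable, finiteness is first
  obtained in the extended reals, for large \<open>l\<close>.\<close>

lemma L2_limit:
assumes M: "\<And>l. X l \<in> bm M" "Y \<in> bm M" "Z \<in> bm M"
 and lim: "(%l::nat. \<integral>\<^sup>+x. ennreal ((X l x-Y x)^2) \<partial>M) \<longlonglongrightarrow> 0"
 and Z: "integrable M (%x. (Z x)\<^sup>2)" and XZ: "\<And>l. integrable M (%x. X l x*Z x)"
shows "integrable M (%x. Y x*Z x :: real)" "(%l. \<integral>x. X l x*Z x \<partial>M) \<longlonglongrightarrow> (LINT x|M. Y x*Z x)"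
proof -
note M[measurable]
define a where "a l = (\<integral>\<^sup>+x. ennreal ((X l x-Y x)^2) \<partial>M)" for l
define z where "z = (\<integral>\<^sup>+x. ennreal ((Z x)^2) \<partial>M)"
have z: "z < \<infinity>" using Z unfolding z_def integrable_iff_bounded by simp
define e where "e l = (\<integral>\<^sup>+x. ennreal \<bar>(X l x-Y x)*Z x\<bar> \<partial>M)" for l
have e: "(e l)^2 <= a l*z" for l
proof -
 have "e l = (\<integral>\<^sup>+x. ennreal \<bar>X l x-Y x\<bar>*ennreal \<bar>Z x\<bar> \<partial>M)" unfolding e_def by (simp add: abs_mult ennreal_mult)
 hence "(e l)^2 <= (\<integral>\<^sup>+x. (ennreal \<bar>X l x-Y x\<bar>)\<^sup>2 \<partial>M)*(\<integral>\<^sup>+x. (ennreal \<bar>Z x\<bar>)\<^sup>2 \<partial>M)"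
  using Cauchy_Schwarz_nn_integral[of "%x. ennreal \<bar>X l x-Y x\<bar>" M "%x. ennreal \<bar>Z x\<bar>"] by simp
 thus ?thesis unfolding a_def z_def by (simp add: ennreal_power)
qed
have "eventually (%l. a l < \<infinity>) sequentially"
 using order_tendstoD(2)[OF lim, of \<infinity>] unfolding a_def by simp
hence fin: "eventually (%l. e l < \<infinity>) sequentially"
proof eventually_elim
 case (elim l)
 hence "(e l)^2 < \<infinity>" using e[of l] z by (metis ennreal_mult_less_top le_less_trans infinity_ennreal_def)
 thus ?case by (auto simp: power2_eq_square ennreal_mult_less_top)
qed
have diff: "integrable M (%x. (X l x-Y x)*Z x)" if "e l < \<infinity>" for l
 using that unfolding e_def integrable_iff_bounded by simp
obtain l0 where "e l0 < \<infinity>" using fin unfolding eventually_sequentially by blast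
have "integrable M (%x. X l0 x*Z x-(X l0 x-Y x)*Z x)"
 by (rule Bochner_Integration.integrable_diff[OF XZ diff[OF `e l0 < \<infinity>`]])
thus YZ: "integrable M (%x. Y x*Z x)" by (simp add: algebra_simps)
have "(%l. enn2real (a l*z)) \<longlonglongrightarrow> enn2real (0*z)"
proof (rule tendsto_enn2real)
 show "(%l. a l*z) \<longlonglongrightarrow> ennreal (enn2real (0*z))"
  using tendsto_mult_ennreal[OF lim tendsto_const[of z]] z unfolding a_def by simp
qed simp
from tendsto_real_sqrt[OF this]
have s0: "(%l. sqrt (enn2real (a l*z))) \<longlonglongrightarrow> 0" by simp
have "eventually (%l. norm ((LINT x|M. X l x*Z x)-(LINT x|M. Y x*Z x)) <= sqrt (enn2real (a l*z))) sequentially"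
 using fin `eventually (%l. a l < \<infinity>) sequentially`
proof eventually_elim
 case (elim l)
 have "(LINT x|M. X l x*Z x)-(LINT x|M. Y x*Z x) = (LINT x|M. (X l x-Y x)*Z x)"
  using XZ YZ by (simp add: left_diff_distrib)
 also have "norm ... <= (LINT x|M. \<bar>(X l x-Y x)*Z x\<bar>)" using integral_norm_bound[of M "%x. (X l x-Y x)*Z x"] by simp
 also have "... = enn2real (e l)" unfolding e_def by (rule integral_eq_nn_integral) auto
 also have "... = sqrt ((enn2real (e l))^2)" by simp
 also have "(enn2real (e l))^2 = enn2real ((e l)^2)" by (simp add: power2_eq_square enn2real_mult)
 also have "sqrt ... <= sqrt (enn2real (a l*z))"
  using e[of l] elim(2) z by (intro real_sqrt_le_mono enn2real_mono) (auto simp: ennreal_mult_less_top)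
 finally show ?case .
qed
hence "(%l. (LINT x|M. X l x*Z x)-(LINT x|M. Y x*Z x)) \<longlonglongrightarrow> 0"
 by (rule Lim_null_comparison[OF _ s0])
thus "(%l. \<integral>x. X l x*Z x \<partial>M) \<longlonglongrightarrow> (LINT x|M. Y x*Z x)" by (simp add: LIM_zero_iff)
qed

lemma Nd_square: "integrable Nd (%z. z\<^sup>2)" "(LINT z|Nd. z\<^sup>2) = 1"
proof -
note D = prob_space.iid_normalD[OF prob_space_gaus iid_gaus UNIV_I, of "(0, 0)"]
have m: "(%z::real. z\<^sup>2) \<in> bm borel" by simp
show "integrable Nd (%z. z\<^sup>2)" by (rule iffD1[OF integral_gaus_coord(1)[OF m] D(7)])
show "(LINT z|Nd. z\<^sup>2) = 1" by (rule trans[OF integral_gaus_coord(2)[OF m, symmetric] D(6)])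
qed

context brownian
begin

lemma Ft_normal:
fixes Y :: "'a => real" and h :: "real => real"
assumes s: "0 <= s" "s < t" "t <= 1" and Y: "Y \<in> bm (Ft s)" "integrable Q Y"
 and h: "h \<in> bm borel" "integrable Nd h"
shows "integrable Q (%w. Y w*h ((B t w-B s w)/sqrt (t-s)))"
 "(LINT w|Q. Y w*h ((B t w-B s w)/sqrt (t-s))) = (LINT w|Q. Y w)*(LINT z|Nd. h z)"
proof -
let ?z = "%w. (B t w-B s w)/sqrt (t-s)"
have z: "?z \<in> bm Q"
 by (intro borel_measurable_divide borel_measurable_diff B_meas borel_measurable_const) (use s in auto)
have "distributed Q lborel (%w. ((B t w-B s w)-0)/sqrt (t-s)) std_normal_density"
 using B_incr[OF s] by (subst normal_standard_normal_convert[symmetric]) (use s in auto)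
hence "distr Q lborel ?z = Nd" using distributed_distr_eq_density by simp
hence d: "distr Q borel ?z = Nd" by (simp cong: distr_cong add: distr_def)
have hz: "integrable Q (%w. h (?z w))" "(LINT w|Q. h (?z w)) = (LINT z|Nd. h z)"
 using integrable_distr_eq[OF z h(1)] integral_distr[OF z h(1)] h(2) unfolding d by auto
have m: "(%x. h (x/sqrt (t-s))) \<in> bm borel" using h(1) by simp
have "indep_var borel ((%x. x) \<circ> Y) borel ((%x. h (x/sqrt (t-s))) \<circ> (%w. B t w-B s w))"
 by (rule indep_var_compose[OF Ft_indep[OF s Y(1)] _ m]) simp
hence i: "indep_var borel Y borel (%w. h (?z w))" by (simp add: o_def)
show "integrable Q (%w. Y w*h (?z w))" by (rule indep_var_integrable[OF i Y(2) hz(1)])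
show "(LINT w|Q. Y w*h (?z w)) = (LINT w|Q. Y w)*(LINT z|Nd. h z)"
 using indep_var_lebesgue_integral[OF i Y(2) hz(1)] hz(2) by simp
qed

lemma Ft_noise: "0 <= s ==> s < t ==> t <= 1 ==> noise Q (Ft s) (%w. (B t w-B s w)/sqrt (t-s))"
proof (intro noise.intro noise_axioms.intro conjI prob_space_axioms)
assume s: "0 <= s" "s < t" "t <= 1"
show "(Y :: 'a => real) \<in> bm Q" if "Y \<in> bm (Ft s)" for Y
 using Ft_meas[OF that] s by simp
show "(%w. (B t w-B s w)/sqrt (t-s)) \<in> bm Q"
 by (intro borel_measurable_divide borel_measurable_diff B_meas borel_measurable_const) (use s in auto)
fix Y :: "'a => real" and h :: "real => real" and k :: real
assume Y: "Y \<in> bm (Ft s)" "\<And>w. \<bar>Y w\<bar> <= k" and h: "h \<in> bm borel" "integrable Nd h"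
have "integrable Q Y" by (rule integrable_const_bound[of _ k]) (use Y Ft_meas[OF Y(1)] s in auto)
from Ft_normal[OF s Y(1) this h] show "integrable Q (%w. Y w*h ((B t w-B s w)/sqrt (t-s)))"
 "(LINT w|Q. Y w*h ((B t w-B s w)/sqrt (t-s))) = (LINT w|Q. Y w)*(LINT z|Nd. h z)" by auto
qed

lemma Ft_moments:
assumes s: "0 <= s" "s <= t" "t <= 1" and Y: "Y \<in> bm (Ft s)" "integrable Q Y"
shows "integrable Q (%w. Y w*(B t w-B s w))" "(LINT w|Q. Y w*(B t w-B s w)) = 0"
 "integrable Q (%w. Y w*(B t w-B s w)^2)" "(LINT w|Q. Y w*(B t w-B s w)^2) = (LINT w|Q. Y w)*(t-s)"
proof -
have "integrable Q (%w. Y w*(B t w-B s w)) & (LINT w|Q. Y w*(B t w-B s w)) = 0 &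
 integrable Q (%w. Y w*(B t w-B s w)^2) & (LINT w|Q. Y w*(B t w-B s w)^2) = (LINT w|Q. Y w)*(t-s)"
\<comment> \<open>Coinciding times have no normalised increment; all four claims are then
  trivial.\<close>
proof (cases "s = t")
 case False
 hence st: "s < t" using s by simp
 have m: "(%z::real. z) \<in> bm borel" "(%z::real. z\<^sup>2) \<in> bm borel" by simp_all
 note a = Ft_normal[OF s(1) st s(3) Y m(1) Nd_moments(1)] and b = Ft_normal[OF s(1) st s(3) Y m(2) Nd_square(1)]
 have p: "0 < sqrt (t-s)" using st by simp
 have e: "Y w*(B t w-B s w) = sqrt (t-s)*(Y w*((B t w-B s w)/sqrt (t-s)))"
  "Y w*(B t w-B s w)^2 = (t-s)*(Y w*((B t w-B s w)/sqrt (t-s))^2)" for w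
  using p st by (simp_all add: power_divide)
 show ?thesis unfolding e
  by (intro conjI integrable_mult_right a(1) b(1)) (unfold integral_mult_right_zero a(2) b(2) Nd_moments(2) Nd_square(2), simp_all)
qed simp
thus "integrable Q (%w. Y w*(B t w-B s w))" "(LINT w|Q. Y w*(B t w-B s w)) = 0"
 "integrable Q (%w. Y w*(B t w-B s w)^2)" "(LINT w|Q. Y w*(B t w-B s w)^2) = (LINT w|Q. Y w)*(t-s)"
 by blast+
qed

end

text \<open>The increment over \<open>{s..t}\<close> of the integral of a simple integrand; \<open>c x\<close> is the projection
  of \<open>x\<close> to \<open>{s..t}\<close>.\<close>

locale simple_increment = brownian Q B for Q :: "'a measure" and B +
fixes n :: nat and \<tau> :: "nat => real" and et :: "nat => 'a => real" and s t :: real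
assumes simple: "simple_integrand Q B n \<tau> et" and st: "0 <= s" "s <= t" "t <= 1"
begin

definition c :: "real => real" where "c x = max s (min t x)"

abbreviation "a i \<equiv> c (\<tau> i)"

definition D :: "'a => real" where "D w = simple_integral B n \<tau> et t w-simple_integral B n \<tau> et s w"

lemma a: "0 <= a i" "s <= a i" "a i <= t" "a i <= 1" "i < n ==> a i <= a (Suc i)"
using st simple unfolding c_def simple_integrand_def by (auto simp: max_def min_def)

lemma D_eq: "D w = (\<Sum>i<n. et i w*(B (a (Suc i)) w-B (a i) w))"
proof -
have e: "B (min t x) w-B (min s x) w = B (c x) w-B s w" for x
 using st by (auto simp: c_def max_def min_def)
have "(B (min t x) w-B (min t y) w)-(B (min s x) w-B (min s y) w) = B (c x) w-B (c y) w" for x y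
 using e[of x] e[of y] by linarith
thus ?thesis unfolding D_def simple_integral_def sum_subtractf[symmetric] right_diff_distrib[symmetric] by simp
qed

lemma eta:
assumes "i < n" shows "et i \<in> bm Q" "\<exists>k. \<forall>w\<in>space Q. \<bar>et i w\<bar> <= k" "integrable Q (et i)"
 "a i < a (Suc i) ==> et i \<in> bm (Ft (a i))"
proof -
have m: "et i \<in> bm (Ft (\<tau> i))" and b: "\<exists>k. \<forall>w\<in>space Q. \<bar>et i w\<bar> <= k" and n: "\<tau> n = 1" and mono: "\<And>i. i < n ==> \<tau> i < \<tau> (Suc i)"
 using simple assms unfolding simple_integrand_def by auto
have "\<tau> i <= \<tau> n"
proof (rule inc_induct[of i n "%j. \<tau> j <= \<tau> n"])
 show "\<tau> m <= \<tau> n" if "i <= m" "m < n" "\<tau> (Suc m) <= \<tau> n" for m using mono[OF that(2)] that(3) by simp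
qed (use assms in auto)
thus q: "et i \<in> bm Q" using Ft_meas[OF m] n by simp
show "\<exists>k. \<forall>w\<in>space Q. \<bar>et i w\<bar> <= k" by (rule b)
then obtain k where "\<forall>w\<in>space Q. \<bar>et i w\<bar> <= k" by blast
thus "integrable Q (et i)" by (intro integrable_const_bound[of _ k]) (use q in auto)
show "et i \<in> bm (Ft (a i))" if "a i < a (Suc i)"
proof (rule Ft_meas_mono[OF m])
 show "\<tau> i <= a i" using that mono[OF assms] by (auto simp: c_def max_def min_def split: if_splits)
qed
qed

lemma tau: "i <= n ==> 0 <= \<tau> i"
proof (induction i)
case 0
thus ?case using simple unfolding simple_integrand_def by simp
next
case (Suc i)
hence "\<tau> i < \<tau> (Suc i)" using simple unfolding simple_integrand_def by simp
thus ?case using Suc by simp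
qed

lemma integral_meas: "0 <= r ==> r <= 1 ==> simple_integral B n \<tau> et r \<in> bm Q"
unfolding simple_integral_def[abs_def] using eta(1) tau
by (intro borel_measurable_sum borel_measurable_times borel_measurable_diff B_meas) auto

lemma integral_zero: "simple_integral B n \<tau> et 0 w = 0"
unfolding simple_integral_def using tau by (intro sum.neutral) (simp add: min_def)

lemma D_meas: "D \<in> bm Q"
unfolding D_eq[abs_def] using eta(1) B_meas a by (intro borel_measurable_sum borel_measurable_times borel_measurable_diff) auto

lemma term_past:
assumes i: "i < n" and Y: "Y \<in> bm (Ft (a i))" "integrable Q (%w. Y w*et i w)"
shows "integrable Q (%w. Y w*(et i w*(B (a (Suc i)) w-B (a i) w)))"
 "(LINT w|Q. Y w*(et i w*(B (a (Suc i)) w-B (a i) w))) = 0"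
proof -
have "integrable Q (%w. Y w*et i w*(B (a (Suc i)) w-B (a i) w)) & (LINT w|Q. Y w*et i w*(B (a (Suc i)) w-B (a i) w)) = 0"
proof (cases "a i < a (Suc i)")
 case True
 hence "(%w. Y w*et i w) \<in> bm (Ft (a i))" using eta(4)[OF i] Y(1) by simp
 from Ft_moments(1,2)[OF a(1) a(5)[OF i] a(4) this Y(2)] show ?thesis by simp
next
 case False
 hence "a (Suc i) = a i" using a(5)[OF i] by simp
 thus ?thesis by simp
qed
thus "integrable Q (%w. Y w*(et i w*(B (a (Suc i)) w-B (a i) w)))"
 "(LINT w|Q. Y w*(et i w*(B (a (Suc i)) w-B (a i) w))) = 0" by (simp_all add: mult.assoc)
qed

lemma bounded_mult:
assumes "i < n" "integrable Q Z" shows "integrable Q (%w. Z w*et i w :: real)"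
proof -
obtain k where k: "\<forall>w\<in>space Q. \<bar>et i w\<bar> <= k" using eta(2)[OF assms(1)] by blast
have "integrable Q (%w. k*Z w)" using assms(2) by simp
thus ?thesis
proof (rule int_bound)
 show "(%w. Z w*et i w) \<in> bm Q" using eta(1)[OF assms(1)] assms(2) by simp
 show "AE w in Q. norm (Z w*et i w) <= norm (k*Z w)"
 proof (rule AE_I2)
  fix w assume "w \<in> space Q"
  hence "\<bar>et i w\<bar> <= \<bar>k\<bar>" using k by fastforce
  from mult_right_mono[OF this abs_ge_zero[of "Z w"]] show "norm (Z w*et i w) <= norm (k*Z w)"
   by (simp add: abs_mult mult.commute)
 qed
qed
qed

lemma past:
assumes Y: "Y \<in> bm (Ft s)" "integrable Q Y"
shows "integrable Q (%w. D w*Y w)" "(LINT w|Q. D w*Y w) = 0"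
proof -
note p = term_past[OF _ Ft_meas_mono[OF Y(1) a(2)] bounded_mult[OF _ Y(2)]]
have e: "D w*Y w = (\<Sum>i<n. Y w*(et i w*(B (a (Suc i)) w-B (a i) w)))" for w
 unfolding D_eq by (simp add: sum_distrib_left mult.commute)
show "integrable Q (%w. D w*Y w)" unfolding e using p(1) by (intro Bochner_Integration.integrable_sum) auto
show "(LINT w|Q. D w*Y w) = 0" unfolding e using p by (subst int_sum) auto
qed

lemma covariance:
"integrable Q (%w. D w*(B t w-B s w))"
"(LINT w|Q. D w*(B t w-B s w)) = (\<Sum>i<n. (LINT w|Q. et i w)*(a (Suc i)-a i))"
proof -
let ?t = "%i w. et i w*(B (a (Suc i)) w-B (a i) w)*(B t w-B s w)"
have one: "integrable Q (?t i) & (LINT w|Q. ?t i w) = (LINT w|Q. et i w)*(a (Suc i)-a i)" if i: "i < n" for i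
proof (cases "a i < a (Suc i)")
 case True
 note ii = a(5)[OF i]
 have c1: "(%_. 1 :: real) \<in> bm (Ft r)" "integrable Q (%_. 1 :: real)" for r by simp_all
 have ba: "(%w. B (a i) w-B s w) \<in> bm (Ft (a i))" using a st by (intro borel_measurable_diff B_Ft) auto
 have bi: "integrable Q (%w. B (a i) w-B s w)" using Ft_moments(1)[OF st(1) a(2) a(4) c1] by simp
 note p1 = term_past[OF i ba bounded_mult[OF i bi]]
 note p2 = Ft_moments(3,4)[OF a(1) ii a(4) eta(4)[OF i True] eta(3)[OF i]]
 have m3: "(%w. et i w*(B (a (Suc i)) w-B (a i) w)) \<in> bm (Ft (a (Suc i)))"
  using a ii by (intro borel_measurable_times Ft_meas_mono[OF eta(4)[OF i True]] borel_measurable_diff B_Ft) auto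
 note p3 = Ft_moments(1,2)[OF a(1) a(3) st(3) m3 Ft_moments(1)[OF a(1) ii a(4) eta(4)[OF i True] eta(3)[OF i]]]
 \<comment> \<open>\<open>B t - B s\<close> is split at the ends of the block: the part before is
   past, the part inside contributes the variance, the part after is future.\<close>
 have e: "?t i w = (B (a i) w-B s w)*(et i w*(B (a (Suc i)) w-B (a i) w))+et i w*(B (a (Suc i)) w-B (a i) w)^2
  +et i w*(B (a (Suc i)) w-B (a i) w)*(B t w-B (a (Suc i)) w)" for w
  by (simp add: algebra_simps power2_eq_square)
 show ?thesis unfolding e using p1 p2 p3 by simp
next
 case False
 hence "a (Suc i) = a i" using a(5)[OF i] by simp
 thus ?thesis by simp
qed
have e: "D w*(B t w-B s w) = (\<Sum>i<n. ?t i w)" for w unfolding D_eq by (rule sum_distrib_right)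
show "integrable Q (%w. D w*(B t w-B s w))" unfolding e using one by (intro Bochner_Integration.integrable_sum) auto
show "(LINT w|Q. D w*(B t w-B s w)) = (\<Sum>i<n. (LINT w|Q. et i w)*(a (Suc i)-a i))"
 unfolding e using one by (subst int_sum) auto
qed

end

abbreviation unit_line :: "real measure" where "unit_line \<equiv> restrict_space lborel {0..1}"

lemma unit_line: "prob_space unit_line" "sets unit_line = sets (restrict_space borel {0..1})" "space unit_line = {0..1}"
by (auto intro!: prob_space_restrict_space simp: sets_restrict_space)

context simple_increment
begin

lemma process_meas: "(%(r, w). simple_process n \<tau> et r w) \<in> bm (unit_line \<Otimes>\<^sub>M Q)"
proof -
have "(%x. \<Sum>i<n. et i (snd x)*indicator {\<tau> i<..\<tau> (Suc i)} (fst x) :: real) \<in> bm (unit_line \<Otimes>\<^sub>M Q)"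
proof (intro borel_measurable_sum borel_measurable_times)
 fix i assume "i \<in> {..<n}"
 hence [measurable]: "et i \<in> bm Q" using eta(1) by simp
 show "(%x. et i (snd x)) \<in> bm (unit_line \<Otimes>\<^sub>M Q)" by measurable
 have [measurable]: "(%r. indicator {\<tau> i<..\<tau> (Suc i)} r :: real) \<in> bm unit_line"
  by (intro measurable_restrict_space1) simp
 show "(%x. indicator {\<tau> i<..\<tau> (Suc i)} (fst x) :: real) \<in> bm (unit_line \<Otimes>\<^sub>M Q)" by measurable
qed
thus ?thesis by (simp add: simple_process_def case_prod_beta')
qed

text \<open>The right side is the sum found in \<open>covariance\<close>; equating the two is the
  polarised Ito isometry for a simple integrand.\<close>

lemma process_integral:
"integrable (unit_line \<Otimes>\<^sub>M Q) (%x. (case x of (r, w) => simple_process n \<tau> et r w)*indicator {s<..t} (fst x))"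
"(LINT x|(unit_line \<Otimes>\<^sub>M Q). (case x of (r, w) => simple_process n \<tau> et r w)*indicator {s<..t} (fst x)) =
 (\<Sum>i<n. (LINT w|Q. et i w)*(a (Suc i)-a i))"
proof -
let ?RQ = "unit_line \<Otimes>\<^sub>M Q" and ?p = "%x. (case x of (r, w) => simple_process n \<tau> et r w)*indicator {s<..t} (fst x)"
interpret R: prob_space unit_line by (rule unit_line)
interpret RQ: pair_prob_space unit_line Q ..
let ?f = "%i x. et i (snd x)*indicator {max (\<tau> i) s<..min (\<tau> (Suc i)) t} (fst x) :: real"
have one: "integrable ?RQ (?f i) & (LINT x|?RQ. ?f i x) = (LINT w|Q. et i w)*(a (Suc i)-a i)" if i: "i < n" for i
proof
 let ?A = "{max (\<tau> i) s<..min (\<tau> (Suc i)) t}"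
 have [measurable]: "et i \<in> bm Q" by (rule eta(1)[OF i])
 have [measurable]: "(%r. indicator ?A r :: real) \<in> bm unit_line"
  by (intro measurable_restrict_space1) simp
 obtain k where k: "\<forall>w\<in>space Q. \<bar>et i w\<bar> <= k" using eta(2)[OF i] by blast
 have m: "?f i \<in> bm ?RQ" by measurable
 show int: "integrable ?RQ (?f i)"
 proof (rule RQ.integrable_const_bound[of _ "\<bar>k\<bar>"])
  show "AE x in ?RQ. norm (?f i x) <= \<bar>k\<bar>"
   using k by (intro AE_I2) (auto simp: space_pair_measure indicator_def intro: order_trans[OF _ abs_ge_self])
 qed (rule m)
 have A: "?A \<subseteq> {0..1}" using st by auto
 have "?A \<in> sets unit_line" by (subst sets_restrict_space_iff) (use A in auto)
 have "measure unit_line (?A \<inter> {0..1}) = measure lborel ?A"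
  using A by (simp add: Int_absorb2 measure_restrict_space)
 also have "... = a (Suc i)-a i"
 proof -
  have "\<tau> i < \<tau> (Suc i)" using simple i unfolding simple_integrand_def by simp
  thus ?thesis using st unfolding c_def
   by (cases "max (\<tau> i) s <= min (\<tau> (Suc i)) t") (auto simp: max_def min_def split: if_splits)
 qed
 finally have mA: "(LINT r|unit_line. indicator ?A r) = a (Suc i)-a i" by (simp add: unit_line)
 have "(LINT x|?RQ. ?f i x) = (LINT w|Q. (LINT r|unit_line. ?f i (r, w)))"
  using RQ.integral_snd[of "%r w. ?f i (r, w)"] int by (simp add: case_prod_beta')
 also have "... = (LINT w|Q. et i w*(a (Suc i)-a i))" unfolding fst_conv snd_conv integral_mult_right_zero mA ..
 finally show "(LINT x|?RQ. ?f i x) = (LINT w|Q. et i w)*(a (Suc i)-a i)" by simp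
qed
have e: "?p x = (\<Sum>i<n. ?f i x)" for x
 unfolding simple_process_def case_prod_beta' sum_distrib_right by (intro sum.cong) (auto simp: indicator_def)
show "integrable ?RQ (%x. ?p x)"
 unfolding e using one by (intro Bochner_Integration.integrable_sum) auto
show "(LINT x|?RQ. ?p x) =
 (\<Sum>i<n. (LINT w|Q. et i w)*(a (Suc i)-a i))"
 unfolding e using one by (subst int_sum) auto
qed

end

context brownian
begin

text \<open>Everything holds for simple integrands and passes to mean-square limits by
  \<open>L2_limit\<close>. For the covariance one numerical sequence converges to both
  sides.\<close>

lemma ito_moments:
assumes ito: "ito_integral Q B \<phi> J" and st: "0 <= s" "s <= t" "t <= 1"
shows ito_past: "Y \<in> bm (Ft s) ==> (\<And>w. \<bar>Y w\<bar> <= k) ==> integrable Q (%w. (J t w-J s w)*Y w)"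
 "Y \<in> bm (Ft s) ==> (\<And>w. \<bar>Y w\<bar> <= k) ==> (LINT w|Q. (J t w-J s w)*Y w) = 0"
 and ito_covariance: "(LINT w|Q. (J t w-J s w)*(B t w-B s w)) = (LINT r:{s<..t}|lborel. (LINT w|Q. \<phi> r w))"
 and ito_process: "set_integrable lborel {s<..t} (%r. \<integral>w. \<phi> r w \<partial>Q)"
 and ito_zero: "AE w in Q. J 0 w = 0"
proof -
obtain n \<tau> et where simple: "\<And>l. simple_integrand Q B (n l) (\<tau> l) (et l)"
 and lim: "(%l::nat. \<integral>\<^sup>+w. (\<integral>\<^sup>+s\<in>{0..1}. ennreal ((simple_process (n l) (\<tau> l) (et l) s w-\<phi> s w)^2) \<partial>lborel) \<partial>Q) \<longlonglongrightarrow> 0"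
 and limJ: "\<And>t. t \<in> {0..1} ==> (%l::nat. \<integral>\<^sup>+w. ennreal ((simple_integral B (n l) (\<tau> l) (et l) t w-J t w)^2) \<partial>Q) \<longlonglongrightarrow> 0"
 and phi: "(%(s, w). \<phi> s w) \<in> bm (restrict_space borel {0..1} \<Otimes>\<^sub>M Q)"
 and adJ: "adapted_process Q B J"
 using ito unfolding ito_integral_def by blast
have I: "simple_increment Q B (n l) (\<tau> l) (et l) s t" for l
 by (intro simple_increment.intro simple_increment_axioms.intro brownian_axioms simple st)
let ?D = "%l. simple_increment.D B (n l) (\<tau> l) (et l) s t"
let ?e = "%l. \<Sum>i<n l. (LINT w|Q. et l i w)*(simple_increment.c s t (\<tau> l (Suc i))-simple_increment.c s t (\<tau> l i))"
note D = simple_increment.D_meas[OF I]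
have J: "J r \<in> bm Q" if "0 <= r" "r <= 1" for r
 using adJ Ft_meas[of "J r" r] that unfolding adapted_process_def by simp
have Jst: "J t \<in> bm Q" "J s \<in> bm Q" "(%w. J t w-J s w) \<in> bm Q"
 using J[of t] J[of s] st by auto
let ?S = "%r l. simple_integral B (n l) (\<tau> l) (et l) r" and ?RQ = "unit_line \<Otimes>\<^sub>M Q" and ?z = "%x. indicator {s<..t} (fst x) :: real"
 and ?c = "\<integral>w. (J t w-J s w)*(B t w-B s w) \<partial>Q"
let ?d = "%r l. \<integral>\<^sup>+w. ennreal ((?S r l w-J r w)^2) \<partial>Q"
have le: "(\<integral>\<^sup>+w. ennreal ((?D l w-(J t w-J s w))^2) \<partial>Q) <= 2*?d t l+2*?d s l" for l
proof -
 have S: "?S t l \<in> bm Q" "?S s l \<in> bm Q"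
  using simple_increment.integral_meas[OF I] st by auto
 have p: "(?D l w-(J t w-J s w))^2 <= 2*(?S t l w-J t w)^2+2*(?S s l w-J s w)^2" for w
  using zero_le_power2[of "(?S t l w-J t w)+(?S s l w-J s w)"]
  unfolding simple_increment.D_def[OF I] by (simp add: power2_eq_square algebra_simps)
 have "(\<integral>\<^sup>+w. ennreal ((?D l w-(J t w-J s w))^2) \<partial>Q) \<le>
  (\<integral>\<^sup>+w. 2*ennreal ((?S t l w-J t w)^2)+2*ennreal ((?S s l w-J s w)^2) \<partial>Q)"
 proof (rule nn_integral_mono)
  fix w
  show "ennreal ((?D l w-(J t w-J s w))^2) <= 2*ennreal ((?S t l w-J t w)^2)+2*ennreal ((?S s l w-J s w)^2)"
   using ennreal_leI[OF p[of w]] by (simp add: ennreal_plus ennreal_mult)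
 qed
 also have "... = 2*?d t l+2*?d s l" using S Jst by (subst nn_integral_add) (auto simp: nn_integral_cmult)
 finally show ?thesis .
qed
have limD: "(%l. \<integral>\<^sup>+w. ennreal ((?D l w-(J t w-J s w))^2) \<partial>Q) \<longlonglongrightarrow> 0"
proof (rule tendsto_sandwich[of "%_. 0" _ _ "%l. 2*?d t l+2*?d s l"])
 have "(%l. 2*?d t l+2*?d s l) \<longlonglongrightarrow> 2*0+2*0"
  using st by (intro tendsto_add tendsto_mult_ennreal tendsto_const limJ) auto
 thus "(%l. 2*?d t l+2*?d s l) \<longlonglongrightarrow> 0" by simp
qed (use le in auto)
show "integrable Q (%w. (J t w-J s w)*Y w)" "(LINT w|Q. (J t w-J s w)*Y w) = 0"
 if Y: "Y \<in> bm (Ft s)" "\<And>w. \<bar>Y w\<bar> <= k" for Y :: "'a => real" and k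
proof -
 have Ym: "Y \<in> bm Q" using Ft_meas[OF Y(1)] st by simp
 have Yi: "integrable Q Y" by (rule integrable_const_bound[of _ k]) (use Y Ym in auto)
 have Y2: "integrable Q (%w. (Y w)\<^sup>2)"
  by (rule integrable_const_bound[of _ "k^2"]) (use Y(2) Ym in "auto simp: abs_le_square_iff[symmetric] intro: order_trans[OF _ abs_ge_self]")
 note p = simple_increment.past[OF I Y(1) Yi]
 note L = L2_limit[OF D Jst(3) Ym limD Y2 p(1)]
 show "integrable Q (%w. (J t w-J s w)*Y w)" by (rule L(1))
 show "(LINT w|Q. (J t w-J s w)*Y w) = 0" by (rule LIMSEQ_unique[OF L(2)]) (simp add: p(2))
qed
have Bm: "(%w. B t w-B s w) \<in> bm Q" using B_meas st by (intro borel_measurable_diff) auto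
have c1: "(%_. 1 :: real) \<in> bm (Ft s)" "integrable Q (%_. 1 :: real)" by simp_all
have B2: "integrable Q (%w. (B t w-B s w)\<^sup>2)" using Ft_moments(3)[OF st c1] by simp
note cov = simple_increment.covariance[OF I]
have "?e \<longlonglongrightarrow> ?c"
 using L2_limit(2)[OF D Jst(3) Bm limD B2 cov(1)] unfolding cov(2) .
interpret R: prob_space unit_line by (rule unit_line)
interpret RQ: pair_prob_space unit_line Q ..
let ?X = "%l x. case x of (r, w) => simple_process (n l) (\<tau> l) (et l) r w" and ?\<phi> = "%x. case x of (r, w) => \<phi> r w"
have phi': "?\<phi> \<in> bm ?RQ"
 using phi measurable_cong_sets[OF sets_pair_measure_cong[OF unit_line(2) refl] refl] by blast
have X: "?X l \<in> bm ?RQ" for l by (rule simple_increment.process_meas[OF I])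
have lim': "(%l. \<integral>\<^sup>+x. ennreal ((?X l x-?\<phi> x)^2) \<partial>?RQ) \<longlonglongrightarrow> 0"
proof -
 have "(\<integral>\<^sup>+x. ennreal ((?X l x-?\<phi> x)^2) \<partial>?RQ) =
  (\<integral>\<^sup>+w. (\<integral>\<^sup>+s\<in>{0..1}. ennreal ((simple_process (n l) (\<tau> l) (et l) s w-\<phi> s w)^2) \<partial>lborel) \<partial>Q)" for l
 proof -
  have "(%x. ennreal ((?X l x-?\<phi> x)^2)) \<in> bm ?RQ" using X phi' by measurable
  from RQ.nn_integral_snd[OF this, symmetric] show ?thesis
   by (simp add: nn_integral_restrict_space)
 qed
 thus ?thesis using lim by simp
qed
have [measurable]: "(%r. indicator {s<..t} r :: real) \<in> bm unit_line" by (intro measurable_restrict_space1) simp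
have Zm: "?z \<in> bm ?RQ" by measurable
have Z2: "integrable ?RQ (%x. (?z x)\<^sup>2)"
 by (rule RQ.integrable_const_bound[of _ 1]) (use Zm in "auto simp: indicator_def")
note P = simple_increment.process_integral[OF I]
note L = L2_limit[OF X phi' Zm lim' Z2 P(1)]
have "?e \<longlonglongrightarrow> (LINT x|?RQ. ?\<phi> x*?z x)" using L(2) unfolding P(2) .
hence "?c = (LINT x|?RQ. ?\<phi> x*?z x)"
 using `?e \<longlonglongrightarrow> ?c` LIMSEQ_unique by blast
also have "... = (LINT r|unit_line. (LINT w|Q. \<phi> r w*indicator {s<..t} r))"
 using RQ.integral_fst'[OF L(1)] by simp
also have "... = (LINT r|unit_line. (LINT w|Q. \<phi> r w)*indicator {s<..t} r)" by simp
also have "... = (LINT r:{s<..t}|lborel. (LINT w|Q. \<phi> r w))"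
 unfolding set_lebesgue_integral_def using st
 by (subst integral_restrict_space) (auto intro!: int_cong simp: indicator_def set_lebesgue_integral_def)
finally show "?c = (LINT r:{s<..t}|lborel. (LINT w|Q. \<phi> r w))" .
have "integrable unit_line (%r. (LINT w|Q. \<phi> r w*indicator {s<..t} r))"
 using RQ.integrable_fst'[OF L(1)] by simp
hence "integrable lborel (%r. indicator {0..1} r *\<^sub>R (LINT w|Q. \<phi> r w*indicator {s<..t} r))"
 by (subst (asm) integrable_restrict_space) (auto simp: set_integrable_def)
moreover have "indicator {0..1} r *\<^sub>R (LINT w|Q. \<phi> r w*indicator {s<..t} r) = indicator {s<..t} r *\<^sub>R (LINT w|Q. \<phi> r w)" for r
 using st by (auto simp: indicator_def)
ultimately show "set_integrable lborel {s<..t} (%r. \<integral>w. \<phi> r w \<partial>Q)" unfolding set_integrable_def by (simp only:)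
have "?d 0 l = (\<integral>\<^sup>+w. ennreal ((J 0 w)^2) \<partial>Q)" for l
 by (simp add: simple_increment.integral_zero[OF I])
hence "(\<integral>\<^sup>+w. ennreal ((J 0 w)^2) \<partial>Q) = 0" using limJ[of 0] LIMSEQ_unique[OF tendsto_const] by simp
hence "AE w in Q. ennreal ((J 0 w)^2) = 0" using J[of 0] by (subst (asm) nn_integral_0_iff_AE) auto
thus "AE w in Q. J 0 w = 0" by eventually_elim simp
qed

end

context brownian
begin

text \<open>On the event \<open>g*J t > 1\<close> the increment from \<open>t\<close> to
  \<open>T\<close> has a strict sign, as \<open>J T\<close> lies in \<open>[-1,1]\<close>; but its
  mean on this past event is zero, so the event is null.\<close>

lemma ito_bounded:
assumes ito: "ito_integral Q B \<phi> J" and T: "T <= 1" and b: "AE w in Q. J T w \<in> {-1..1}" and t: "0 <= t" "t <= T"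
shows "AE w in Q. \<bar>J t w\<bar> <= 1"
proof -
have J: "J t \<in> bm (Ft t)" using ito t T unfolding ito_integral_def adapted_process_def by auto
have side: "AE w in Q. g*J t w <= 1" if g: "g = 1 \<or> g = - 1" for g :: real
proof -
 define Y where "Y w = (if 1 < g*J t w then 1 else 0 :: real)" for w
 note J[measurable]
 have Y: "Y \<in> bm (Ft t)" unfolding Y_def by measurable
 have Y1: "\<bar>Y w\<bar> <= 1" for w by (simp add: Y_def)
 note p = ito_moments(1,2)[OF ito t T Y Y1]
 have "integrable Q (%w. - g*((J T w-J t w)*Y w))" "(LINT w|Q. - g*((J T w-J t w)*Y w)) = 0"
  by (rule integrable_mult_right[OF p(1)]) (unfold integral_mult_right_zero p(2), simp)
 moreover have "AE w in Q. 0 <= - g*((J T w-J t w)*Y w)"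
  using b by eventually_elim (use g in "auto simp: Y_def")
 ultimately have "AE w in Q. - g*((J T w-J t w)*Y w) = 0"
  by (subst integral_nonneg_eq_0_iff_AE[symmetric])
 with b show ?thesis by eventually_elim (use g in "auto simp: Y_def split: if_splits")
qed
show ?thesis using side[of 1] side[of "-1"] by (auto elim: eventually_elim2)
qed

text \<open>Orthogonality of increments is available for bounded test variables, so
  \<open>J s\<close> is replaced by a truncation that equals it almost surely.\<close>

lemma ito_increment_variance:
assumes ito: "ito_integral Q B \<phi> J" and T: "T <= 1" and b: "AE w in Q. J T w \<in> {-1..1}" and st: "0 <= s" "s <= t" "t <= T"
shows "(LINT w|Q. (J t w-J s w)\<^sup>2) = (LINT w|Q. (J t w)\<^sup>2)-(LINT w|Q. (J s w)\<^sup>2)"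
proof -
have J: "J s \<in> bm (Ft s)" "J t \<in> bm (Ft t)"
 using ito st T unfolding ito_integral_def adapted_process_def by auto
have [measurable]: "J s \<in> bm Q" "J t \<in> bm Q" using Ft_meas[OF J(1)] Ft_meas[OF J(2)] st T by auto
have bs: "AE w in Q. \<bar>J s w\<bar> <= 1" "AE w in Q. \<bar>J t w\<bar> <= 1" using ito_bounded[OF ito T b] st by auto
define Y where "Y w = max (-1) (min 1 (J s w))" for w
have Y: "Y \<in> bm (Ft s)" unfolding Y_def using J(1) by (intro borel_measurable_max borel_measurable_min borel_measurable_const)
have Y1: "\<bar>Y w\<bar> <= 1" for w by (auto simp: Y_def)
have [measurable]: "Y \<in> bm Q" using Ft_meas[OF Y] st T by simp
note p = ito_moments(1,2)[OF ito st(1,2) order_trans[OF st(3) T] Y Y1]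
have i: "integrable Q (%w. (J s w)\<^sup>2)" "integrable Q (%w. (J t w)\<^sup>2)"
 by (rule integrable_const_bound[of _ 1]; use bs in "auto simp: abs_square_le_1")+
have "(LINT w|Q. (J t w-J s w)\<^sup>2) = (LINT w|Q. (J t w)\<^sup>2-(J s w)\<^sup>2-2*((J t w-J s w)*Y w))"
proof (rule integral_cong_AE)
 show "AE w in Q. (J t w-J s w)\<^sup>2 = (J t w)^2-(J s w)\<^sup>2-2*((J t w-J s w)*Y w)"
  using bs(1)
 proof eventually_elim
  case (elim w)
  hence "Y w = J s w" by (auto simp: Y_def)
  thus ?case by (simp add: power2_eq_square algebra_simps)
 qed
qed simp_all
also have "... = (LINT w|Q. (J t w)\<^sup>2)-(LINT w|Q. (J s w)\<^sup>2)-2*0"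
 unfolding p(2)[symmetric] using i p(1) by (subst Bochner_Integration.integral_diff | simp)+
finally show ?thesis by simp
qed

lemma ito_mean:
assumes ito: "ito_integral Q B \<phi> J" and t: "0 <= t" "t <= 1"
shows "(LINT w|Q. J t w) = 0"
proof -
have "J r \<in> bm Q" if "r \<in> {0..1}" for r
 using ito Ft_meas[of "J r" r] that unfolding ito_integral_def adapted_process_def by simp
hence [measurable]: "J t \<in> bm Q" "J 0 \<in> bm Q" using t by auto
have "(LINT w|Q. J t w) = (LINT w|Q. (J t w-J 0 w)*1)"
 by (rule integral_cong_AE) (use ito_zero[OF ito order_refl t] in "auto elim: eventually_mono")
also have "... = 0" by (rule ito_moments(2)[OF ito order_refl t]) auto
finally show ?thesis .
qed

end

section \<open>Discretisation error and conclusion\<close>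

context mixture_coeffs
begin

text \<open>The derivative of \<xi>'' is a power series with nonnegative coefficients, so on
  \<open>[0,1]\<close> it is largest at 1.\<close>

lemma xi2_lipschitz: "\<exists>L\<ge>0. \<forall>x y. 0 <= x --> x <= y --> y <= 1 --> xi2 c y-xi2 c x <= L*(y-x)"
proof -
define D where "D = diffs (diffs (diffs (%k. (deg c k)\<^sup>2)))"
have d: "DERIV (xi2 c) x :> (\<Sum>k. D k*x^k)" if "norm x < rad" for x
 unfolding xi2_def[abs_def] D_def using that by (intro termdiffs_strong'[where K=rad]) (use summable_diffs2 in auto)
have s: "summable (%k. D k*x^k)" if "norm (x :: real) < rad" for x
 unfolding D_def by (rule termdiff_converges[OF that summable_diffs2])
have D0: "0 <= D k" for k using diffs_nonneg(2)[of "Suc k"] unfolding D_def by (subst diffs_def) simp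
have le: "(\<Sum>k. D k*x^k) <= (\<Sum>k. D k*1^k)" if "0 <= x" "x <= 1" for x
 using that D0 rad(1) by (intro suminf_le s mult_left_mono power_mono) auto
have "xi2 c y-xi2 c x <= (\<Sum>k. D k*1^k)*(y-x)" if xy: "0 <= x" "x <= y" "y <= 1" for x y
proof (cases "x = y")
 case False
 hence "x < y" using xy by simp
 have "\<exists>z>x. z < y & xi2 c y-xi2 c x = (y-x)*(\<Sum>k. D k*z^k)"
  by (rule MVT2[OF `x < y` d[OF less_rad]]) (use xy in auto)
 then obtain z where z: "x < z" "z < y" "xi2 c y-xi2 c x = (y-x)*(\<Sum>k. D k*z^k)" by blast
 thus ?thesis using mult_left_mono[OF le[of z], of "y-x"] xy by (simp add: mult.commute)
qed simp
moreover have "0 <= (\<Sum>k. D k*1^k)" using s[of 1] D0 rad(1) by (intro suminf_nonneg) auto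
ultimately show ?thesis by blast
qed

end

context disorder
begin

lemma HH_mean:
assumes m: "in_cube N m"
shows "(\<integral>\<^sup>+w. ennreal \<bar>HH m w\<bar> \<partial>P) <= ennreal ((\<Sum>k. \<bar>deg c k\<bar>) * sqrt (real N))"
proof -
have "(\<integral>\<^sup>+w. ennreal \<bar>HH m w\<bar> \<partial>P) <= (\<integral>\<^sup>+w. (\<Sum>k. ennreal \<bar>hT k m w\<bar>) \<partial>P)"
proof (rule nn_integral_mono)
 fix w
 show "ennreal \<bar>HH m w\<bar> <= (\<Sum>k. ennreal \<bar>hT k m w\<bar>)"
 proof (cases "(\<Sum>k. ennreal \<bar>hT k m w\<bar>) = top")
  case False
  hence s: "summable (%k. \<bar>hT k m w\<bar>)" by (intro summable_suminf_not_top) auto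
  have "\<bar>HH m w\<bar> <= (\<Sum>k. \<bar>hT k m w\<bar>)" unfolding hamiltonian_eq by (rule summable_rabs[OF s])
  thus ?thesis using s by (simp add: suminf_ennreal2 ennreal_leI)
 qed simp
qed
also have "... = (\<Sum>k. \<integral>\<^sup>+w. ennreal \<bar>hT k m w\<bar> \<partial>P)" by (intro nn_integral_suminf) simp
also have "... <= (\<Sum>k. ennreal (\<bar>deg c k\<bar> * sqrt (real N)))"
proof (rule suminf_le)
 fix k
 have "sqrt (\<Sum>js\<in>mi k. (deg c k*nrm N k*(\<Prod>j<k. m (js ! j)))\<^sup>2) <= \<bar>deg c k\<bar> * sqrt (real N)"
  using hT_variance_le[OF m] by (intro real_le_lsqrt) (auto intro: sum_nonneg)
 thus "(\<integral>\<^sup>+w. ennreal \<bar>hT k m w\<bar> \<partial>P) <= ennreal (\<bar>deg c k\<bar> * sqrt (real N))"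
  unfolding hT_lin by (intro order_trans[OF abs_lin ennreal_leI])
qed auto
also have "... = ennreal ((\<Sum>k. \<bar>deg c k\<bar>) * sqrt (real N))"
 using summable_deg by (simp add: suminf_ennreal2 summable_mult2 suminf_mult2)
finally show ?thesis .
qed

end

text \<open>At a fixed point the energy has mean absolute value of order \<open>sqrt N\<close>, so
  Markov's inequality suffices. This serves the case of a target below the permitted loss.\<close>

lemma (in mixture_coeffs) fixed_point_energy:
fixes P :: "nat => 'w measure"
assumes gauss: "\<And>N. gaussian_tensors (P N) N (G N)" and e: "0 < et" and m: "\<And>N. in_cube N m"
shows "with_high_probability P (%N w. - et <= hamiltonian c N (sym_disorder G N w) m/real N)"
proof -
define A where "A = (\<Sum>k. \<bar>deg c k\<bar>)"
define S where "S N = (if N = 0 then {} else {w \<in> space (P N). \<not> et*real N <= \<bar>hamiltonian c N (sym_disorder G N w) m\<bar>})" for N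
have S: "S N \<in> sets (P N) & 1-A/et*(1/sqrt (real N)) <= measure (P N) (S N) & measure (P N) (S N) <= 1" if N: "1 <= N" for N
proof -
 have "prob_space (P N)" using gauss[of N] by (simp add: gaussian_tensors_def)
 then interpret D: disorder c \<epsilon>0 "P N" N "G N"
  by (intro disorder.intro mixture_coeffs_axioms disorder_axioms.intro gauss N)
 have h: "hamiltonian c N (sym_disorder G N w) m = D.HH m w" for w unfolding sym_disorder_def tens_def ..
 let ?T = "{w \<in> space (P N). et*real N <= \<bar>D.HH m w\<bar>}"
 have T: "?T \<in> sets (P N)" by measurable
 have ST: "S N = space (P N)-?T" unfolding S_def h using N by auto
 have p: "0 < et*real N" using e N by simp
 have "emeasure (P N) ?T <= emeasure (P N) ({w \<in> space (P N). 1 <= ennreal (1/(et*real N))*ennreal \<bar>D.HH m w\<bar>} \<inter> space (P N))"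
  using p by (intro emeasure_mono) (auto simp: ennreal_mult[symmetric] field_simps simp flip: ennreal_1)
 also have "... <= ennreal (1/(et*real N))*(\<integral>\<^sup>+w. ennreal \<bar>D.HH m w\<bar>*indicator (space (P N)) w \<partial>P N)"
  by (subst Int_absorb2, blast, rule nn_integral_Markov_inequality) simp_all
 also have "(\<integral>\<^sup>+w. ennreal \<bar>D.HH m w\<bar>*indicator (space (P N)) w \<partial>P N) = (\<integral>\<^sup>+w. ennreal \<bar>D.HH m w\<bar> \<partial>P N)"
  by (intro nn_integral_cong) simp
 also have "ennreal (1/(et*real N))*... <= ennreal (1/(et*real N))*ennreal (A * sqrt (real N))"
  unfolding A_def by (intro mult_left_mono D.HH_mean m) simp
 also have "... = ennreal (A/et*(sqrt (real N)/real N))"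
  using p summable_deg by (simp add: A_def ennreal_mult[symmetric] suminf_nonneg mult.commute)
 also have "sqrt (real N)/real N = 1/sqrt (real N)" using N by (simp add: field_simps)
 finally have "measure (P N) ?T <= A/et*(1/sqrt (real N))"
  using e summable_deg by (simp add: D.emeasure_eq_measure A_def suminf_nonneg)
 thus ?thesis using T D.prob_compl[OF T] unfolding ST by auto
qed
have S': "S N \<in> sets (P N)" for N using S[of N] by (cases "N = 0") (auto simp: S_def)
have "(%N. measure (P N) (S N)) \<longlonglongrightarrow> 1"
proof (rule tendsto_sandwich[of "%N. 1-A/et*(1/sqrt (real N))" _ _ "%_. 1"])
 have "(%N. 1/sqrt (real N)) \<longlonglongrightarrow> 0"
  using tendsto_divide_0[OF tendsto_const filterlim_at_top_imp_at_infinity[OF filterlim_compose[OF sqrt_at_top filterlim_real_sequentially]]] .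
 from tendsto_diff[OF tendsto_const[of 1] tendsto_mult[OF tendsto_const[of "A/et"] this]]
 show "(%N. 1-A/et*(1/sqrt (real N))) \<longlonglongrightarrow> 1" by simp
qed (use S in "auto intro!: eventually_sequentiallyI[of 1]")
moreover have "- et <= hamiltonian c N (sym_disorder G N w) m/real N" if "w \<in> S N" for N w
 using that by (cases "N = 0") (auto simp: S_def field_simps)
ultimately show ?thesis unfolding with_high_probability_def using S' by (intro exI[of _ S] conjI allI ballI)
qed

lemma constant_set_integral:
assumes "s <= t"
shows "set_integrable lborel {s<..t} (%_. k :: real)" "(LINT x:{s<..t}|lborel. k) = k*(t-s)"
proof -
show "set_integrable lborel {s<..t} (%_. k)" unfolding set_integrable_def
 by (intro integrable_scaleR_left integrable_real_indicator) (simp_all add: assms)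
show "(LINT x:{s<..t}|lborel. k) = k*(t-s)" using assms unfolding set_lebesgue_integral_def by simp
qed

text \<open>The case that needs the chain: positive \<open>u\<close>, a nonzero mixture and positive
  \<open>T\<close>. The final proof reduces to it.\<close>

locale target = brownian Q B+mixture_coeffs c \<epsilon>0
for Q :: "'a measure" and B and c :: "nat => real" and \<epsilon>0 :: real +
fixes P :: "nat => 'w measure" and G :: "nat => nat => nat list => 'w => real"
 and u :: "real => real => real" and X M :: "real => 'a => real" and C0 T :: real
assumes gaussT: "\<And>N. gaussian_tensors (P N) N (G N)" and nontriv: "\<exists>k\<ge>2. c k \<noteq> 0"
 and u_pos: "\<And>t x. t \<in> {0..1} ==> 0 < u t x" and u_le: "\<And>t x. t \<in> {0..1} ==> u t x <= C0"
 and ito: "ito_integral Q B (%t w. sqrt (mixture2 c t)*u t (X t w)) M"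
 and T: "0 < T" "T <= 1" and M1: "AE w in Q. M T w \<in> {-1..1}"
 and M2: "\<And>t. t \<in> {0..T} ==> (LINT w|Q. (M t w)\<^sup>2) = t"
begin

definition U :: "real => real" where "U r = (LINT w|Q. u r (X r w))"

abbreviation g :: "real => real" where "g r \<equiv> (LINT w|Q. sqrt (mixture2 c r)*u r (X r w))"

lemma U: "0 <= r ==> r <= 1 ==> 0 <= U r" "0 <= r ==> r <= 1 ==> U r <= C0"
proof -
assume r: "0 <= r" "r <= 1"
thus "0 <= U r" unfolding U_def using u_pos by (intro integral_nonneg_AE AE_I2) (auto intro: less_imp_le)
have C0: "0 <= C0" using u_pos[of 0 0] u_le[of 0 0] by simp
show "U r <= C0"
proof (cases "integrable Q (%w. u r (X r w))")
 case True
 thus ?thesis unfolding U_def using u_le r by (intro integral_le_const AE_I2) auto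
qed (simp add: U_def not_integrable_integral_eq C0)
qed

lemma g: "0 <= r ==> r <= 1 ==> g r = sqrt (xi2 c r)*U r"
unfolding U_def using mixture2_xi2[OF less_rad, of r] by simp

lemma g_nonneg: "0 <= r ==> r <= 1 ==> 0 <= g r"
using U(1)[of r] xi2_nonneg[of r] by (simp only: g) simp

lemma g_integrable: "0 <= s ==> s <= t ==> t <= 1 ==> set_integrable lborel {s<..t} g"
by (rule ito_process[OF ito])

lemma W_integrable:
assumes "0 <= s" "s <= t" "t <= 1"
shows "set_integrable lborel {s<..t} (%r. xi2 c r*U r)"
proof -
have "(%r. indicator {s<..t} r *\<^sub>R sqrt (xi2 c r)) \<in> bm borel"
 using assms by (intro borel_measurable_continuous_on_indicator continuous_at_imp_continuous_on ballI continuous_real_sqrt isCont_xi2) auto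
moreover have i: "integrable lborel (%r. indicator {s<..t} r *\<^sub>R g r)" using g_integrable[OF assms] unfolding set_integrable_def .
ultimately have m: "(%r. (indicator {s<..t} r *\<^sub>R sqrt (xi2 c r))*(indicator {s<..t} r *\<^sub>R g r)) \<in> bm lborel"
 using borel_measurable_integrable[OF i] by (intro borel_measurable_times) auto
have e: "(indicator {s<..t} r *\<^sub>R sqrt (xi2 c r))*(indicator {s<..t} r *\<^sub>R g r) = indicator {s<..t} r *\<^sub>R (xi2 c r*U r)" for r
proof (cases "r \<in> {s<..t}")
 case True
 thus ?thesis using assms xi2_nonneg[of r] g[of r] by simp
qed simp
have "integrable lborel (%r. sqrt (xi2 c 1)*(indicator {s<..t} r *\<^sub>R g r))" using i by (rule integrable_mult_right)
thus ?thesis unfolding set_integrable_def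
proof (rule int_bound)
 show "(%r. indicator {s<..t} r *\<^sub>R (xi2 c r*U r)) \<in> bm lborel" using m unfolding e .
 have "norm (indicator {s<..t} r *\<^sub>R (xi2 c r*U r)) <= norm (sqrt (xi2 c 1)*(indicator {s<..t} r *\<^sub>R g r))" for r
 proof (cases "r \<in> {s<..t}")
  case True
  hence r: "0 <= r" "r <= 1" using assms by auto
  have "sqrt (xi2 c r)*g r <= sqrt (xi2 c 1)*g r"
   by (intro mult_right_mono real_sqrt_le_mono xi2_mono r order_refl g_nonneg)
  moreover have "xi2 c r*U r = sqrt (xi2 c r)*g r" unfolding g[OF r] using xi2_nonneg[OF r] by simp
  moreover have "0 <= xi2 c r*U r" by (intro mult_nonneg_nonneg xi2_nonneg U r)
  ultimately show ?thesis using True by simp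
 qed simp
 thus "AE r in lborel. norm (indicator {s<..t} r *\<^sub>R (xi2 c r*U r)) <= norm (sqrt (xi2 c 1)*(indicator {s<..t} r *\<^sub>R g r))" by simp
qed
qed

text \<open>The point at which \<open>\<xi>''\<close> is evaluated lags behind by \<open>O(1/n)\<close>, and \<open>\<surd>a (\<surd>a - \<surd>b) \<le> a - b\<close>.\<close>

lemma block_bound:
assumes lip: "\<And>x y. 0 <= x ==> x <= y ==> y <= 1 ==> xi2 c y-xi2 c x <= L*(y-x)" "0 <= L"
 and s: "0 <= s" "s <= t" "t <= 1" and b: "0 <= b" "b <= s" "t-b <= h" and k: "0 <= kp" "kp <= 1"
shows "(LINT r:{s<..t}|lborel. xi2 c r*U r) \<le>
 (1-kp)\<^sup>2 * sqrt (xi2 c b)*(LINT r:{s<..t}|lborel. g r)+(2*kp*xi2 c 1+L*h)*C0*(t-s)"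
proof -
let ?K = "(2*kp*xi2 c 1+L*h)*C0" and ?k = "(1-kp)^2 * sqrt (xi2 c b)"
have gi: "set_integrable lborel {s<..t} (%r. ?k*g r)" by (rule set_integrable_mult_right) (rule g_integrable[OF s])
note ci = constant_set_integral[OF s(2), of ?K]
have "(LINT r:{s<..t}|lborel. xi2 c r*U r) <= (LINT r:{s<..t}|lborel. ?k*g r+?K)"
proof (rule set_integral_mono[OF W_integrable[OF s] set_integral_add(1)[OF gi ci(1)]])
 fix r assume "r \<in> {s<..t}"
 hence r: "0 <= r" "r <= 1" "b <= r" "r <= t" using s b by auto
 define p q where "p = sqrt (xi2 c r)" and "q = sqrt (xi2 c b)"
 have pq: "0 <= q" "q <= p" unfolding p_def q_def using xi2_nonneg[of b] xi2_mono[OF b(1) r(3,2)] b r by auto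
 have p2: "p^2 = xi2 c r" "q^2 = xi2 c b" unfolding p_def q_def using xi2_nonneg[of r] xi2_nonneg[of b] b r by auto
 have k1: "1-(1-kp)\<^sup>2 <= 2*kp" by (simp add: power2_diff)
 have k2: "(1-kp)^2 <= 1" using k by (intro power_le_one) auto
 have "p^2-(1-kp)\<^sup>2*q*p = (1-(1-kp)\<^sup>2)*p^2+(1-kp)^2*(p*(p-q))"
  by (simp add: power2_eq_square algebra_simps)
 also have "... <= 2*kp*p^2+1*(p*(p-q))" using k1 k2 pq by (intro add_mono mult_right_mono) auto
 also have "p*(p-q) <= (p+q)*(p-q)" using pq by (intro mult_right_mono) auto
 also have "(p+q)*(p-q) = p^2-q\<^sup>2" by (simp add: power2_eq_square algebra_simps)
 also have "... <= L*(r-b)" unfolding p2 by (rule lip(1)[OF b(1) r(3,2)])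
 also have "... <= L*h" using lip(2) r(4) b(3) by (intro mult_left_mono) auto
 also have "p^2 <= xi2 c 1" unfolding p2 using xi2_mono[OF r(1,2)] by simp
 finally have d: "p^2-(1-kp)\<^sup>2*q*p <= 2*kp*xi2 c 1+L*h" using k by (simp add: mult_left_mono)
 have nn: "0 <= 2*kp*xi2 c 1+L*h" using k xi2_nonneg[of 1] lip(2) b s by simp
 have "(p^2-(1-kp)\<^sup>2*q*p)*U r <= ?K"
  by (rule order_trans[OF mult_right_mono[OF d U(1)[OF r(1,2)]] mult_left_mono[OF U(2)[OF r(1,2)] nn]])
 thus "xi2 c r*U r <= ?k*g r+?K" unfolding g[OF r(1,2)] p2(1)[symmetric] p_def[symmetric] q_def[symmetric] using pq by (simp add: algebra_simps)
qed
also have "... = ?k*(LINT r:{s<..t}|lborel. g r)+?K*(t-s)"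
 using set_integral_add(2)[OF gi ci(1)] unfolding ci(2) by (simp only: set_integral_mult_right)
finally show ?thesis .
qed

end

text \<open>Makes the grid fine enough: \<open>n\<close> roundings by \<open>2/(2^(2*n+1)-1)\<close>
  add up to at most \<open>1/n\<close>.\<close>

lemma double_square_le: "2*(real n)^2 <= real (2^(2*n+1)-1)"
proof -
have "n+1 <= 2^n" by (induction n) auto
hence "(n+1)^2 <= (2^n)^2" by (rule power_mono) simp
moreover have "(2^n)^2 = (2^(2*n) :: nat)" by (simp add: power_mult[symmetric] mult.commute)
moreover have "n^2+1 <= (n+1)^2" by (simp add: power2_eq_square)
ultimately have "n^2+1 <= 2^(2*n)" by linarith
hence "2*n^2 <= 2^(2*n+1)-1" by simp
hence "real (2*n^2) <= real (2^(2*n+1)-1)" by (rule of_nat_mono)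
thus ?thesis by simp
qed

context target
begin

text \<open>The block at time 0 is given up at a loss of order \<open>1/n\<close>; each later block
  loses order \<open>1/n^2\<close> by the shrinking and by the lag in \<xi>''. In the constant, 3 is
  1 for the first block plus 2 for the shrinking, and \<open>4*L\<close> is the lag.\<close>

lemma energy:
assumes lip: "\<And>x y. 0 <= x ==> x <= y ==> y <= 1 ==> xi2 c y-xi2 c x <= L*(y-x)" "0 <= L" and n: "2 <= n"
shows "\<exists>T' V. spin_algorithm c \<epsilon>0 T' (Suc n) (2*n+1) V P G &
 (LINT r:{0<..T}|lborel. xi2 c r*U r)-(3*xi2 c 1+4*L)*C0/real n <= toy.elim c (%a. teval (T' a)) (Suc n)"
proof -
\<comment> \<open>The step length, which is also the variance of an increment of \<open>M\<close>,
  and the margin for rounding.\<close>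
define \<delta> kp where "\<delta> = T/real n" and "kp = 1/real n"
define tt where "tt a = real a*\<delta>" for a
have d: "0 < \<delta>" "\<delta> <= kp" "real n*\<delta> = T" "0 < kp" "kp <= 1/2" using n T by (auto simp: \<delta>_def kp_def divide_right_mono)
have tS: "tt (Suc a) = tt a+\<delta>" "tt (Suc a)-tt a = \<delta>" for a by (simp_all add: tt_def distrib_right)
have t0: "tt 0 = 0" "tt 1 = \<delta>" "tt n = T" using d by (simp_all add: tt_def)
have tp: "0 <= tt a" for a using d by (simp add: tt_def)
have tT: "tt a <= T" if "a <= n" for a using mult_right_mono[of "real a" "real n" \<delta>] that d by (simp add: tt_def)
have t1: "tt a <= 1" if "a <= n" for a using tT[OF that] T by simp
have tlt: "tt a < tt (Suc a)" for a using d by (simp add: tS)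
have tle: "tt a <= tt (Suc a)" for a by (rule less_imp_le[OF tlt])
define \<zeta> where "\<zeta> a w = (B (tt (Suc a)) w-B (tt a) w)/sqrt (tt (Suc a)-tt a)" for a w
let ?dM = "%a w. M (tt (Suc a)) w-M (tt a) w" and ?g = "%a. LINT r:{tt a<..tt (Suc a)}|lborel. g r"
let ?e = "%a. \<integral>w. ?dM a w*\<zeta> a w \<partial>Q"
have cov: "sqrt \<delta>*?e a = ?g a" if "a < n" for a
proof -
 have "?dM a w*(B (tt (Suc a)) w-B (tt a) w) = sqrt \<delta>*(?dM a w*\<zeta> a w)" for w
  unfolding \<zeta>_def tS(2) using d(1) by simp
 hence "(LINT w|Q. ?dM a w*(B (tt (Suc a)) w-B (tt a) w)) =
   sqrt \<delta>*?e a" by (simp only: integral_mult_right_zero)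
 thus ?thesis using ito_covariance[OF ito tp tle t1[OF Suc_leI[OF that]]] by (rule trans[OF sym])
qed
have gpos: "0 <= ?g a" if "a < n" for a
 using tp[of a] t1[of "Suc a"] that unfolding set_lebesgue_integral_def
 by (intro integral_nonneg_AE AE_I2) (auto simp: indicator_def simp del: integral_mult_right_zero intro!: g_nonneg)
have CA: "chain_algorithm Q (%a. Ft (tt a)) (%a. M (tt a)) \<zeta> n (2*n+1) \<delta> kp c \<epsilon>0 P G"
proof (intro chain_algorithm.intro chain.intro chain_axioms.intro chain_algorithm_axioms.intro prob_space_axioms mixture_coeffs_axioms gaussT nontriv d(1,4) n)
 show "noise Q (Ft (tt a)) (\<zeta> a)" if "1 <= a" "a < n" for a
  unfolding \<zeta>_def using that by (intro Ft_noise tp tlt t1) simp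
 show "Y \<in> bm (Ft (tt (Suc a)))" if "Y \<in> bm (Ft (tt a))" "a < n" for a and Y :: "'a => real"
  by (rule Ft_meas_mono[OF that(1) tle])
 show "Y \<in> bm Q" if "Y \<in> bm (Ft (tt a))" "a <= n" for a and Y :: "'a => real"
  by (rule Ft_meas[OF that(1) t1[OF that(2)]])
 show "M (tt a) \<in> bm (Ft (tt a))" if "a <= n" for a
  using ito tp[of a] t1[OF that] unfolding ito_integral_def adapted_process_def by auto
 show "AE w in Q. \<bar>M (tt a) w\<bar> <= 1" if "a <= n" for a
  by (rule ito_bounded[OF ito T(2) M1 tp tT[OF that]])
 show "(LINT w|Q. Y w*?dM a w) = 0"
  if "1 <= a" "a < n" "Y \<in> bm (Ft (tt a))" "\<And>w. \<bar>Y w\<bar> <= k" for a Y k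
  using ito_moments(2)[OF ito tp tle t1 that(3,4)] that(2) by (simp add: mult.commute)
 show "(LINT w|Q. M (tt 1) w) = 0" by (rule ito_mean[OF ito tp t1]) (use n in simp)
 show "(LINT w|Q. (M (tt 1) w)\<^sup>2) = \<delta>" by (rule trans[OF M2 t0(2)]) (use tp[of 1] tT[of 1] n in simp)
 show "(LINT w|Q. (?dM a w)\<^sup>2) = \<delta>" if "1 <= a" "a < n" for a
  using ito_increment_variance[OF ito T(2) M1 tp tle tT[of "Suc a"]] M2[of "tt a"] M2[of "tt (Suc a)"] tp[of a] tp[of "Suc a"] tT[of a] tT[of "Suc a"] that
  by (simp add: tS)
 show "kp < 1" using d by simp
 show "real n*(2/real (2^(2*n+1)-1)) <= kp"
 proof -
  have "0 < 2*(real n)^2" using n by simp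
  hence "real n*(2/real (2^(2*n+1)-1)) <= real n*(2/(2*(real n)^2))"
   by (intro mult_left_mono divide_left_mono double_square_le mult_pos_pos order_less_le_trans[OF _ double_square_le]) auto
  also have "... = kp" using n by (simp add: kp_def power2_eq_square)
  finally show ?thesis .
 qed
 show "0 <= ?e a" if "1 <= a" "a < n" for a
  using cov[OF that(2)] gpos[OF that(2)] d(1) by (metis real_sqrt_gt_zero zero_le_mult_iff not_le)
qed simp_all
define W where "W a = (LINT r:{tt a<..tt (Suc a)}|lborel. xi2 c r*U r)" for a
define I where "I a = ?g a" for a
\<comment> \<open>The lower bound for the second moment of the chain at which
  \<open>elim_bound\<close> evaluates \<xi>''.\<close>
define b where "b a = real (a-1)*((1-kp)^2*\<delta>)" for a
let ?K = "(2*kp*xi2 c 1+L*(2*\<delta>+2*kp))*C0"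
have sum: "(LINT r:{0<..tt a}|lborel. xi2 c r*U r) = (\<Sum>i<a. W i)" if "a <= n" for a
 using that
proof (induction a)
 case 0
 thus ?case by (simp add: t0 set_lebesgue_integral_def)
next
 case (Suc a)
 have e: "{0<..tt (Suc a)} = {0<..tt a} \<union> {tt a<..tt (Suc a)}" using tp[of a] tle[of a] by auto
 have "(LINT r:{0<..tt (Suc a)}|lborel. xi2 c r*U r) = (LINT r:{0<..tt a}|lborel. xi2 c r*U r)+W a"
  unfolding e W_def by (rule set_integral_Un) (use W_integrable tp tle t1 Suc.prems in auto)
 thus ?case using Suc by simp
qed
have k2: "1-2*kp <= (1-kp)^2" by (simp add: power2_diff)
have k3: "(1-kp)^2 <= 1" using d by (intro power_le_one) auto
have blk: "W a <= (1-kp)^2 * sqrt (xi2 c (b a))*I a+?K*\<delta>" if a: "1 <= a" "a < n" for a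
proof -
 have r: "real a = real (a-1)+1" using a by simp
 have 1: "real (a-1)*\<delta> <= tt a" unfolding tt_def using d by (intro mult_right_mono) auto
 have 2: "b a <= real (a-1)*\<delta>*1" unfolding b_def using mult_left_mono[OF k3, of "real (a-1)*\<delta>"] d by (simp add: mult_ac)
 have "real (a-1)*\<delta>*(1-2*kp) <= b a" unfolding b_def using mult_left_mono[OF k2, of "real (a-1)*\<delta>"] d by (simp only: mult_ac) simp
 hence "real (a-1)*\<delta>-real (a-1)*\<delta>*(2*kp) <= b a" by (simp add: right_diff_distrib)
 moreover have "real (a-1)*\<delta>*(2*kp) <= 1*(2*kp)" using 1 t1[of a] a d by (intro mult_right_mono) auto
 moreover have "tt (Suc a) = real (a-1)*\<delta>+2*\<delta>" unfolding tt_def of_nat_Suc r by (simp add: algebra_simps)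
 ultimately have 3: "tt (Suc a)-b a <= 2*\<delta>+2*kp" by simp
 have "0 <= b a" unfolding b_def using d by simp
 from block_bound[OF lip tp tle t1 this _ 3, of kp] show ?thesis
  unfolding W_def I_def tS(2) using 1 2 a d by simp
qed
\<comment> \<open>The sum in \<open>elim_bound\<close> starts at 1, so the first block is estimated
  crudely.\<close>
have "W 0 <= (LINT r:{tt 0<..tt 1}|lborel. xi2 c 1*C0)"
 unfolding W_def One_nat_def
proof (rule set_integral_mono[OF W_integrable[OF tp tle] constant_set_integral(1)[OF tle]])
 show "tt (Suc 0) <= 1" using t1[of 1] n by simp
 thus "xi2 c r*U r <= xi2 c 1*C0" if "r \<in> {tt 0<..tt (Suc 0)}" for r
  using that tp[of 0] by (intro mult_mono xi2_mono U xi2_nonneg) auto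
qed
also have "... = xi2 c 1*C0*\<delta>" unfolding t0 using constant_set_integral(2)[of 0 \<delta> "xi2 c 1*C0"] d(1) by simp
finally have W0: "W 0 <= xi2 c 1*C0*\<delta>" .
have C0: "0 <= C0" using U[of 0] by simp
have x1: "0 <= xi2 c 1" by (rule xi2_nonneg) auto
have "{..<n} = insert 0 {1..<n}" using n by auto
hence "(LINT r:{0<..T}|lborel. xi2 c r*U r) = W 0+(\<Sum>a=1..<n. W a)"
 using sum[OF order_refl] by (simp add: t0)
also have "... <= xi2 c 1*C0*\<delta>+(\<Sum>a=1..<n. (1-kp)\<^sup>2 * sqrt (xi2 c (b a))*I a+?K*\<delta>)"
 by (intro add_mono W0 sum_mono blk) auto
also have "... = xi2 c 1*C0*\<delta>+real (n-1)*\<delta>*?K+(\<Sum>a=1..<n. (1-kp)\<^sup>2 * sqrt (xi2 c (b a))*I a)"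
 by (simp add: sum.distrib mult_ac)
also have "(\<Sum>a=1..<n. (1-kp)\<^sup>2 * sqrt (xi2 c (b a))*I a) =
 (\<Sum>a=1..<n. (1-kp)\<^sup>2 * sqrt (xi2 c (real (a-1)*((1-kp)^2*\<delta>)))*(sqrt \<delta>*?e a))"
 unfolding b_def I_def using cov by (intro sum.cong refl) simp
also have "... <= toy.elim c (%a. teval (chain.T Q (%a. M (tt a)) \<zeta> n (2*n+1) kp a)) (Suc n)"
 by (rule chain_algorithm.elim_bound[OF CA])
also have "xi2 c 1*C0*\<delta>+real (n-1)*\<delta>*?K <= xi2 c 1*C0*kp+1*((2*kp*xi2 c 1+L*(2*kp+2*kp))*C0)"
proof (intro add_mono mult_mono mult_left_mono mult_right_mono d(2))
 have "real (n-1)*\<delta> <= real n*\<delta>" using d by (intro mult_right_mono) auto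
 thus "real (n-1)*\<delta> <= 1" using d T by simp
qed (use C0 x1 lip(2) d in auto)
also have "xi2 c 1*C0*kp+1*((2*kp*xi2 c 1+L*(2*kp+2*kp))*C0) = (3*xi2 c 1+4*L)*C0/real n"
 by (simp add: kp_def algebra_simps add_divide_distrib)
finally have "(LINT r:{0<..T}|lborel. xi2 c r*U r)-(3*xi2 c 1+4*L)*C0/real n \<le>
  toy.elim c (%a. teval (chain.T Q (%a. M (tt a)) \<zeta> n (2*n+1) kp a)) (Suc n)" by simp
with chain_algorithm.spin_algorithm[OF CA] show ?thesis by blast
qed

lemma target_integral: "(LINT t:{0..T}|lborel. mixture2 c t*U t) = (LINT r:{0<..T}|lborel. xi2 c r*U r)"
proof -
have e: "indicator {0..T} t *\<^sub>R (mixture2 c t*U t) = indicator {0<..T} t *\<^sub>R (xi2 c t*U t)+(mixture2 c 0*U 0)*indicator {0} t" for t :: real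
 using T mixture2_xi2[OF less_rad, of t] by (auto simp: indicator_def)
have i: "integrable lborel (%t. indicator {0<..T} t *\<^sub>R (xi2 c t*U t))"
 using W_integrable[of 0 T] T unfolding set_integrable_def by simp
have "integrable lborel (%t. (mixture2 c 0*U 0)*indicator {0} t :: real)"
 by (intro integrable_mult_right integrable_real_indicator) auto
thus ?thesis unfolding set_lebesgue_integral_def e using i by simp
qed

lemma target_le: "(LINT r:{0<..T}|lborel. xi2 c r*U r) <= xi2 c 1*C0"
proof -
have x1: "0 <= xi2 c 1" and C0: "0 <= C0" using U[of 0] by (auto intro: xi2_nonneg)
have "(LINT r:{0<..T}|lborel. xi2 c r*U r) <= (LINT r:{0<..T}|lborel. xi2 c 1*C0)"
proof (rule set_integral_mono)
 show "set_integrable lborel {0<..T} (%r. xi2 c r*U r)" "set_integrable lborel {0<..T} (%r. xi2 c 1*C0)"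
  using T by (auto intro: W_integrable constant_set_integral)
 show "xi2 c r*U r <= xi2 c 1*C0" if "r \<in> {0<..T}" for r
  using that T by (intro mult_mono xi2_mono U x1) auto
qed
also have "... = xi2 c 1*C0*T" using T constant_set_integral(2)[of 0 T "xi2 c 1*C0"] by simp
also have "... <= xi2 c 1*C0*1" using T x1 C0 by (intro mult_left_mono) auto
finally show ?thesis by simp
qed

end

lemma nonvanishing_sign:
fixes f :: "'x :: topological_space => real"
assumes "connected S" "continuous_on S f" "\<And>x. x \<in> S ==> f x \<noteq> 0" "a \<in> S" "b \<in> S" "0 < f a"
shows "0 < f b"
proof (rule ccontr)
assume "\<not> 0 < f b"
hence "0 \<in> f ` S"
 using connectedD_interval[OF connected_continuous_image[OF assms(2,1)], of "f b" "f a" 0] assms(4-6) by auto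
thus False using assms(3) by auto
qed

text \<open>The sign is carried from \<open>(0,0)\<close> first along time at \<open>x = 0\<close>,
  by continuity, and then in space at fixed \<open>t\<close>, by the Lipschitz bound.\<close>

lemma nonvanishing_coefficient:
assumes reg: "regular_coefficients C0 u v" and nz: "\<And>t x. t \<in> {0..1} ==> u t x \<noteq> 0"
 and g: "g = 1 \<or> g = - 1" "0 < g*u 0 0" and t: "t \<in> {0..1}"
shows "0 < g*u t x"
proof -
have "continuous_on {0..1} (%t. g*u t 0)" using reg unfolding regular_coefficients_def by (intro continuous_on_mult_left) auto
hence "0 < g*u t 0"
 using nonvanishing_sign[of "{0..1}" "%t. g*u t 0" 0 t] nz g t by auto
moreover have "continuous_on UNIV (%x. g*u t x)"
proof (intro continuous_on_mult_left lipschitz_on_continuous_on[of "max C0 0"] lipschitz_onI)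
 fix x y
 have "\<bar>u t x-u t y\<bar> <= C0*\<bar>x-y\<bar>" using reg t unfolding regular_coefficients_def by blast
 also have "... <= max C0 0*\<bar>x-y\<bar>" by (intro mult_right_mono) auto
 finally show "dist (u t x) (u t y) <= max C0 0*dist x y" by (simp add: dist_real_def)
qed simp
ultimately show ?thesis
 using nonvanishing_sign[of UNIV "%x. g*u t x" 0 x] nz g t by auto
qed

text \<open>\<open>Skip\<close> leaves array 0 at zero, which is read as the all-plus
  configuration.\<close>

lemma (in mixture_coeffs) constant_algorithm:
assumes gauss: "\<And>N. gaussian_tensors (P N) N (G N)" and e: "E < ep" and C: "0 <= C"
shows "achieves c u v P G (%N kp \<kappa>1. C*(kp+real N)+real N*\<kappa>1) (E-ep) prog.Skip"
proof (rule achievesI)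
show "prob_space (P N)" for N using gauss[of N] by (simp add: gaussian_tensors_def)
have "with_high_probability P (%N w. - (ep-E) <= hamiltonian c N (sym_disorder G N w) (%_. 1)/real N)"
 by (rule fixed_point_energy[OF gauss]) (use e in "auto simp: in_cube_def")
thus "with_high_probability P (%N w. E-ep <= hamiltonian c N (sym_disorder G N w) (%_. 1)/real N)" by simp
fix kp \<kappa>1 :: real and N w \<rho> assume k: "0 <= kp" "0 <= \<kappa>1"
have s: "spin_output start_state = (%_. 1)" by (simp add: spin_output_def start_state_def fun_eq_iff)
have "0 <= C*(kp+real N)+real N*\<kappa>1" using C k by (intro add_nonneg_nonneg mult_nonneg_nonneg) auto
thus "\<exists>T \<sigma>. outputs (spin_machine c u v kp \<kappa>1 N (sym_disorder G N w) \<rho>) prog.Skip T \<sigma> &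
  T <= C*(kp+real N)+real N*\<kappa>1 & hamiltonian c N (sym_disorder G N w) \<sigma> = hamiltonian c N (sym_disorder G N w) (%_. 1)"
 unfolding outputs_def s[symmetric] by (intro exI[of _ 0] exI[of _ "spin_output start_state"] exI[of _ start_state] conjI exec.Skip refl)
qed

text \<open>For \<open>n, N >= 1\<close> the three factors are at most \<open>3*n\<close>,
  \<open>238*n\<close> and \<open>2*N\<close>, and \<open>3*238*2 = 1428\<close> is rounded up to
  1500.\<close>

lemma cost_bound:
assumes n: "1 <= n" and N: "1 <= N" and k: "0 <= (kp :: real)" and nK: "real n*ep <= K" and e: "0 < ep"
shows "real (Suc n)*kp+(real (Suc n)+1)*(80*real (Suc n)+6*real (2*n+1)+60)*(real N+1)
 <= 1500*K^2/ep^2*(kp+real N)"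
proof -
have n1: "1 <= real n" using n by simp
have "(real (Suc n)+1)*(80*real (Suc n)+6*real (2*n+1)+60)*(real N+1) <= (3*real n)*(238*real n)*(2*real N)"
 using n N by (intro mult_mono) auto
also have "... <= 1500*(real n)^2*real N" by (simp add: power2_eq_square)
finally have 1: "(real (Suc n)+1)*(80*real (Suc n)+6*real (2*n+1)+60)*(real N+1) <= 1500*(real n)^2*real N" .
have "real (Suc n) <= 2*real n*1" using n by simp
also have "... <= 1500*real n*real n" using n1 by (intro mult_mono) auto
finally have "real (Suc n)*kp <= 1500*(real n)^2*kp" using k by (intro mult_right_mono) (auto simp: power2_eq_square)
with 1 have "real (Suc n)*kp+(real (Suc n)+1)*(80*real (Suc n)+6*real (2*n+1)+60)*(real N+1) <= 1500*(real n)^2*(kp+real N)"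
 by (simp add: distrib_left)
also have "... <= 1500*K^2/ep^2*(kp+real N)"
proof (rule mult_right_mono)
 have "real n <= K/ep" using nK e by (simp add: pos_le_divide_eq)
 from power_mono[OF this, of 2] show "1500*(real n)^2 <= 1500*K^2/ep^2" by (simp add: power_divide)
qed (use k in simp)
finally show ?thesis .
qed

lemma (in target) target_algorithm:
fixes ep L :: real
assumes lip: "\<And>x y. 0 <= x ==> x <= y ==> y <= 1 ==> xi2 c y-xi2 c x <= L*(y-x)" "0 <= L"
 and e: "0 < ep" "ep <= E" and E: "E = (LINT t:{0..T}|lborel. mixture2 c t*(LINT w'|Q. u t (X t w')))"
shows "\<exists>alg. achieves c u v P G (%N kp \<kappa>1. 1500*(2*((3*xi2 c 1+4*L)*C0)+3*(xi2 c 1*C0))^2/ep^2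
*(kp+real N)+real N*\<kappa>1) (E-ep) alg"
proof -
define K where "K = (3*xi2 c 1+4*L)*C0"
have K: "0 <= K" unfolding K_def using U[of 0] lip(2) xi2_nonneg[of 1] by (intro mult_nonneg_nonneg) auto
have EI: "E = (LINT r:{0<..T}|lborel. xi2 c r*U r)" using E target_integral unfolding U_def by simp
\<comment> \<open>Large enough for a discretisation loss \<open>K/n\<close> of at most
  \<open>ep/2\<close>; the other half is left for the fluctuations of the disorder.\<close>
define n where "n = nat \<lceil>2*K/ep\<rceil>+2"
have n: "2 <= n" "1 <= n" by (simp_all add: n_def)
have "0 <= 2*K/ep" using K e by simp
hence rn: "real n = of_int \<lceil>2*K/ep\<rceil>+2" unfolding n_def by simp
have "2*K/ep <= real n" unfolding rn by linarith
hence loss: "K/real n <= ep/2" using e n by (simp add: field_simps)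
have "real n <= 2*K/ep+3" unfolding rn by linarith
hence "real n*ep <= 2*K+3*ep" using e by (simp add: field_simps)
\<comment> \<open>\<open>ep <= E <= \<xi>''(1)*C0\<close> absorbs the additive constant in
  \<open>n\<close>, so \<open>n*ep\<close> stays bounded.\<close>
hence nK: "real n*ep <= 2*K+3*(xi2 c 1*C0)" using e(2) target_le unfolding EI by linarith
obtain T' V where A: "spin_algorithm c \<epsilon>0 T' (Suc n) (2*n+1) V P G"
 and el: "(LINT r:{0<..T}|lborel. xi2 c r*U r)-K/real n <= toy.elim c (%a. teval (T' a)) (Suc n)"
 using energy[OF lip n(1)] unfolding K_def by blast
have "0 < ep/2" using e by simp
from achieves_mono[OF spin_algorithm.algorithm[OF A this, where u=u and v=v]] show ?thesis unfolding K_def[symmetric]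
proof (rule exI)
 show "E-ep <= toy.elim c (%a. teval (T' a)) (Suc n)-ep/2" using el loss unfolding EI by linarith
 fix N :: nat and kp \<kappa>1 :: real assume N: "1 <= N" and k: "0 <= kp" "0 <= \<kappa>1"
 have "0 <= real N*\<kappa>1" using k by simp
 with cost_bound[OF n(2) N k(1) nK e(1)]
 show "real (Suc n)*kp+(real (Suc n)+1)*(80*real (Suc n)+6*real (2*n+1)+60)*(real N+1) \<le>
  1500*(2*K+3*(xi2 c 1*C0))^2/ep^2*(kp+real N)+real N*\<kappa>1" by linarith
qed
qed

theorem theorem2:
  fixes c :: "nat \<Rightarrow> real" and \<epsilon>0 C0 tstar :: real
    and P :: "nat \<Rightarrow> 'w measure" and G :: "nat \<Rightarrow> nat \<Rightarrow> nat list \<Rightarrow> 'w \<Rightarrow> real"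
    and u v :: "real \<Rightarrow> real \<Rightarrow> real"
    and Q :: "'a measure" and B X M :: "real \<Rightarrow> 'a \<Rightarrow> real"
  assumes disorder: "\<And>N. gaussian_tensors (P N) N (G N)"
    and mixture_finite: "\<epsilon>0 > 0" "summable (\<lambda>k. (c k)\<^sup>2 * (1 + \<epsilon>0) ^ k)"
    and u_measurable: "(\<lambda>(t, x). u t x) \<in> borel_measurable (restrict_space borel ({0..1} \<times> UNIV))"
    and v_measurable: "(\<lambda>(t, x). v t x) \<in> borel_measurable (restrict_space borel ({0..1} \<times> UNIV))"
    and u_nonvanishing: "\<And>t x. t \<in> {0..1} \<Longrightarrow> u t x \<noteq> 0"
    and regular: "regular_coefficients C0 u v"
    and brownian: "standard_brownian_motion Q B"
    and X_solution: "strong_solution Q B v (\<lambda>t x. sqrt (mixture2 c t)) 0 X"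
    and M_integral: "ito_integral Q B (\<lambda>t \<omega>. sqrt (mixture2 c t) * u t (X t \<omega>)) M"
    and tstar: "tstar \<in> {0..1}"
    and M_bounded: "AE \<omega> in Q. M tstar \<omega> \<in> {-1..1}"
    and M_variance: "\<And>t. t \<in> {0..tstar} \<Longrightarrow> (LINT \<omega>|Q. (M t \<omega>)\<^sup>2) = t"
  shows "\<exists>C::real. \<forall>\<epsilon>>0. \<exists>alg::prog. \<forall>\<kappa> \<kappa>1 :: nat \<Rightarrow> real.
    (\<forall>N. 0 \<le> \<kappa> N \<and> 0 \<le> \<kappa>1 N) \<longrightarrow>
      (\<forall>N\<ge>1. \<forall>\<omega>\<in>space (P N). \<forall>\<rho>\<in>space coin_space.
         \<exists>T \<sigma>. outputs (spin_machine c u v (\<kappa> N) (\<kappa>1 N) N (sym_disorder G N \<omega>) \<rho>) alg T \<sigma> \<and>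
               T \<le> C / \<epsilon>\<^sup>2 * (\<kappa> N + real N) + real N * \<kappa>1 N) \<and>
      with_high_probability (\<lambda>N. P N \<Otimes>\<^sub>M coin_space) (\<lambda>N (\<omega>, \<rho>).
         \<exists>T \<sigma>. outputs (spin_machine c u v (\<kappa> N) (\<kappa>1 N) N (sym_disorder G N \<omega>) \<rho>) alg T \<sigma> \<and>
               hamiltonian c N (sym_disorder G N \<omega>) \<sigma> / real N
                 \<ge> (LINT t:{0..tstar}|lborel. mixture2 c t * (LINT \<omega>'|Q. u t (X t \<omega>'))) - \<epsilon>)"
proof -
interpret mixture_coeffs c \<epsilon>0 using mixture_finite by unfold_locales
have "prob_space Q" using brownian by (simp add: standard_brownian_motion_def)
then interpret brownian Q B by (intro brownian.intro brownian_axioms.intro brownian)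
let ?U = "%t. LINT w'|Q. u t (X t w')"
define E where "E = (LINT t:{0..tstar}|lborel. mixture2 c t*?U t)"
obtain L where lip: "\<And>x y. 0 <= x ==> x <= y ==> y <= 1 ==> xi2 c y-xi2 c x <= L*(y-x)" "0 <= L"
 using xi2_lipschitz by blast
define C where "C = 1500*(2*((3*xi2 c 1+4*L)*C0)+3*(xi2 c 1*C0))^2"
have m2: "mixture2 c t = xi2 c t" if "t \<in> {0..1}" for t by (rule mixture2_xi2[OF less_rad[OF that]])
show ?thesis unfolding E_def[symmetric]
proof (intro exI[of _ C] allI impI)
 fix ep :: real assume e: "ep > 0"
 have "\<exists>alg. achieves c u v P G (%N kp \<kappa>1. C/ep^2*(kp+real N)+real N*\<kappa>1) (E-ep) alg"
 proof (cases "E < ep")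
  \<comment> \<open>A target below the permitted loss is reached by the all-plus
    configuration.\<close>
  case True
  show ?thesis by (rule exI, rule constant_algorithm[OF disorder True]) (simp add: C_def)
 next
  case False
  \<comment> \<open>From here on \<open>E\<close> is positive, which rules out
    \<open>tstar = 0\<close>, a vanishing mixture and negative \<open>u\<close>.\<close>
  have "E \<noteq> 0" "\<not> E <= 0" using False e by auto
  have "tstar \<noteq> 0"
  proof
   assume "tstar = 0"
   hence "indicator {0..tstar} t *\<^sub>R (mixture2 c t*?U t) = (mixture2 c 0*?U 0)*indicator {0} t" for t :: real
    by (auto simp: indicator_def)
   hence "E = 0" unfolding E_def set_lebesgue_integral_def by simp
   thus False using `E \<noteq> 0` by simp
  qed
  hence T: "0 < tstar" "tstar <= 1" using tstar by auto
  have nontriv: "\<exists>k\<ge>2. c k \<noteq> 0"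
  proof (rule ccontr)
   assume "\<not> (\<exists>k\<ge>2. c k \<noteq> 0)"
   hence "deg c k = 0" for k by (simp add: deg_def)
   hence "xi2 c t = 0" for t by (simp add: xi2_def diffs_def)
   hence "E = (LINT t:{0..tstar}|lborel. 0)"
    unfolding E_def using T m2 by (intro set_lebesgue_integral_cong) auto
   thus False using `E \<noteq> 0` by (simp add: set_lebesgue_integral_def)
  qed
  \<comment> \<open>Otherwise \<open>u\<close> would be negative everywhere and the integrand
    nonpositive, contrary to \<open>E > 0\<close>.\<close>
  have "0 < u 0 0"
  proof (rule ccontr)
   assume "\<not> 0 < u 0 0"
   hence n: "0 < - 1*u 0 0" using u_nonvanishing[of 0 0] by simp
   have neg: "0 <= - u t x" if "t \<in> {0..1}" for t x
    using nonvanishing_coefficient[OF regular u_nonvanishing _ n that, of x] by simp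
   have "0 <= (LINT t:{0..tstar}|lborel. - (mixture2 c t*?U t))" unfolding set_lebesgue_integral_def
   proof (rule integral_nonneg_AE, rule AE_I2)
    fix t
    show "0 <= indicat_real {0..tstar} t *\<^sub>R-(mixture2 c t*?U t)"
    proof (cases "t \<in> {0..tstar}")
     case True
     hence t: "t \<in> {0..1}" using T by auto
     have "0 <= (LINT w'|Q. - u t (X t w'))" by (intro integral_nonneg_AE AE_I2 neg t)
     hence "0 <= mixture2 c t*- ?U t" unfolding m2[OF t] using t by (intro mult_nonneg_nonneg xi2_nonneg) auto
     thus ?thesis using True by simp
    qed simp
   qed
   thus False using `\<not> E <= 0` unfolding E_def set_lebesgue_integral_def by simp
  qed
  hence up: "0 < u t x" if "t \<in> {0..1}" for t x
   using nonvanishing_coefficient[OF regular u_nonvanishing, of 1 t x] that by simp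
  have ul: "u t x <= C0" if "t \<in> {0..1}" for t x
   using regular that unfolding regular_coefficients_def by (auto simp: abs_le_iff)
  have "target Q B c \<epsilon>0 P G u X M C0 tstar"
   by (intro target.intro target_axioms.intro brownian_axioms mixture_coeffs_axioms disorder nontriv up ul M_integral T M_bounded M_variance)
  from target.target_algorithm[OF this lip e _ E_def] show ?thesis unfolding C_def using False by simp
 qed
 thus "\<exists>alg::prog. \<forall>kp \<kappa>1 :: nat => real.
 (\<forall>N. 0 <= kp N & 0 <= \<kappa>1 N) \<longrightarrow>
  (\<forall>N\<ge>1. \<forall>w\<in>space (P N). \<forall>\<rho>\<in>space coin_space.
   \<exists>T \<sigma>. outputs (spin_machine c u v (kp N) (\<kappa>1 N) N (sym_disorder G N w) \<rho>) alg T \<sigma> &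
      T <= C/ep^2*(kp N+real N)+real N*\<kappa>1 N) &
  with_high_probability (%N. P N \<Otimes>\<^sub>M coin_space) (%N (w, \<rho>).
   \<exists>T \<sigma>. outputs (spin_machine c u v (kp N) (\<kappa>1 N) N (sym_disorder G N w) \<rho>) alg T \<sigma> &
      hamiltonian c N (sym_disorder G N w) \<sigma>/real N \<ge> E-ep)"
  unfolding achieves_def .
qed
qed

end
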